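(* For every $p\in(1,\infty)$, the Ahlfors-Beurling operator $T$ satisfies $$\frac{\|T\|_p}{p^*-1}\leqslant\frac{2\log 2}{I(\sqrt2,\pi/2)}\approx 2.00714 .$$
   Context: The Ahlfors-Beurling operator is $Tf(z)=-\frac1\pi\,\mathrm{p.v.}\int_{\mathbb C}\frac{f(\zeta)}{(z-\zeta)^2}\,dA(\zeta)$ on $L^p(\mathbb C)$; $\|T\|_p$ is its operator norm on $L^p(\mathbb C)$; $p^*=\max\{p,q\}$ with $1/p+1/q=1$. Let $\chi_0$ be the characteristic function of $[-1/2,1/2)$ and $h_0=\chi_{[0,1/2)}-\chi_{[-1/2,0)}$ its Haar function. Put $\alpha=h_0*h_0$, $\beta=\chi_0*\chi_0$ and $$F(x,y)=\alpha(x)\beta(y)-\beta(x)\alpha(y)-\alpha(x)\alpha(y).$$ The constant is $$I(\sqrt2,\pi/2)=-4\int_{\mathbb R}\int_{\mathbb R}F(x,y)\,\frac{y^2}{x^2+2y^2}\,dx\,dy .$$ *)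

theory Defs
  imports "HOL-Analysis.Analysis"
begin

definition Lp_space :: "real \<Rightarrow> (complex \<Rightarrow> complex) set" where
  "Lp_space p = {f \<in> borel_measurable lebesgue. integrable lebesgue (\<lambda>z. norm (f z) powr p)}"

(* The value is infinite outside L^p, so a finite bound on the norm of a function includes the
   assertion that the function is Lebesgue measurable and belongs to L^p. *)
definition Lp_norm :: "real \<Rightarrow> (complex \<Rightarrow> complex) \<Rightarrow> ennreal" where
  "Lp_norm p f =
     (if f \<in> Lp_space p then ennreal ((LINT z|lebesgue. norm (f z) powr p) powr (1 / p)) else \<infinity>)"

definition Lp_operator_norm :: "real \<Rightarrow> ((complex \<Rightarrow> complex) \<Rightarrow> complex \<Rightarrow> complex) \<Rightarrow> ennreal" where
  "Lp_operator_norm p T = (SUP f \<in> {f. Lp_norm p f \<le> 1}. Lp_norm p (T f))"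

definition beurling_truncated :: "(complex \<Rightarrow> complex) \<Rightarrow> complex \<Rightarrow> real \<Rightarrow> complex" where
  "beurling_truncated f z \<epsilon> =
     - (1 / complex_of_real pi) * (LINT \<zeta>:{\<zeta>. \<epsilon> < dist z \<zeta>}|lebesgue. f \<zeta> / (z - \<zeta>)\<^sup>2)"

definition beurling_pv_exists :: "(complex \<Rightarrow> complex) \<Rightarrow> complex \<Rightarrow> bool" where
  "beurling_pv_exists f z \<longleftrightarrow> (\<exists>l. (beurling_truncated f z \<longlongrightarrow> l) (at_right 0))"

(* The value is unspecified at points where the principal value does not exist. For f in L^p,
   1 < p < infinity, these points form a null set. *)
definition ahlfors_beurling :: "(complex \<Rightarrow> complex) \<Rightarrow> complex \<Rightarrow> complex" where
  "ahlfors_beurling f z = Lim (at_right 0) (beurling_truncated f z)"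

definition convolution :: "(real \<Rightarrow> real) \<Rightarrow> (real \<Rightarrow> real) \<Rightarrow> real \<Rightarrow> real" where
  "convolution f g x = (LINT t|lborel. f t * g (x - t))"

definition chi0 :: "real \<Rightarrow> real" where
  "chi0 = indicator {-1/2..<1/2}"

definition haar0 :: "real \<Rightarrow> real" where
  "haar0 x = indicator {0..<1/2} x - indicator {-1/2..<0} x"

definition haar_alpha :: "real \<Rightarrow> real" where
  "haar_alpha = convolution haar0 haar0"

definition haar_beta :: "real \<Rightarrow> real" where
  "haar_beta = convolution chi0 chi0"

definition haar_F :: "real \<Rightarrow> real \<Rightarrow> real" where
  "haar_F x y = haar_alpha x * haar_beta y - haar_beta x * haar_alpha y - haar_alpha x * haar_alpha y"

(* The constant I(sqrt 2, pi/2). *)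
definition I_sqrt2_pi_half :: real where
  "I_sqrt2_pi_half =
     - 4 * (LINT y|lborel. LINT x|lborel. haar_F x y * (y\<^sup>2 / (x\<^sup>2 + 2 * y\<^sup>2)))"

end

theory Submission
  imports Defs
begin

text \<open>The weaker bound \<open>\<parallel>T\<parallel>\<^sub>p \<le> 2(p\<^sup>* - 1)\<close> suffices, because \<open>2 log 2 / I > 2\<close>.

  For \<open>p \<ge> 2\<close> consider the random walk in the plane whose steps are \<open>\<plusminus>h e\<close>, where \<open>e\<close> runs through
  three sixth roots of unity. Multiplying a step in direction \<open>e\<close> by the square of the conjugate of
  \<open>e\<close> is a martingale transform by unimodular numbers, so Burkholder's function bounds the associated
  bilinear form by \<open>p - 1\<close>. On the logarithmic potential \<open>log(|z|\<^sup>2 + a\<^sup>2)\<close> the generator of the walk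
  tends to a multiple of \<open>\<Delta>\<close> and the weighted second difference to a multiple of \<open>\<partial>\<^sup>2\<close> as
  \<open>h \<rightarrow> 0\<close>. In the limit, twice the transform is the convolution with the smooth kernel
  \<open>K\<^sub>a(z) = \<partial>\<^sup>2 log(|z|\<^sup>2 + a\<^sup>2) / \<pi>\<close>. Duality gives \<open>p < 2\<close>.

  Principal values are compared with the convolutions with \<open>K\<^sub>a\<close>. Convolution with \<open>K\<^sub>a\<close> commutes
  with an approximate identity, and the Hardy-Littlewood inequality yields a weak type bound for the
  maximal operator (Cotlar's inequality). Since the principal value exists trivially for functions
  that are locally constant almost everywhere, and these are dense, it exists almost everywhere for
  all of \<open>L\<^sup>p\<close>, and Fatou's lemma transfers the bound to \<open>T\<close>.

  Integration in closed form gives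
  \<open>I = 2/3 log 2 - 2 log (3/2) + 16/3 arctan(\<surd>2/5) / \<surd>2\<close>.\<close>

subsection \<open>The Burkholder function\<close>

text \<open>All probability is discrete: the last choice in a step of the walk is a fair sign, so
  concavity of Burkholder's function along segments is all that is used, and functions only have to
  be shifted and averaged. The three directions are chosen because the squares and the fourth powers
  of their conjugates both sum to zero. The first fact makes the generator isotropic; the second
  leaves only the square of \<open>cnj z\<close> in the weighted difference. Two perpendicular
  directions violate the second condition. Write P for one step of the walk and F for a potential of
  f. The bilinear form summed over time telescopes if it starts from F - P^2 F. The constant 2 is a
  balance of three factors: summation by parts contributes 1/2; the norm of F - P^2 F is at most
  twice that of F - P F, because P is a contraction; and the weighted difference has size 2 pi h^2
  against pi h^2 for the generator. The logarithm is neither bounded nor square integrable, so the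
  potential is a difference of logarithms at two scales a and b, and b tends to infinity.\<close>

definition burkholder :: "real \<Rightarrow> complex \<Rightarrow> complex \<Rightarrow> real" where
  "burkholder p x y = (norm x + norm y) powr p - p * norm x * (norm x + norm y) powr (p - 1)"

lemma has_real_derivative_norm_line:
  fixes x h :: "'a::real_inner"
  assumes "x + t *\<^sub>R h \<noteq> 0"
  shows "((\<lambda>t. norm (x + t *\<^sub>R h)) has_real_derivative ((x + t *\<^sub>R h) \<bullet> h) / norm (x + t *\<^sub>R h)) (at t)"
proof -
  have "((\<lambda>t. norm (x + t *\<^sub>R h)) has_derivative (\<lambda>s. (s *\<^sub>R h) \<bullet> sgn (x + t *\<^sub>R h))) (at t)"
    by (rule has_derivative_compose[where f = "\<lambda>t. x + t *\<^sub>R h" and g = norm, OF _ has_derivative_norm[OF assms]])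
       (auto intro!: derivative_eq_intros)
  then show ?thesis
    by (rule has_derivative_imp_has_field_derivative)
       (simp add: sgn_div_norm inner_commute divide_inverse)
qed

lemma has_real_derivative_norm_line_deriv:
  fixes x h :: "'a::real_inner"
  assumes "x + t *\<^sub>R h \<noteq> 0"
  shows "((\<lambda>t. ((x + t *\<^sub>R h) \<bullet> h) / norm (x + t *\<^sub>R h)) has_real_derivative
    ((norm h)\<^sup>2 - (((x + t *\<^sub>R h) \<bullet> h) / norm (x + t *\<^sub>R h))\<^sup>2) / norm (x + t *\<^sub>R h)) (at t)"
proof -
  have 1: "((\<lambda>t. (x + t *\<^sub>R h) \<bullet> h) has_real_derivative h \<bullet> h) (at t)"
    by (auto intro!: derivative_eq_intros simp: inner_add_left)
  show ?thesis
    by (rule DERIV_cong[OF DERIV_divide[OF 1 has_real_derivative_norm_line[OF assms]]])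
       (use assms in \<open>simp_all add: field_simps power2_eq_square flip: power2_norm_eq_inner\<close>)
qed

text \<open>Here a and b are the norms of the two components along a line, a1, b1, a2, b2 their
  derivatives, H and K the squared lengths of the direction vectors. The expression is the second
  derivative of \<open>burkholder\<close> without the positive factor p (a + b)^(p - 3). It splits
  into three terms of constant sign: one with K - H, and two that carry the factor p - 2.\<close>

lemma burkholder_second_derivative_sign:
  fixes a b a1 b1 a2 b2 p H K :: real
  assumes p: "p \<ge> 2" and a: "a > 0" and b: "b > 0" and KH: "K \<le> H"
    and a2: "a2 = (H - a1\<^sup>2) / a" and b2: "b2 = (K - b1\<^sup>2) / b" and b2pos: "b1\<^sup>2 \<le> K"
  shows "(p-1)*(a+b)*(a1+b1)*b1 + (a+b)\<^sup>2*b2 - (p-1)*(a1*(a+b)*(a1+b1) + a*(a+b)*(a2+b2)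
     + (p-2)*a*(a1+b1)\<^sup>2) \<le> 0"
proof -
  have eA: "a * a2 = H - a1\<^sup>2" and eB: "b * b2 = K - b1\<^sup>2" using a b a2 b2 by auto
  have "b2 \<ge> 0" using b2 b b2pos by simp
  have "(p-1)*(a+b)*(a1+b1)*b1 + (a+b)\<^sup>2*b2 - (p-1)*(a1*(a+b)*(a1+b1) + a*(a+b)*(a2+b2)
     + (p-2)*a*(a1+b1)\<^sup>2)
     = (p-1)*(a+b)*(b1\<^sup>2 - a1\<^sup>2 - a*a2 + b*b2) - (p-2)*(a+b)\<^sup>2*b2 - (p-1)*(p-2)*a*(a1+b1)\<^sup>2"
    by (simp add: algebra_simps power2_eq_square)
  also have "b1\<^sup>2 - a1\<^sup>2 - a*a2 + b*b2 = K - H" by (simp add: eA eB)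
  also have "(p-1)*(a+b)*(K - H) \<le> 0" using p a b KH by (simp add: mult_nonneg_nonpos)
  moreover have "(p-2)*(a+b)\<^sup>2*b2 \<ge> 0" using p \<open>b2 \<ge> 0\<close> by simp
  moreover have "(p-1)*(p-2)*a*(a1+b1)\<^sup>2 \<ge> 0" using p a by simp
  ultimately show ?thesis by linarith
qed

text \<open>The function is concave along every line whose second component moves no faster than the
  first. Off the origin both norms are smooth, so concavity is a second derivative test; the
  midpoint form is what a fair sign needs.\<close>

lemma burkholder_midpoint_off_zero:
  fixes x y h k :: complex
  assumes p: "p \<ge> 2" and kh: "norm k \<le> norm h"
    and nx: "\<And>t::real. x + t *\<^sub>R h \<noteq> 0" and ny: "\<And>t::real. y + t *\<^sub>R k \<noteq> 0"
  shows "(burkholder p (x + h) (y + k) + burkholder p (x - h) (y - k)) / 2 \<le> burkholder p x y"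
proof -
  define a b a1 b1 a2 b2 where
    "a t = norm (x + t *\<^sub>R h)" and "b t = norm (y + t *\<^sub>R k)"
    and "a1 t = ((x + t *\<^sub>R h) \<bullet> h) / norm (x + t *\<^sub>R h)"
    and "b1 t = ((y + t *\<^sub>R k) \<bullet> k) / norm (y + t *\<^sub>R k)"
    and "a2 t = ((norm h)\<^sup>2 - (((x + t *\<^sub>R h) \<bullet> h) / norm (x + t *\<^sub>R h))\<^sup>2) / norm (x + t *\<^sub>R h)"
    and "b2 t = ((norm k)\<^sup>2 - (((y + t *\<^sub>R k) \<bullet> k) / norm (y + t *\<^sub>R k))\<^sup>2) / norm (y + t *\<^sub>R k)"
    for t :: real
  have apos: "a t > 0" "b t > 0" for t using nx ny by (auto simp: a_def b_def)
  then have spos: "a t + b t > 0" for t by (simp add: add_pos_pos)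
  have da: "(a has_real_derivative a1 t) (at t)" "(a1 has_real_derivative a2 t) (at t)"
    "(b has_real_derivative b1 t) (at t)" "(b1 has_real_derivative b2 t) (at t)" for t
    unfolding a_def b_def a1_def b1_def a2_def b2_def
    by (intro has_real_derivative_norm_line has_real_derivative_norm_line_deriv nx ny)+
  define G where "G t = (a t + b t) powr p - p * a t * (a t + b t) powr (p - 1)" for t
  define G1 where "G1 t = p * (a t + b t) powr (p-1) * b1 t
     - p*(p-1) * a t * (a t + b t) powr (p-2) * (a1 t + b1 t)" for t
  define G2 where "G2 t = p * (a t + b t) powr (p-3) *
     ((p-1)*(a t + b t)*(a1 t + b1 t)*b1 t + (a t + b t)\<^sup>2*b2 t - (p-1)*(a1 t*(a t+b t)*(a1 t+b1 t)
       + a t*(a t+b t)*(a2 t+b2 t) + (p-2)*a t*(a1 t+b1 t)\<^sup>2))" for t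
  \<comment> \<open>With p - 3 as the common exponent, the derivative of \<open>G1\<close> matches
    \<open>G2\<close> by ring arithmetic.\<close>
  have e1: "(a t + b t) powr (p-2) = (a t + b t) powr (p-3) * (a t + b t)"
    "(a t + b t) powr (p-1) = (a t + b t) powr (p-3) * (a t + b t)\<^sup>2" for t
    using spos[of t] powr_add[of "a t + b t" "p-3" 1] powr_add[of "a t + b t" "p-3" 2] by auto
  have dG: "(G has_real_derivative G1 t) (at t)" for t
    unfolding G_def
    by (rule derivative_eq_intros da[THEN DERIV_cong] | use spos[of t] in \<open>simp; fail\<close>)+
       (use spos[of t] in \<open>simp add: G1_def algebra_simps diff_divide_distrib add_divide_distrib powr_diff\<close>)
  have dG1: "(G1 has_real_derivative G2 t) (at t)" for t
    unfolding G1_def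
    apply (rule derivative_eq_intros da[THEN DERIV_cong] | use spos[of t] in \<open>simp; fail\<close>)+
    using spos[of t] e1[of t] by (simp add: G2_def algebra_simps power2_eq_square)
  have "G2 t \<le> 0" for t
  proof -
    have "((y + t *\<^sub>R k) \<bullet> k)\<^sup>2 \<le> (norm (y + t *\<^sub>R k))\<^sup>2 * (norm k)\<^sup>2"
      by (metis Cauchy_Schwarz_ineq power2_norm_eq_inner)
    then have "(b1 t)\<^sup>2 \<le> (norm k)\<^sup>2"
      using ny[of t] by (simp add: b1_def power_divide divide_le_eq mult.commute)
    then have "(p-1)*(a t + b t)*(a1 t + b1 t)*b1 t + (a t + b t)\<^sup>2*b2 t - (p-1)*(a1 t*(a t+b t)*(a1 t+b1 t)
       + a t*(a t+b t)*(a2 t+b2 t) + (p-2)*a t*(a1 t+b1 t)\<^sup>2) \<le> 0"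
      using kh by (intro burkholder_second_derivative_sign[OF p apos, of "(norm k)\<^sup>2" "(norm h)\<^sup>2"])
        (auto simp: a_def b_def a1_def b1_def a2_def b2_def intro!: power_mono)
    then show ?thesis using p unfolding G2_def by (simp add: mult_nonneg_nonpos)
  qed
  then have "concave_on UNIV G"
    by (intro f''_le0_imp_concave[where f' = G1 and f'' = G2] dG dG1) auto
  then have "convex_on UNIV (\<lambda>t. - G t)" by (simp add: concave_on_def)
  from convex_onD[OF this, of "1/2" 1 "-1"] have "G 0 \<ge> (1/2) * G 1 + (1/2) * G (-1)"
    by simp
  moreover have "G 0 = burkholder p x y" "G 1 = burkholder p (x + h) (y + k)"
    "G (-1) = burkholder p (x - h) (y - k)"
    by (simp_all add: G_def a_def b_def burkholder_def)
  ultimately show ?thesis by simp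
qed

lemma eventually_at_right_neq: "eventually (\<lambda>e. e \<noteq> (c::real)) (at_right 0)"
proof (cases "c > 0")
  case True
  then show ?thesis using eventually_at_right_real[OF True] by (auto elim: eventually_mono)
next
  case False
  then show ?thesis by (auto simp: eventually_at_filter)
qed

text \<open>A line through the origin is a limit of parallel lines that miss it: the base points are
  moved transversally by e, and all but at most three values of e are admissible. If h = 0, then k =
  0 and nothing moves.\<close>

lemma burkholder_midpoint:
  fixes x y h k :: complex
  assumes p: "p \<ge> 2" and kh: "norm k \<le> norm h"
  shows "(burkholder p (x + h) (y + k) + burkholder p (x - h) (y - k)) / 2 \<le> burkholder p x y"
proof (cases "h = 0")
  case True
  then show ?thesis using kh by simp
next
  case False
  \<comment> \<open>For k = 0 the line of y is a single point; a shift in the real direction takes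
    it off the origin.\<close>
  define v where "v = (if k = 0 then 1 else \<i> * k)"
  have ev: "\<forall>\<^sub>F e in at_right (0::real). (burkholder p (x + e *\<^sub>R (\<i> * h) + h) (y + e *\<^sub>R v + k)
      + burkholder p (x + e *\<^sub>R (\<i> * h) - h) (y + e *\<^sub>R v - k)) / 2
      \<le> burkholder p (x + e *\<^sub>R (\<i> * h)) (y + e *\<^sub>R v)"
    \<comment> \<open>Solving x + e i h + t h = 0 for x / h shows that a zero forces e = - Im (x /
      h); the other two excluded values arise from y in the same way.\<close>
    using eventually_at_right_neq[of "- Im (x / h)"] eventually_at_right_neq[of "- Im (y / k)"]
      eventually_at_right_neq[of "- Re y"]
  proof eventually_elim
    case (elim e)
    have "x + e *\<^sub>R (\<i> * h) + t *\<^sub>R h \<noteq> 0" for t :: real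
    proof
      assume "x + e *\<^sub>R (\<i> * h) + t *\<^sub>R h = 0"
      then have "x / h = - of_real t - \<i> * of_real e"
        using False by (simp add: field_simps scaleR_conv_of_real)
           (metis (no_types, opaque_lifting) add.commute add.assoc add_eq_0_iff2 minus_add_distrib)
      then have "Im (x / h) = - e" by simp
      with elim show False by simp
    qed
    moreover have "y + e *\<^sub>R v + t *\<^sub>R k \<noteq> 0" for t :: real
    proof (cases "k = 0")
      case True
      have "Re (y + e *\<^sub>R v) \<noteq> 0" using elim True by (simp add: v_def)
      then show ?thesis using True by (metis add.right_neutral scaleR_zero_right zero_complex.sel(1))
    next
      case k: False
      show ?thesis
      proof
        assume "y + e *\<^sub>R v + t *\<^sub>R k = 0"
        then have "y / k = - of_real t - \<i> * of_real e"
          using k by (simp add: v_def field_simps scaleR_conv_of_real)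
           (metis (no_types, opaque_lifting) add.commute add.assoc add_eq_0_iff2 minus_add_distrib)
        then have "Im (y / k) = - e" by simp
        with elim show False by simp
      qed
    qed
    ultimately show ?case by (rule burkholder_midpoint_off_zero[OF p kh])
  qed
  have lim: "((\<lambda>e::real. burkholder p (x + e *\<^sub>R (\<i> * h) + u) (y + e *\<^sub>R v + w))
     \<longlongrightarrow> burkholder p (x + u) (y + w)) (at_right 0)" for u w
  proof -
    have "((\<lambda>e::real. burkholder p (x + e *\<^sub>R (\<i> * h) + u) (y + e *\<^sub>R v + w))
     \<longlongrightarrow> burkholder p (x + 0 *\<^sub>R (\<i> * h) + u) (y + 0 *\<^sub>R v + w)) (at_right 0)"
      unfolding burkholder_def
      using p by (intro tendsto_diff tendsto_mult tendsto_powr' tendsto_add tendsto_norm tendsto_intros) auto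
    then show ?thesis by simp
  qed
  have l0: "((\<lambda>e::real. burkholder p (x + e *\<^sub>R (\<i> * h)) (y + e *\<^sub>R v)) \<longlongrightarrow> burkholder p x y) (at_right 0)"
    using lim[of 0 0] by simp
  have l1: "((\<lambda>e::real. (burkholder p (x + e *\<^sub>R (\<i> * h) + h) (y + e *\<^sub>R v + k)
      + burkholder p (x + e *\<^sub>R (\<i> * h) - h) (y + e *\<^sub>R v - k)) / 2)
      \<longlongrightarrow> (burkholder p (x + h) (y + k) + burkholder p (x - h) (y - k)) / 2) (at_right 0)"
    using lim[of h k] lim[of "-h" "-k"] by (intro tendsto_intros) auto
  show ?thesis
    by (rule tendsto_le[OF _ l0 l1 ev]) simp
qed

section \<open>The majorant property of the Burkholder function\<close>

lemma burkholder_log_ineq: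
  fixes p r :: real
  assumes p: "p \<ge> 2" and r: "r > 0" and E: "1 + (p-1) * (r-1) > 0"
  shows "r \<ge> 1 \<Longrightarrow> r powr (p-1) \<le> ((1 + (p-1)*r)/p) powr (p-2) * (1 + (p-1)*(r-1))"
    and "r \<le> 1 \<Longrightarrow> ((1 + (p-1)*r)/p) powr (p-2) * (1 + (p-1)*(r-1)) \<le> r powr (p-1)"
proof -
  \<comment> \<open>The difference of the logarithms of the two sides vanishes at 1 and is
    non-decreasing, so the sides cross at 1 in the stated order.\<close>
  define L where "L t = (p-2) * ln ((1 + (p-1)*t)/p) + ln (1 + (p-1)*(t-1)) - (p-1) * ln t" for t
  have dL: "(L has_real_derivative (p-1)*(p-2) / ((1 + (p-1)*t) * t * (1 + (p-1)*(t-1)))) (at t)"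
    if t: "t > 0" "1 + (p-1)*(t-1) > 0" for t
  proof -
    have m: "(1 + (p-1)*t)/p > 0" "1 + (p-1)*t > 0" using p t by (simp_all add: add_pos_nonneg)
    have "(L has_real_derivative ((p-2) * ((p-1)/p / ((1 + (p-1)*t)/p)) + (p-1)/(1 + (p-1)*(t-1)) - (p-1)/t)) (at t)"
      unfolding L_def by (rule derivative_eq_intros refl | use m t p in \<open>simp; fail\<close>)+
    moreover have "(p-2) * ((p-1)/p / ((1 + (p-1)*t)/p)) + (p-1)/(1 + (p-1)*(t-1)) - (p-1)/t
       = (p-1)*(p-2) / ((1 + (p-1)*t) * t * (1 + (p-1)*(t-1)))"
    proof -
      have ne: "1 + (p-1)*t \<noteq> 0" "1 + (p-1)*(t-1) \<noteq> 0" "t \<noteq> 0" "p \<noteq> 0" using m t p by auto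
      then have "(p-2) * ((p-1)/p / ((1 + (p-1)*t)/p)) = (p-2)*(p-1) / (1 + (p-1)*t)" by simp
      moreover have "a * b / u + a / v - a / t = (a * b * (v * t) + a * (u * t) - a * (u * v)) / (u * t * v)"
        if "u \<noteq> 0" "v \<noteq> 0" for a b u v using that ne by (simp add: field_simps)
      moreover have "(p-1) * (p-2) * ((1 + (p-1)*(t-1)) * t) + (p-1) * ((1 + (p-1)*t) * t) - (p-1) * ((1 + (p-1)*t) * (1 + (p-1)*(t-1)))
          = (p-1) * (p-2)" by algebra
      ultimately show ?thesis using ne by (simp add: mult.commute[of "p-2" "p-1"])
    qed
    ultimately show ?thesis by simp
  qed
  have mono: "L s \<le> L t" if st: "s \<le> t" "s > 0" "1 + (p-1)*(s-1) > 0" for s t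
  proof (rule DERIV_nonneg_imp_nondecreasing[OF \<open>s \<le> t\<close>])
    fix x assume x: "s \<le> x" "x \<le> t"
    have "(p-1)*(s-1) \<le> (p-1)*(x-1)" using p x by (intro mult_left_mono) auto
    then have x': "x > 0" "1 + (p-1)*(x-1) > 0" using x st by linarith+
    moreover have "(p-1)*(p-2) / ((1 + (p-1)*x) * x * (1 + (p-1)*(x-1))) \<ge> 0"
      using p x' by (intro divide_nonneg_nonneg mult_nonneg_nonneg) auto
    ultimately show "\<exists>y. (L has_real_derivative y) (at x) \<and> 0 \<le> y" using dL by blast
  qed
  have L1: "L 1 = 0" using p by (simp add: L_def)
  have m: "(1 + (p-1)*r)/p > 0" using p r by (simp add: add_pos_nonneg)
  have m': "1 + (p-1)*r > 0" using p r by (simp add: add_pos_nonneg)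
  have eL: "exp ((p-2) * ln ((1 + (p-1)*r)/p) + ln (1 + (p-1)*(r-1))) = ((1 + (p-1)*r)/p) powr (p-2) * (1 + (p-1)*(r-1))"
    using m m' E p by (simp add: exp_add powr_def)
  have eR: "exp ((p-1) * ln r) = r powr (p-1)" using r by (simp add: powr_def)
  show "r powr (p-1) \<le> ((1 + (p-1)*r)/p) powr (p-2) * (1 + (p-1)*(r-1))" if "r \<ge> 1"
    unfolding eL[symmetric] eR[symmetric] using mono[OF that] L1 p by (simp add: L_def)
  show "((1 + (p-1)*r)/p) powr (p-2) * (1 + (p-1)*(r-1)) \<le> r powr (p-1)" if "r \<le> 1"
    unfolding eL[symmetric] eR[symmetric] using mono[OF that r E] L1 p by (simp add: L_def)
qed

text \<open>This is the majorant property after the substitution b = (p - 1) a r. The right side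
  minus r^p has its minimum at r = 1, where equality holds; the sign of its derivative is
  \<open>burkholder_log_ineq\<close>.\<close>

lemma burkholder_scalar_ineq:
  fixes p r :: real
  assumes p: "p \<ge> 2" and r: "r \<ge> 0"
  shows "r powr p - 1 \<le> p * (r - 1) * ((1 + (p-1)*r)/p) powr (p-1)"
\<comment> \<open>The derivative argument needs positive arguments. At the endpoint the claim
  reduces to p^(2 - p) <= 1.\<close>
proof (cases "r = 0")
  case True
  have "p * (1/p) powr (p-1) = p powr (2-p)"
    using p powr_add[of p 1 "1-p"] by (simp add: powr_divide powr_minus_divide[symmetric])
  also have "\<dots> \<le> 1" using p powr_mono[of "2-p" 0 p] by simp
  finally show ?thesis using True p by simp
next
  case False
  define m where "m t = (1 + (p-1)*t)/p" for t
  define f where "f t = p * (t-1) * m t powr (p-1) - t powr p" for t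
  define f' where "f' t = p * (m t powr (p-2) * (1 + (p-1)*(t-1)) - t powr (p-1))" for t
  have df: "(f has_real_derivative f' t) (at t)" if t: "t > 0" for t
  proof -
    have mt: "m t > 0" using p t by (simp add: m_def add_pos_nonneg)
    have dm: "(m has_real_derivative (p-1)/p) (at t)"
      unfolding m_def using p by (auto intro!: derivative_eq_intros)
    have e: "m t powr (p-1) = m t powr (p-2) * m t" using mt powr_add[of "m t" "p-2" 1] by simp
    have "(f has_real_derivative (p * m t powr (p-1) + p*(t-1) * ((p-1) * m t powr (p-2) * ((p-1)/p)) - p * t powr (p-1))) (at t)"
      unfolding f_def
      by (rule derivative_eq_intros dm[THEN DERIV_cong] refl | use mt t in \<open>simp; fail\<close>)+
    also have "p * m t powr (p-1) + p*(t-1) * ((p-1) * m t powr (p-2) * ((p-1)/p)) - p * t powr (p-1)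
       = p * (m t powr (p-2) * (m t + (t-1)*(p-1)*(p-1)/p) - t powr (p-1))"
      unfolding e using p by (simp add: field_simps)
    also have "m t + (t-1)*(p-1)*(p-1)/p = 1 + (p-1)*(t-1)"
      using p by (simp add: m_def field_simps)
    finally show ?thesis by (simp add: f'_def)
  qed
  have f1: "f 1 = -1" using p by (simp add: f_def m_def)
  have "f 1 \<le> f r"
  proof (cases "r \<ge> 1")
    case True
    show ?thesis
    proof (rule DERIV_nonneg_imp_nondecreasing[OF True])
      fix x :: real assume x: "1 \<le> x" "x \<le> r"
      have "f' x \<ge> 0" using burkholder_log_ineq(1)[OF p, of x] x p
        by (auto simp: f'_def m_def add_pos_nonneg)
      with df[of x] x show "\<exists>y. (f has_real_derivative y) (at x) \<and> 0 \<le> y" by auto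
    qed
  next
    case r1: False
    show ?thesis
    proof (rule DERIV_nonpos_imp_nonincreasing[where f = f and a = r and b = 1])
      show "r \<le> 1" using r1 by simp
      fix x :: real assume x: "r \<le> x" "x \<le> 1"
      have x0: "x > 0" using x r False by simp
      have "m x powr (p-2) * (1 + (p-1)*(x-1)) \<le> x powr (p-1)"
      proof (cases "1 + (p-1)*(x-1) > 0")
        case True
        then show ?thesis using burkholder_log_ineq(2)[OF p x0] x by (simp add: m_def)
      next
        case False
        then have "m x powr (p-2) * (1 + (p-1)*(x-1)) \<le> 0" by (intro mult_nonneg_nonpos) auto
        then show ?thesis by (meson order_trans powr_ge_zero)
      qed
      then have "f' x \<le> 0" using p by (simp add: f'_def mult_nonneg_nonpos)
      with df[OF x0] show "\<exists>y. (f has_real_derivative y) (at x) \<and> y \<le> 0" by auto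
    qed
  qed
  then show ?thesis using f1 by (simp add: f_def m_def)
qed

text \<open>Burkholder's function factors as (|y| - (p - 1)|x|) (|x| + |y|)^(p - 1), so both sides
  vanish for b = (p - 1) a. The constant p (1 - 1/p)^(p - 1) makes them tangent there.\<close>

lemma burkholder_majorant_pos:
  fixes a b p :: real
  assumes p: "p \<ge> 2" and a: "a > 0" and b: "b \<ge> 0"
  shows "b powr p - (p-1) powr p * a powr p
    \<le> p * (1 - 1/p) powr (p-1) * ((a + b) powr p - p * a * (a + b) powr (p-1))"
proof -
  define r where "r = b / ((p-1)*a)"
  have br: "b = (p-1)*a*r" and r: "r \<ge> 0" using p a b by (auto simp: r_def)
  define s where "s = 1 + (p-1)*r"
  have s: "s > 0" using p r by (simp add: s_def add_pos_nonneg)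
  have ab: "a + b = a * s" by (simp add: br s_def algebra_simps)
  have sp: "s powr p = s powr (p-1) * s" using s powr_add[of s "p-1" 1] by simp
  have ap: "a powr p = a powr (p-1) * a" using a powr_add[of a "p-1" 1] by simp
  have pp: "(p-1) powr p = (p-1) powr (p-1) * (p-1)" using p powr_add[of "p-1" "p-1" 1] by simp
  have q: "(1 - 1/p) powr (p-1) = (p-1) powr (p-1) / p powr (p-1)"
    using p powr_divide[of "p-1" p "p-1"] by (simp add: diff_divide_distrib)
  have "b powr p - (p-1) powr p * a powr p = (p-1) powr p * a powr p * (r powr p - 1)"
  proof -
    have "b powr p = (p-1) powr p * a powr p * r powr p"
      unfolding br using p a r by (simp add: powr_mult del: left_diff_distrib_numeral)
    then show ?thesis by (simp add: algebra_simps)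
  qed
  also have "\<dots> \<le> (p-1) powr p * a powr p * (p * (r - 1) * (s/p) powr (p-1))"
    unfolding s_def by (intro mult_left_mono burkholder_scalar_ineq p r) auto
  also have "\<dots> = p * ((p-1) powr (p-1) / p powr (p-1)) * (a powr (p-1) * a * s powr (p-1) * ((p-1)*(r-1)))"
    using p s by (simp add: powr_divide ap pp)
  also have "a powr (p-1) * a * s powr (p-1) * ((p-1)*(r-1)) = (a * s) powr p - p * a * (a * s) powr (p-1)"
    using a s by (simp add: powr_mult sp ap) (simp add: s_def algebra_simps)
  finally show ?thesis by (simp add: q ab)
qed

lemma burkholder_majorant:
  fixes x y :: complex
  assumes p: "p \<ge> 2"
  shows "norm y powr p - (p-1) powr p * norm x powr p \<le> p * (1 - 1/p) powr (p-1) * burkholder p x y"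
\<comment> \<open>The scaling behind \<open>burkholder_majorant_pos\<close> excludes x = 0, so |x|
  is replaced by |x| + e and e tends to 0 from the right.\<close>
proof (rule tendsto_le[OF trivial_limit_at_right_real[of 0]])
  show "\<forall>\<^sub>F e in at_right 0. norm y powr p - (p-1) powr p * (norm x + e) powr p \<le> p * (1 - 1/p) powr (p-1) *
     ((norm x + e + norm y) powr p - p * (norm x + e) * (norm x + e + norm y) powr (p-1))"
    by (rule eventually_at_rightI[of 0 1]) (auto intro!: burkholder_majorant_pos p add_nonneg_pos)
  have l: "((\<lambda>e::real. (norm x + e + c) powr t) \<longlongrightarrow> (norm x + c) powr t) (at_right 0)" if "t > 0" "c \<ge> 0" for t c
  proof -
    have "\<forall>\<^sub>F e in at_right 0. norm x + e + c \<ge> 0"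
      using eventually_at_right_less[of 0] by eventually_elim (use that in auto)
    then have "((\<lambda>e::real. (norm x + e + c) powr t) \<longlongrightarrow> (norm x + 0 + c) powr t) (at_right 0)"
      using that by (intro tendsto_powr' tendsto_intros) auto
    then show ?thesis by simp
  qed
  have l0: "((\<lambda>e::real. norm x + e) \<longlongrightarrow> norm x) (at_right 0)"
    using tendsto_add[OF tendsto_const[of "norm x"] tendsto_ident_at[of 0 "{0<..}"]] by simp
  show "((\<lambda>e. norm y powr p - (p-1) powr p * (norm x + e) powr p) \<longlongrightarrow>
     norm y powr p - (p-1) powr p * norm x powr p) (at_right 0)"
    using l[of p 0] p by (intro tendsto_diff tendsto_mult tendsto_const) auto
  show "((\<lambda>e. p * (1 - 1/p) powr (p-1) *
     ((norm x + e + norm y) powr p - p * (norm x + e) * (norm x + e + norm y) powr (p-1))) \<longlongrightarrow>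
     p * (1 - 1/p) powr (p-1) * burkholder p x y) (at_right 0)"
    unfolding burkholder_def using p by (intro tendsto_diff tendsto_mult tendsto_const l l0) auto
qed

subsection \<open>Random walks\<close>

definition sym_avg :: "complex \<Rightarrow> (complex \<Rightarrow> 'a::real_vector) \<Rightarrow> complex \<Rightarrow> 'a" where
  "sym_avg v F x = (1/2) *\<^sub>R (F (x + v) + F (x - v))"

definition sym_dif :: "complex \<Rightarrow> (complex \<Rightarrow> 'a::real_vector) \<Rightarrow> complex \<Rightarrow> 'a" where
  "sym_dif v F x = (1/2) *\<^sub>R (F (x + v) - F (x - v))"

definition avg3 :: "(nat \<Rightarrow> 'a::real_vector) \<Rightarrow> 'a" where
  "avg3 a = (1/3) *\<^sub>R (a 0 + a 1 + a 2)"

text \<open>The transition operator of the walk: one of three vectors and a sign, all six outcomes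
  equally likely.\<close>

definition walk :: "(nat \<Rightarrow> complex) \<Rightarrow> (complex \<Rightarrow> 'a::real_vector) \<Rightarrow> complex \<Rightarrow> 'a" where
  "walk v F x = avg3 (\<lambda>j. sym_avg (v j) F x)"

text \<open>The expected final values of f and g, given the walk so far, are martingales. In each
  step the direction is revealed first and the sign second; the sign changes them by plus or minus
  \<open>sym_dif\<close>. The form is the expectation of the sum over n steps of the products of
  these changes, those of f multiplied by \<omega>. The recursion conditions on the first
  step.\<close>

primrec walk_form :: "(nat \<Rightarrow> complex) \<Rightarrow> (nat \<Rightarrow> complex) \<Rightarrow> (complex \<Rightarrow> complex) \<Rightarrow> (complex \<Rightarrow> complex)
    \<Rightarrow> nat \<Rightarrow> complex \<Rightarrow> complex" where
  "walk_form v \<omega> f g 0 = (\<lambda>x. 0)"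
| "walk_form v \<omega> f g (Suc n) = (\<lambda>x. walk v (walk_form v \<omega> f g n) x +
     avg3 (\<lambda>j. \<omega> j * sym_dif (v j) ((walk v ^^ n) f) x * sym_dif (v j) ((walk v ^^ n) g) x))"

lemma avg3_mono:
  fixes a b :: "nat \<Rightarrow> real"
  assumes "\<And>j. j < 3 \<Longrightarrow> a j \<le> b j"
  shows "avg3 a \<le> avg3 b"
  using assms[of 0] assms[of 1] assms[of 2] by (simp add: avg3_def)

text \<open>Revealing the direction moves only the first variable, in which the function is concave:
  this is \<open>burkholder_midpoint\<close> with k = 0.\<close>

lemma burkholder_avg3:
  assumes p: "p \<ge> 2"
  shows "avg3 (\<lambda>j. burkholder p (a j) y) \<le> burkholder p (avg3 a) y"
proof -
  define m where "m = avg3 a"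
  have mid: "(burkholder p u y + burkholder p w y) / 2 \<le> burkholder p ((u + w)/2) y" for u w
  proof -
    have "(u + w)/2 + (u - w)/2 = u" "(u + w)/2 - (u - w)/2 = w"
      by (simp_all add: field_simps)
    then show ?thesis
      using burkholder_midpoint[OF p, of 0 "(u - w)/2" "(u + w)/2" y] by simp
  qed
  \<comment> \<open>The mean itself serves as a fourth point, which reduces three points to two
    rounds of midpoints; its own term then cancels.\<close>
  have "((a 0 + a 1)/2 + (a 2 + m)/2) / 2 = m"
    by (simp add: m_def avg3_def scaleR_conv_of_real field_simps)
  with mid[of "(a 0 + a 1)/2" "(a 2 + m)/2"] mid[of "a 0" "a 1"] mid[of "a 2" m]
  have "burkholder p (a 0) y + burkholder p (a 1) y + burkholder p (a 2) y + burkholder p m y \<le> 4 * burkholder p m y"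
    by simp
  then show ?thesis by (simp add: avg3_def m_def)
qed

lemma burkholder_zero_right: "p \<ge> 2 \<Longrightarrow> burkholder p x 0 \<le> 0"
proof -
  assume p: "p \<ge> 2"
  have "norm x powr p = norm x * norm x powr (p - 1)"
    using powr_add[of "norm x" 1 "p-1"] p by (cases "x = 0") auto
  then have "burkholder p x 0 = (1 - p) * (norm x * norm x powr (p - 1))"
    by (simp add: burkholder_def algebra_simps)
  then show ?thesis using p by (simp add: mult_nonpos_nonneg)
qed

lemma walk_form_le_arith:
  fixes r s t a u b r1 t1 a1 u1 b1 r2 t2 a2 u2 b2 :: real
  assumes "r1 + t1 \<le> a1 + u1 + b1" "r2 + t2 \<le> a2 + u2 + b2" "u1 + u2 \<le> 2 * u" "r1 + r2 = 2 * (r + s)"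
    "2 * t = t1 + t2" "2 * a = a1 + a2" "2 * b = b1 + b2"
  shows "r + s + t \<le> a + u + b"
  using assms by (smt (verit))

text \<open>Each increment of the second variable equals a unimodular multiple of the increment of the
  first one, so the Burkholder function decreases on average. The variable \<open>y\<close> records the
  value of the transformed martingale; the dual function enters only linearly in \<open>y\<close>.\<close>

lemma walk_form_le:
  assumes p: "p \<ge> 2" and pq: "1/p + 1/q = 1" and w: "\<And>j. j < 3 \<Longrightarrow> norm (\<omega> j) = 1"
  shows "Re (y * (walk v ^^ n) g x) + Re (walk_form v \<omega> f g n x)
    \<le> ((p-1) powr p * (walk v ^^ n) (\<lambda>x. norm (f x) powr p) x
        + p * (1 - 1/p) powr (p-1) * burkholder p ((walk v ^^ n) f x) y) / p
      + (walk v ^^ n) (\<lambda>x. norm (g x) powr q) x / q"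
proof (induction n arbitrary: x y)
  case 0
  have q: "q > 1"
  proof -
    have "1/q = 1 - 1/p" using pq by simp
    moreover have "1/p \<le> 1/2" "1/p > 0" using p by (auto simp: field_simps)
    ultimately have "1/q > 0" "1/q < 1" by linarith+
    then show ?thesis by (cases "q > 0") (auto simp: field_simps)
  qed
  \<comment> \<open>With no steps left, Young's inequality separates the dual function, and the
    majorant property trades |y|^p for the Burkholder function.\<close>
  have "Re (y * g x) \<le> norm y * norm (g x)" by (metis complex_Re_le_cmod norm_mult)
  also have "\<dots> \<le> norm y powr p / p + norm (g x) powr q / q"
    using p q pq by (intro Youngs_inequality) auto
  also have "norm y powr p / p \<le> ((p-1) powr p * norm (f x) powr p
        + p * (1 - 1/p) powr (p-1) * burkholder p (f x) y) / p"
    using burkholder_majorant[OF p, of y "f x"] p by (intro divide_right_mono) auto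
  finally show ?case by simp
next
  case (Suc n)
  define fn where "fn = (walk v ^^ n) f"
  define gn where "gn = (walk v ^^ n) g"
  define An where "An = (walk v ^^ n) (\<lambda>x. norm (f x) powr p)"
  define Bn where "Bn = (walk v ^^ n) (\<lambda>x. norm (g x) powr q)"
  define Qn where "Qn = walk_form v \<omega> f g n"
  define c where "c = p * (1 - 1/p) powr (p-1)"
  have c: "c \<ge> 0" using p by (simp add: c_def)
  have IH: "Re (y * gn x) + Re (Qn x) \<le> ((p-1) powr p * An x + c * burkholder p (fn x) y) / p + Bn x / q" for x y
    using Suc unfolding fn_def gn_def An_def Bn_def Qn_def c_def .
  have step: "Re (y * sym_avg (v j) gn x) + Re (\<omega> j * sym_dif (v j) fn x * sym_dif (v j) gn x) + Re (sym_avg (v j) Qn x)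
     \<le> ((p-1) powr p * sym_avg (v j) An x + c * burkholder p (sym_avg (v j) fn x) y) / p + sym_avg (v j) Bn x / q"
    if j: "j < 3" for j
  proof -
    define d where "d = sym_dif (v j) fn x"
    have f: "fn (x + v j) = sym_avg (v j) fn x + d" "fn (x - v j) = sym_avg (v j) fn x - d"
      by (simp_all add: d_def sym_avg_def sym_dif_def scaleR_conv_of_real field_simps)
    \<comment> \<open>The sign moves \<open>fn\<close> by d and y by \<open>\<omega> j * d\<close>,
      which has the same length, so concavity along segments applies.\<close>
    have "(burkholder p (fn (x + v j)) (y + \<omega> j * d) + burkholder p (fn (x - v j)) (y - \<omega> j * d)) / 2
        \<le> burkholder p (sym_avg (v j) fn x) y"
      unfolding f by (rule burkholder_midpoint[OF p]) (simp add: norm_mult w[OF j])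
    from mult_left_mono[OF this, of "c / p"] c p
    have U: "c * burkholder p (fn (x + v j)) (y + \<omega> j * d) / p + c * burkholder p (fn (x - v j)) (y - \<omega> j * d) / p
       \<le> 2 * (c * burkholder p (sym_avg (v j) fn x) y / p)" by (simp add: field_simps)
    \<comment> \<open>Averaging the term linear in y over both signs leaves its value at the
      averaged g plus exactly the product of increments collected by
      \<open>walk_form\<close>.\<close>
    have eq: "Re ((y + \<omega> j * d) * gn (x + v j)) + Re ((y - \<omega> j * d) * gn (x - v j))
      = 2 * (Re (y * sym_avg (v j) gn x) + Re (\<omega> j * d * sym_dif (v j) gn x))"
      by (simp add: sym_avg_def sym_dif_def algebra_simps)
    have S: "2 * Re (sym_avg (v j) Qn x) = Re (Qn (x + v j)) + Re (Qn (x - v j))"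
      "2 * ((p-1) powr p * sym_avg (v j) An x / p) = (p-1) powr p * An (x + v j) / p + (p-1) powr p * An (x - v j) / p"
      "2 * (sym_avg (v j) Bn x / q) = Bn (x + v j) / q + Bn (x - v j) / q"
      by (simp_all add: sym_avg_def ring_distribs add_divide_distrib)
    show ?thesis
      unfolding d_def[symmetric] add_divide_distrib
      by (rule walk_form_le_arith[OF IH[of "y + \<omega> j * d" "x + v j", unfolded add_divide_distrib]
            IH[of "y - \<omega> j * d" "x - v j", unfolded add_divide_distrib] U eq S])
  qed
  have "avg3 (\<lambda>j. Re (y * sym_avg (v j) gn x) + Re (\<omega> j * sym_dif (v j) fn x * sym_dif (v j) gn x) + Re (sym_avg (v j) Qn x))
     \<le> avg3 (\<lambda>j. ((p-1) powr p * sym_avg (v j) An x + c * burkholder p (sym_avg (v j) fn x) y) / p + sym_avg (v j) Bn x / q)"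
    by (rule avg3_mono, rule step)
  also have "\<dots> = ((p-1) powr p * walk v An x + c * avg3 (\<lambda>j. burkholder p (sym_avg (v j) fn x) y)) / p + walk v Bn x / q"
    by (simp add: walk_def avg3_def add_divide_distrib algebra_simps)
  also have "\<dots> \<le> ((p-1) powr p * walk v An x + c * burkholder p (walk v fn x) y) / p + walk v Bn x / q"
    using burkholder_avg3[OF p, of "\<lambda>j. sym_avg (v j) fn x" y] c p
    by (intro add_right_mono divide_right_mono add_left_mono mult_left_mono) (auto simp: walk_def)
  also have "avg3 (\<lambda>j. Re (y * sym_avg (v j) gn x) + Re (\<omega> j * sym_dif (v j) fn x * sym_dif (v j) gn x) + Re (sym_avg (v j) Qn x))
     = Re (y * walk v gn x) + Re (walk_form v \<omega> f g (Suc n) x)"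
    by (simp add: walk_def avg3_def fn_def gn_def Qn_def algebra_simps)
  finally show ?case
    by (simp add: fn_def gn_def An_def Bn_def c_def)
qed


section \<open>Translation of integrals, test functions and summation by parts\<close>

lemma
  fixes f :: "complex \<Rightarrow> 'b::{banach, second_countable_topology}"
  shows lborel_integrable_shift: "integrable lborel f \<Longrightarrow> integrable lborel (\<lambda>x. f (x + v))"
    and lborel_integral_shift: "f \<in> borel_measurable borel \<Longrightarrow> (LINT x|lborel. f (x + v)) = (LINT x|lborel. f x)"
proof -
  assume f: "integrable lborel f"
  then have [measurable]: "f \<in> borel_measurable borel" using borel_measurable_integrable[OF f] by simp
  from f have "integrable (distr lborel borel ((+) v)) f" by (simp add: lborel_distr_plus)
  then show "integrable lborel (\<lambda>x. f (x + v))"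
    by (subst (asm) integrable_distr_eq) (auto simp: add.commute)
next
  assume "f \<in> borel_measurable borel"
  then have "(LINT x|distr lborel borel ((+) v). f x) = (LINT x|lborel. f (v + x))"
    by (intro integral_distr) auto
  then show "(LINT x|lborel. f (x + v)) = (LINT x|lborel. f x)"
    by (simp add: lborel_distr_plus add.commute)
qed

definition bounded_borel :: "(complex \<Rightarrow> complex) set" where
  "bounded_borel = {f \<in> borel_measurable borel. bounded (range f)}"

text \<open>No smoothness is asked for: the walk only translates and averages, and this class is
  stable under both and under products with bounded Borel functions.\<close>

definition test_fun :: "(complex \<Rightarrow> complex) set" where
  "test_fun = {f \<in> bounded_borel. \<exists>R. \<forall>x. norm x > R \<longrightarrow> f x = 0}"

lemma bounded_borelI: "f \<in> borel_measurable borel \<Longrightarrow> (\<And>x. norm (f x) \<le> B) \<Longrightarrow> f \<in> bounded_borel"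
  by (auto simp: bounded_borel_def bounded_iff)

lemma bounded_borelE:
  assumes "f \<in> bounded_borel"
  obtains B where "B > 0" "\<And>x. norm (f x) \<le> B" "f \<in> borel_measurable borel"
  using assms by (auto simp: bounded_borel_def bounded_pos)

lemma bounded_borel_measurable: "f \<in> bounded_borel \<Longrightarrow> f \<in> borel_measurable borel"
  by (auto simp: bounded_borel_def)

lemma test_fun_bounded_borel: "f \<in> test_fun \<Longrightarrow> f \<in> bounded_borel"
  by (simp add: test_fun_def)

lemma
  assumes f: "f \<in> bounded_borel"
  shows bounded_borel_shift: "(\<lambda>x. f (x + v)) \<in> bounded_borel"
    and bounded_borel_cmult: "(\<lambda>x. c * f x) \<in> bounded_borel"
    and bounded_borel_add: "g \<in> bounded_borel \<Longrightarrow> (\<lambda>x. f x + g x) \<in> bounded_borel"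
    and bounded_borel_diff: "g \<in> bounded_borel \<Longrightarrow> (\<lambda>x. f x - g x) \<in> bounded_borel"
    and bounded_borel_mult: "g \<in> bounded_borel \<Longrightarrow> (\<lambda>x. f x * g x) \<in> bounded_borel"
proof -
  obtain B where B: "B > 0" "\<And>x. norm (f x) \<le> B" and [measurable]: "f \<in> borel_measurable borel"
    using bounded_borelE[OF f] by metis
  show "(\<lambda>x. f (x + v)) \<in> bounded_borel" by (rule bounded_borelI[of _ B]) (use B in auto)
  show "(\<lambda>x. c * f x) \<in> bounded_borel"
    by (rule bounded_borelI[of _ "norm c * B"]) (use B in \<open>auto simp: norm_mult intro!: mult_left_mono\<close>)
  {
    assume g: "g \<in> bounded_borel"
    obtain C where C: "C > 0" "\<And>x. norm (g x) \<le> C" and [measurable]: "g \<in> borel_measurable borel"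
      using bounded_borelE[OF g] by metis
    show "(\<lambda>x. f x + g x) \<in> bounded_borel"
      by (rule bounded_borelI[of _ "B + C"]) (auto intro!: norm_triangle_mono B C)
    show "(\<lambda>x. f x - g x) \<in> bounded_borel"
      by (rule bounded_borelI[of _ "B + C"]) (auto intro!: order_trans[OF norm_triangle_ineq4] add_mono B C)
    show "(\<lambda>x. f x * g x) \<in> bounded_borel"
      by (rule bounded_borelI[of _ "B * C"]) (use B C in \<open>auto simp: norm_mult intro!: mult_mono intro: less_imp_le\<close>)
  }
qed

lemmas bounded_borel_intros = bounded_borel_cmult bounded_borel_add bounded_borel_diff bounded_borel_mult

lemma bounded_borel_shift': "f \<in> bounded_borel \<Longrightarrow> (\<lambda>x. f (x - v)) \<in> bounded_borel"
  using bounded_borel_shift[of f "-v"] by simp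

lemma
  assumes f: "f \<in> test_fun"
  shows test_fun_shift: "(\<lambda>x. f (x + v)) \<in> test_fun"
    and test_fun_cmult: "(\<lambda>x. c * f x) \<in> test_fun"
    and test_fun_add: "g \<in> test_fun \<Longrightarrow> (\<lambda>x. f x + g x) \<in> test_fun"
    and test_fun_diff: "g \<in> test_fun \<Longrightarrow> (\<lambda>x. f x - g x) \<in> test_fun"
    and test_fun_mult: "g \<in> bounded_borel \<Longrightarrow> (\<lambda>x. f x * g x) \<in> test_fun"
    and test_fun_mult_left: "g \<in> bounded_borel \<Longrightarrow> (\<lambda>x. g x * f x) \<in> test_fun"
proof -
  obtain R where R: "\<And>x. norm x > R \<Longrightarrow> f x = 0" and fb: "f \<in> bounded_borel"
    using f by (auto simp: test_fun_def)
  show "(\<lambda>x. f (x + v)) \<in> test_fun"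
    unfolding test_fun_def
  proof (intro CollectI conjI exI allI impI)
    fix x :: complex assume "norm x > R + norm v"
    then have "norm (x + v) > R" using norm_triangle_ineq4[of "x+v" v] by simp
    then show "f (x + v) = 0" by (rule R)
  qed (rule bounded_borel_shift fb)+
  show "(\<lambda>x. c * f x) \<in> test_fun"
    unfolding test_fun_def by (auto intro!: bounded_borel_intros fb exI[of _ R] R)
  show "(\<lambda>x. f x * g x) \<in> test_fun" "(\<lambda>x. g x * f x) \<in> test_fun" if "g \<in> bounded_borel"
    unfolding test_fun_def using that by (auto intro!: bounded_borel_intros fb exI[of _ R] R)
  {
    assume "g \<in> test_fun"
    then obtain T where T: "\<And>x. norm x > T \<Longrightarrow> g x = 0" and gb: "g \<in> bounded_borel"
      by (auto simp: test_fun_def)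
    show "(\<lambda>x. f x + g x) \<in> test_fun" "(\<lambda>x. f x - g x) \<in> test_fun"
      unfolding test_fun_def by (auto intro!: bounded_borel_intros fb gb exI[of _ "max R T"] simp: R T)
  }
qed

lemma test_fun_shift': "f \<in> test_fun \<Longrightarrow> (\<lambda>x. f (x - v)) \<in> test_fun"
  using test_fun_shift[of f "-v"] by simp

lemma
  assumes f: "f \<in> bounded_borel"
  shows bounded_borel_sym_avg: "sym_avg v f \<in> bounded_borel"
    and bounded_borel_sym_dif: "sym_dif v f \<in> bounded_borel"
    and bounded_borel_walk: "walk w f \<in> bounded_borel"
    and bounded_borel_walk_funpow: "(walk w ^^ n) f \<in> bounded_borel"
proof -
  have *: "sym_avg v f \<in> bounded_borel" if "f \<in> bounded_borel" for v f
    unfolding sym_avg_def[abs_def] scaleR_conv_of_real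
    by (intro bounded_borel_intros) (rule bounded_borel_shift bounded_borel_shift' that)+
  show "sym_avg v f \<in> bounded_borel" by (rule *[OF f])
  show "sym_dif v f \<in> bounded_borel"
    unfolding sym_dif_def[abs_def] scaleR_conv_of_real
    by (intro bounded_borel_intros) (rule bounded_borel_shift bounded_borel_shift' f)+
  have **: "walk w f \<in> bounded_borel" if "f \<in> bounded_borel" for f
    unfolding walk_def[abs_def] avg3_def scaleR_conv_of_real
    by (intro bounded_borel_cmult bounded_borel_add * that)
  show "walk w f \<in> bounded_borel" by (rule **[OF f])
  show "(walk w ^^ n) f \<in> bounded_borel" by (induction n) (auto intro: ** f)
qed

lemma
  assumes f: "f \<in> test_fun"
  shows test_fun_sym_avg: "sym_avg v f \<in> test_fun"
    and test_fun_sym_dif: "sym_dif v f \<in> test_fun"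
    and test_fun_walk: "walk w f \<in> test_fun"
    and test_fun_walk_funpow: "(walk w ^^ n) f \<in> test_fun"
proof -
  have *: "sym_avg v f \<in> test_fun" if "f \<in> test_fun" for v f
    unfolding sym_avg_def[abs_def] scaleR_conv_of_real
    by (intro test_fun_cmult test_fun_add) (rule test_fun_shift test_fun_shift' that)+
  show "sym_avg v f \<in> test_fun" by (rule *[OF f])
  show "sym_dif v f \<in> test_fun"
    unfolding sym_dif_def[abs_def] scaleR_conv_of_real
    by (intro test_fun_cmult test_fun_diff) (rule test_fun_shift test_fun_shift' f)+
  have **: "walk w f \<in> test_fun" if "f \<in> test_fun" for f
    unfolding walk_def[abs_def] avg3_def scaleR_conv_of_real
    by (intro test_fun_cmult test_fun_add * that)
  show "walk w f \<in> test_fun" by (rule **[OF f])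
  show "(walk w ^^ n) f \<in> test_fun" by (induction n) (auto intro: ** f)
qed

lemma test_fun_walk_form:
  assumes f: "f \<in> bounded_borel" and g: "g \<in> test_fun"
  shows "walk_form v \<omega> f g n \<in> test_fun"
proof (induction n)
  case 0
  show ?case by (auto simp: test_fun_def bounded_borel_def)
next
  case (Suc n)
  have "(\<lambda>x. \<omega> j * sym_dif (v j) ((walk v ^^ n) f) x * sym_dif (v j) ((walk v ^^ n) g) x) \<in> test_fun" for j
    by (intro test_fun_mult_left bounded_borel_cmult test_fun_sym_dif test_fun_walk_funpow bounded_borel_sym_dif
         bounded_borel_walk_funpow f g)
  with Suc show ?case
    unfolding walk_form.simps avg3_def scaleR_conv_of_real
    by (intro test_fun_cmult test_fun_add test_fun_walk)
qed

lemma test_fun_integrable: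
  assumes "f \<in> test_fun"
  shows "integrable lborel f"
proof -
  obtain R where R: "\<And>x. norm x > R \<Longrightarrow> f x = 0" and fb: "f \<in> bounded_borel"
    using assms by (auto simp: test_fun_def)
  obtain B where B: "B > 0" "\<And>x. norm (f x) \<le> B" and [measurable]: "f \<in> borel_measurable borel"
    using bounded_borelE[OF fb] by metis
  show ?thesis
  proof (rule Bochner_Integration.integrable_bound)
    show "integrable lborel (\<lambda>x::complex. B * indicator (cball 0 R) x :: real)"
      using emeasure_lborel_cball_finite by (intro integrable_mult_right integrable_real_indicator) auto
    show "AE x in lborel. norm (f x) \<le> norm (B * indicator (cball 0 R) x)"
      using R B by (intro AE_I2) (auto simp: indicator_def not_le)
  qed simp
qed

lemma test_fun_integrable_powr:
  assumes "f \<in> test_fun" "r > 0"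
  shows "integrable lborel (\<lambda>x. norm (f x) powr r)"
proof -
  obtain B where B: "B > 0" "\<And>x. norm (f x) \<le> B" and [measurable]: "f \<in> borel_measurable borel"
    using bounded_borelE[OF test_fun_bounded_borel[OF assms(1)]] by metis
  have "(\<lambda>x. of_real (norm (f x) powr r)) \<in> test_fun"
    unfolding test_fun_def
  proof (intro CollectI conjI)
    show "(\<lambda>x. complex_of_real (norm (f x) powr r)) \<in> bounded_borel"
      using B assms by (intro bounded_borelI[of _ "B powr r"]) (auto intro!: powr_mono2)
    show "\<exists>R. \<forall>x. norm x > R \<longrightarrow> complex_of_real (norm (f x) powr r) = 0"
      using assms by (auto simp: test_fun_def)
  qed
  from integrable_Re[OF test_fun_integrable[OF this]] show ?thesis by simp
qed

lemma
  fixes f :: "complex \<Rightarrow> 'b::{banach, second_countable_topology}"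
  assumes f: "integrable lborel f"
  shows integrable_sym_avg: "integrable lborel (sym_avg v f)"
    and integral_sym_avg: "(LINT x|lborel. sym_avg v f x) = (LINT x|lborel. f x)"
    and integrable_walk: "integrable lborel (walk w f)"
    and integral_walk: "(LINT x|lborel. walk w f x) = (LINT x|lborel. f x)"
proof -
  have [measurable]: "f \<in> borel_measurable borel" using borel_measurable_integrable[OF f] by simp
  have i: "integrable lborel (\<lambda>x. f (x + v))" "integrable lborel (\<lambda>x. f (x - v))" for v
    using lborel_integrable_shift[OF f, of v] lborel_integrable_shift[OF f, of "-v"] by auto
  have e: "(LINT x|lborel. f (x + v)) = (LINT x|lborel. f x)" "(LINT x|lborel. f (x - v)) = (LINT x|lborel. f x)" for v
    using lborel_integral_shift[of f v] lborel_integral_shift[of f "-v"] by auto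
  have *: "integrable lborel (sym_avg v f)" for v
    unfolding sym_avg_def[abs_def] using i by simp
  have **: "(LINT x|lborel. sym_avg v f x) = (LINT x|lborel. f x)" for v
    unfolding sym_avg_def[abs_def] using i e[of v] by (simp add: scaleR_2[symmetric])
  show "integrable lborel (sym_avg v f)" "(LINT x|lborel. sym_avg v f x) = (LINT x|lborel. f x)" by (rule * **)+
  have third: "a + a + a = 3 *\<^sub>R a" for a :: 'b
    using scaleR_add_left[of "1 + 1" 1 a] by (simp add: scaleR_2)
  show "integrable lborel (walk w f)"
    unfolding walk_def[abs_def] avg3_def using * by simp
  show "(LINT x|lborel. walk w f x) = (LINT x|lborel. f x)"
    unfolding walk_def[abs_def] avg3_def using * **
    by (simp add: third)
qed

lemma integrable_walk_funpow:
  fixes f :: "complex \<Rightarrow> 'b::{banach, second_countable_topology}"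
  assumes "integrable lborel f"
  shows "integrable lborel ((walk w ^^ n) f)" "(LINT x|lborel. (walk w ^^ n) f x) = (LINT x|lborel. f x)"
proof (induction n)
  case (Suc n)
  case 1
  show ?case using Suc by (simp add: integrable_walk)
  case 2
  show ?case using Suc by (simp add: integral_walk)
qed (use assms in auto)

text \<open>Summation by parts: translation invariance turns a product of two odd differences into a
  second difference. Its step is 2 v because the shifts by v and - v combine; \<open>walk_op\<close>
  is defined with this doubled step for that reason.\<close>

lemma integral_sym_dif_mult:
  assumes f: "f \<in> bounded_borel" and g: "g \<in> test_fun"
  shows "(LINT x|lborel. sym_dif v f x * sym_dif v g x)
    = - (1/2) * (LINT x|lborel. g x * (sym_avg (2 * v) f x - f x))"
proof -
  have fg: "(\<lambda>x. f (x + a) * g (x + b)) \<in> test_fun" for a b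
    by (rule test_fun_mult_left[OF test_fun_shift[OF g] bounded_borel_shift[OF f]])
  have i: "integrable lborel (\<lambda>x. f (x + a) * g (x + b))" for a b
    by (intro test_fun_integrable fg)
  have e: "(LINT x|lborel. f (x + a) * g (x + b)) = (LINT x|lborel. f (x + (a - b)) * g x)" for a b
    using lborel_integral_shift[of "\<lambda>x. f (x + (a - b)) * g x" b] fg[of "a-b" 0]
    by (simp add: add.assoc bounded_borel_measurable test_fun_bounded_borel)
  have h: "has_bochner_integral lborel (\<lambda>x. f (x + a) * g (x + b)) (LINT x|lborel. f (x + c) * g x)"
    if "a - b = c" for a b c
    using i[of a b] e[of a b] that by (simp add: has_bochner_integral_iff)
  have "has_bochner_integral lborel (\<lambda>x. (1/4) * (f (x + v) * g (x + v) + f (x + -v) * g (x + -v)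
        - f (x + v) * g (x + -v) - f (x + -v) * g (x + v)))
      ((1/4) * ((LINT x|lborel. f (x + 0) * g x) + (LINT x|lborel. f (x + 0) * g x)
       - (LINT x|lborel. f (x + 2 * v) * g x) - (LINT x|lborel. f (x + -(2 * v)) * g x)))"
    by (intro has_bochner_integral_mult_right has_bochner_integral_add has_bochner_integral_diff h) auto
  moreover have "(\<lambda>x. (1/4) * (f (x + v) * g (x + v) + f (x + -v) * g (x + -v)
        - f (x + v) * g (x + -v) - f (x + -v) * g (x + v))) = (\<lambda>x. sym_dif v f x * sym_dif v g x)"
    by (auto simp: sym_dif_def algebra_simps scaleR_conv_of_real)
  moreover have "has_bochner_integral lborel (\<lambda>x. (1/2) * (f (x + 2 * v) * g (x + 0)) + (1/2) * (f (x + -(2 * v)) * g (x + 0)) - f (x + 0) * g (x + 0))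
      ((1/2) * (LINT x|lborel. f (x + 2 * v) * g x) + (1/2) * (LINT x|lborel. f (x + -(2 * v)) * g x) - (LINT x|lborel. f (x + 0) * g x))"
    by (intro has_bochner_integral_mult_right has_bochner_integral_add has_bochner_integral_diff h) auto
  moreover have "(\<lambda>x. (1/2) * (f (x + 2 * v) * g (x + 0)) + (1/2) * (f (x + -(2 * v)) * g (x + 0)) - f (x + 0) * g (x + 0))
      = (\<lambda>x. g x * (sym_avg (2 * v) f x - f x))"
    by (auto simp: sym_avg_def algebra_simps scaleR_conv_of_real)
  ultimately have "has_bochner_integral lborel (\<lambda>x. sym_dif v f x * sym_dif v g x)
      ((1/4) * ((LINT x|lborel. f (x + 0) * g x) + (LINT x|lborel. f (x + 0) * g x)
       - (LINT x|lborel. f (x + 2 * v) * g x) - (LINT x|lborel. f (x + -(2 * v)) * g x)))"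
    "has_bochner_integral lborel (\<lambda>x. g x * (sym_avg (2 * v) f x - f x))
      ((1/2) * (LINT x|lborel. f (x + 2 * v) * g x) + (1/2) * (LINT x|lborel. f (x + -(2 * v)) * g x) - (LINT x|lborel. f (x + 0) * g x))"
    by simp_all
  then have 1: "(LINT x|lborel. sym_dif v f x * sym_dif v g x) =
      ((1/4) * ((LINT x|lborel. f (x + 0) * g x) + (LINT x|lborel. f (x + 0) * g x)
       - (LINT x|lborel. f (x + 2 * v) * g x) - (LINT x|lborel. f (x + -(2 * v)) * g x)))"
    and 2: "(LINT x|lborel. g x * (sym_avg (2 * v) f x - f x)) =
      ((1/2) * (LINT x|lborel. f (x + 2 * v) * g x) + (1/2) * (LINT x|lborel. f (x + -(2 * v)) * g x) - (LINT x|lborel. f (x + 0) * g x))"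
    by (simp_all only: has_bochner_integral_integral_eq)
  show ?thesis unfolding 1 2 by (simp add: ring_distribs)
qed

text \<open>Each step v is as likely as - v, so the operator of the walk is symmetric for the
  bilinear pairing.\<close>

lemma integral_mult_walk:
  assumes f: "f \<in> bounded_borel" and g: "g \<in> test_fun"
  shows "(LINT x|lborel. walk v g x * f x) = (LINT x|lborel. g x * walk v f x)"
proof -
  have i: "integrable lborel (\<lambda>x. g x * f (x + b))" "integrable lborel (\<lambda>x. g (x + b) * f x)" for b
    by (rule test_fun_integrable[OF test_fun_mult] test_fun_shift bounded_borel_shift f g)+
  have i': "integrable lborel (\<lambda>x. g x * f (x - b))" "integrable lborel (\<lambda>x. g (x - b) * f x)" for b
    using i[of "-b"] by auto
  have gm: "g \<in> borel_measurable borel" "f \<in> borel_measurable borel"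
    using f g by (auto intro: bounded_borel_measurable test_fun_bounded_borel)
  have e: "(LINT x|lborel. g (x + a) * f x) = (LINT x|lborel. g x * f (x - a))" for a
    using lborel_integral_shift[of "\<lambda>x. g x * f (x - a)" a] gm by simp
  have e': "(LINT x|lborel. g (x - a) * f x) = (LINT x|lborel. g x * f (x + a))" for a
    using e[of "-a"] by simp
  have *: "(LINT x|lborel. sym_avg u g x * f x) = (LINT x|lborel. g x * sym_avg u f x)" for u
  proof -
    have "(LINT x|lborel. sym_avg u g x * f x) = (LINT x|lborel. (1/2) * (g (x + u) * f x) + (1/2) * (g (x - u) * f x))"
      by (rule Bochner_Integration.integral_cong) (simp_all add: sym_avg_def scaleR_conv_of_real ring_distribs)
    also have "\<dots> = (LINT x|lborel. (1/2) * (g x * f (x - u)) + (1/2) * (g x * f (x + u)))"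
      using i i' by (simp add: e e')
    also have "\<dots> = (LINT x|lborel. g x * sym_avg u f x)"
      by (rule Bochner_Integration.integral_cong) (simp_all add: sym_avg_def scaleR_conv_of_real ring_distribs)
    finally show ?thesis .
  qed
  have j: "integrable lborel (\<lambda>x. sym_avg u g x * f x)" "integrable lborel (\<lambda>x. g x * sym_avg u f x)" for u
    by (intro test_fun_integrable test_fun_mult test_fun_sym_avg bounded_borel_sym_avg f g)+
  have "(LINT x|lborel. walk v g x * f x) = (LINT x|lborel. (1/3) * (sym_avg (v 0) g x * f x)
      + (1/3) * (sym_avg (v 1) g x * f x) + (1/3) * (sym_avg (v 2) g x * f x))"
    by (rule Bochner_Integration.integral_cong) (simp_all add: walk_def avg3_def scaleR_conv_of_real ring_distribs)
  also have "\<dots> = (LINT x|lborel. (1/3) * (g x * sym_avg (v 0) f x)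
      + (1/3) * (g x * sym_avg (v 1) f x) + (1/3) * (g x * sym_avg (v 2) f x))"
    using j by (simp add: *)
  also have "\<dots> = (LINT x|lborel. g x * walk v f x)"
    by (rule Bochner_Integration.integral_cong) (simp_all add: walk_def avg3_def scaleR_conv_of_real ring_distribs)
  finally show ?thesis .
qed

lemma integral_mult_walk_funpow:
  assumes f: "f \<in> bounded_borel" and g: "g \<in> test_fun"
  shows "(LINT x|lborel. (walk v ^^ n) g x * f x) = (LINT x|lborel. g x * (walk v ^^ n) f x)"
  using f
proof (induction n arbitrary: f)
  case (Suc n)
  have "(LINT x|lborel. (walk v ^^ Suc n) g x * f x) = (LINT x|lborel. (walk v ^^ n) g x * walk v f x)"
    by (simp add: integral_mult_walk Suc.prems test_fun_walk_funpow g)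
  also have "\<dots> = (LINT x|lborel. g x * (walk v ^^ n) (walk v f) x)"
    by (intro Suc bounded_borel_walk)
  finally show ?case by (simp add: funpow_swap1)
qed simp

definition walk_op :: "(nat \<Rightarrow> complex) \<Rightarrow> (nat \<Rightarrow> complex) \<Rightarrow> (complex \<Rightarrow> complex) \<Rightarrow> complex \<Rightarrow> complex" where
  "walk_op v \<omega> F x = avg3 (\<lambda>j. \<omega> j * (sym_avg (2 * v j) F x - F x))"

lemma sym_avg_commute: "sym_avg u (sym_avg v F) = sym_avg v (sym_avg u F)"
  by (rule ext) (simp add: sym_avg_def algebra_simps)

lemma sym_avg_linear:
  "sym_avg u (\<lambda>x. F x + G x) = (\<lambda>x. sym_avg u F x + sym_avg u G x)"
  "sym_avg u (\<lambda>x. F x - G x) = (\<lambda>x. sym_avg u F x - sym_avg u G x)"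
  "sym_avg u (\<lambda>x. c *\<^sub>R F x) = (\<lambda>x. c *\<^sub>R sym_avg u F x)"
  "sym_avg u (\<lambda>x. (a::'b::real_algebra) * H x) = (\<lambda>x. a * sym_avg u H x)"
  by (simp_all add: fun_eq_iff sym_avg_def algebra_simps)

lemma walk_linear:
  "walk v (\<lambda>x. F x + G x) = (\<lambda>x. walk v F x + walk v G x)"
  "walk v (\<lambda>x. F x - G x) = (\<lambda>x. walk v F x - walk v G x)"
  by (simp_all add: fun_eq_iff walk_def avg3_def sym_avg_linear algebra_simps)

lemma sym_avg_walk: "sym_avg u (walk v F) = walk v (sym_avg u F)"
  unfolding walk_def[abs_def] avg3_def
  by (simp add: sym_avg_linear sym_avg_commute[of u "v _"])

lemma walk_op_linear:
  "walk_op v \<omega> (\<lambda>x. F x + G x) = (\<lambda>x. walk_op v \<omega> F x + walk_op v \<omega> G x)"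
  "walk_op v \<omega> (\<lambda>x. F x - G x) = (\<lambda>x. walk_op v \<omega> F x - walk_op v \<omega> G x)"
  "walk_op v \<omega> (\<lambda>x. c * F x) = (\<lambda>x. c * walk_op v \<omega> F x)"
  by (simp_all add: fun_eq_iff walk_op_def avg3_def sym_avg_linear algebra_simps)

lemma walk_cmult: "walk v (\<lambda>x. (c::complex) * F x) = (\<lambda>x. c * walk v F x)"
  by (simp add: fun_eq_iff walk_def avg3_def sym_avg_linear algebra_simps)

lemma walk_walk_op: "walk v (walk_op v \<omega> F) = walk_op v \<omega> (walk v F)"
  unfolding walk_op_def[abs_def] sym_avg_walk walk_def[abs_def] avg3_def sym_avg_linear
    sym_avg_commute[of "v i" "2 * v j" for i j]
  by (simp add: fun_eq_iff algebra_simps)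

lemma walk_funpow_walk_op: "(walk v ^^ n) (walk_op v \<omega> F) = walk_op v \<omega> ((walk v ^^ n) F)"
  by (induction n) (simp_all add: walk_walk_op)

lemma bounded_borel_walk_op: "F \<in> bounded_borel \<Longrightarrow> walk_op v \<omega> F \<in> bounded_borel"
  unfolding walk_op_def[abs_def] avg3_def scaleR_conv_of_real
  by (intro bounded_borel_cmult bounded_borel_add bounded_borel_diff bounded_borel_sym_avg)

lemma walk_funpow_diff: "(walk v ^^ n) (\<lambda>x. F x - G x) = (\<lambda>x. (walk v ^^ n) F x - (walk v ^^ n) G x)"
  by (induction n) (simp_all add: walk_linear)

lemma integral_walk_form_term:
  assumes f: "f \<in> bounded_borel" and g: "g \<in> test_fun"
  shows "(LINT x|lborel. avg3 (\<lambda>j. \<omega> j * sym_dif (v j) f x * sym_dif (v j) g x))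
    = - (1/2) * (LINT x|lborel. g x * walk_op v \<omega> f x)"
proof -
  have h: "has_bochner_integral lborel (\<lambda>x. \<omega> j * sym_dif (v j) f x * sym_dif (v j) g x)
      (\<omega> j * (- (1/2) * (LINT x|lborel. g x * (sym_avg (2 * v j) f x - f x))))" for j
    unfolding mult.assoc integral_sym_dif_mult[OF f g, symmetric]
    by (intro has_bochner_integral_mult_right has_bochner_integral_integrable test_fun_integrable
        test_fun_mult_left test_fun_sym_dif bounded_borel_sym_dif f g)
  have h': "has_bochner_integral lborel (\<lambda>x. \<omega> j * (g x * (sym_avg (2 * v j) f x - f x)))
      (\<omega> j * (LINT x|lborel. g x * (sym_avg (2 * v j) f x - f x)))" for j
    by (intro has_bochner_integral_mult_right has_bochner_integral_integrable test_fun_integrable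
        test_fun_mult bounded_borel_diff bounded_borel_sym_avg f g)
  have "has_bochner_integral lborel (\<lambda>x. avg3 (\<lambda>j. \<omega> j * sym_dif (v j) f x * sym_dif (v j) g x))
    (avg3 (\<lambda>j. \<omega> j * (- (1/2) * (LINT x|lborel. g x * (sym_avg (2 * v j) f x - f x)))))"
    unfolding avg3_def by (intro has_bochner_integral_scaleR_right has_bochner_integral_add h)
  moreover have "has_bochner_integral lborel (\<lambda>x. avg3 (\<lambda>j. \<omega> j * (g x * (sym_avg (2 * v j) f x - f x))))
    (avg3 (\<lambda>j. \<omega> j * (LINT x|lborel. g x * (sym_avg (2 * v j) f x - f x))))"
    unfolding avg3_def by (intro has_bochner_integral_scaleR_right has_bochner_integral_add h')
  moreover have "(\<lambda>x. avg3 (\<lambda>j. \<omega> j * (g x * (sym_avg (2 * v j) f x - f x)))) = (\<lambda>x. g x * walk_op v \<omega> f x)"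
    by (simp add: fun_eq_iff walk_op_def avg3_def scaleR_conv_of_real ring_distribs mult_ac)
  ultimately have "(LINT x|lborel. avg3 (\<lambda>j. \<omega> j * sym_dif (v j) f x * sym_dif (v j) g x)) =
    avg3 (\<lambda>j. \<omega> j * (- (1/2) * (LINT x|lborel. g x * (sym_avg (2 * v j) f x - f x))))"
    "(LINT x|lborel. g x * walk_op v \<omega> f x) = avg3 (\<lambda>j. \<omega> j * (LINT x|lborel. g x * (sym_avg (2 * v j) f x - f x)))"
    by (simp_all only: has_bochner_integral_integral_eq)
  then show ?thesis by (simp add: avg3_def scaleR_conv_of_real algebra_simps)
qed

text \<open>Moving all steps from g to f turns the k-th term of the sum into the pairing of g with
  \<open>walk_op\<close> of P^(2k) f, where P is \<open>walk v\<close>. For f = F - P^2 F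
  consecutive terms cancel; that is why two steps and not one are subtracted.\<close>

lemma integral_walk_form:
  assumes F: "F \<in> bounded_borel" and g: "g \<in> test_fun"
  shows "(LINT x|lborel. walk_form v \<omega> (\<lambda>x. F x - (walk v ^^ 2) F x) g n x)
    = - (1/2) * (LINT x|lborel. g x * walk_op v \<omega> F x)
      + (1/2) * (LINT x|lborel. g x * walk_op v \<omega> ((walk v ^^ (2 * n)) F) x)"
proof (induction n)
  case 0
  show ?case by simp
next
  case (Suc n)
  define f where "f = (\<lambda>x. F x - (walk v ^^ 2) F x)"
  have f: "f \<in> bounded_borel" unfolding f_def by (intro bounded_borel_diff bounded_borel_walk_funpow F)
  have fn: "(walk v ^^ n) f \<in> bounded_borel" and gn: "(walk v ^^ n) g \<in> test_fun"
    by (intro bounded_borel_walk_funpow test_fun_walk_funpow f g)+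
  have i: "integrable lborel (\<lambda>x. g x * walk_op v \<omega> ((walk v ^^ m) F) x)" for m
    by (intro test_fun_integrable test_fun_mult bounded_borel_walk_op bounded_borel_walk_funpow F g)
  have "(LINT x|lborel. walk_form v \<omega> f g (Suc n) x) = (LINT x|lborel. walk_form v \<omega> f g n x)
     + (LINT x|lborel. avg3 (\<lambda>j. \<omega> j * sym_dif (v j) ((walk v ^^ n) f) x * sym_dif (v j) ((walk v ^^ n) g) x))"
  proof -
    have "integrable lborel (\<lambda>x. \<omega> j * sym_dif (v j) ((walk v ^^ n) f) x * sym_dif (v j) ((walk v ^^ n) g) x)" for j
      by (intro test_fun_integrable test_fun_mult_left bounded_borel_cmult test_fun_sym_dif bounded_borel_sym_dif fn gn)
    then have "integrable lborel (\<lambda>x. avg3 (\<lambda>j. \<omega> j * sym_dif (v j) ((walk v ^^ n) f) x * sym_dif (v j) ((walk v ^^ n) g) x))"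
      unfolding avg3_def by auto
    moreover have "integrable lborel (walk_form v \<omega> f g n)"
      by (intro test_fun_integrable test_fun_walk_form f g)
    ultimately show ?thesis by (simp add: integrable_walk integral_walk)
  qed
  also have "(LINT x|lborel. avg3 (\<lambda>j. \<omega> j * sym_dif (v j) ((walk v ^^ n) f) x * sym_dif (v j) ((walk v ^^ n) g) x))
     = - (1/2) * (LINT x|lborel. (walk v ^^ n) g x * walk_op v \<omega> ((walk v ^^ n) f) x)"
    by (rule integral_walk_form_term[OF fn gn])
  also have "(LINT x|lborel. (walk v ^^ n) g x * walk_op v \<omega> ((walk v ^^ n) f) x)
     = (LINT x|lborel. g x * walk_op v \<omega> ((walk v ^^ (2 * n)) f) x)"
    by (subst integral_mult_walk_funpow) (auto intro!: bounded_borel_walk_op fn g simp: walk_funpow_walk_op mult_2 funpow_add)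
  also have "walk_op v \<omega> ((walk v ^^ (2 * n)) f) =
      (\<lambda>x. walk_op v \<omega> ((walk v ^^ (2 * n)) F) x - walk_op v \<omega> ((walk v ^^ (2 * Suc n)) F) x)"
  proof -
    have "(walk v ^^ (2 * n)) ((walk v ^^ 2) F) = (walk v ^^ (2 * Suc n)) F"
      by (metis comp_apply funpow_add mult_Suc_right add.commute)
    then show ?thesis unfolding f_def by (simp only: walk_funpow_diff walk_op_linear)
  qed
  also have "(LINT x|lborel. g x * (walk_op v \<omega> ((walk v ^^ (2 * n)) F) x - walk_op v \<omega> ((walk v ^^ (2 * Suc n)) F) x))
    = (LINT x|lborel. g x * walk_op v \<omega> ((walk v ^^ (2 * n)) F) x) - (LINT x|lborel. g x * walk_op v \<omega> ((walk v ^^ (2 * Suc n)) F) x)"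
    using i[of "2 * n"] i[of "2 * Suc n"] by (simp only: right_diff_distrib Bochner_Integration.integral_diff)
  finally show ?case using Suc unfolding f_def by (simp add: algebra_simps)
qed

section \<open>Energy along the walk\<close>

lemma
  fixes G :: "complex \<Rightarrow> complex"
  assumes G: "G \<in> bounded_borel" and i: "integrable lborel (\<lambda>x. (norm (G x))\<^sup>2)"
  shows integrable_norm2_sym_avg: "integrable lborel (\<lambda>x. (norm (sym_avg v G x))\<^sup>2)"
    and integrable_norm2_sym_dif: "integrable lborel (\<lambda>x. (norm (sym_dif v G x))\<^sup>2)"
    and integral_norm2_sym: "(LINT x|lborel. (norm (sym_avg v G x))\<^sup>2) + (LINT x|lborel. (norm (sym_dif v G x))\<^sup>2)
        = (LINT x|lborel. (norm (G x))\<^sup>2)"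
proof -
  have [measurable]: "G \<in> borel_measurable borel" using G by (rule bounded_borel_measurable)
  have [measurable]: "sym_avg v G \<in> borel_measurable borel" "sym_dif v G \<in> borel_measurable borel"
    using G by (auto intro: bounded_borel_measurable bounded_borel_sym_avg bounded_borel_sym_dif)
  \<comment> \<open>The parallelogram law. After integration, translation invariance turns the right
    side into the energy of G.\<close>
  have par: "(norm (sym_avg v G x))\<^sup>2 + (norm (sym_dif v G x))\<^sup>2 = (1/2) * ((norm (G (x + v)))\<^sup>2 + (norm (G (x + -v)))\<^sup>2)" for x
    unfolding sym_avg_def sym_dif_def norm_scaleR power_mult_distrib cmod_power2
    by (simp add: power2_eq_square field_simps)
  have j: "integrable lborel (\<lambda>x. (1/2) * ((norm (G (x + v)))\<^sup>2 + (norm (G (x + -v)))\<^sup>2))"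
    using lborel_integrable_shift[OF i, of v] lborel_integrable_shift[OF i, of "-v"] by auto
  show a: "integrable lborel (\<lambda>x. (norm (sym_avg v G x))\<^sup>2)"
  proof (rule Bochner_Integration.integrable_bound[OF j])
    show "AE x in lborel. norm ((norm (sym_avg v G x))\<^sup>2) \<le> norm ((1/2) * ((norm (G (x + v)))\<^sup>2 + (norm (G (x + -v)))\<^sup>2))"
      unfolding par[symmetric] by simp
  qed simp
  show b: "integrable lborel (\<lambda>x. (norm (sym_dif v G x))\<^sup>2)"
  proof (rule Bochner_Integration.integrable_bound[OF j])
    show "AE x in lborel. norm ((norm (sym_dif v G x))\<^sup>2) \<le> norm ((1/2) * ((norm (G (x + v)))\<^sup>2 + (norm (G (x + -v)))\<^sup>2))"
      unfolding par[symmetric] by simp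
  qed simp
  have "(LINT x|lborel. (norm (sym_avg v G x))\<^sup>2) + (LINT x|lborel. (norm (sym_dif v G x))\<^sup>2)
      = (LINT x|lborel. (1/2) * ((norm (G (x + v)))\<^sup>2 + (norm (G (x + -v)))\<^sup>2))"
    unfolding par[symmetric] using a b by simp
  also have "\<dots> = (1/2) * ((LINT x|lborel. (norm (G (x + v)))\<^sup>2) + (LINT x|lborel. (norm (G (x + -v)))\<^sup>2))"
    using lborel_integrable_shift[OF i, of v] lborel_integrable_shift[OF i, of "-v"] by simp
  also have "\<dots> = (LINT x|lborel. (norm (G x))\<^sup>2)"
    using lborel_integral_shift[of "\<lambda>x. (norm (G x))\<^sup>2" v] lborel_integral_shift[of "\<lambda>x. (norm (G x))\<^sup>2" "-v"] by simp
  finally show "(LINT x|lborel. (norm (sym_avg v G x))\<^sup>2) + (LINT x|lborel. (norm (sym_dif v G x))\<^sup>2)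
        = (LINT x|lborel. (norm (G x))\<^sup>2)" .
qed

lemma norm_avg3_le: "norm (avg3 (a :: nat \<Rightarrow> 'a::real_normed_vector)) \<le> avg3 (\<lambda>j. norm (a j))"
  unfolding avg3_def by (simp add: norm_triangle_le norm_triangle_mono)

lemma norm2_avg3_le: "(norm (avg3 (a :: nat \<Rightarrow> complex)))\<^sup>2 \<le> avg3 (\<lambda>j. (norm (a j))\<^sup>2)"
proof -
  have t: "norm (avg3 a) \<le> (norm (a 0) + norm (a 1) + norm (a 2)) / 3"
    unfolding avg3_def by (simp add: norm_triangle_le norm_triangle_mono)
  have "(norm (avg3 a))\<^sup>2 \<le> ((norm (a 0) + norm (a 1) + norm (a 2)) / 3)\<^sup>2"
    by (rule power_mono[OF t]) simp
  also have "\<dots> \<le> ((norm (a 0))\<^sup>2 + (norm (a 1))\<^sup>2 + (norm (a 2))\<^sup>2) / 3"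
  proof -
    have "0 \<le> (norm (a 0) - norm (a 1))\<^sup>2 + (norm (a 0) - norm (a 2))\<^sup>2 + (norm (a 1) - norm (a 2))\<^sup>2" by simp
    then show ?thesis by (simp add: power2_eq_square algebra_simps divide_simps)
  qed
  finally show ?thesis by (simp add: avg3_def)
qed

text \<open>Convexity of the square bounds the energy after averaging by the average of the
  energies, and the parallelogram law expresses the loss through the odd differences.\<close>

lemma
  fixes G :: "complex \<Rightarrow> complex"
  assumes G: "G \<in> bounded_borel" and i: "integrable lborel (\<lambda>x. (norm (G x))\<^sup>2)"
  shows integrable_norm2_walk: "integrable lborel (\<lambda>x. (norm (walk v G x))\<^sup>2)"
    and integral_norm2_walk: "(LINT x|lborel. (norm (walk v G x))\<^sup>2) + avg3 (\<lambda>j. LINT x|lborel. (norm (sym_dif (v j) G x))\<^sup>2)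
        \<le> (LINT x|lborel. (norm (G x))\<^sup>2)"
proof -
  have [measurable]: "walk v G \<in> borel_measurable borel"
    using G by (auto intro: bounded_borel_measurable bounded_borel_walk)
  have le: "(norm (walk v G x))\<^sup>2 \<le> avg3 (\<lambda>j. (norm (sym_avg (v j) G x))\<^sup>2)" for x
    unfolding walk_def by (rule norm2_avg3_le)
  have j: "integrable lborel (\<lambda>x. avg3 (\<lambda>j. (norm (sym_avg (v j) G x))\<^sup>2))"
    unfolding avg3_def using integrable_norm2_sym_avg[OF G i] by auto
  show k: "integrable lborel (\<lambda>x. (norm (walk v G x))\<^sup>2)"
    by (rule Bochner_Integration.integrable_bound[OF j]) (use order_trans[OF zero_le_power2 le] le in auto)
  have "(LINT x|lborel. (norm (walk v G x))\<^sup>2) \<le> (LINT x|lborel. avg3 (\<lambda>j. (norm (sym_avg (v j) G x))\<^sup>2))"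
    by (intro integral_mono k j le)
  also have "\<dots> = avg3 (\<lambda>j. LINT x|lborel. (norm (sym_avg (v j) G x))\<^sup>2)"
    unfolding avg3_def using integrable_norm2_sym_avg[OF G i] by simp
  also have "\<dots> = avg3 (\<lambda>j. (LINT x|lborel. (norm (G x))\<^sup>2) - (LINT x|lborel. (norm (sym_dif (v j) G x))\<^sup>2))"
  proof -
    have "(LINT x|lborel. (norm (sym_avg (v j) G x))\<^sup>2)
      = (LINT x|lborel. (norm (G x))\<^sup>2) - (LINT x|lborel. (norm (sym_dif (v j) G x))\<^sup>2)" for j
      using integral_norm2_sym[OF G i, of "v j"] by linarith
    then show ?thesis by simp
  qed
  finally show "(LINT x|lborel. (norm (walk v G x))\<^sup>2) + avg3 (\<lambda>j. LINT x|lborel. (norm (sym_dif (v j) G x))\<^sup>2)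
        \<le> (LINT x|lborel. (norm (G x))\<^sup>2)" by (simp add: avg3_def field_simps)
qed

text \<open>Summation by parts puts one difference on each factor, and then 2 |u w| <= t |u|^2 +
  |w|^2 / t. A small t makes the term with g small, while the term with G is controlled by the
  energy loss.\<close>

lemma norm_walk_op_integral_le:
  assumes G: "G \<in> bounded_borel" and i: "integrable lborel (\<lambda>x. (norm (G x))\<^sup>2)" and g: "g \<in> test_fun"
    and w: "\<And>j. j < 3 \<Longrightarrow> norm (\<omega> j) = 1" and t: "t > 0"
  shows "norm (LINT x|lborel. g x * walk_op v \<omega> G x)
    \<le> t * avg3 (\<lambda>j. LINT x|lborel. (norm (sym_dif (v j) g x))\<^sup>2)
      + (1/t) * avg3 (\<lambda>j. LINT x|lborel. (norm (sym_dif (v j) G x))\<^sup>2)"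
proof -
  have gb: "g \<in> bounded_borel" using g by (rule test_fun_bounded_borel)
  have "integrable lborel (\<lambda>x. norm (g x) powr 2)" using g by (intro test_fun_integrable_powr) auto
  then have gi: "integrable lborel (\<lambda>x. (norm (g x))\<^sup>2)" by simp
  have prod: "integrable lborel (\<lambda>x. sym_dif (v j) G x * sym_dif (v j) g x)" for j
    by (intro test_fun_integrable test_fun_mult_left test_fun_sym_dif bounded_borel_sym_dif G g)
  have each: "2 * norm (LINT x|lborel. sym_dif (v j) G x * sym_dif (v j) g x)
     \<le> t * (LINT x|lborel. (norm (sym_dif (v j) g x))\<^sup>2) + (1/t) * (LINT x|lborel. (norm (sym_dif (v j) G x))\<^sup>2)" for j
  proof -
    have pt: "2 * norm (sym_dif (v j) G x * sym_dif (v j) g x) \<le> t * (norm (sym_dif (v j) g x))\<^sup>2 + (1/t) * (norm (sym_dif (v j) G x))\<^sup>2" for x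
    proof -
      have "0 \<le> (t * norm (sym_dif (v j) g x) - norm (sym_dif (v j) G x))\<^sup>2 / t" using t by simp
      also have "\<dots> = t * (norm (sym_dif (v j) g x))\<^sup>2 + (1/t) * (norm (sym_dif (v j) G x))\<^sup>2 - 2 * norm (sym_dif (v j) G x * sym_dif (v j) g x)"
        using t by (simp add: power2_eq_square field_simps norm_mult)
      finally show ?thesis by simp
    qed
    have "2 * norm (LINT x|lborel. sym_dif (v j) G x * sym_dif (v j) g x) \<le> (LINT x|lborel. 2 * norm (sym_dif (v j) G x * sym_dif (v j) g x))"
      by (simp add: integral_norm_bound)
    also have "\<dots> \<le> (LINT x|lborel. t * (norm (sym_dif (v j) g x))\<^sup>2 + (1/t) * (norm (sym_dif (v j) G x))\<^sup>2)"
      using prod integrable_norm2_sym_dif[OF gb gi] integrable_norm2_sym_dif[OF G i]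
      by (intro integral_mono pt) auto
    also have "\<dots> = t * (LINT x|lborel. (norm (sym_dif (v j) g x))\<^sup>2) + (1/t) * (LINT x|lborel. (norm (sym_dif (v j) G x))\<^sup>2)"
      using integrable_norm2_sym_dif[OF gb gi] integrable_norm2_sym_dif[OF G i] by simp
    finally show ?thesis .
  qed
  have "(LINT x|lborel. g x * walk_op v \<omega> G x) = -2 * (LINT x|lborel. avg3 (\<lambda>j. \<omega> j * sym_dif (v j) G x * sym_dif (v j) g x))"
    by (subst integral_walk_form_term[OF G g]) simp
  also have "(LINT x|lborel. avg3 (\<lambda>j. \<omega> j * sym_dif (v j) G x * sym_dif (v j) g x))
     = avg3 (\<lambda>j. \<omega> j * (LINT x|lborel. sym_dif (v j) G x * sym_dif (v j) g x))"
    unfolding avg3_def mult.assoc using prod by simp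
  finally have "norm (LINT x|lborel. g x * walk_op v \<omega> G x) \<le> 2 * norm (avg3 (\<lambda>j. \<omega> j * (LINT x|lborel. sym_dif (v j) G x * sym_dif (v j) g x)))"
    by (simp add: norm_mult)
  also have "\<dots> \<le> 2 * avg3 (\<lambda>j. norm (LINT x|lborel. sym_dif (v j) G x * sym_dif (v j) g x))"
    using norm_avg3_le[of "\<lambda>j. \<omega> j * (LINT x|lborel. sym_dif (v j) G x * sym_dif (v j) g x)"] w[of 0] w[of 1] w[of 2]
    by (simp add: avg3_def norm_mult)
  also have "\<dots> = avg3 (\<lambda>j. 2 * norm (LINT x|lborel. sym_dif (v j) G x * sym_dif (v j) g x))" by (simp add: avg3_def)
  also have "\<dots> \<le> avg3 (\<lambda>j. t * (LINT x|lborel. (norm (sym_dif (v j) g x))\<^sup>2) + (1/t) * (LINT x|lborel. (norm (sym_dif (v j) G x))\<^sup>2))"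
    by (rule avg3_mono, rule each)
  also have "\<dots> = t * avg3 (\<lambda>j. LINT x|lborel. (norm (sym_dif (v j) g x))\<^sup>2)
      + (1/t) * avg3 (\<lambda>j. LINT x|lborel. (norm (sym_dif (v j) G x))\<^sup>2)"
    by (simp add: avg3_def algebra_simps add_divide_distrib)
  finally show ?thesis .
qed

text \<open>The energy \<open>\<integral>|P\<^sup>n F|\<^sup>2\<close> decreases in \<open>n\<close>, so its decrements, which dominate the
  pairing, tend to zero; no decay estimate for the random walk is needed.\<close>

lemma walk_op_funpow_tendsto_0:
  assumes F: "F \<in> bounded_borel" and i: "integrable lborel (\<lambda>x. (norm (F x))\<^sup>2)" and g: "g \<in> test_fun"
    and w: "\<And>j. j < 3 \<Longrightarrow> norm (\<omega> j) = 1"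
  shows "(\<lambda>n. LINT x|lborel. g x * walk_op v \<omega> ((walk v ^^ n) F) x) \<longlonglongrightarrow> 0"
proof -
  define E where "E n = (LINT x|lborel. (norm ((walk v ^^ n) F x))\<^sup>2)" for n
  define d where "d n = E n - E (Suc n)" for n
  define b where "b = avg3 (\<lambda>j. LINT x|lborel. (norm (sym_dif (v j) g x))\<^sup>2)"
  have Fb: "(walk v ^^ n) F \<in> bounded_borel" for n by (intro bounded_borel_walk_funpow F)
  have Fi: "integrable lborel (\<lambda>x. (norm ((walk v ^^ n) F x))\<^sup>2)" for n
    by (induction n) (auto intro: i integrable_norm2_walk Fb)
  have dn: "avg3 (\<lambda>j. LINT x|lborel. (norm (sym_dif (v j) ((walk v ^^ n) F) x))\<^sup>2) \<le> d n" for n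
    using integral_norm2_walk[OF Fb Fi, of v n] by (simp add: E_def d_def)
  have av0: "0 \<le> avg3 (\<lambda>j. LINT x|lborel. (norm (sym_dif (v j) G x))\<^sup>2)" for G :: "complex \<Rightarrow> complex"
    unfolding avg3_def by (intro scaleR_nonneg_nonneg add_nonneg_nonneg integral_nonneg_AE) auto
  have d0: "d n \<ge> 0" for n using dn[of n] av0[of "(walk v ^^ n) F"] by linarith
  have "decseq E" using d0 by (intro decseq_SucI) (simp add: d_def)
  then obtain l where "E \<longlonglongrightarrow> l"
    by (rule decseq_convergent[of E 0]) (auto simp: E_def)
  then have "d \<longlonglongrightarrow> l - l" unfolding d_def by (intro tendsto_diff LIMSEQ_Suc)
  then have "(\<lambda>n. d n + 1 / real (Suc n)) \<longlonglongrightarrow> 0 + 0"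
    by (intro tendsto_add LIMSEQ_Suc[OF lim_1_over_n]) auto
  then have lim: "(\<lambda>n. sqrt (d n + 1 / real (Suc n)) * (b + 1)) \<longlonglongrightarrow> 0"
    using tendsto_real_sqrt tendsto_mult_left_zero by fastforce
  have bound: "norm (LINT x|lborel. g x * walk_op v \<omega> ((walk v ^^ n) F) x) \<le> sqrt (d n + 1 / real (Suc n)) * (b + 1)" for n
  proof -
    \<comment> \<open>The square root balances the two terms of the estimate; 1 / (n + 1) is added
      only to keep s positive.\<close>
    define s where "s = sqrt (d n + 1 / real (Suc n))"
    have s: "s > 0" using d0[of n] by (simp add: s_def add_nonneg_pos)
    have "norm (LINT x|lborel. g x * walk_op v \<omega> ((walk v ^^ n) F) x) \<le> s * b
        + (1/s) * avg3 (\<lambda>j. LINT x|lborel. (norm (sym_dif (v j) ((walk v ^^ n) F) x))\<^sup>2)"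
      unfolding b_def by (rule norm_walk_op_integral_le[OF Fb Fi g w s])
    also have "\<dots> \<le> s * b + (1/s) * s\<^sup>2"
      using s dn[of n] d0[of n] by (intro add_left_mono mult_left_mono) (auto simp: s_def intro: order_trans)
    also have "\<dots> = s * (b + 1)" using s by (simp add: power2_eq_square algebra_simps)
    finally show ?thesis unfolding s_def .
  qed
  show ?thesis by (rule Lim_null_comparison[OF _ lim]) (use bound in auto)
qed


section \<open>From the bilinear form to norms\<close>

lemma Young_optimize:
  fixes X a b p q :: real
  assumes p: "p > 1" and q: "q > 1" and pq: "1/p + 1/q = 1" and a: "a \<ge> 0" and b: "b \<ge> 0"
    and le: "\<And>t. t > 0 \<Longrightarrow> X \<le> (t * a) powr p / p + (b / t) powr q / q"
  shows "X \<le> a * b"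
proof -
  have pos: "X \<le> c * d" if cd: "c > 0" "d > 0" "a \<le> c" "b \<le> d" for c d
  proof -
    \<comment> \<open>This choice makes each of the powers (t c)^p and (d / t)^q equal to c *
      d.\<close>
    define t where "t = (d powr q / c powr p) powr (1 / (p * q))"
    have t: "t > 0" using cd by (simp add: t_def)
    have pq': "p / q = p - 1" "q / p = q - 1" using pq p q by (auto simp: field_simps)
    have lt: "ln t = (q * ln d - p * ln c) / (p * q)"
      using cd by (simp add: t_def ln_powr ln_div)
    have lt1: "p * ln t = ln d - (p / q) * ln c" and lt2: "q * ln t = (q / p) * ln d - ln c"
      using p q by (simp_all add: lt diff_divide_distrib right_diff_distrib)
    have "(t * c) powr p = exp (p * ln t + p * ln c)"
      using t cd unfolding powr_def by (simp add: ln_mult distrib_left)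
    also have "p * ln t + p * ln c = ln c + ln d" unfolding lt1 pq' by (simp add: algebra_simps)
    finally have e1: "(t * c) powr p = c * d" using cd by (simp add: exp_add)
    have "(d / t) powr q = exp (q * ln d - q * ln t)"
      using t cd unfolding powr_def by (simp add: ln_div right_diff_distrib)
    also have "q * ln d - q * ln t = ln c + ln d" unfolding lt2 pq' by (simp add: algebra_simps)
    finally have e2: "(d / t) powr q = c * d" using cd by (simp add: exp_add)
    have "X \<le> (t * a) powr p / p + (b / t) powr q / q" by (rule le[OF t])
    also have "\<dots> \<le> (t * c) powr p / p + (d / t) powr q / q"
      using t a b cd p q by (intro add_mono divide_right_mono powr_mono2 mult_left_mono divide_right_mono) auto
    also have "\<dots> = c * d * (1/p + 1/q)" unfolding e1 e2 by (simp add: distrib_left)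
    finally show ?thesis by (simp add: pq)
  qed
  \<comment> \<open>If a or b vanishes there is no optimal t, so both are increased by e, which then
    tends to 0.\<close>
  have "((\<lambda>e. (a + e) * (b + e)) \<longlongrightarrow> (a + 0) * (b + 0)) (at_right 0)"
    by (intro tendsto_intros)
  moreover have "\<forall>\<^sub>F e in at_right 0. X \<le> (a + e) * (b + e)"
    using eventually_at_right_less[of 0] by eventually_elim (use a b in \<open>auto intro!: pos\<close>)
  ultimately show ?thesis using tendsto_lowerbound[of "\<lambda>e. (a + e) * (b + e)" "a * b" "at_right 0" X] by simp
qed

lemma Re_rotate:
  assumes "\<And>\<zeta>. norm \<zeta> = 1 \<Longrightarrow> Re (\<zeta> * z) \<le> X"
  shows "norm z \<le> X"
proof (cases "z = 0")
  case True
  then show ?thesis using assms[of 1] by simp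
next
  case False
  have eq: "cnj z / of_real (norm z) * z = of_real (norm z)"
    using False complex_norm_square[of z] by (simp add: field_simps power2_eq_square)
  have "Re (cnj z / of_real (norm z) * z) \<le> X"
    using False by (intro assms) (simp add: norm_divide)
  then show ?thesis unfolding eq by simp
qed

lemma conjugate_exponent:
  fixes p q :: real
  assumes "p > 1" "1/p + 1/q = 1"
  shows "q > 1"
proof -
  have "1/q = 1 - 1/p" using assms by simp
  moreover have "1/p < 1" "1/p > 0" using assms by auto
  ultimately have "1/q > 0" "1/q < 1" by linarith+
  then show ?thesis by (cases "q > 0") (auto simp: field_simps)
qed

lemma half_le: "(x::real) \<le> 2 * y \<longleftrightarrow> x / 2 \<le> y"
  by (simp add: mult.commute)

text \<open>\<open>walk_form_le\<close> at y = 0 is integrated over the starting point. The walk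
  preserves integrals, so the bound does not depend on n, and the remainder of the telescoping sum
  tends to 0.\<close>

lemma walk_bound_aux:
  assumes p: "p \<ge> 2" and pq: "1/p + 1/q = 1" and w: "\<And>j. j < 3 \<Longrightarrow> norm (\<omega> j) = 1"
    and F: "F \<in> bounded_borel" and F2: "integrable lborel (\<lambda>x. (norm (F x))\<^sup>2)" and g: "g \<in> test_fun"
    and Hi: "integrable lborel (\<lambda>x. norm (F x - (walk v ^^ 2) F x) powr p)"
  shows "Re (LINT x|lborel. g x * walk_op v \<omega> F x)
    \<le> 2 * (((p-1) powr p * (LINT x|lborel. norm (F x - (walk v ^^ 2) F x) powr p)) / p + (LINT x|lborel. norm (g x) powr q) / q)"
proof -
  define f where "f = (\<lambda>x. F x - (walk v ^^ 2) F x)"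
  define c where "c = p * (1 - 1/p) powr (p-1)"
  have c: "c \<ge> 0" using p by (simp add: c_def)
  have q: "q > 1" using conjugate_exponent[OF _ pq] p by simp
  have f: "f \<in> bounded_borel" unfolding f_def by (intro bounded_borel_diff bounded_borel_walk_funpow F)
  have fi: "integrable lborel (\<lambda>x. norm (f x) powr p)" using Hi by (simp add: f_def)
  have gi: "integrable lborel (\<lambda>x. norm (g x) powr q)" using test_fun_integrable_powr[OF g, of q] q by simp
  have le: "Re (walk_form v \<omega> f h n x) \<le> ((p-1) powr p / p) * (walk v ^^ n) (\<lambda>x. norm (f x) powr p) x
      + (1/q) * (walk v ^^ n) (\<lambda>x. norm (h x) powr q) x" for h n x
  proof -
    have "((p-1) powr p * (walk v ^^ n) (\<lambda>x. norm (f x) powr p) x + c * burkholder p ((walk v ^^ n) f x) 0) / p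
        \<le> ((p-1) powr p * (walk v ^^ n) (\<lambda>x. norm (f x) powr p) x + 0) / p"
      using c p by (intro divide_right_mono add_left_mono mult_nonneg_nonpos burkholder_zero_right) auto
    then show ?thesis
      using walk_form_le[where \<omega> = \<omega> and y = 0 and v = v and n = n and f = f and g = h and x = x, OF p pq w]
      by (simp add: c_def)
  qed
  \<comment> \<open>The telescoped form carries the factor - 1/2; replacing g by - g corrects the
    sign.\<close>
  define h where "h = (\<lambda>x. - g x)"
  have h: "h \<in> test_fun" using test_fun_cmult[OF g, of "-1"] by (simp add: h_def)
  have hi: "integrable lborel (\<lambda>x. norm (h x) powr q)" using gi by (simp add: h_def)
  have bound: "Re (LINT x|lborel. walk_form v \<omega> f h n x)
     \<le> ((p-1) powr p / p) * (LINT x|lborel. norm (f x) powr p) + (1/q) * (LINT x|lborel. norm (h x) powr q)" for n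
  proof -
    have wi: "integrable lborel (walk_form v \<omega> f h n)" by (intro test_fun_integrable test_fun_walk_form f h)
    have "Re (LINT x|lborel. walk_form v \<omega> f h n x) = (LINT x|lborel. Re (walk_form v \<omega> f h n x))"
      using wi by simp
    also have "\<dots> \<le> (LINT x|lborel. ((p-1) powr p / p) * (walk v ^^ n) (\<lambda>x. norm (f x) powr p) x
      + (1/q) * (walk v ^^ n) (\<lambda>x. norm (h x) powr q) x)"
      by (intro integral_mono le integrable_Re[OF wi] Bochner_Integration.integrable_add integrable_mult_right
          integrable_walk_funpow fi hi)
    also have "\<dots> = ((p-1) powr p / p) * (LINT x|lborel. norm (f x) powr p) + (1/q) * (LINT x|lborel. norm (h x) powr q)"
      using integrable_walk_funpow[OF fi, where w = v and n = n] integrable_walk_funpow[OF hi, where w = v and n = n] by simp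
    finally show ?thesis .
  qed
  have "(\<lambda>n. LINT x|lborel. h x * walk_op v \<omega> ((walk v ^^ (2 * n)) F) x) \<longlonglongrightarrow> 0"
    using LIMSEQ_subseq_LIMSEQ[OF walk_op_funpow_tendsto_0[where \<omega> = \<omega> and v = v, OF F F2 h w], of "\<lambda>n. 2 * n"]
    by (simp add: strict_mono_def comp_def)
  then have "(\<lambda>n. Re (LINT x|lborel. walk_form v \<omega> f h n x))
      \<longlonglongrightarrow> Re (- (1/2) * (LINT x|lborel. h x * walk_op v \<omega> F x) + (1/2) * 0)"
    unfolding f_def integral_walk_form[OF F h]
    by (intro tendsto_Re tendsto_add tendsto_mult tendsto_const)
  then have "Re (- (1/2) * (LINT x|lborel. h x * walk_op v \<omega> F x) + (1/2) * 0)
     \<le> ((p-1) powr p / p) * (LINT x|lborel. norm (f x) powr p) + (1/q) * (LINT x|lborel. norm (h x) powr q)"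
    by (rule LIMSEQ_le_const2) (use bound in auto)
  then have "Re (LINT x|lborel. g x * walk_op v \<omega> F x) / 2
     \<le> ((p-1) powr p * (LINT x|lborel. norm (f x) powr p)) / p + (LINT x|lborel. norm (g x) powr q) / q"
    by (simp add: h_def)
  then show ?thesis unfolding f_def by (rule half_le[THEN iffD2])
qed

lemma convex_on_powr:
  assumes p: "p \<ge> 1"
  shows "convex_on {0..} (\<lambda>x::real. x powr p)"
proof (rule convex_onI)
  fix t x y :: real
  assume t: "0 < t" "t < 1" and xy: "x \<in> {0..}" "y \<in> {0..}"
  have le: "s powr p \<le> s" if "0 < s" "s < 1" for s :: real
    using powr_mono'[of 1 p s] that p by simp
  consider "x = 0" | "y = 0" | "x > 0" "y > 0" using xy by force
  then show "((1 - t) *\<^sub>R x + t *\<^sub>R y) powr p \<le> (1 - t) * x powr p + t * y powr p"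
  proof cases
    case 1
    have "t powr p * y powr p \<le> t * y powr p" using le[OF t] by (rule mult_right_mono) simp
    then show ?thesis using 1 t xy p by (simp add: powr_mult)
  next
    case 2
    have "(1 - t) powr p * x powr p \<le> (1 - t) * x powr p" using le[of "1 - t"] t by (intro mult_right_mono) auto
    then show ?thesis using 2 t xy p by (simp add: powr_mult)
  next
    case 3
    then show ?thesis using convex_onD[OF powr_convex[OF p], of t x y] t by simp
  qed
qed simp

lemma powr_avg3_le:
  assumes "p \<ge> 1" "\<And>j. a j \<ge> 0"
  shows "(avg3 a) powr p \<le> avg3 (\<lambda>j. (a j :: real) powr p)"
proof -
  have c: "convex_on {0..} (\<lambda>x::real. x powr p)" by (rule convex_on_powr[OF assms(1)])
  have "(\<Sum>i\<in>{0,1,2::nat}. (1/3) *\<^sub>R a i) powr p \<le> (\<Sum>i\<in>{0,1,2}. (1/3) * a i powr p)"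
    by (rule convex_on_sum[OF _ _ c]) (use assms in auto)
  then show ?thesis by (simp add: avg3_def algebra_simps)
qed

lemma powr_sum_le:
  fixes a b :: real
  assumes "p \<ge> 1" "a \<ge> 0" "b \<ge> 0"
  shows "(a + b) powr p \<le> 2 powr (p - 1) * (a powr p + b powr p)"
proof -
  have c: "convex_on {0..} (\<lambda>x::real. x powr p)" by (rule convex_on_powr[OF assms(1)])
  have "((1 - 1/2) *\<^sub>R a + (1/2) *\<^sub>R b) powr p \<le> (1 - 1/2) * a powr p + (1/2) * b powr p"
    by (rule convex_onD[OF c]) (use assms in auto)
  then have "((a + b) / 2) powr p \<le> (a powr p + b powr p) / 2" by (simp add: add_divide_distrib)
  then have "2 powr p * ((a + b) / 2) powr p \<le> 2 powr p * ((a powr p + b powr p) / 2)" by (rule mult_left_mono) simp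
  moreover have "2 powr p * ((a + b) / 2) powr p = (a + b) powr p"
    using assms by (simp add: powr_divide)
  moreover have "2 powr p * ((a powr p + b powr p) / 2) = 2 powr (p - 1) * (a powr p + b powr p)"
    by (simp add: powr_diff)
  ultimately show ?thesis by linarith
qed

text \<open>Jensen's inequality at each of the averages, followed by invariance of the integral: the
  walk contracts L^p.\<close>

lemma integrable_powr_walk:
  assumes G: "G \<in> bounded_borel" and i: "integrable lborel (\<lambda>x. norm (G x) powr p)" and p: "p \<ge> 1"
  shows "integrable lborel (\<lambda>x. norm (walk v G x) powr p)"
    and "(LINT x|lborel. norm (walk v G x) powr p) \<le> (LINT x|lborel. norm (G x) powr p)"
proof -
  have [measurable]: "walk v G \<in> borel_measurable borel"
    using G by (auto intro: bounded_borel_measurable bounded_borel_walk)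
  have le: "norm (walk v G x) powr p \<le> walk v (\<lambda>x. norm (G x) powr p) x" for x
  proof -
    have s: "norm (sym_avg u G x) powr p \<le> sym_avg u (\<lambda>x. norm (G x) powr p) x" for u
    proof -
      have c: "convex_on {0..} (\<lambda>x::real. x powr p)" by (rule convex_on_powr[OF p])
      have "norm (sym_avg u G x) powr p \<le> ((1 - 1/2) *\<^sub>R norm (G (x + u)) + (1/2) *\<^sub>R norm (G (x - u))) powr p"
        using p norm_triangle_ineq[of "G (x + u)" "G (x - u)"] by (intro powr_mono2) (auto simp: sym_avg_def)
      also have "\<dots> \<le> (1 - 1/2) * norm (G (x + u)) powr p + (1/2) * norm (G (x - u)) powr p"
        by (rule convex_onD[OF c]) auto
      finally show ?thesis by (simp add: sym_avg_def algebra_simps)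
    qed
    have "norm (walk v G x) powr p \<le> avg3 (\<lambda>j. norm (sym_avg (v j) G x)) powr p"
      unfolding walk_def using p by (intro powr_mono2 norm_avg3_le) auto
    also have "\<dots> \<le> avg3 (\<lambda>j. norm (sym_avg (v j) G x) powr p)"
      using p by (intro powr_avg3_le) auto
    also have "\<dots> \<le> avg3 (\<lambda>j. sym_avg (v j) (\<lambda>x. norm (G x) powr p) x)"
      by (intro avg3_mono s)
    finally show ?thesis by (simp add: walk_def)
  qed
  show j: "integrable lborel (\<lambda>x. norm (walk v G x) powr p)"
  proof (rule Bochner_Integration.integrable_bound[OF integrable_walk[OF i, of v]])
    show "AE x in lborel. norm (norm (walk v G x) powr p) \<le> norm (walk v (\<lambda>x. norm (G x) powr p) x)"
    proof (rule AE_I2)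
      fix x
      show "norm (norm (walk v G x) powr p) \<le> norm (walk v (\<lambda>x. norm (G x) powr p) x)"
        using le[of x] abs_ge_self[of "walk v (\<lambda>x. norm (G x) powr p) x"] by simp
    qed
  qed simp
  have "(LINT x|lborel. norm (walk v G x) powr p) \<le> (LINT x|lborel. walk v (\<lambda>x. norm (G x) powr p) x)"
    by (intro integral_mono j le integrable_walk i)
  then show "(LINT x|lborel. norm (walk v G x) powr p) \<le> (LINT x|lborel. norm (G x) powr p)"
    by (simp add: integral_walk i)
qed

text \<open>The factor 4 has two sources: the 1/2 of summation by parts, and the factorization of 1
  - P^2 into 1 + P and 1 - P, where P = \<open>walk v\<close> contracts L^p. Scaling F by t and g by
  1 / t turns the sum of two powers into a product of norms.\<close>

theorem walk_bound:
  assumes p: "p \<ge> 2" and pq: "1/p + 1/q = 1" and w: "\<And>j. j < 3 \<Longrightarrow> norm (\<omega> j) = 1"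
    and F: "F \<in> bounded_borel" and F2: "integrable lborel (\<lambda>x. (norm (F x))\<^sup>2)" and g: "g \<in> test_fun"
    and Gi: "integrable lborel (\<lambda>x. norm (walk v F x - F x) powr p)"
  shows "norm (LINT x|lborel. g x * walk_op v \<omega> F x)
    \<le> 4 * (p-1) * (LINT x|lborel. norm (walk v F x - F x) powr p) powr (1/p)
        * (LINT x|lborel. norm (g x) powr q) powr (1/q)"
proof -
  define G where "G = (\<lambda>x. walk v F x - F x)"
  define A where "A = (LINT x|lborel. norm (G x) powr p)"
  define H where "H = (\<lambda>x. F x - (walk v ^^ 2) F x)"
  define B where "B = (LINT x|lborel. norm (g x) powr q)"
  have q: "q > 1" using conjugate_exponent[OF _ pq] p by simp
  have A0: "A \<ge> 0" and B0: "B \<ge> 0" unfolding A_def B_def by (auto intro!: integral_nonneg_AE)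
  have G: "G \<in> bounded_borel" unfolding G_def by (intro bounded_borel_diff bounded_borel_walk F)
  have Gi': "integrable lborel (\<lambda>x. norm (G x) powr p)" using Gi by (simp add: G_def)
  have Hm: "H \<in> borel_measurable borel" unfolding H_def
    by (intro bounded_borel_measurable bounded_borel_diff bounded_borel_walk_funpow F)
  have HG: "H x = - (walk v G x + G x)" for x
    by (simp add: H_def G_def walk_linear numeral_2_eq_2)
  have Hle: "norm (H x) powr p \<le> 2 powr (p-1) * (norm (walk v G x) powr p + norm (G x) powr p)" for x
  proof -
    have "norm (H x) powr p \<le> (norm (walk v G x) + norm (G x)) powr p"
      unfolding HG norm_minus_cancel using p by (intro powr_mono2 norm_triangle_ineq) auto
    also have "\<dots> \<le> 2 powr (p-1) * (norm (walk v G x) powr p + norm (G x) powr p)"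
      using p by (intro powr_sum_le) auto
    finally show ?thesis .
  qed
  have p1: "p \<ge> 1" using p by simp
  have dom: "integrable lborel (\<lambda>x. 2 powr (p-1) * (norm (walk v G x) powr p + norm (G x) powr p))"
    using integrable_powr_walk[OF G Gi' p1] Gi' by auto
  have Hi: "integrable lborel (\<lambda>x. norm (H x) powr p)"
  proof (rule Bochner_Integration.integrable_bound[OF dom])
    show "(\<lambda>x. norm (H x) powr p) \<in> borel_measurable lborel" using Hm by measurable
    show "AE x in lborel. norm (norm (H x) powr p)
        \<le> norm (2 powr (p-1) * (norm (walk v G x) powr p + norm (G x) powr p))"
    proof (rule AE_I2)
      fix x
      show "norm (norm (H x) powr p) \<le> norm (2 powr (p-1) * (norm (walk v G x) powr p + norm (G x) powr p))"
        using Hle[of x] abs_ge_self[of "2 powr (p-1) * (norm (walk v G x) powr p + norm (G x) powr p)"] by simp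
    qed
  qed
  have "(LINT x|lborel. norm (H x) powr p) \<le> (LINT x|lborel. 2 powr (p-1) * (norm (walk v G x) powr p + norm (G x) powr p))"
    by (intro integral_mono Hi dom Hle)
  also have "\<dots> \<le> 2 powr (p-1) * (A + A)"
    using integrable_powr_walk[OF G Gi' p1] Gi' by (auto simp: A_def)
  also have "\<dots> = 2 powr p * A" by (simp add: powr_diff)
  finally have HA: "(LINT x|lborel. norm (H x) powr p) \<le> 2 powr p * A" .
  \<comment> \<open>The unimodular \<zeta> rotates the integral, so that bounds for real parts give
    one for the modulus.\<close>
  have main: "Re (\<zeta> * (LINT x|lborel. g x * walk_op v \<omega> F x)) / 2
      \<le> (2 * (p-1) * A powr (1/p)) * B powr (1/q)" if z: "norm \<zeta> = 1" for \<zeta>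
  proof (rule Young_optimize[of p q])
    show "p > 1" "q > 1" "1/p + 1/q = 1" using p q pq by auto
    fix t :: real assume t: "t > 0"
    define Ft where "Ft = (\<lambda>x. of_real t * F x)"
    define gt where "gt = (\<lambda>x. (\<zeta> / of_real t) * g x)"
    have Fb: "Ft \<in> bounded_borel" unfolding Ft_def by (intro bounded_borel_cmult F)
    have gb: "gt \<in> test_fun" unfolding gt_def by (intro test_fun_cmult g)
    have Fi: "integrable lborel (\<lambda>x. (norm (Ft x))\<^sup>2)"
      using F2 by (simp add: Ft_def norm_mult power_mult_distrib)
    have e: "Ft x - (walk v ^^ 2) Ft x = of_real t * H x" for x
      by (simp add: Ft_def H_def walk_cmult numeral_2_eq_2 right_diff_distrib)
    have e': "norm (of_real t * H x) powr p = t powr p * norm (H x) powr p" for x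
      using t by (simp add: norm_mult powr_mult)
    have "Re (LINT x|lborel. gt x * walk_op v \<omega> Ft x)
      \<le> 2 * (((p-1) powr p * (LINT x|lborel. norm (Ft x - (walk v ^^ 2) Ft x) powr p)) / p + (LINT x|lborel. norm (gt x) powr q) / q)"
      by (rule walk_bound_aux[OF p pq w Fb Fi gb]) (use Hi in \<open>auto simp: e e'\<close>)
    also have "(LINT x|lborel. norm (Ft x - (walk v ^^ 2) Ft x) powr p) = t powr p * (LINT x|lborel. norm (H x) powr p)"
      by (simp add: e e')
    also have "(LINT x|lborel. norm (gt x) powr q) = B / t powr q"
      using t z by (simp add: gt_def B_def norm_mult norm_divide powr_mult powr_divide)
    also have "(LINT x|lborel. gt x * walk_op v \<omega> Ft x) = \<zeta> * (LINT x|lborel. g x * walk_op v \<omega> F x)"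
    proof -
      have "(LINT x|lborel. gt x * walk_op v \<omega> Ft x) = (LINT x|lborel. \<zeta> * (g x * walk_op v \<omega> F x))"
        using t by (intro Bochner_Integration.integral_cong) (auto simp: gt_def Ft_def walk_op_linear)
      then show ?thesis by simp
    qed
    finally have 1: "Re (\<zeta> * (LINT x|lborel. g x * walk_op v \<omega> F x)) / 2
       \<le> ((p-1) powr p * (t powr p * (LINT x|lborel. norm (H x) powr p))) / p + B / t powr q / q" by (rule half_le[THEN iffD1])
    have "((p-1) powr p * (t powr p * (LINT x|lborel. norm (H x) powr p))) / p \<le> ((p-1) powr p * (t powr p * (2 powr p * A))) / p"
      using HA p by (intro divide_right_mono mult_left_mono) auto
    also have "(p-1) powr p * (t powr p * (2 powr p * A)) = (t * (2 * (p-1) * A powr (1/p))) powr p"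
    proof -
      have "(t * (2 * (p-1) * A powr (1/p))) powr p = t powr p * ((2 powr p * (p-1) powr p) * (A powr (1/p)) powr p)"
        using t p A0 by (simp only: powr_mult)
      also have "(A powr (1/p)) powr p = A" using p A0 by (simp add: powr_powr)
      finally show ?thesis by (simp only: mult_ac)
    qed
    finally have 2: "((p-1) powr p * (t powr p * (LINT x|lborel. norm (H x) powr p))) / p
       \<le> (t * (2 * (p-1) * A powr (1/p))) powr p / p" .
    have 3: "B / t powr q = (B powr (1/q) / t) powr q"
      using t q B0 by (simp add: powr_divide powr_powr)
    show "Re (\<zeta> * (LINT x|lborel. g x * walk_op v \<omega> F x)) / 2
       \<le> (t * (2 * (p-1) * A powr (1/p))) powr p / p + (B powr (1/q) / t) powr q / q"
      using order_trans[OF 1[unfolded 3] add_right_mono[OF 2]] .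
  qed (use p in auto)
  have fin: "norm (LINT x|lborel. g x * walk_op v \<omega> F x) \<le> 2 * ((2 * (p-1) * A powr (1/p)) * B powr (1/q))"
  proof (rule Re_rotate)
    fix \<zeta> :: complex assume "norm \<zeta> = 1"
    from main[OF this] show "Re (\<zeta> * (LINT x|lborel. g x * walk_op v \<omega> F x)) \<le> 2 * ((2 * (p-1) * A powr (1/p)) * B powr (1/q))"
      by linarith
  qed
  have eq: "2 * ((2 * (p-1) * a) * b) = 4 * (p-1) * a * b" for a b :: real by simp
  show ?thesis using fin unfolding eq A_def B_def G_def .
qed

subsection \<open>Layer cake integrals over the plane\<close>

lemma nn_integral_shift:
  assumes [measurable]: "f \<in> borel_measurable borel"
  shows "(\<integral>\<^sup>+x. f (x + v) \<partial>lborel) = (\<integral>\<^sup>+x. f (x::complex) \<partial>lborel)"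
proof -
  have "(\<integral>\<^sup>+x. f x \<partial>distr lborel borel ((+) v)) = (\<integral>\<^sup>+x. f (v + x) \<partial>lborel)"
    by (rule nn_integral_distr) auto
  then show ?thesis by (simp add: lborel_distr_plus add.commute)
qed

lemma lborel_distr_reflect: "distr lborel borel (\<lambda>y. x - y) = (lborel :: complex measure)"
  using lborel_affine[of "-1" "x :: complex"] by (simp add: density_1)

lemma nn_integral_reflect:
  assumes [measurable]: "f \<in> borel_measurable borel"
  shows "(\<integral>\<^sup>+y. f (x - y) \<partial>lborel) = (\<integral>\<^sup>+y. f (y::complex) \<partial>lborel)"
proof -
  have "(\<integral>\<^sup>+y. f y \<partial>distr lborel borel (\<lambda>y. x - y)) = (\<integral>\<^sup>+y. f (x - y) \<partial>lborel)"
    by (rule nn_integral_distr) auto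
  then show ?thesis by (simp add: lborel_distr_reflect)
qed

lemma lborel_integral_reflect:
  fixes f :: "complex \<Rightarrow> 'b::{banach, second_countable_topology}"
  assumes [measurable]: "f \<in> borel_measurable borel"
  shows "(LINT y|lborel. f (x - y)) = (LINT y|lborel. f y)"
proof -
  have "(LINT y|distr lborel borel (\<lambda>y. x - y). f y) = (LINT y|lborel. f (x - y))"
    by (rule integral_distr) auto
  then show ?thesis by (simp add: lborel_distr_reflect)
qed

lemma lborel_integrable_reflect:
  fixes f :: "complex \<Rightarrow> 'b::{banach, second_countable_topology}"
  assumes f: "integrable lborel f"
  shows "integrable lborel (\<lambda>y. f (x - y))"
proof -
  have [measurable]: "f \<in> borel_measurable borel" using borel_measurable_integrable[OF f] by simp
  from f have "integrable (distr lborel borel (\<lambda>y. x - y)) f" by (simp add: lborel_distr_reflect)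
  then show ?thesis by (subst (asm) integrable_distr_eq) auto
qed

lemma nn_integral_lborel_swap:
  fixes f :: "'a::euclidean_space \<Rightarrow> 'b::euclidean_space \<Rightarrow> ennreal"
  assumes "(\<lambda>(x, y). f x y) \<in> borel_measurable (borel \<Otimes>\<^sub>M borel)"
  shows "(\<integral>\<^sup>+x. \<integral>\<^sup>+y. f x y \<partial>lborel \<partial>lborel) = (\<integral>\<^sup>+y. \<integral>\<^sup>+x. f x y \<partial>lborel \<partial>lborel)"
  using lborel_pair.Fubini'[of f] assms by (simp cong: measurable_cong_sets sets_pair_measure_cong)

text \<open>A radially decreasing profile is a superposition of indicators of discs. The weight w is
  the density of the radii, and Tonelli's theorem exchanges it with the integral over the
  plane.\<close>

lemma layer_cake:
  fixes u :: "complex \<Rightarrow> ennreal" and w :: "real \<Rightarrow> real"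
  assumes [measurable]: "u \<in> borel_measurable borel" "w \<in> borel_measurable borel"
    and \<phi>: "\<And>r. r \<ge> 0 \<Longrightarrow> ennreal (\<phi> r) = (\<integral>\<^sup>+t. ennreal (w t) * indicator {r..} t \<partial>lborel)"
  shows "(\<integral>\<^sup>+y. ennreal (\<phi> (norm (z - y))) * u y \<partial>lborel)
    = (\<integral>\<^sup>+t. ennreal (w t) * indicator {0..} t * (\<integral>\<^sup>+y. u y * indicator (cball z t) y \<partial>lborel) \<partial>lborel)"
proof -
  have ind: "indicator {norm (z - y)..} t = (indicator {0..} t * indicator (cball z t) y :: ennreal)" for y t
    by (auto simp: indicator_def dist_norm intro: order_trans[OF norm_ge_zero])
  define J where "J = (\<lambda>(y, t). indicator (cball z t) y :: ennreal)"
  have [measurable]: "J \<in> borel_measurable (borel \<Otimes>\<^sub>M borel)"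
  proof -
    have "{p :: complex \<times> real. dist z (fst p) \<le> snd p} \<in> sets borel"
      by (intro borel_closed closed_Collect_le continuous_intros)
    then have "indicator {p :: complex \<times> real. dist z (fst p) \<le> snd p} \<in> borel_measurable (borel :: (complex \<times> real) measure)"
      by (rule borel_measurable_indicator)
    also have "indicator {p :: complex \<times> real. dist z (fst p) \<le> snd p} = (\<lambda>(y, t). indicator (cball z t) y :: ennreal)"
      by (auto simp: indicator_def fun_eq_iff)
    finally show ?thesis by (simp add: borel_prod J_def)
  qed
  have "(\<lambda>p. ennreal (w (snd p)) * indicator {0..} (snd p) * (u (fst p) * J p)) \<in> borel_measurable (borel \<Otimes>\<^sub>M borel)"
    by measurable
  then have m: "(\<lambda>(y, t). ennreal (w t) * indicator {0..} t * (u y * indicator (cball z t) y)) \<in> borel_measurable (borel \<Otimes>\<^sub>M borel)"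
    by (simp add: case_prod_unfold J_def)
  have "(\<integral>\<^sup>+y. ennreal (\<phi> (norm (z - y))) * u y \<partial>lborel)
     = (\<integral>\<^sup>+y. \<integral>\<^sup>+t. ennreal (w t) * indicator {0..} t * (u y * indicator (cball z t) y) \<partial>lborel \<partial>lborel)"
  proof (rule nn_integral_cong)
    fix y
    have "ennreal (\<phi> (norm (z - y))) * u y = (\<integral>\<^sup>+t. u y * (ennreal (w t) * indicator {norm (z - y)..} t) \<partial>lborel)"
      by (subst nn_integral_cmult) (auto simp: \<phi> mult.commute)
    also have "\<dots> = (\<integral>\<^sup>+t. ennreal (w t) * indicator {0..} t * (u y * indicator (cball z t) y) \<partial>lborel)"
      by (rule nn_integral_cong) (simp only: ind mult_ac)
    finally show "ennreal (\<phi> (norm (z - y))) * u y = (\<integral>\<^sup>+t. ennreal (w t) * indicator {0..} t * (u y * indicator (cball z t) y) \<partial>lborel)" .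
  qed
  also have "\<dots> = (\<integral>\<^sup>+t. \<integral>\<^sup>+y. ennreal (w t) * indicator {0..} t * (u y * indicator (cball z t) y) \<partial>lborel \<partial>lborel)"
    by (rule nn_integral_lborel_swap[OF m])
  also have "\<dots> = (\<integral>\<^sup>+t. ennreal (w t) * indicator {0..} t * (\<integral>\<^sup>+y. u y * indicator (cball z t) y \<partial>lborel) \<partial>lborel)"
    by (intro nn_integral_cong nn_integral_cmult borel_measurable_times_ennreal borel_measurable_indicator)
       (use assms in simp_all)
  finally show ?thesis .
qed

lemma emeasure_cball_complex: "r \<ge> 0 \<Longrightarrow> emeasure lborel (cball (z::complex) r) = ennreal (pi * r\<^sup>2)"
  by (subst emeasure_cball) (auto simp: unit_ball_vol_2)

text \<open>This is \<open>\<Delta> log(|z|\<^sup>2 + a\<^sup>2) / (4\<pi>)\<close>, not the Poisson kernel of the upper half space.\<close>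

definition poisson :: "real \<Rightarrow> complex \<Rightarrow> real" where
  "poisson a z = a\<^sup>2 / (pi * ((norm z)\<^sup>2 + a\<^sup>2)\<^sup>2)"

text \<open>Minus the derivative of the radial profile of \<open>poisson\<close>, hence its density
  of radii in \<open>layer_cake\<close>.\<close>

definition poisson_weight :: "real \<Rightarrow> real \<Rightarrow> real" where
  "poisson_weight a t = 4 * a\<^sup>2 * t / (pi * (t\<^sup>2 + a\<^sup>2)^3)"

lemma borel_measurable_poisson_weight [measurable]: "poisson_weight a \<in> borel_measurable borel"
  unfolding poisson_weight_def[abs_def] by measurable

lemma borel_measurable_poisson [measurable]: "poisson a \<in> borel_measurable borel"
  unfolding poisson_def[abs_def] by measurable

lemma poisson_nonneg [simp]: "poisson a z \<ge> 0" by (simp add: poisson_def)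

lemma poisson_weight_integral:
  assumes a: "a > 0" and r: "r \<ge> 0"
  shows "ennreal (a\<^sup>2 / (pi * (r\<^sup>2 + a\<^sup>2)\<^sup>2)) = (\<integral>\<^sup>+t. ennreal (poisson_weight a t) * indicator {r..} t \<partial>lborel)"
proof -
  have "(\<integral>\<^sup>+t. ennreal (poisson_weight a t) * indicator {r..} t \<partial>lborel) = ennreal (0 - (- (a\<^sup>2 / (pi * (r\<^sup>2 + a\<^sup>2)\<^sup>2))))"
  proof (rule nn_integral_FTC_atLeast[where F = "\<lambda>t. - (a\<^sup>2 / (pi * (t\<^sup>2 + a\<^sup>2)\<^sup>2))"])
    fix t assume t: "r \<le> t"
    define d where "d = t\<^sup>2 + a\<^sup>2"
    have D: "t\<^sup>2 + a\<^sup>2 > 0" and d0: "d \<noteq> 0" and ad: "a\<^sup>2 = d - t\<^sup>2"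
      using a by (simp_all add: d_def add_nonneg_pos)
    show "((\<lambda>t. - (a\<^sup>2 / (pi * (t\<^sup>2 + a\<^sup>2)\<^sup>2))) has_real_derivative poisson_weight a t) (at t)"
      unfolding poisson_weight_def
      by (rule derivative_eq_intros refl | use D a in \<open>simp; fail\<close>)+
         (fold d_def, use d0 in \<open>simp add: field_simps eval_nat_numeral\<close>)
    show "poisson_weight a t \<ge> 0" using t r by (simp add: poisson_weight_def)
  next
    show "((\<lambda>t. - (a\<^sup>2 / (pi * (t\<^sup>2 + a\<^sup>2)\<^sup>2))) \<longlongrightarrow> 0) at_top"
      using a pi_gt_zero by real_asymp
  qed simp
  then show ?thesis by simp
qed

text \<open>Weighted with the areas of the discs, the density of radii has mass one; so
  \<open>poisson\<close> is a mean of normalized discs.\<close>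

lemma poisson_weight_mass:
  assumes a: "a > 0"
  shows "(\<integral>\<^sup>+t. ennreal (poisson_weight a t) * indicator {0..} t * ennreal (pi * t\<^sup>2) \<partial>lborel) = 1"
proof -
  have "(\<integral>\<^sup>+t. ennreal (poisson_weight a t * (pi * t\<^sup>2)) * indicator {0..} t \<partial>lborel) = ennreal (1 - 0^4 / (0\<^sup>2 + a\<^sup>2)\<^sup>2)"
  proof (rule nn_integral_FTC_atLeast[where F = "\<lambda>t. t^4 / (t\<^sup>2 + a\<^sup>2)\<^sup>2"])
    fix t :: real assume t: "0 \<le> t"
    define d where "d = t\<^sup>2 + a\<^sup>2"
    have D: "t\<^sup>2 + a\<^sup>2 > 0" and d0: "d \<noteq> 0" and ad: "a\<^sup>2 = d - t\<^sup>2"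
      using a by (simp_all add: d_def add_nonneg_pos)
    show "((\<lambda>t. t^4 / (t\<^sup>2 + a\<^sup>2)\<^sup>2) has_real_derivative poisson_weight a t * (pi * t\<^sup>2)) (at t)"
      unfolding poisson_weight_def
      by (rule derivative_eq_intros refl | use D a in \<open>simp; fail\<close>)+
         (fold d_def, unfold ad, use d0 in \<open>simp add: field_simps eval_nat_numeral\<close>)
    show "poisson_weight a t * (pi * t\<^sup>2) \<ge> 0" using t by (simp add: poisson_weight_def)
  next
    show "((\<lambda>t. t^4 / (t\<^sup>2 + a\<^sup>2)\<^sup>2) \<longlongrightarrow> 1) at_top"
      using a by real_asymp
  qed simp
  moreover have "ennreal (poisson_weight a t * (pi * t\<^sup>2)) * indicator {0..} t
      = ennreal (poisson_weight a t) * indicator {0..} t * ennreal (pi * t\<^sup>2)" for t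
    by (subst ennreal_mult'') (simp_all add: mult_ac)
  ultimately show ?thesis by simp
qed

text \<open>A Poisson average is a mean of disc averages, so a bound for all discs around z passes
  to it with the same constant.\<close>

lemma poisson_average_le:
  assumes a: "a > 0" and u [measurable]: "u \<in> borel_measurable borel"
    and le: "\<And>t. t > 0 \<Longrightarrow> (\<integral>\<^sup>+y. u y * indicator (cball z t) y \<partial>lborel) \<le> c * ennreal (pi * t\<^sup>2)"
  shows "(\<integral>\<^sup>+y. ennreal (poisson a (z - y)) * u y \<partial>lborel) \<le> c"
proof -
  have "(\<integral>\<^sup>+y. ennreal (poisson a (z - y)) * u y \<partial>lborel)
    = (\<integral>\<^sup>+t. ennreal (poisson_weight a t) * indicator {0..} t * (\<integral>\<^sup>+y. u y * indicator (cball z t) y \<partial>lborel) \<partial>lborel)"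
    unfolding poisson_def
    by (rule layer_cake[where \<phi> = "\<lambda>r. a\<^sup>2 / (pi * (r\<^sup>2 + a\<^sup>2)\<^sup>2)"]) (auto intro: poisson_weight_integral a)
  also have "\<dots> \<le> (\<integral>\<^sup>+t. c * (ennreal (poisson_weight a t) * indicator {0..} t * ennreal (pi * t\<^sup>2)) \<partial>lborel)"
  proof (rule nn_integral_mono)
    fix t :: real
    consider "t < 0" | "t = 0" | "t > 0" by linarith
    then show "ennreal (poisson_weight a t) * indicator {0..} t * (\<integral>\<^sup>+y. u y * indicator (cball z t) y \<partial>lborel)
       \<le> c * (ennreal (poisson_weight a t) * indicator {0..} t * ennreal (pi * t\<^sup>2))"
    proof cases
      case 3
      have "ennreal (poisson_weight a t) * (\<integral>\<^sup>+y. u y * indicator (cball z t) y \<partial>lborel) \<le>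
        ennreal (poisson_weight a t) * (c * ennreal (pi * t\<^sup>2))" by (intro mult_left_mono le 3) auto
      then show ?thesis using 3 by (simp add: mult_ac)
    qed (auto simp: poisson_weight_def)
  qed
  also have "\<dots> = c" by (subst nn_integral_cmult) (auto simp: poisson_weight_mass a)
  finally show ?thesis .
qed

lemma poisson_mass:
  assumes a: "a > 0"
  shows "(\<integral>\<^sup>+y. ennreal (poisson a y) \<partial>lborel) = 1"
proof -
  have "(\<integral>\<^sup>+y. ennreal (poisson a (0 - y)) * 1 \<partial>lborel)
    = (\<integral>\<^sup>+t. ennreal (poisson_weight a t) * indicator {0..} t * (\<integral>\<^sup>+y. 1 * indicator (cball (0::complex) t) y \<partial>lborel) \<partial>lborel)"
    unfolding poisson_def
    by (rule layer_cake[where \<phi> = "\<lambda>r. a\<^sup>2 / (pi * (r\<^sup>2 + a\<^sup>2)\<^sup>2)"]) (auto intro: poisson_weight_integral a)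
  also have "\<dots> = (\<integral>\<^sup>+t. ennreal (poisson_weight a t) * indicator {0..} t * ennreal (pi * t\<^sup>2) \<partial>lborel)"
  proof (rule nn_integral_cong)
    fix t
    show "ennreal (poisson_weight a t) * indicator {0..} t * (\<integral>\<^sup>+y. 1 * indicator (cball (0::complex) t) y \<partial>lborel)
      = ennreal (poisson_weight a t) * indicator {0..} t * ennreal (pi * t\<^sup>2)"
      by (cases "t \<ge> 0") (simp_all add: emeasure_cball_complex)
  qed
  finally show ?thesis by (simp add: poisson_weight_mass a poisson_def)
qed

text \<open>The square integrability of potentials and the L^q bounds for \<open>decay\<close> rest
  on this integral; in the plane it converges exactly for s > 1.\<close>

lemma nn_integral_decay_finite:
  assumes a: "a > 0" and s: "s > 1"
  shows "(\<integral>\<^sup>+y. ennreal (((norm (y::complex))\<^sup>2 + a\<^sup>2) powr (-s)) \<partial>lborel) < \<infinity>"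
proof -
  define w where "w t = 2 * s * t * (t\<^sup>2 + a\<^sup>2) powr (-s - 1)" for t
  have D: "t\<^sup>2 + a\<^sup>2 > 0" for t using a by (simp add: add_nonneg_pos)
  have [measurable]: "w \<in> borel_measurable borel" unfolding w_def[abs_def] by measurable
  have w: "ennreal ((r\<^sup>2 + a\<^sup>2) powr (-s)) = (\<integral>\<^sup>+t. ennreal (w t) * indicator {r..} t \<partial>lborel)" if r: "r \<ge> 0" for r
  proof -
    have "(\<integral>\<^sup>+t. ennreal (w t) * indicator {r..} t \<partial>lborel) = ennreal (0 - (- ((r\<^sup>2 + a\<^sup>2) powr (-s))))"
    proof (rule nn_integral_FTC_atLeast[where F = "\<lambda>t. - ((t\<^sup>2 + a\<^sup>2) powr (-s))"])
      fix t assume t: "r \<le> t"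
      show "((\<lambda>t. - ((t\<^sup>2 + a\<^sup>2) powr (-s))) has_real_derivative w t) (at t)"
        unfolding w_def by (rule derivative_eq_intros refl | use D[of t] in \<open>simp; fail\<close>)+
      show "w t \<ge> 0" using t r s by (simp add: w_def)
    next
      show "((\<lambda>t. - ((t\<^sup>2 + a\<^sup>2) powr (-s))) \<longlongrightarrow> 0) at_top"
        using a s by real_asymp
    qed simp
    then show ?thesis by simp
  qed
  have "(\<integral>\<^sup>+y. ennreal (((norm ((0::complex) - y))\<^sup>2 + a\<^sup>2) powr (-s)) * 1 \<partial>lborel)
    = (\<integral>\<^sup>+t. ennreal (w t) * indicator {0..} t * (\<integral>\<^sup>+y. 1 * indicator (cball (0::complex) t) y \<partial>lborel) \<partial>lborel)"
    by (rule layer_cake[where \<phi> = "\<lambda>r. (r\<^sup>2 + a\<^sup>2) powr (-s)"]) (auto intro: w)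
  also have "\<dots> = (\<integral>\<^sup>+t. ennreal (w t * (pi * t\<^sup>2)) * indicator {0..} t \<partial>lborel)"
  proof (rule nn_integral_cong)
    fix t
    show "ennreal (w t) * indicator {0..} t * (\<integral>\<^sup>+y. 1 * indicator (cball (0::complex) t) y \<partial>lborel)
      = ennreal (w t * (pi * t\<^sup>2)) * indicator {0..} t"
      by (cases "t \<ge> 0") (simp_all add: emeasure_cball_complex ennreal_mult'')
  qed
  \<comment> \<open>The factor t^2 from the area is absorbed by t^2 + a^2, after which the integrand
    has an explicit primitive.\<close>
  also have "\<dots> \<le> (\<integral>\<^sup>+t. ennreal (2 * s * pi * t * (t\<^sup>2 + a\<^sup>2) powr (-s)) * indicator {0..} t \<partial>lborel)"
  proof (intro nn_integral_mono)
    fix t :: real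
    show "ennreal (w t * (pi * t\<^sup>2)) * indicator {0..} t \<le> ennreal (2 * s * pi * t * (t\<^sup>2 + a\<^sup>2) powr (-s)) * indicator {0..} t"
    proof (cases "t \<ge> 0")
      case True
      have "(t\<^sup>2 + a\<^sup>2) powr (-s - 1) * t\<^sup>2 \<le> (t\<^sup>2 + a\<^sup>2) powr (-s - 1) * (t\<^sup>2 + a\<^sup>2)"
        by (intro mult_left_mono) auto
      also have "\<dots> = (t\<^sup>2 + a\<^sup>2) powr (-s)"
        using powr_add[of "t\<^sup>2 + a\<^sup>2" "-s-1" 1] D[of t] by simp
      finally have "2 * s * pi * t * ((t\<^sup>2 + a\<^sup>2) powr (-s - 1) * t\<^sup>2) \<le> 2 * s * pi * t * (t\<^sup>2 + a\<^sup>2) powr (-s)"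
        using True s by (intro mult_left_mono) auto
      then show ?thesis using True by (auto simp: w_def mult_ac intro!: ennreal_leI)
    qed simp
  qed
  also have "\<dots> = ennreal (0 - (- (s * pi / (s - 1) * (0\<^sup>2 + a\<^sup>2) powr (1-s))))"
  proof (rule nn_integral_FTC_atLeast[where F = "\<lambda>t. - (s * pi / (s - 1) * (t\<^sup>2 + a\<^sup>2) powr (1-s))"])
    fix t :: real assume t: "0 \<le> t"
    show "((\<lambda>t. - (s * pi / (s - 1) * (t\<^sup>2 + a\<^sup>2) powr (1-s))) has_real_derivative 2 * s * pi * t * (t\<^sup>2 + a\<^sup>2) powr (-s)) (at t)"
      by (rule derivative_eq_intros refl | use D[of t] in \<open>simp; fail\<close>)+
         (use s in \<open>simp add: field_simps\<close>)
    show "2 * s * pi * t * (t\<^sup>2 + a\<^sup>2) powr (-s) \<ge> 0" using t s by simp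
  next
    show "((\<lambda>t. - (s * pi / (s - 1) * (t\<^sup>2 + a\<^sup>2) powr (1-s))) \<longlongrightarrow> 0) at_top"
      using a s pi_gt_zero by real_asymp
  qed simp
  finally have "(\<integral>\<^sup>+y. ennreal (((norm ((0::complex) - y))\<^sup>2 + a\<^sup>2) powr (-s)) * 1 \<partial>lborel) < top"
    by (rule le_less_trans) simp
  then show ?thesis by simp
qed

subsection \<open>The weak type inequality\<close>

text \<open>The maximal function itself never appears: U is a Borel set containing the centre of
  every disc with average above c, which avoids questions of measurability. Vitali's lemma selects
  disjoint discs whose fivefold enlargements cover, so 25 is a ratio of areas.\<close>

lemma hardy_littlewood:
  fixes u :: "complex \<Rightarrow> ennreal"
  assumes u [measurable]: "u \<in> borel_measurable borel" and fin: "(\<integral>\<^sup>+y. u y \<partial>lborel) \<le> ennreal A"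
    and c: "c > 0" and A: "A \<ge> 0"
  obtains U where "U \<in> sets borel" "emeasure lborel U \<le> ennreal (25 * A / c)"
    "\<And>z t. t > 0 \<Longrightarrow> (\<integral>\<^sup>+y. u y * indicator (cball z t) y \<partial>lborel) > ennreal c * ennreal (pi * t\<^sup>2) \<Longrightarrow> z \<in> U"
proof -
  define K where "K = {(z, t). t > 0 \<and> (\<integral>\<^sup>+y. u y * indicator (cball z t) y \<partial>lborel) > ennreal c * ennreal (pi * t\<^sup>2)}"
  \<comment> \<open>The total mass bounds the radii of the offending discs, as the covering lemma
    demands.\<close>
  have r: "0 < snd i \<and> snd i \<le> sqrt (A / (c * pi))" if "i \<in> K" for i
  proof -
    obtain z t where i: "i = (z, t)" by (cases i)
    have t: "t > 0" and lt: "ennreal c * ennreal (pi * t\<^sup>2) < (\<integral>\<^sup>+y. u y * indicator (cball z t) y \<partial>lborel)"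
      using that by (auto simp: K_def i)
    have "(\<integral>\<^sup>+y. u y * indicator (cball z t) y \<partial>lborel) \<le> (\<integral>\<^sup>+y. u y \<partial>lborel)"
      by (intro nn_integral_mono) (auto simp: indicator_def)
    with lt fin have "ennreal (c * (pi * t\<^sup>2)) \<le> ennreal A"
      using c by (simp add: ennreal_mult)
    then have "c * (pi * t\<^sup>2) \<le> A" using A by simp
    then have "t\<^sup>2 \<le> A / (c * pi)" using c by (simp add: field_simps)
    then have "t \<le> sqrt (A / (c * pi))" using t by (simp add: real_le_rsqrt)
    then show ?thesis using t i by simp
  qed
  obtain C where C: "countable C" "C \<subseteq> K"
     "pairwise (\<lambda>i j. disjnt (cball (fst i) (snd i)) (cball (fst j) (snd j))) C"
     "(\<Union>i\<in>K. cball (fst i) (snd i)) \<subseteq> (\<Union>i\<in>C. cball (fst i) (5 * snd i))"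
    by (rule Vitali_covering_lemma_cballs[where S = "\<Union>i\<in>K. cball (fst i) (snd i)" and K = K
        and a = fst and r = snd, OF order_refl r])
  define U where "U = (\<Union>i\<in>C. cball (fst i) (5 * snd i))"
  show ?thesis
  proof
    show U: "U \<in> sets borel" unfolding U_def using C(1) by (intro sets.countable_UN'') auto
    show "z \<in> U" if "t > 0" "(\<integral>\<^sup>+y. u y * indicator (cball z t) y \<partial>lborel) > ennreal c * ennreal (pi * t\<^sup>2)" for z t
    proof -
      have "(z, t) \<in> K" using that by (simp add: K_def)
      moreover have "z \<in> cball z t" using that by simp
      ultimately show ?thesis using C(4) unfolding U_def by force
    qed
    have ic: "ennreal c * ennreal (pi * (5 * snd i)\<^sup>2) \<le> 25 * (\<integral>\<^sup>+y. u y * indicator (cball (fst i) (snd i)) y \<partial>lborel)"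
      if "i \<in> C" for i
    proof -
      have "ennreal c * ennreal (pi * (snd i)\<^sup>2) < (\<integral>\<^sup>+y. u y * indicator (cball (fst i) (snd i)) y \<partial>lborel)"
        using that C(2) by (auto simp: K_def)
      then have "25 * (ennreal c * ennreal (pi * (snd i)\<^sup>2)) \<le> 25 * (\<integral>\<^sup>+y. u y * indicator (cball (fst i) (snd i)) y \<partial>lborel)"
        by (intro mult_left_mono) auto
      moreover have "25 * (ennreal c * ennreal (pi * (snd i)\<^sup>2)) = ennreal c * ennreal (pi * (5 * snd i)\<^sup>2)"
        using c by (simp add: ennreal_mult[symmetric] ennreal_numeral[symmetric] power_mult_distrib mult_ac del: ennreal_numeral)
      ultimately show ?thesis by simp
    qed
    have "(\<integral>\<^sup>+i. (\<integral>\<^sup>+y. u y * indicator (cball (fst i) (snd i)) y \<partial>lborel) \<partial>count_space C)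
       = (\<integral>\<^sup>+i. emeasure (density lborel u) (cball (fst i) (snd i)) \<partial>count_space C)"
      by (intro nn_integral_cong) (simp add: emeasure_density)
    also have "\<dots> = emeasure (density lborel u) (\<Union>i\<in>C. cball (fst i) (snd i))"
      using C by (intro emeasure_UN_countable[symmetric]) (auto simp: disjoint_family_on_def pairwise_def disjnt_def)
    also have "\<dots> \<le> emeasure (density lborel u) (space (density lborel u))" by (rule emeasure_space)
    also have "\<dots> = (\<integral>\<^sup>+y. u y \<partial>lborel)" by (simp add: emeasure_density)
    also have "\<dots> \<le> ennreal A" by (rule fin)
    finally have T: "(\<integral>\<^sup>+i. (\<integral>\<^sup>+y. u y * indicator (cball (fst i) (snd i)) y \<partial>lborel) \<partial>count_space C) \<le> ennreal A" .
    have "ennreal c * emeasure lborel U \<le> ennreal c * (\<integral>\<^sup>+i. emeasure lborel (cball (fst i) (5 * snd i)) \<partial>count_space C)"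
    proof (intro mult_left_mono)
      have "emeasure lborel U = (\<integral>\<^sup>+x. indicator U x \<partial>lborel)" using U by simp
      also have "\<dots> \<le> (\<integral>\<^sup>+x. (\<integral>\<^sup>+i. indicator (cball (fst i) (5 * snd i)) x \<partial>count_space C) \<partial>lborel)"
      proof (intro nn_integral_mono)
        fix x :: complex
        show "indicator U x \<le> (\<integral>\<^sup>+i. indicator (cball (fst i) (5 * snd i)) x \<partial>count_space C)"
        proof (cases "x \<in> U")
          case True
          then obtain i where i: "i \<in> C" "x \<in> cball (fst i) (5 * snd i)" by (auto simp: U_def)
          have "indicator (cball (fst i) (5 * snd i)) x \<le> (\<integral>\<^sup>+i. indicator (cball (fst i) (5 * snd i)) x \<partial>count_space C)"
            using i(1) by (rule nn_integral_ge_point)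
          then show ?thesis using i True by simp
        qed simp
      qed
      also have "\<dots> = (\<integral>\<^sup>+i. emeasure lborel (cball (fst i) (5 * snd i)) \<partial>count_space C)"
        using C(1) by (subst nn_integral_count_space_nn_integral) (auto intro!: borel_measurable_indicator)
      finally show "emeasure lborel U \<le> (\<integral>\<^sup>+i. emeasure lborel (cball (fst i) (5 * snd i)) \<partial>count_space C)" .
    qed simp
    also have "\<dots> = (\<integral>\<^sup>+i. ennreal c * emeasure lborel (cball (fst i) (5 * snd i)) \<partial>count_space C)"
      by (simp add: nn_integral_cmult)
    also have "\<dots> \<le> (\<integral>\<^sup>+i. 25 * (\<integral>\<^sup>+y. u y * indicator (cball (fst i) (snd i)) y \<partial>lborel) \<partial>count_space C)"
    proof (intro nn_integral_mono)
      fix i assume "i \<in> space (count_space C)"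
      then have i: "i \<in> C" by simp
      then have "snd i > 0" using r[of i] C(2) by blast
      then show "ennreal c * emeasure lborel (cball (fst i) (5 * snd i)) \<le> 25 * (\<integral>\<^sup>+y. u y * indicator (cball (fst i) (snd i)) y \<partial>lborel)"
        using ic[OF i] by (simp add: emeasure_cball_complex)
    qed
    also have "\<dots> = 25 * (\<integral>\<^sup>+i. (\<integral>\<^sup>+y. u y * indicator (cball (fst i) (snd i)) y \<partial>lborel) \<partial>count_space C)"
      by (simp add: nn_integral_cmult)
    also have "\<dots> \<le> 25 * ennreal A" by (intro mult_left_mono T) simp
    finally have "ennreal c * emeasure lborel U \<le> ennreal (25 * A)" using A by (simp add: ennreal_mult)
    then have "ennreal (1/c) * (ennreal c * emeasure lborel U) \<le> ennreal (1/c) * ennreal (25 * A)" by (intro mult_left_mono) auto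
    then show "emeasure lborel U \<le> ennreal (25 * A / c)"
      using c A by (simp add: mult.assoc[symmetric] ennreal_mult[symmetric])
  qed
qed

subsection \<open>Convolutions\<close>

text \<open>The convex function t^p lies above its tangent at t = c; the inequality is solved for
  t.\<close>

lemma powr_tangent:
  fixes t c p :: real
  assumes "t \<ge> 0" "c > 0" "p > 1"
  shows "t \<le> c powr (1 - p) / p * t powr p + c * (1 - 1/p)"
proof -
  define q where "q = p / (p - 1)"
  have q: "q > 1" "1/p + 1/q = 1" "1/q = 1 - 1/p" using assms by (auto simp: q_def field_simps)
  have "t = (t * c powr (1/p - 1)) * c powr (1 - 1/p)"
    using assms by (simp add: powr_add[symmetric] mult.assoc)
  also have "\<dots> \<le> (t * c powr (1/p - 1)) powr p / p + (c powr (1 - 1/p)) powr q / q"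
    using assms q by (intro Youngs_inequality) auto
  also have "(c powr (1 - 1/p)) powr q = c"
  proof -
    have "(1 - 1/p) * q = 1" using assms by (simp add: q_def field_simps)
    then show ?thesis using assms(2) by (simp add: powr_powr)
  qed
  also have "(t * c powr (1/p - 1)) powr p = t powr p * c powr (1 - p)"
  proof -
    have "(1/p - 1) * p = 1 - p" using assms by (simp add: field_simps)
    then show ?thesis using assms by (simp add: powr_mult powr_powr)
  qed
  also have "c / q = c * (1 - 1/p)" unfolding q(3)[symmetric] by simp
  finally show ?thesis by (simp add: mult.commute)
qed

text \<open>Jensen's inequality for a weight of mass at most m, from the tangent at c = N / m. The
  mean enters only through a lower bound N, so N may be the norm of a Bochner integral, including
  the value 0 of a divergent one.\<close>

lemma nn_integral_jensen:
  fixes \<kappa> \<phi> :: "'a \<Rightarrow> real"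
  assumes [measurable]: "\<kappa> \<in> borel_measurable M" "\<phi> \<in> borel_measurable M"
    and nn: "\<And>y. \<kappa> y \<ge> 0" "\<And>y. \<phi> y \<ge> 0" and p: "p > 1" and m: "m > 0"
    and mass: "(\<integral>\<^sup>+y. ennreal (\<kappa> y) \<partial>M) \<le> ennreal m"
    and N: "N \<ge> 0" "ennreal N \<le> (\<integral>\<^sup>+y. ennreal (\<kappa> y * \<phi> y) \<partial>M)"
  shows "ennreal (N powr p) \<le> ennreal (m powr (p - 1)) * (\<integral>\<^sup>+y. ennreal (\<kappa> y * \<phi> y powr p) \<partial>M)"
proof (cases "N = 0 \<or> (\<integral>\<^sup>+y. ennreal (\<kappa> y * \<phi> y powr p) \<partial>M) = top")
  case True
  then show ?thesis using p m by (auto simp: ennreal_mult_top ennreal_top_mult)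
next
  case False
  then have N0: "N > 0" using N by simp
  obtain A where A: "A \<ge> 0" "(\<integral>\<^sup>+y. ennreal (\<kappa> y * \<phi> y powr p) \<partial>M) = ennreal A"
    using False by (metis ennreal_cases)
  define c where "c = N / m"
  have c: "c > 0" using N0 m by (simp add: c_def)
  have "ennreal N \<le> (\<integral>\<^sup>+y. ennreal (\<kappa> y * \<phi> y) \<partial>M)" by fact
  also have "\<dots> \<le> (\<integral>\<^sup>+y. ennreal (c powr (1 - p) / p) * ennreal (\<kappa> y * \<phi> y powr p)
      + ennreal (c * (1 - 1/p)) * ennreal (\<kappa> y) \<partial>M)"
  proof (rule nn_integral_mono)
    fix y
    have "\<kappa> y * \<phi> y \<le> \<kappa> y * (c powr (1 - p) / p * \<phi> y powr p + c * (1 - 1/p))"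
      by (intro mult_left_mono powr_tangent nn c p)
    also have "\<dots> = c powr (1 - p) / p * (\<kappa> y * \<phi> y powr p) + c * (1 - 1/p) * \<kappa> y"
      by (simp add: algebra_simps)
    finally have "ennreal (\<kappa> y * \<phi> y) \<le> ennreal (c powr (1 - p) / p * (\<kappa> y * \<phi> y powr p) + c * (1 - 1/p) * \<kappa> y)"
      by (rule ennreal_leI)
    also have "\<dots> = ennreal (c powr (1 - p) / p) * ennreal (\<kappa> y * \<phi> y powr p) + ennreal (c * (1 - 1/p)) * ennreal (\<kappa> y)"
    proof -
      have n: "0 \<le> c powr (1 - p) / p" "0 \<le> \<kappa> y * \<phi> y powr p" "0 \<le> c * (1 - 1/p)"
        using c p nn by auto
      show ?thesis
        by (simp only: ennreal_plus[OF mult_nonneg_nonneg[OF n(1,2)] mult_nonneg_nonneg[OF n(3) nn(1)]]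
            ennreal_mult[OF n(1,2)] ennreal_mult[OF n(3) nn(1)])
    qed
    finally show "ennreal (\<kappa> y * \<phi> y) \<le> ennreal (c powr (1 - p) / p) * ennreal (\<kappa> y * \<phi> y powr p)
        + ennreal (c * (1 - 1/p)) * ennreal (\<kappa> y)" .
  qed
  also have "\<dots> = ennreal (c powr (1 - p) / p) * ennreal A + ennreal (c * (1 - 1/p)) * (\<integral>\<^sup>+y. ennreal (\<kappa> y) \<partial>M)"
    by (simp add: nn_integral_add nn_integral_cmult A)
  also have "\<dots> \<le> ennreal (c powr (1 - p) / p) * ennreal A + ennreal (c * (1 - 1/p)) * ennreal m"
    by (intro add_left_mono mult_left_mono mass) simp
  also have "\<dots> = ennreal (c powr (1 - p) / p * A + c * (1 - 1/p) * m)"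
  proof -
    have n: "0 \<le> c powr (1 - p) / p" "0 \<le> c * (1 - 1/p)" "0 \<le> m" using c p m by auto
    show ?thesis
      by (simp only: ennreal_plus[OF mult_nonneg_nonneg[OF n(1) A(1)] mult_nonneg_nonneg[OF n(2,3)]]
          ennreal_mult[OF n(1) A(1)] ennreal_mult[OF n(2,3)])
  qed
  finally have "N \<le> c powr (1 - p) / p * A + c * (1 - 1/p) * m"
    using A c p m by (subst (asm) ennreal_le_iff) (auto intro!: add_nonneg_nonneg mult_nonneg_nonneg)
  \<comment> \<open>By the choice of c the term N cancels on both sides and N / p is left to be
    estimated.\<close>
  also have "c * (1 - 1/p) * m = N - N / p" using m by (simp add: c_def algebra_simps)
  finally have "N \<le> c powr (1 - p) * A" using p by (simp add: field_simps)
  then have "c powr (p - 1) * N \<le> c powr (p - 1) * (c powr (1 - p) * A)" by (rule mult_left_mono) simp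
  also have "\<dots> = A" using c by (simp add: mult.assoc[symmetric] powr_add[symmetric])
  finally have "m powr (p - 1) * (c powr (p - 1) * N) \<le> m powr (p - 1) * A" by (rule mult_left_mono) simp
  moreover have "m powr (p - 1) * (c powr (p - 1) * N) = N powr p"
    using N0 m powr_add[of N "p-1" 1] by (simp add: c_def powr_divide)
  ultimately show ?thesis unfolding A(2) using A m by (simp add: ennreal_mult[symmetric])
qed

text \<open>Where the integrand is not integrable the value is 0, so \<open>norm_cconv_le\<close>
  holds at every point.\<close>

definition cconv :: "(complex \<Rightarrow> complex) \<Rightarrow> (complex \<Rightarrow> complex) \<Rightarrow> complex \<Rightarrow> complex" where
  "cconv \<kappa> f x = (LINT y|lborel. \<kappa> (x - y) * f y)"

lemma borel_measurable_cconv [measurable]: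
  assumes [measurable]: "\<kappa> \<in> borel_measurable borel" "f \<in> borel_measurable borel"
  shows "cconv \<kappa> f \<in> borel_measurable borel"
  unfolding cconv_def[abs_def] by measurable

lemma norm_cconv_le:
  "ennreal (norm (cconv \<kappa> f x)) \<le> (\<integral>\<^sup>+y. ennreal (norm (\<kappa> (x - y)) * norm (f y)) \<partial>lborel)"
proof (cases "integrable lborel (\<lambda>y. \<kappa> (x - y) * f y)")
  case True
  show ?thesis using integral_norm_bound_ennreal[OF True] by (simp add: cconv_def norm_mult)
next
  case False
  then show ?thesis by (simp add: cconv_def not_integrable_integral_eq)
qed

text \<open>Young's convolution inequality for L^1 and L^p: Jensen at each point, then Tonelli. The
  function N only has to be dominated by a convolution, so kernel and function can exchange their
  roles in later uses.\<close>

lemma nn_integral_conv_powr: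
  fixes \<kappa> \<phi> :: "complex \<Rightarrow> real"
  assumes [measurable]: "\<kappa> \<in> borel_measurable borel" "\<phi> \<in> borel_measurable borel"
    and [measurable]: "N \<in> borel_measurable borel"
    and nn: "\<And>y. \<kappa> y \<ge> 0" "\<And>y. \<phi> y \<ge> 0" and p: "p > 1" and m: "m > 0"
    and mass: "(\<integral>\<^sup>+y. ennreal (\<kappa> y) \<partial>lborel) \<le> ennreal m"
    and N: "\<And>x. N x \<ge> 0" "\<And>x. ennreal (N x) \<le> (\<integral>\<^sup>+y. ennreal (\<kappa> (x - y) * \<phi> y) \<partial>lborel)"
  shows "(\<integral>\<^sup>+x. ennreal (N x powr p) \<partial>lborel) \<le> ennreal (m powr p) * (\<integral>\<^sup>+y. ennreal (\<phi> y powr p) \<partial>lborel)"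
proof -
  have "(\<integral>\<^sup>+x. ennreal (N x powr p) \<partial>lborel)
     \<le> (\<integral>\<^sup>+x. ennreal (m powr (p - 1)) * (\<integral>\<^sup>+y. ennreal (\<kappa> (x - y) * \<phi> y powr p) \<partial>lborel) \<partial>lborel)"
  proof (rule nn_integral_mono)
    fix x
    have "(\<integral>\<^sup>+y. ennreal (\<kappa> (x - y)) \<partial>lborel) \<le> ennreal m"
      using mass nn_integral_reflect[of "\<lambda>y. ennreal (\<kappa> y)" x] by simp
    then show "ennreal (N x powr p) \<le> ennreal (m powr (p - 1)) * (\<integral>\<^sup>+y. ennreal (\<kappa> (x - y) * \<phi> y powr p) \<partial>lborel)"
      by (intro nn_integral_jensen nn p m N) auto
  qed
  also have "\<dots> = ennreal (m powr (p - 1)) * (\<integral>\<^sup>+x. (\<integral>\<^sup>+y. ennreal (\<kappa> (x - y) * \<phi> y powr p) \<partial>lborel) \<partial>lborel)"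
    by (rule nn_integral_cmult) measurable
  also have "(\<integral>\<^sup>+x. (\<integral>\<^sup>+y. ennreal (\<kappa> (x - y) * \<phi> y powr p) \<partial>lborel) \<partial>lborel)
     = (\<integral>\<^sup>+y. (\<integral>\<^sup>+x. ennreal (\<kappa> (x - y) * \<phi> y powr p) \<partial>lborel) \<partial>lborel)"
    by (rule nn_integral_lborel_swap) measurable
  also have "\<dots> = (\<integral>\<^sup>+y. (\<integral>\<^sup>+x. ennreal (\<kappa> x) \<partial>lborel) * ennreal (\<phi> y powr p) \<partial>lborel)"
  proof (rule nn_integral_cong)
    fix y
    have "(\<integral>\<^sup>+x. ennreal (\<kappa> (x - y) * \<phi> y powr p) \<partial>lborel) = (\<integral>\<^sup>+x. ennreal (\<kappa> (x + - y)) \<partial>lborel) * ennreal (\<phi> y powr p)"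
      using nn by (simp add: ennreal_mult nn_integral_multc)
    also have "(\<integral>\<^sup>+x. ennreal (\<kappa> (x + - y)) \<partial>lborel) = (\<integral>\<^sup>+x. ennreal (\<kappa> x) \<partial>lborel)"
      by (rule nn_integral_shift) measurable
    finally show "(\<integral>\<^sup>+x. ennreal (\<kappa> (x - y) * \<phi> y powr p) \<partial>lborel) = (\<integral>\<^sup>+x. ennreal (\<kappa> x) \<partial>lborel) * ennreal (\<phi> y powr p)" .
  qed
  also have "\<dots> = (\<integral>\<^sup>+x. ennreal (\<kappa> x) \<partial>lborel) * (\<integral>\<^sup>+y. ennreal (\<phi> y powr p) \<partial>lborel)"
    by (rule nn_integral_cmult) measurable
  also have "ennreal (m powr (p - 1)) * \<dots> \<le> ennreal (m powr (p - 1)) * (ennreal m * (\<integral>\<^sup>+y. ennreal (\<phi> y powr p) \<partial>lborel))"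
    by (intro mult_left_mono mult_right_mono mass) auto
  also have "\<dots> = ennreal (m powr p) * (\<integral>\<^sup>+y. ennreal (\<phi> y powr p) \<partial>lborel)"
    using m powr_add[of m "p-1" 1] by (simp add: mult.assoc[symmetric] ennreal_mult[symmetric])
  finally show ?thesis .
qed

subsection \<open>The logarithmic potential on the hexagonal lattice\<close>

text \<open>One sixth root of unity from each antipodal pair; the sign of a step supplies the other
  three.\<close>

definition hexdir :: "nat \<Rightarrow> complex" where
  "hexdir j = (if j = 0 then 1 else if j = 1 then Complex (1/2) (sqrt 3 / 2) else Complex (-1/2) (sqrt 3 / 2))"

definition hex :: "real \<Rightarrow> nat \<Rightarrow> complex" where "hex h j = of_real h * hexdir j"

definition hexw :: "nat \<Rightarrow> complex" where "hexw j = (cnj (hexdir j))\<^sup>2"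

lemma norm_hexdir [simp]: "norm (hexdir j) = 1"
  by (simp add: hexdir_def cmod_def power_divide)

lemma norm_hexw [simp]: "norm (hexw j) = 1"
  by (simp add: hexw_def norm_power)

text \<open>The squares of the conjugates run through the cube roots of unity, and so do the squares
  of these.\<close>

lemma hexdir_sums:
  "avg3 (\<lambda>j. (cnj (hexdir j))\<^sup>2) = 0" "avg3 (\<lambda>j. (cnj (hexdir j))\<^sup>2 * (cnj (hexdir j))\<^sup>2) = 0"
  by (simp_all add: avg3_def hexdir_def complex_eq_iff power2_eq_square algebra_simps)

lemma hexw_cancel: "(cnj (hexdir j))\<^sup>2 * (hexdir j)\<^sup>2 = 1"
proof -
  have "cnj (hexdir j) * hexdir j = 1" using complex_norm_square[of "hexdir j"] by (simp add: mult.commute)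
  then show ?thesis by (simp add: power_mult_distrib[symmetric])
qed

definition log_kernel :: "real \<Rightarrow> complex \<Rightarrow> complex" where
  "log_kernel a z = of_real (ln ((norm z)\<^sup>2 + a\<^sup>2))"

text \<open>With \<open>\<partial>\<close> the derivative in \<open>z\<close>, this is \<open>\<partial>\<^sup>2 log(|z|\<^sup>2 + a\<^sup>2) / \<pi>\<close>, a smooth version of \<open>-1 / (\<pi> z\<^sup>2)\<close>.\<close>

definition beurling_kernel :: "real \<Rightarrow> complex \<Rightarrow> complex" where
  "beurling_kernel a z = - (cnj z)\<^sup>2 / of_real (pi * ((norm z)\<^sup>2 + a\<^sup>2)\<^sup>2)"

text \<open>With d = |z|^2 + a^2 the two shifted arguments multiply to d^2 (1 + X), where X is of
  order s^2 / d, so the second difference is half of ln (1 + X). The condition 6 s^2 <= a^2 keeps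
  |X| below 1/2. The error is 9 s^4 / d^2 from the logarithm and half of s^4 / d^2 from X itself,
  rounded up to 10.\<close>

lemma log_second_difference:
  fixes z u :: complex and a s :: real
  assumes a: "a > 0" and u: "norm u = 1" and s: "s > 0" "6 * s\<^sup>2 \<le> a\<^sup>2"
  shows "\<bar>(ln ((norm (z + of_real s * u))\<^sup>2 + a\<^sup>2) + ln ((norm (z - of_real s * u))\<^sup>2 + a\<^sup>2)) / 2
      - ln ((norm z)\<^sup>2 + a\<^sup>2) - s\<^sup>2 * (a\<^sup>2 - Re ((z * cnj u)\<^sup>2)) / ((norm z)\<^sup>2 + a\<^sup>2)\<^sup>2\<bar>
     \<le> 10 * s^4 / ((norm z)\<^sup>2 + a\<^sup>2)\<^sup>2"
proof -
  define d where "d = (norm z)\<^sup>2 + a\<^sup>2"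
  define c where "c = Re (z * cnj u)"
  define X where "X = (2 * s\<^sup>2 * (d - 2 * c\<^sup>2) + s^4) / d\<^sup>2"
  have d: "d > 0" "a\<^sup>2 \<le> d" using a by (auto simp: d_def add_nonneg_pos)
  have sd: "6 * s\<^sup>2 \<le> d" using s d by linarith
  have nw: "norm (z * cnj u) = norm z" using u by (simp add: norm_mult)
  have cz: "c\<^sup>2 \<le> (norm z)\<^sup>2" unfolding c_def nw[symmetric] using abs_Re_le_cmod[of "z * cnj u"]
    by (metis abs_ge_zero power2_abs power_mono)
  have c2: "2 * c\<^sup>2 = (norm z)\<^sup>2 + Re ((z * cnj u)\<^sup>2)"
    unfolding nw[symmetric] c_def cmod_power2 by (simp add: power2_eq_square)
  have u2: "(Re u)\<^sup>2 + (Im u)\<^sup>2 = 1" using u cmod_power2[of u] by simp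
  have np: "(norm (z + of_real s * u))\<^sup>2 + a\<^sup>2 = d + s\<^sup>2 + 2 * s * c"
    and nm: "(norm (z - of_real s * u))\<^sup>2 + a\<^sup>2 = d + s\<^sup>2 - 2 * s * c"
  proof -
    have "s\<^sup>2 * ((Re u)\<^sup>2 + (Im u)\<^sup>2) = s\<^sup>2" using u2 by simp
    then show "(norm (z + of_real s * u))\<^sup>2 + a\<^sup>2 = d + s\<^sup>2 + 2 * s * c"
      "(norm (z - of_real s * u))\<^sup>2 + a\<^sup>2 = d + s\<^sup>2 - 2 * s * c"
      unfolding cmod_power2 d_def c_def by (simp_all add: power2_eq_square algebra_simps)
  qed
  have pos: "d + s\<^sup>2 + 2 * s * c > 0" "d + s\<^sup>2 - 2 * s * c > 0"
    unfolding np[symmetric] nm[symmetric] using a by (simp_all add: add_nonneg_pos)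
  have prod: "(d + s\<^sup>2 + 2 * s * c) * (d + s\<^sup>2 - 2 * s * c) = d\<^sup>2 * (1 + X)"
  proof -
    have "d\<^sup>2 * X = 2 * s\<^sup>2 * (d - 2 * c\<^sup>2) + s^4" unfolding X_def using d by simp
    then have "d\<^sup>2 * (1 + X) = d\<^sup>2 + (2 * s\<^sup>2 * (d - 2 * c\<^sup>2) + s^4)" by (simp add: distrib_left)
    then show ?thesis by (simp add: power2_eq_square eval_nat_numeral algebra_simps)
  qed
  have "d\<^sup>2 * (1 + X) > 0" unfolding prod[symmetric] using pos by (rule mult_pos_pos)
  then have X1: "1 + X > 0" using d by (simp add: zero_less_mult_iff)
  have "ln (d + s\<^sup>2 + 2 * s * c) + ln (d + s\<^sup>2 - 2 * s * c) = ln (d\<^sup>2 * (1 + X))"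
    unfolding prod[symmetric] using pos by (simp add: ln_mult)
  also have "\<dots> = 2 * ln d + ln (1 + X)" using X1 d by (simp add: ln_mult ln_realpow)
  finally have e0: "ln (d + s\<^sup>2 + 2 * s * c) + ln (d + s\<^sup>2 - 2 * s * c) = 2 * ln d + ln (1 + X)" .
  have eq: "(ln (d + s\<^sup>2 + 2 * s * c) + ln (d + s\<^sup>2 - 2 * s * c)) / 2 - ln d = ln (1 + X) / 2"
    unfolding e0 by (simp add: field_simps)
  have s2: "s\<^sup>2 \<le> d" using sd by (smt (verit) zero_le_power2)
  have Xb: "\<bar>X\<bar> \<le> 3 * s\<^sup>2 / d"
  proof -
    have "0 \<le> c\<^sup>2" "0 \<le> a\<^sup>2" by simp_all
    then have "\<bar>d - 2 * c\<^sup>2\<bar> \<le> d" unfolding abs_le_iff d_def using cz by linarith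
    then have "2 * s\<^sup>2 * \<bar>d - 2 * c\<^sup>2\<bar> \<le> 2 * s\<^sup>2 * d" by (intro mult_left_mono) auto
    moreover have "s\<^sup>2 * s\<^sup>2 \<le> s\<^sup>2 * d" using s2 by (rule mult_left_mono) simp
    then have "s^4 \<le> s\<^sup>2 * d" by (simp add: eval_nat_numeral mult.assoc)
    ultimately have "\<bar>2 * s\<^sup>2 * (d - 2 * c\<^sup>2) + s^4\<bar> \<le> 3 * s\<^sup>2 * d"
      using abs_triangle_ineq[of "2 * s\<^sup>2 * (d - 2 * c\<^sup>2)" "s^4"] by (simp add: abs_mult)
    then have "\<bar>2 * s\<^sup>2 * (d - 2 * c\<^sup>2) + s^4\<bar> / d\<^sup>2 \<le> 3 * s\<^sup>2 * d / d\<^sup>2" by (rule divide_right_mono) simp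
    then show ?thesis using d by (simp add: X_def abs_divide power2_eq_square)
  qed
  have "3 * s\<^sup>2 / d \<le> 1/2" using sd d by (simp add: field_simps)
  then have "\<bar>ln (1 + X) - X\<bar> \<le> 2 * X\<^sup>2" using Xb by (intro abs_ln_one_plus_x_minus_x_bound) linarith
  also have "X\<^sup>2 \<le> (3 * s\<^sup>2 / d)\<^sup>2" using power_mono[OF Xb, of 2] by simp
  finally have L: "\<bar>ln (1 + X) - X\<bar> \<le> 2 * (3 * s\<^sup>2 / d)\<^sup>2" by simp
  have main: "s\<^sup>2 * (a\<^sup>2 - Re ((z * cnj u)\<^sup>2)) / d\<^sup>2 = X / 2 - s^4 / (2 * d\<^sup>2)"
  proof -
    have r: "a\<^sup>2 - Re ((z * cnj u)\<^sup>2) = d - 2 * c\<^sup>2" unfolding c2 by (simp add: d_def)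
    show ?thesis unfolding r X_def using d by (simp add: field_simps)
  qed
  have e9: "(3 * s\<^sup>2 / d)\<^sup>2 = 9 * s^4 / d\<^sup>2" by (simp add: power_divide power_mult_distrib)
  have "\<bar>ln (1 + X) / 2 - (X / 2 - s^4 / (2 * d\<^sup>2))\<bar> \<le> \<bar>ln (1 + X) - X\<bar> / 2 + s^4 / (2 * d\<^sup>2)"
  proof -
    have w: "s^4 / (2 * d\<^sup>2) \<ge> 0" by simp
    have e1: "ln (1 + X) / 2 - (X / 2 - s^4 / (2 * d\<^sup>2)) = (ln (1 + X) - X) / 2 + s^4 / (2 * d\<^sup>2)"
      by (simp add: diff_divide_distrib)
    show ?thesis unfolding e1
      using abs_triangle_ineq[of "(ln (1 + X) - X) / 2" "s^4 / (2 * d\<^sup>2)"] w by simp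
  qed
  also have "\<dots> \<le> 9 * s^4 / d\<^sup>2 + s^4 / (2 * d\<^sup>2)" using L unfolding e9 by simp
  also have "\<dots> \<le> 10 * s^4 / d\<^sup>2" using d by (simp add: field_simps)
  finally show ?thesis unfolding np nm d_def[symmetric] eq main .
qed

lemma sym_avg_log_kernel:
  assumes a: "a > 0" and s: "s > 0" "6 * s\<^sup>2 \<le> a\<^sup>2" and u: "norm u = 1"
  obtains e where "sym_avg (of_real s * u) (log_kernel a) z - log_kernel a z
      = of_real (s\<^sup>2 * (a\<^sup>2 - Re ((z * cnj u)\<^sup>2)) / ((norm z)\<^sup>2 + a\<^sup>2)\<^sup>2 + e)"
    "\<bar>e\<bar> \<le> 10 * s^4 / ((norm z)\<^sup>2 + a\<^sup>2)\<^sup>2"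
proof
  show "sym_avg (of_real s * u) (log_kernel a) z - log_kernel a z
      = of_real (s\<^sup>2 * (a\<^sup>2 - Re ((z * cnj u)\<^sup>2)) / ((norm z)\<^sup>2 + a\<^sup>2)\<^sup>2 +
       ((ln ((norm (z + of_real s * u))\<^sup>2 + a\<^sup>2) + ln ((norm (z - of_real s * u))\<^sup>2 + a\<^sup>2)) / 2
      - ln ((norm z)\<^sup>2 + a\<^sup>2) - s\<^sup>2 * (a\<^sup>2 - Re ((z * cnj u)\<^sup>2)) / ((norm z)\<^sup>2 + a\<^sup>2)\<^sup>2))"
    by (simp add: sym_avg_def log_kernel_def scaleR_conv_of_real)
qed (rule log_second_difference[OF a u s])

text \<open>The angular parts of the second differences average to 0 over the three directions. What
  remains is h^2 a^2 / (|z|^2 + a^2)^2, a multiple of \<open>poisson\<close>.\<close>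

lemma walk_log_kernel:
  assumes a: "a > 0" and h: "h > 0" "6 * h\<^sup>2 \<le> a\<^sup>2"
  shows "norm (walk (hex h) (log_kernel a) z - log_kernel a z - of_real (pi * h\<^sup>2 * poisson a z))
     \<le> 10 * h^4 / ((norm z)\<^sup>2 + a\<^sup>2)\<^sup>2"
proof -
  define d where "d = (norm z)\<^sup>2 + a\<^sup>2"
  have d: "d > 0" using a by (simp add: d_def add_nonneg_pos)
  have "\<exists>e. sym_avg (hex h j) (log_kernel a) z - log_kernel a z
      = of_real (h\<^sup>2 * (a\<^sup>2 - Re ((z * cnj (hexdir j))\<^sup>2)) / d\<^sup>2 + e) \<and> \<bar>e\<bar> \<le> 10 * h^4 / d\<^sup>2" for j
    unfolding hex_def d_def by (rule sym_avg_log_kernel[OF a h norm_hexdir[of j], of z]) blast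
  then have "\<forall>j. \<exists>e. sym_avg (hex h j) (log_kernel a) z - log_kernel a z
      = of_real (h\<^sup>2 * (a\<^sup>2 - Re ((z * cnj (hexdir j))\<^sup>2)) / d\<^sup>2 + e) \<and> \<bar>e\<bar> \<le> 10 * h^4 / d\<^sup>2" by blast
  from choice[OF this] obtain e where e: "\<And>j. sym_avg (hex h j) (log_kernel a) z - log_kernel a z
      = of_real (h\<^sup>2 * (a\<^sup>2 - Re ((z * cnj (hexdir j))\<^sup>2)) / d\<^sup>2 + e j)" "\<And>j. \<bar>e j\<bar> \<le> 10 * h^4 / d\<^sup>2" by blast
  have R: "avg3 (\<lambda>j. Re ((z * cnj (hexdir j))\<^sup>2)) = 0"
  proof -
    have "avg3 (\<lambda>j. Re ((z * cnj (hexdir j))\<^sup>2)) = Re (z\<^sup>2 * avg3 (\<lambda>j. (cnj (hexdir j))\<^sup>2))"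
      unfolding avg3_def by (simp only: power_mult_distrib) (simp add: algebra_simps)
    then show ?thesis by (simp add: hexdir_sums)
  qed
  have "walk (hex h) (log_kernel a) z - log_kernel a z = avg3 (\<lambda>j. sym_avg (hex h j) (log_kernel a) z - log_kernel a z)"
    by (simp add: walk_def avg3_def scaleR_conv_of_real field_simps)
  also have "\<dots> = avg3 (\<lambda>j. of_real (h\<^sup>2 * (a\<^sup>2 - Re ((z * cnj (hexdir j))\<^sup>2)) / d\<^sup>2 + e j))" by (simp only: e)
  also have "\<dots> = of_real (h\<^sup>2 * (a\<^sup>2 - avg3 (\<lambda>j. Re ((z * cnj (hexdir j))\<^sup>2))) / d\<^sup>2 + avg3 e)"
    unfolding avg3_def scaleR_conv_of_real by (simp add: add_divide_distrib diff_divide_distrib ring_distribs)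
  also have "h\<^sup>2 * (a\<^sup>2 - avg3 (\<lambda>j. Re ((z * cnj (hexdir j))\<^sup>2))) / d\<^sup>2 = pi * h\<^sup>2 * poisson a z"
    by (simp add: R poisson_def d_def)
  finally have "walk (hex h) (log_kernel a) z - log_kernel a z - of_real (pi * h\<^sup>2 * poisson a z) = of_real (avg3 e)" by simp
  then have "norm (walk (hex h) (log_kernel a) z - log_kernel a z - of_real (pi * h\<^sup>2 * poisson a z)) = \<bar>avg3 e\<bar>" by (simp only: norm_of_real)
  also have "\<dots> \<le> avg3 (\<lambda>j. \<bar>e j\<bar>)" using norm_avg3_le[of e] by simp
  also have "\<dots> \<le> avg3 (\<lambda>j. 10 * h^4 / d\<^sup>2)" by (intro avg3_mono e)
  finally show ?thesis by (simp add: avg3_def d_def)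
qed

text \<open>Twice the real part of (z cnj e)^2 is the sum of this square and its conjugate. After
  multiplication by the weight (cnj e)^2, averaging over the directions e kills everything except
  the term with the square of \<open>cnj z\<close>. The second differences have step 2 h, whence 24
  and 160 in place of 6 and 10.\<close>

lemma walk_op_log_kernel:
  assumes a: "a > 0" and h: "h > 0" "24 * h\<^sup>2 \<le> a\<^sup>2"
  shows "norm (walk_op (hex h) hexw (log_kernel a) z - of_real (2 * pi * h\<^sup>2) * beurling_kernel a z)
     \<le> 160 * h^4 / ((norm z)\<^sup>2 + a\<^sup>2)\<^sup>2"
proof -
  define d where "d = (norm z)\<^sup>2 + a\<^sup>2"
  have d: "d > 0" using a by (simp add: d_def add_nonneg_pos)
  have h2: "2 * h > 0" "6 * (2 * h)\<^sup>2 \<le> a\<^sup>2" using h by (auto simp: power_mult_distrib)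
  have two: "2 * hex h j = of_real (2 * h) * hexdir j" for j by (simp add: hex_def)
  have "\<exists>e. sym_avg (2 * hex h j) (log_kernel a) z - log_kernel a z
      = of_real ((2 * h)\<^sup>2 * (a\<^sup>2 - Re ((z * cnj (hexdir j))\<^sup>2)) / d\<^sup>2 + e) \<and> \<bar>e\<bar> \<le> 10 * (2 * h)^4 / d\<^sup>2" for j
    unfolding two d_def by (rule sym_avg_log_kernel[OF a h2 norm_hexdir[of j], of z]) blast
  then have "\<forall>j. \<exists>e. sym_avg (2 * hex h j) (log_kernel a) z - log_kernel a z
      = of_real ((2 * h)\<^sup>2 * (a\<^sup>2 - Re ((z * cnj (hexdir j))\<^sup>2)) / d\<^sup>2 + e) \<and> \<bar>e\<bar> \<le> 10 * (2 * h)^4 / d\<^sup>2" by blast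
  from choice[OF this] obtain e where e: "\<And>j. sym_avg (2 * hex h j) (log_kernel a) z - log_kernel a z
      = of_real ((2 * h)\<^sup>2 * (a\<^sup>2 - Re ((z * cnj (hexdir j))\<^sup>2)) / d\<^sup>2 + e j)" "\<And>j. \<bar>e j\<bar> \<le> 10 * (2 * h)^4 / d\<^sup>2" by blast
  define k where "k = complex_of_real ((2 * h)\<^sup>2 / d\<^sup>2)"
  have W: "hexw j * of_real ((2 * h)\<^sup>2 * (a\<^sup>2 - Re ((z * cnj (hexdir j))\<^sup>2)) / d\<^sup>2 + e j)
     = k * of_real (a\<^sup>2) * (cnj (hexdir j))\<^sup>2 - k / 2 * z\<^sup>2 * ((cnj (hexdir j))\<^sup>2 * (cnj (hexdir j))\<^sup>2)
        - k / 2 * (cnj z)\<^sup>2 + hexw j * of_real (e j)" for j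
  proof -
    define R where "R = Re ((z * cnj (hexdir j))\<^sup>2)"
    have R: "complex_of_real R = (z\<^sup>2 * (cnj (hexdir j))\<^sup>2 + (cnj z)\<^sup>2 * (hexdir j)\<^sup>2) / 2"
      unfolding R_def using complex_add_cnj[of "(z * cnj (hexdir j))\<^sup>2"] by (simp add: power_mult_distrib)
    have alg: "k * (A - (Z * C + Y * H) / 2) * C = k * A * C - k / 2 * Z * (C * C) - k / 2 * Y * (C * H)"
      for A Z C Y H by (simp add: field_simps)
    have "hexw j * of_real ((2 * h)\<^sup>2 * (a\<^sup>2 - R) / d\<^sup>2 + e j)
      = k * (of_real (a\<^sup>2) - of_real R) * (cnj (hexdir j))\<^sup>2 + hexw j * of_real (e j)"
      by (simp add: k_def hexw_def field_simps)
    also have "\<dots> = k * of_real (a\<^sup>2) * (cnj (hexdir j))\<^sup>2 - k / 2 * z\<^sup>2 * ((cnj (hexdir j))\<^sup>2 * (cnj (hexdir j))\<^sup>2)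
        - k / 2 * (cnj z)\<^sup>2 * ((cnj (hexdir j))\<^sup>2 * (hexdir j)\<^sup>2) + hexw j * of_real (e j)"
      unfolding R alg ..
    finally have "hexw j * of_real ((2 * h)\<^sup>2 * (a\<^sup>2 - Re ((z * cnj (hexdir j))\<^sup>2)) / d\<^sup>2 + e j)
       = k * of_real (a\<^sup>2) * (cnj (hexdir j))\<^sup>2 - k / 2 * z\<^sup>2 * ((cnj (hexdir j))\<^sup>2 * (cnj (hexdir j))\<^sup>2)
        - k / 2 * (cnj z)\<^sup>2 * ((cnj (hexdir j))\<^sup>2 * (hexdir j)\<^sup>2) + hexw j * of_real (e j)"
      unfolding R_def .
    then show ?thesis by (simp only: hexw_cancel mult_1_right)
  qed
  have "walk_op (hex h) hexw (log_kernel a) z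
      = avg3 (\<lambda>j. hexw j * of_real ((2 * h)\<^sup>2 * (a\<^sup>2 - Re ((z * cnj (hexdir j))\<^sup>2)) / d\<^sup>2 + e j))"
    unfolding walk_op_def e ..
  also have "\<dots> = k * of_real (a\<^sup>2) * avg3 (\<lambda>j. (cnj (hexdir j))\<^sup>2)
      - k / 2 * z\<^sup>2 * avg3 (\<lambda>j. (cnj (hexdir j))\<^sup>2 * (cnj (hexdir j))\<^sup>2)
      - k / 2 * (cnj z)\<^sup>2 + avg3 (\<lambda>j. hexw j * of_real (e j))"
    unfolding W avg3_def scaleR_conv_of_real by (simp add: algebra_simps)
  also have "\<dots> = - k / 2 * (cnj z)\<^sup>2 + avg3 (\<lambda>j. hexw j * of_real (e j))" unfolding hexdir_sums by simp
  also have "- k / 2 * (cnj z)\<^sup>2 = of_real (2 * pi * h\<^sup>2) * beurling_kernel a z"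
    by (simp add: k_def beurling_kernel_def d_def power_mult_distrib)
  finally have "norm (walk_op (hex h) hexw (log_kernel a) z - of_real (2 * pi * h\<^sup>2) * beurling_kernel a z)
     = norm (avg3 (\<lambda>j. hexw j * of_real (e j)))" by simp
  also have "\<dots> \<le> avg3 (\<lambda>j. norm (hexw j * of_real (e j)))" by (rule norm_avg3_le)
  also have "\<dots> \<le> avg3 (\<lambda>j. 10 * (2 * h)^4 / d\<^sup>2)" by (intro avg3_mono) (use e(2) in \<open>simp add: norm_mult power_mult_distrib\<close>)
  finally show ?thesis by (simp add: avg3_def d_def power_mult_distrib)
qed

section \<open>Convolutions with smooth kernels and their commutation with the walk\<close>

lemma den_pos: "a > 0 \<Longrightarrow> (norm (z::complex))\<^sup>2 + a\<^sup>2 > 0"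
  by (simp add: add_nonneg_pos)

lemma norm_beurling_kernel:
  assumes a: "a > 0"
  shows "norm (beurling_kernel a z) \<le> 1 / (pi * ((norm z)\<^sup>2 + a\<^sup>2))"
proof -
  define d where "d = (norm z)\<^sup>2 + a\<^sup>2"
  have d: "d > 0" "(norm z)\<^sup>2 \<le> d" using den_pos[OF a] by (auto simp: d_def)
  have "norm (beurling_kernel a z) = (norm z)\<^sup>2 / (pi * d\<^sup>2)"
    unfolding beurling_kernel_def norm_divide norm_of_real by (simp add: norm_power d_def)
  also have "\<dots> \<le> d / (pi * d\<^sup>2)" using d by (intro divide_right_mono) auto
  also have "\<dots> = 1 / (pi * d)" using d by (simp add: power2_eq_square)
  finally show ?thesis by (simp add: d_def)
qed

lemma borel_measurable_beurling_kernel [measurable]: "beurling_kernel a \<in> borel_measurable borel"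
proof -
  have "beurling_kernel a = (\<lambda>z. - (cnj z)\<^sup>2 * of_real (1 / (pi * ((norm z)\<^sup>2 + a\<^sup>2)\<^sup>2)))"
    by (simp add: fun_eq_iff beurling_kernel_def divide_inverse)
  moreover have "cnj \<in> borel_measurable borel" by (intro borel_measurable_continuous_onI continuous_intros)
  ultimately show ?thesis by simp
qed

lemma borel_measurable_log_kernel [measurable]: "log_kernel a \<in> borel_measurable borel"
  unfolding log_kernel_def[abs_def] by measurable

lemma bounded_borel_beurling_kernel:
  assumes a: "a > 0"
  shows "beurling_kernel a \<in> bounded_borel"
proof (rule bounded_borelI)
  fix z :: complex
  have "1 / (pi * ((norm z)\<^sup>2 + a\<^sup>2)) \<le> 1 / (pi * a\<^sup>2)"
    using a by (intro divide_left_mono mult_left_mono mult_pos_pos den_pos) auto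
  then show "norm (beurling_kernel a z) \<le> 1 / (pi * a\<^sup>2)" using norm_beurling_kernel[OF a, of z] by linarith
qed simp

lemma bounded_borel_reflect: "\<kappa> \<in> bounded_borel \<Longrightarrow> (\<lambda>y. \<kappa> (x - y)) \<in> bounded_borel"
  unfolding bounded_borel_def by (auto simp: bounded_iff)

lemma integrable_cconv:
  assumes "\<kappa> \<in> bounded_borel" "f \<in> test_fun"
  shows "integrable lborel (\<lambda>y. \<kappa> (x - y) * f y)"
  by (intro test_fun_integrable test_fun_mult_left bounded_borel_reflect assms)

lemma cconv_linear:
  assumes "\<kappa> \<in> bounded_borel" "f \<in> test_fun"
  shows "\<kappa>' \<in> bounded_borel \<Longrightarrow> cconv (\<lambda>z. \<kappa> z + \<kappa>' z) f x = cconv \<kappa> f x + cconv \<kappa>' f x"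
    and "\<kappa>' \<in> bounded_borel \<Longrightarrow> cconv (\<lambda>z. \<kappa> z - \<kappa>' z) f x = cconv \<kappa> f x - cconv \<kappa>' f x"
    and "cconv (\<lambda>z. c * \<kappa> z) f x = c * cconv \<kappa> f x"
  unfolding cconv_def using integrable_cconv[OF _ assms(2), of _ x] assms(1)
  by (simp_all add: distrib_right left_diff_distrib mult.assoc)

lemma cconv_scaleR:
  assumes "\<kappa> \<in> bounded_borel" "f \<in> test_fun"
  shows "cconv (\<lambda>z. r *\<^sub>R \<kappa> z) f x = r *\<^sub>R cconv \<kappa> f x"
  using cconv_linear(3)[OF assms, of "of_real r" x] by (simp add: scaleR_conv_of_real)

lemma cconv_shift: "cconv \<kappa> f (x + v) = cconv (\<lambda>z. \<kappa> (z + v)) f x" "cconv \<kappa> f (x - v) = cconv (\<lambda>z. \<kappa> (z - v)) f x"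
  by (simp_all add: cconv_def algebra_simps)

lemma sym_avg_cconv:
  assumes "\<kappa> \<in> bounded_borel" "f \<in> test_fun"
  shows "sym_avg v (cconv \<kappa> f) = cconv (sym_avg v \<kappa>) f"
proof
  fix x
  have b: "(\<lambda>z. \<kappa> (z + v)) \<in> bounded_borel" "(\<lambda>z. \<kappa> (z - v)) \<in> bounded_borel"
    by (rule bounded_borel_shift bounded_borel_shift' assms)+
  show "sym_avg v (cconv \<kappa> f) x = cconv (sym_avg v \<kappa>) f x"
    unfolding sym_avg_def[abs_def] cconv_shift
    using cconv_scaleR[OF bounded_borel_add[OF b] assms(2), of "1/2" x] cconv_linear(1)[OF b(1) assms(2) b(2), of x] by simp
qed

lemma avg3_cconv:
  assumes "\<And>j. \<kappa> j \<in> bounded_borel" "f \<in> test_fun"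
  shows "avg3 (\<lambda>j. cconv (\<kappa> j) f x) = cconv (\<lambda>z. avg3 (\<lambda>j. \<kappa> j z)) f x"
  unfolding avg3_def
  using cconv_scaleR[OF bounded_borel_add[OF bounded_borel_add[OF assms(1,1)] assms(1)] assms(2), of "1/3" 0 1 2 x]
    cconv_linear(1)[OF bounded_borel_add[OF assms(1,1)] assms(2,1), of 0 1 2 x]
    cconv_linear(1)[OF assms(1,2,1), of 0 1 x] by simp

lemma walk_cconv:
  assumes "\<kappa> \<in> bounded_borel" "f \<in> test_fun"
  shows "walk v (cconv \<kappa> f) = cconv (walk v \<kappa>) f"
  unfolding walk_def[abs_def] sym_avg_cconv[OF assms]
  by (rule ext) (rule avg3_cconv[OF bounded_borel_sym_avg[OF assms(1)] assms(2)])

lemma walk_op_cconv: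
  assumes "\<kappa> \<in> bounded_borel" "f \<in> test_fun"
  shows "walk_op v \<omega> (cconv \<kappa> f) = cconv (walk_op v \<omega> \<kappa>) f"
proof
  fix x
  have b: "(\<lambda>z. sym_avg u \<kappa> z - \<kappa> z) \<in> bounded_borel" for u
    by (intro bounded_borel_diff bounded_borel_sym_avg assms)
  have "walk_op v \<omega> (cconv \<kappa> f) x = avg3 (\<lambda>j. cconv (\<lambda>z. \<omega> j * (sym_avg (2 * v j) \<kappa> z - \<kappa> z)) f x)"
    unfolding walk_op_def sym_avg_cconv[OF assms]
    by (simp add: cconv_linear(3)[OF b assms(2)] cconv_linear(2)[OF bounded_borel_sym_avg[OF assms(1)] assms(2,1)])
  also have "\<dots> = cconv (walk_op v \<omega> \<kappa>) f x"
    unfolding walk_op_def[abs_def] by (rule avg3_cconv[OF bounded_borel_cmult[OF b] assms(2)])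
  finally show "walk_op v \<omega> (cconv \<kappa> f) x = cconv (walk_op v \<omega> \<kappa>) f x" .
qed

lemma norm_cconv_bound:
  assumes k: "\<And>z. norm (\<kappa> z) \<le> c" "\<kappa> \<in> bounded_borel" and f: "f \<in> test_fun"
  shows "norm (cconv \<kappa> f x) \<le> c * (LINT y|lborel. norm (f y))"
proof -
  have c: "c \<ge> 0" using k(1)[of 0] norm_ge_zero order_trans by blast
  have "norm (cconv \<kappa> f x) \<le> (LINT y|lborel. norm (\<kappa> (x - y) * f y))"
    unfolding cconv_def by (rule integral_norm_bound)
  also have "\<dots> \<le> (LINT y|lborel. c * norm (f y))"
    using test_fun_integrable[OF f] integrable_norm[OF integrable_cconv[OF k(2) f, of x]]
    by (intro integral_mono) (auto simp: norm_mult intro!: mult_right_mono k)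
  finally show ?thesis by simp
qed

lemma bounded_borel_cconv:
  assumes k: "\<kappa> \<in> bounded_borel" and f: "f \<in> test_fun"
  shows "cconv \<kappa> f \<in> bounded_borel"
proof -
  obtain B where B: "B > 0" "\<And>x. norm (\<kappa> x) \<le> B" "\<kappa> \<in> borel_measurable borel" using bounded_borelE[OF k] by metis
  show ?thesis
    using norm_cconv_bound[OF B(2) k f] B(3) bounded_borel_measurable[OF test_fun_bounded_borel[OF f]]
    by (intro bounded_borelI) auto
qed

lemma norm_pairing_bound:
  assumes k: "\<And>z. norm (\<kappa> z) \<le> c" "\<kappa> \<in> bounded_borel" and f: "f \<in> test_fun" and g: "g \<in> test_fun"
  shows "norm (LINT x|lborel. g x * cconv \<kappa> f x) \<le> c * ((LINT y|lborel. norm (g y)) * (LINT y|lborel. norm (f y)))"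
proof -
  have "norm (LINT x|lborel. g x * cconv \<kappa> f x) \<le> (LINT x|lborel. norm (g x * cconv \<kappa> f x))" by (rule integral_norm_bound)
  also have "\<dots> \<le> (LINT x|lborel. norm (g x) * (c * (LINT y|lborel. norm (f y))))"
    using test_fun_integrable[OF g]
      integrable_norm[OF test_fun_integrable[OF test_fun_mult[OF g bounded_borel_cconv[OF k(2) f]]]]
    by (intro integral_mono) (auto simp: norm_mult intro!: mult_left_mono norm_cconv_bound k f)
  finally show ?thesis by (simp add: mult_ac)
qed

text \<open>A single logarithm is unbounded. The difference is bounded and decays like |z|^(-2),
  hence is square integrable; the contribution of the scale b disappears as b grows.\<close>

definition log_diff :: "real \<Rightarrow> real \<Rightarrow> complex \<Rightarrow> complex" where
  "log_diff a b z = log_kernel a z - log_kernel b z"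

lemma norm_log_diff:
  assumes ab: "0 < a" "a \<le> b"
  shows "norm (log_diff a b z) \<le> (b\<^sup>2 - a\<^sup>2) / ((norm z)\<^sup>2 + a\<^sup>2)"
proof -
  have b: "b > 0" using ab by simp
  have ab2: "a\<^sup>2 \<le> b\<^sup>2" using ab by (intro power_mono) auto
  have da: "(norm z)\<^sup>2 + a\<^sup>2 > 0" and db: "(norm z)\<^sup>2 + b\<^sup>2 > 0" using den_pos ab b by auto
  have "norm (log_diff a b z) = \<bar>ln ((norm z)\<^sup>2 + a\<^sup>2) - ln ((norm z)\<^sup>2 + b\<^sup>2)\<bar>"
    unfolding log_diff_def log_kernel_def by (metis norm_of_real of_real_diff)
  also have "\<dots> = ln ((norm z)\<^sup>2 + b\<^sup>2) - ln ((norm z)\<^sup>2 + a\<^sup>2)" using da db ab2 by (simp add: abs_if)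
  also have "\<dots> = ln (((norm z)\<^sup>2 + b\<^sup>2) / ((norm z)\<^sup>2 + a\<^sup>2))" by (rule ln_divide_pos[OF db da, symmetric])
  also have "\<dots> \<le> ((norm z)\<^sup>2 + b\<^sup>2) / ((norm z)\<^sup>2 + a\<^sup>2) - 1" using da db by (intro ln_le_minus_one) auto
  also have "\<dots> = (b\<^sup>2 - a\<^sup>2) / ((norm z)\<^sup>2 + a\<^sup>2)"
  proof -
    have "X / y - 1 = (X - y) / y" if "y > 0" for X y :: real using that by (simp add: field_simps)
    from this[OF da] show ?thesis by simp
  qed
  finally show ?thesis .
qed

lemma bounded_borel_log_diff:
  assumes ab: "0 < a" "a \<le> b"
  shows "log_diff a b \<in> bounded_borel"
proof (rule bounded_borelI)
  fix z :: complex
  have "a\<^sup>2 \<le> b\<^sup>2" using ab by (intro power_mono) auto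
  then have "(b\<^sup>2 - a\<^sup>2) / ((norm z)\<^sup>2 + a\<^sup>2) \<le> (b\<^sup>2 - a\<^sup>2) / a\<^sup>2"
    using ab by (intro divide_left_mono mult_pos_pos den_pos) auto
  with norm_log_diff[OF ab, of z] show "norm (log_diff a b z) \<le> (b\<^sup>2 - a\<^sup>2) / a\<^sup>2" by linarith
qed (simp add: log_diff_def[abs_def])

lemma test_fun_nn_integral:
  assumes "f \<in> test_fun"
  shows "(\<integral>\<^sup>+y. ennreal (norm (f y)) \<partial>lborel) = ennreal (LINT y|lborel. norm (f y))"
  using test_fun_integrable[OF assms] by (intro nn_integral_eq_integral) auto

text \<open>The energy argument for the walk requires this. Young's inequality is used with |f| as
  the integrable kernel, since \<open>log_diff\<close> decays only like |z|^(-2).\<close>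

lemma integrable_square_cconv_log_diff:
  assumes ab: "0 < a" "a \<le> b" and f: "f \<in> test_fun"
  shows "integrable lborel (\<lambda>x. (norm (cconv (log_diff a b) f x))\<^sup>2)"
proof (rule integrableI_bounded)
  \<comment> \<open>The added 1 keeps the mass positive for f = 0 as well.\<close>
  define m where "m = (LINT y|lborel. norm (f y)) + 1"
  have m: "m > 0" unfolding m_def by (intro add_nonneg_pos integral_nonneg_AE) auto
  have [measurable]: "f \<in> borel_measurable borel" "log_diff a b \<in> borel_measurable borel"
    using bounded_borel_measurable test_fun_bounded_borel f bounded_borel_log_diff[OF ab] by blast+
  show "(\<lambda>x. (norm (cconv (log_diff a b) f x))\<^sup>2) \<in> borel_measurable lborel" by measurable
  define c where "c = (b\<^sup>2 - a\<^sup>2)\<^sup>2"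
  have "(\<integral>\<^sup>+x. ennreal (norm (cconv (log_diff a b) f x) powr 2) \<partial>lborel)
     \<le> ennreal (m powr 2) * (\<integral>\<^sup>+y. ennreal (norm (log_diff a b y) powr 2) \<partial>lborel)"
  proof (rule nn_integral_conv_powr[where \<kappa> = "\<lambda>y. norm (f y)"])
    show "(\<integral>\<^sup>+y. ennreal (norm (f y)) \<partial>lborel) \<le> ennreal m"
      unfolding test_fun_nn_integral[OF f] m_def by (intro ennreal_leI) simp
    fix x
    have "(\<integral>\<^sup>+y. ennreal (norm (log_diff a b (x - y)) * norm (f y)) \<partial>lborel)
       = (\<integral>\<^sup>+y. ennreal (norm (log_diff a b y) * norm (f (x - y))) \<partial>lborel)"
      by (subst nn_integral_reflect[symmetric, of _ x]) auto
    with norm_cconv_le[of "log_diff a b" f x]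
    show "ennreal (norm (cconv (log_diff a b) f x)) \<le> (\<integral>\<^sup>+y. ennreal (norm (f (x - y)) * norm (log_diff a b y)) \<partial>lborel)"
      by (simp add: mult.commute)
  qed (use m in auto)
  also have "(\<integral>\<^sup>+y. ennreal (norm (log_diff a b y) powr 2) \<partial>lborel)
      \<le> (\<integral>\<^sup>+y. ennreal c * ennreal (((norm (y::complex))\<^sup>2 + a\<^sup>2) powr (-2)) \<partial>lborel)"
  proof (rule nn_integral_mono)
    fix y :: complex
    have d: "(norm y)\<^sup>2 + a\<^sup>2 > 0" using den_pos ab by simp
    have "(norm (log_diff a b y))\<^sup>2 \<le> ((b\<^sup>2 - a\<^sup>2) / ((norm y)\<^sup>2 + a\<^sup>2))\<^sup>2"
      by (intro power_mono norm_log_diff ab) simp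
    also have "\<dots> = c * ((norm y)\<^sup>2 + a\<^sup>2) powr (-2)"
      using d by (simp add: c_def power_divide powr_minus powr_numeral divide_inverse power_mult_distrib power_inverse)
    finally show "ennreal (norm (log_diff a b y) powr 2) \<le> ennreal c * ennreal (((norm y)\<^sup>2 + a\<^sup>2) powr (-2))"
      by (simp add: ennreal_mult[symmetric] c_def)
  qed
  also have "\<dots> = ennreal c * (\<integral>\<^sup>+y. ennreal (((norm (y::complex))\<^sup>2 + a\<^sup>2) powr (-2)) \<partial>lborel)"
    by (rule nn_integral_cmult) measurable
  finally have le: "(\<integral>\<^sup>+x. ennreal (norm (cconv (log_diff a b) f x) powr 2) \<partial>lborel)
     \<le> ennreal (m powr 2) * (ennreal c * (\<integral>\<^sup>+y. ennreal (((norm (y::complex))\<^sup>2 + a\<^sup>2) powr (-2)) \<partial>lborel))"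
    by (simp add: mult_left_mono)
  also have "\<dots> < \<infinity>"
    using nn_integral_decay_finite[of a 2] ab by (simp add: ennreal_mult_less_top)
  finally show "(\<integral>\<^sup>+x. ennreal (norm ((norm (cconv (log_diff a b) f x))\<^sup>2)) \<partial>lborel) < \<infinity>" by simp
qed

lemma recip_den_square_le:
  assumes ab: "0 < a" "a \<le> b"
  shows "1 / ((norm (z::complex))\<^sup>2 + b\<^sup>2)\<^sup>2 \<le> 1 / ((norm z)\<^sup>2 + a\<^sup>2)\<^sup>2"
proof -
  have "a\<^sup>2 \<le> b\<^sup>2" using ab by (intro power_mono) auto
  then show ?thesis using den_pos[of a z] den_pos[of b z] ab
    by (intro divide_left_mono power_mono mult_pos_pos zero_less_power) auto
qed

text \<open>Since 1 / (|z|^2 + a^2)^2 is a multiple of \<open>poisson a\<close>, the first bound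
  hides its error in a slightly larger coefficient of the main term; it serves for norm estimates.
  The other two keep the error explicit, for limits in h.\<close>

lemma walk_log_diff:
  assumes ab: "0 < a" "a \<le> b" and h: "h > 0" "24 * h\<^sup>2 \<le> a\<^sup>2"
  shows "norm (walk (hex h) (log_diff a b) z - log_diff a b z)
      \<le> pi * h\<^sup>2 * ((1 + 20 * h\<^sup>2 / a\<^sup>2) * poisson a z + poisson b z)"
    and "norm (walk (hex h) (log_diff a b) z - log_diff a b z - of_real (pi * h\<^sup>2 * (poisson a z - poisson b z)))
      \<le> 20 * h^4 / ((norm z)\<^sup>2 + a\<^sup>2)\<^sup>2"
    and "norm (walk_op (hex h) hexw (log_diff a b) z - of_real (2 * pi * h\<^sup>2) * (beurling_kernel a z - beurling_kernel b z))
      \<le> 320 * h^4 / ((norm z)\<^sup>2 + a\<^sup>2)\<^sup>2"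
proof -
  have b: "b > 0" using ab by simp
  have ab2: "a\<^sup>2 \<le> b\<^sup>2" using ab by (intro power_mono) auto
  have h6: "6 * h\<^sup>2 \<le> a\<^sup>2" "6 * h\<^sup>2 \<le> b\<^sup>2" "24 * h\<^sup>2 \<le> b\<^sup>2" using h ab2 zero_le_power2[of h] by linarith+
  define E1 where "E1 c = walk (hex h) (log_kernel c) z - log_kernel c z - of_real (pi * h\<^sup>2 * poisson c z)" for c
  define E2 where "E2 c = walk_op (hex h) hexw (log_kernel c) z - of_real (2 * pi * h\<^sup>2) * beurling_kernel c z" for c
  define r where "r = 1 / ((norm z)\<^sup>2 + a\<^sup>2)\<^sup>2"
  have rb: "1 / ((norm z)\<^sup>2 + b\<^sup>2)\<^sup>2 \<le> r" unfolding r_def by (rule recip_den_square_le[OF ab])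
  have e1: "norm (E1 a) \<le> 10 * h^4 * r" unfolding E1_def r_def using walk_log_kernel[OF ab(1) h(1) h6(1), of z] by simp
  have "norm (E1 b) \<le> 10 * h^4 * (1 / ((norm z)\<^sup>2 + b\<^sup>2)\<^sup>2)" unfolding E1_def using walk_log_kernel[OF b h(1) h6(2), of z] by simp
  also have "\<dots> \<le> 10 * h^4 * r" using rb by (intro mult_left_mono) auto
  finally have e1b: "norm (E1 b) \<le> 10 * h^4 * r" .
  have e2: "norm (E2 a) \<le> 160 * h^4 * r" unfolding E2_def r_def using walk_op_log_kernel[OF ab(1) h, of z] by simp
  have "norm (E2 b) \<le> 160 * h^4 * (1 / ((norm z)\<^sup>2 + b\<^sup>2)\<^sup>2)" unfolding E2_def using walk_op_log_kernel[OF b h(1) h6(3), of z] by simp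
  also have "\<dots> \<le> 160 * h^4 * r" using rb by (intro mult_left_mono) auto
  finally have e2b: "norm (E2 b) \<le> 160 * h^4 * r" .
  have w1: "walk (hex h) (log_diff a b) z - log_diff a b z - of_real (pi * h\<^sup>2 * (poisson a z - poisson b z)) = E1 a - E1 b"
    by (simp add: E1_def log_diff_def[abs_def] walk_linear right_diff_distrib)
  show A: "norm (walk (hex h) (log_diff a b) z - log_diff a b z - of_real (pi * h\<^sup>2 * (poisson a z - poisson b z)))
      \<le> 20 * h^4 / ((norm z)\<^sup>2 + a\<^sup>2)\<^sup>2"
    unfolding w1 using norm_triangle_ineq4[of "E1 a" "E1 b"] e1 e1b by (simp add: r_def)
  have w2: "walk_op (hex h) hexw (log_diff a b) z - of_real (2 * pi * h\<^sup>2) * (beurling_kernel a z - beurling_kernel b z) = E2 a - E2 b"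
    by (simp add: E2_def log_diff_def[abs_def] walk_op_linear right_diff_distrib)
  show "norm (walk_op (hex h) hexw (log_diff a b) z - of_real (2 * pi * h\<^sup>2) * (beurling_kernel a z - beurling_kernel b z))
      \<le> 320 * h^4 / ((norm z)\<^sup>2 + a\<^sup>2)\<^sup>2"
    unfolding w2 using norm_triangle_ineq4[of "E2 a" "E2 b"] e2 e2b by (simp add: r_def)
  have P: "20 * h^4 / ((norm z)\<^sup>2 + a\<^sup>2)\<^sup>2 = pi * h\<^sup>2 * (20 * h\<^sup>2 / a\<^sup>2 * poisson a z)"
    using ab den_pos[OF ab(1), of z] by (simp add: poisson_def eval_nat_numeral)
  have "norm (complex_of_real (pi * h\<^sup>2 * (poisson a z - poisson b z))) \<le> pi * h\<^sup>2 * (poisson a z + poisson b z)"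
  proof -
    have "\<bar>poisson a z - poisson b z\<bar> \<le> poisson a z + poisson b z"
      using poisson_nonneg[of a z] poisson_nonneg[of b z] unfolding abs_le_iff by linarith
    then show ?thesis unfolding norm_of_real abs_mult using h by (simp add: mult_left_mono)
  qed
  then have "norm (walk (hex h) (log_diff a b) z - log_diff a b z)
     \<le> pi * h\<^sup>2 * (poisson a z + poisson b z) + pi * h\<^sup>2 * (20 * h\<^sup>2 / a\<^sup>2 * poisson a z)"
    using A[unfolded P] norm_triangle_sub[of "walk (hex h) (log_diff a b) z - log_diff a b z"
       "of_real (pi * h\<^sup>2 * (poisson a z - poisson b z))"] by linarith
  also have "\<dots> = pi * h\<^sup>2 * ((1 + 20 * h\<^sup>2 / a\<^sup>2) * poisson a z + poisson b z)" by (simp add: algebra_simps)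
  finally show "norm (walk (hex h) (log_diff a b) z - log_diff a b z)
      \<le> pi * h\<^sup>2 * ((1 + 20 * h\<^sup>2 / a\<^sup>2) * poisson a z + poisson b z)" .
qed

text \<open>Convexity with unequal weights does the work of Minkowski's inequality: as t tends to 0
  the factor of the main term u tends to 1, and the growing factor of v will meet a v that is
  small.\<close>

lemma powr_add_le_weighted:
  fixes u v t p :: real
  assumes p: "p \<ge> 1" and t: "0 < t" "t < 1" and uv: "u \<ge> 0" "v \<ge> 0"
  shows "(u + v) powr p \<le> (1 - t) powr (1 - p) * u powr p + t powr (1 - p) * v powr p"
proof -
  have "((1 - t) *\<^sub>R (u / (1 - t)) + t *\<^sub>R (v / t)) powr p \<le> (1 - t) * (u / (1 - t)) powr p + t * (v / t) powr p"
    by (rule convex_onD[OF convex_on_powr[OF p]]) (use t uv in auto)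
  moreover have "(1 - t) *\<^sub>R (u / (1 - t)) + t *\<^sub>R (v / t) = u + v" using t by simp
  moreover have "s * (w / s) powr p = s powr (1 - p) * w powr p" if "s > 0" "w \<ge> 0" for s w :: real
    using that by (simp add: powr_divide powr_diff)
  ultimately show ?thesis using t uv by simp
qed

lemma poisson_le:
  assumes "b > 0"
  shows "poisson b z \<le> 1 / (pi * b\<^sup>2)"
proof -
  have "b\<^sup>2 / (pi * ((norm z)\<^sup>2 + b\<^sup>2)\<^sup>2) \<le> b\<^sup>2 / (pi * (b\<^sup>2)\<^sup>2)"
    using assms den_pos[OF assms, of z] by (intro divide_left_mono mult_left_mono power_mono mult_pos_pos) auto
  also have "\<dots> = 1 / (pi * b\<^sup>2)" using assms by (simp add: power2_eq_square)
  finally show ?thesis by (simp add: poisson_def)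
qed

lemma nn_integral_poisson_powr:
  assumes b: "b > 0" and p: "p \<ge> 1"
  shows "(\<integral>\<^sup>+y. ennreal (poisson b y powr p) \<partial>lborel) \<le> ennreal ((1 / (pi * b\<^sup>2)) powr (p - 1))"
proof -
  have "(\<integral>\<^sup>+y. ennreal (poisson b y powr p) \<partial>lborel) \<le> (\<integral>\<^sup>+y. ennreal ((1 / (pi * b\<^sup>2)) powr (p - 1)) * ennreal (poisson b y) \<partial>lborel)"
  proof (rule nn_integral_mono)
    fix y
    have pos: "poisson b y > 0" using b den_pos[OF b, of y] by (simp add: poisson_def)
    have "poisson b y powr p = poisson b y powr (p - 1) * poisson b y"
      using pos powr_add[of "poisson b y" "p - 1" 1] by simp
    also have "\<dots> \<le> (1 / (pi * b\<^sup>2)) powr (p - 1) * poisson b y"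
      using p b by (intro mult_right_mono powr_mono2 poisson_le) auto
    finally show "ennreal (poisson b y powr p) \<le> ennreal ((1 / (pi * b\<^sup>2)) powr (p - 1)) * ennreal (poisson b y)"
      by (simp add: ennreal_mult[symmetric])
  qed
  also have "\<dots> = ennreal ((1 / (pi * b\<^sup>2)) powr (p - 1))"
    by (subst nn_integral_cmult) (auto simp: poisson_mass b)
  finally show ?thesis .
qed

lemma integrable_poisson_conv:
  assumes b: "b > 0" and f: "f \<in> test_fun"
  shows "integrable lborel (\<lambda>y. poisson b (x - y) * norm (f y))"
proof -
  have "(\<lambda>y. complex_of_real (poisson b (x - y))) \<in> bounded_borel"
    using b poisson_le[OF b] by (intro bounded_borelI[of _ "1 / (pi * b\<^sup>2)"]) auto
  from integrable_norm[OF test_fun_integrable[OF test_fun_mult_left[OF f this]]]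
  show ?thesis by (simp add: norm_mult)
qed

text \<open>Two bounds for two purposes: contraction of L^p for the scale a, and for the large scale
  b a bound through the L^1 norm of f that vanishes as b grows.\<close>

lemma poisson_conv_powr:
  assumes b: "b > 0" and f: "f \<in> test_fun" and p: "p > 1"
  shows "(\<integral>\<^sup>+x. ennreal ((LINT y|lborel. poisson b (x - y) * norm (f y)) powr p) \<partial>lborel)
      \<le> ennreal (LINT y|lborel. norm (f y) powr p)"
    and "(\<integral>\<^sup>+x. ennreal ((LINT y|lborel. poisson b (x - y) * norm (f y)) powr p) \<partial>lborel)
      \<le> ennreal (((LINT y|lborel. norm (f y)) + 1) powr p * (1 / (pi * b\<^sup>2)) powr (p - 1))"
proof -
  have [measurable]: "f \<in> borel_measurable borel" using f by (intro bounded_borel_measurable test_fun_bounded_borel)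
  define N where "N x = (LINT y|lborel. poisson b (x - y) * norm (f y))" for x
  have N0: "N x \<ge> 0" for x unfolding N_def by (intro integral_nonneg_AE) auto
  have [measurable]: "N \<in> borel_measurable borel" unfolding N_def[abs_def] by measurable
  have N: "ennreal (N x) = (\<integral>\<^sup>+y. ennreal (poisson b (x - y) * norm (f y)) \<partial>lborel)" for x
    unfolding N_def using integrable_poisson_conv[OF b f] by (intro nn_integral_eq_integral[symmetric]) auto
  have fp: "(\<integral>\<^sup>+y. ennreal (norm (f y) powr p) \<partial>lborel) = ennreal (LINT y|lborel. norm (f y) powr p)"
    using test_fun_integrable_powr[OF f, of p] p by (intro nn_integral_eq_integral) auto
  have "(\<integral>\<^sup>+x. ennreal (N x powr p) \<partial>lborel) \<le> ennreal (1 powr p) * (\<integral>\<^sup>+y. ennreal (norm (f y) powr p) \<partial>lborel)"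
    by (rule nn_integral_conv_powr[where \<kappa> = "poisson b"]) (use p N0 N in \<open>auto simp: poisson_mass b\<close>)
  then show "(\<integral>\<^sup>+x. ennreal ((LINT y|lborel. poisson b (x - y) * norm (f y)) powr p) \<partial>lborel)
      \<le> ennreal (LINT y|lborel. norm (f y) powr p)" by (simp add: fp N_def)
  define m where "m = (LINT y|lborel. norm (f y)) + 1"
  have m: "m > 0" unfolding m_def by (intro add_nonneg_pos integral_nonneg_AE) auto
  have "(\<integral>\<^sup>+x. ennreal (N x powr p) \<partial>lborel) \<le> ennreal (m powr p) * (\<integral>\<^sup>+y. ennreal (poisson b y powr p) \<partial>lborel)"
  proof (rule nn_integral_conv_powr[where \<kappa> = "\<lambda>y. norm (f y)"])
    show "(\<integral>\<^sup>+y. ennreal (norm (f y)) \<partial>lborel) \<le> ennreal m"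
      unfolding test_fun_nn_integral[OF f] m_def by (intro ennreal_leI) simp
    fix x
    have "(\<integral>\<^sup>+y. ennreal (poisson b (x - y) * norm (f y)) \<partial>lborel)
       = (\<integral>\<^sup>+y. ennreal (poisson b y * norm (f (x - y))) \<partial>lborel)"
      by (subst nn_integral_reflect[symmetric, of _ x]) auto
    with N[of x] show "ennreal (N x) \<le> (\<integral>\<^sup>+y. ennreal (norm (f (x - y)) * poisson b y) \<partial>lborel)"
      by (simp add: mult.commute)
  qed (use m p N0 in auto)
  also have "\<dots> \<le> ennreal (m powr p) * ennreal ((1 / (pi * b\<^sup>2)) powr (p - 1))"
    using p by (intro mult_left_mono nn_integral_poisson_powr b) auto
  finally show "(\<integral>\<^sup>+x. ennreal ((LINT y|lborel. poisson b (x - y) * norm (f y)) powr p) \<partial>lborel)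
      \<le> ennreal (((LINT y|lborel. norm (f y)) + 1) powr p * (1 / (pi * b\<^sup>2)) powr (p - 1))"
    by (simp add: N_def m_def ennreal_mult)
qed

text \<open>The function \<open>log_diff a b\<close> plays the role of a square integrable potential: \<open>P - 1\<close> maps it to
  an approximate identity, and the weighted second difference maps it to the smoothed Beurling kernel.\<close>

lemma pairing_discrete:
  assumes p: "p \<ge> 2" and pq: "1/p + 1/q = 1" and f: "f \<in> test_fun" and g: "g \<in> test_fun"
    and ab: "0 < a" "a \<le> b" and h: "h > 0" "24 * h\<^sup>2 \<le> a\<^sup>2" and t: "0 < t" "t < 1"
  defines "A \<equiv> LINT y|lborel. norm (f y) powr p" and "B \<equiv> LINT y|lborel. norm (g y) powr q"
    and "f1 \<equiv> LINT y|lborel. norm (f y)" and "g1 \<equiv> LINT y|lborel. norm (g y)"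
  shows "norm (LINT x|lborel. g x * cconv (beurling_kernel a) f x)
    \<le> 2 * (p - 1) * ((1 - t) powr (1 - p) * (1 + 20 * h\<^sup>2 / a\<^sup>2) powr p * A
          + t powr (1 - p) * ((f1 + 1) powr p * (1 / (pi * b\<^sup>2)) powr (p - 1))) powr (1/p) * B powr (1/q)
        + (1 / (pi * b\<^sup>2)) * (g1 * f1) + 160 * h\<^sup>2 / (pi * a^4) * (g1 * f1)"
proof -
  define M where "M = log_diff a b"
  have b: "b > 0" using ab by simp
  have p1: "p > 1" using p by simp
  have M: "M \<in> bounded_borel" unfolding M_def by (rule bounded_borel_log_diff[OF ab])
  have [measurable]: "f \<in> borel_measurable borel" using f by (intro bounded_borel_measurable test_fun_bounded_borel)
  define F where "F = cconv M f"
  have Fb: "F \<in> bounded_borel" unfolding F_def by (rule bounded_borel_cconv[OF M f])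
  have F2: "integrable lborel (\<lambda>x. (norm (F x))\<^sup>2)"
    unfolding F_def M_def by (rule integrable_square_cconv_log_diff[OF ab f])
  define \<kappa> where "\<kappa> z = walk (hex h) M z - M z" for z
  have \<kappa>b: "\<kappa> \<in> bounded_borel" unfolding \<kappa>_def[abs_def] by (intro bounded_borel_diff bounded_borel_walk M)
  have G: "walk (hex h) F x - F x = cconv \<kappa> f x" for x
    unfolding F_def walk_cconv[OF M f] \<kappa>_def[abs_def]
    by (rule cconv_linear(2)[OF bounded_borel_walk[OF M] f M, symmetric])
  define N where "N c x = (LINT y|lborel. poisson c (x - y) * norm (f y))" for c x
  have N0: "N c x \<ge> 0" for c x unfolding N_def by (intro integral_nonneg_AE) auto
  have [measurable]: "N c \<in> borel_measurable borel" for c unfolding N_def[abs_def] by measurable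
  define d where "d = 1 + 20 * h\<^sup>2 / a\<^sup>2"
  have d: "d \<ge> 0" unfolding d_def by simp
  have Gle: "norm (cconv \<kappa> f x) \<le> pi * h\<^sup>2 * (d * N a x + N b x)" for x
  proof -
    have i: "integrable lborel (\<lambda>y. poisson a (x - y) * norm (f y))" "integrable lborel (\<lambda>y. poisson b (x - y) * norm (f y))"
      by (intro integrable_poisson_conv ab b f)+
    have "norm (cconv \<kappa> f x) \<le> (LINT y|lborel. norm (\<kappa> (x - y) * f y))"
      unfolding cconv_def by (rule integral_norm_bound)
    also have "\<dots> \<le> (LINT y|lborel. pi * h\<^sup>2 * (d * (poisson a (x - y) * norm (f y)) + poisson b (x - y) * norm (f y)))"
    proof (rule integral_mono)
      show "integrable lborel (\<lambda>y. norm (\<kappa> (x - y) * f y))" by (intro integrable_norm integrable_cconv \<kappa>b f)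
      show "integrable lborel (\<lambda>y. pi * h\<^sup>2 * (d * (poisson a (x - y) * norm (f y)) + poisson b (x - y) * norm (f y)))"
        using i by auto
      fix y
      have "norm (\<kappa> (x - y)) * norm (f y) \<le> pi * h\<^sup>2 * (d * poisson a (x - y) + poisson b (x - y)) * norm (f y)"
        unfolding \<kappa>_def M_def d_def by (intro mult_right_mono walk_log_diff(1) ab h) auto
      then show "norm (\<kappa> (x - y) * f y) \<le> pi * h\<^sup>2 * (d * (poisson a (x - y) * norm (f y)) + poisson b (x - y) * norm (f y))"
        by (simp add: norm_mult algebra_simps)
    qed
    also have "\<dots> = pi * h\<^sup>2 * (d * N a x + N b x)" unfolding N_def using i by simp
    finally show ?thesis .
  qed
  \<comment> \<open>Up to the factor (pi h^2)^p, R bounds the p-th power of the norm of P F - F: the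
    main part at scale a has weight 1 - t, the remainder at scale b has weight t.\<close>
  define R where "R = (1 - t) powr (1 - p) * d powr p * A + t powr (1 - p) * ((f1 + 1) powr p * (1 / (pi * b\<^sup>2)) powr (p - 1))"
  have A0: "A \<ge> 0" and B0: "B \<ge> 0" and f10: "f1 \<ge> 0" and g10: "g1 \<ge> 0"
    unfolding A_def B_def f1_def g1_def by (auto intro!: integral_nonneg_AE)
  have R0: "R \<ge> 0" unfolding R_def using A0 by auto
  have "(\<integral>\<^sup>+x. ennreal (norm (cconv \<kappa> f x) powr p) \<partial>lborel)
    \<le> (\<integral>\<^sup>+x. ennreal ((pi * h\<^sup>2) powr p) * (ennreal ((1 - t) powr (1 - p) * d powr p) * ennreal (N a x powr p)
          + ennreal (t powr (1 - p)) * ennreal (N b x powr p)) \<partial>lborel)"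
  proof (rule nn_integral_mono)
    fix x
    have "norm (cconv \<kappa> f x) powr p \<le> (pi * h\<^sup>2 * (d * N a x + N b x)) powr p"
      using p by (intro powr_mono2 Gle) auto
    also have "\<dots> = (pi * h\<^sup>2) powr p * (d * N a x + N b x) powr p"
      by (rule powr_mult)
    also have "\<dots> \<le> (pi * h\<^sup>2) powr p * ((1 - t) powr (1 - p) * (d * N a x) powr p + t powr (1 - p) * N b x powr p)"
      using p t d N0 by (intro mult_left_mono powr_add_le_weighted) auto
    also have "(d * N a x) powr p = d powr p * N a x powr p" by (rule powr_mult)
    finally show "ennreal (norm (cconv \<kappa> f x) powr p) \<le> ennreal ((pi * h\<^sup>2) powr p) *
        (ennreal ((1 - t) powr (1 - p) * d powr p) * ennreal (N a x powr p) + ennreal (t powr (1 - p)) * ennreal (N b x powr p))"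
      by (simp add: ennreal_mult[symmetric] ennreal_plus[symmetric] mult.assoc del: ennreal_plus)
  qed
  also have "\<dots> = ennreal ((pi * h\<^sup>2) powr p) * (ennreal ((1 - t) powr (1 - p) * d powr p) * (\<integral>\<^sup>+x. ennreal (N a x powr p) \<partial>lborel)
          + ennreal (t powr (1 - p)) * (\<integral>\<^sup>+x. ennreal (N b x powr p) \<partial>lborel))"
    by (simp add: nn_integral_cmult nn_integral_add)
  also have "\<dots> \<le> ennreal ((pi * h\<^sup>2) powr p) * (ennreal ((1 - t) powr (1 - p) * d powr p) * ennreal A
          + ennreal (t powr (1 - p)) * ennreal ((f1 + 1) powr p * (1 / (pi * b\<^sup>2)) powr (p - 1)))"
    unfolding N_def A_def f1_def
    by (intro mult_left_mono add_mono poisson_conv_powr ab b f p1) auto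
  also have "\<dots> = ennreal ((pi * h\<^sup>2) powr p * R)"
    unfolding R_def using A0 by (simp add: ennreal_mult[symmetric] ennreal_plus[symmetric] del: ennreal_plus)
  finally have Gint: "(\<integral>\<^sup>+x. ennreal (norm (cconv \<kappa> f x) powr p) \<partial>lborel) \<le> ennreal ((pi * h\<^sup>2) powr p * R)" .
  have [measurable]: "cconv \<kappa> f \<in> borel_measurable borel" by (intro bounded_borel_measurable bounded_borel_cconv \<kappa>b f)
  have Gi: "integrable lborel (\<lambda>x. norm (cconv \<kappa> f x) powr p)"
    using Gint by (intro integrableI_bounded) (auto intro: le_less_trans)
  have "ennreal (LINT x|lborel. norm (cconv \<kappa> f x) powr p) \<le> ennreal ((pi * h\<^sup>2) powr p * R)"
    using Gint nn_integral_eq_integral[OF Gi] by simp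
  then have GR: "(LINT x|lborel. norm (cconv \<kappa> f x) powr p) \<le> (pi * h\<^sup>2) powr p * R"
    using R0 by (subst (asm) ennreal_le_iff) auto
  have "norm (LINT x|lborel. g x * walk_op (hex h) hexw F x)
      \<le> 4 * (p-1) * (LINT x|lborel. norm (cconv \<kappa> f x) powr p) powr (1/p) * B powr (1/q)"
    using walk_bound[where v = "hex h" and \<omega> = hexw, OF p pq norm_hexw Fb F2 g] Gi unfolding G B_def by blast
  also have "\<dots> \<le> 4 * (p-1) * ((pi * h\<^sup>2) powr p * R) powr (1/p) * B powr (1/q)"
    using p GR by (intro mult_right_mono mult_left_mono powr_mono2) (auto intro!: integral_nonneg_AE)
  also have "((pi * h\<^sup>2) powr p * R) powr (1/p) = pi * h\<^sup>2 * R powr (1/p)"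
    using R0 p h by (simp add: powr_mult powr_powr)
  finally have main: "norm (LINT x|lborel. g x * walk_op (hex h) hexw F x) \<le> 4 * (p-1) * (pi * h\<^sup>2 * R powr (1/p)) * B powr (1/q)" .
  define Ka Kb where "Ka = beurling_kernel a" and "Kb = beurling_kernel b"
  have Kb: "Ka \<in> bounded_borel" "Kb \<in> bounded_borel" unfolding Ka_def Kb_def by (intro bounded_borel_beurling_kernel ab b)+
  define W where "W = walk_op (hex h) hexw M"
  have Wb: "W \<in> bounded_borel" unfolding W_def by (intro bounded_borel_walk_op M)
  define c where "c = complex_of_real (2 * pi * h\<^sup>2)"
  \<comment> \<open>The weighted difference is 2 pi h^2 times the difference of the two Beurling
    kernels up to an error of order h^4. The kernel at scale b is uniformly small and is treated as
    an error as well.\<close>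
  define E where "E z = W z - c * (Ka z - Kb z)" for z
  have Eb: "E \<in> bounded_borel" unfolding E_def[abs_def] by (intro bounded_borel_diff bounded_borel_cmult Wb Kb)
  have Ele: "norm (E z) \<le> 320 * h^4 / a^4" for z
  proof -
    have "norm (E z) \<le> 320 * h^4 / ((norm z)\<^sup>2 + a\<^sup>2)\<^sup>2"
      unfolding E_def W_def M_def c_def Ka_def Kb_def by (rule walk_log_diff(3)[OF ab h])
    also have "\<dots> \<le> 320 * h^4 / (a\<^sup>2)\<^sup>2"
      using ab by (intro divide_left_mono power_mono mult_pos_pos zero_less_power den_pos) auto
    finally show ?thesis by simp
  qed
  have WE: "cconv W f x = c * cconv Ka f x - c * cconv Kb f x + cconv E f x" for x
  proof -
    have "cconv E f x = cconv W f x - c * (cconv Ka f x - cconv Kb f x)"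
      unfolding E_def[abs_def]
      by (simp add: cconv_linear(2)[OF Wb f bounded_borel_cmult[OF bounded_borel_diff[OF Kb]]]
          cconv_linear(3)[OF bounded_borel_diff[OF Kb] f] cconv_linear(2)[OF Kb(1) f Kb(2)])
    then show ?thesis by (simp add: algebra_simps)
  qed
  have ig: "integrable lborel (\<lambda>x. g x * cconv \<kappa>' f x)" if "\<kappa>' \<in> bounded_borel" for \<kappa>'
    by (intro test_fun_integrable test_fun_mult bounded_borel_cconv g f that)
  have "(LINT x|lborel. g x * walk_op (hex h) hexw F x)
     = (LINT x|lborel. c * (g x * cconv Ka f x) - c * (g x * cconv Kb f x) + g x * cconv E f x)"
    unfolding F_def walk_op_cconv[OF M f] W_def[symmetric] WE
    by (rule Bochner_Integration.integral_cong) (auto simp: algebra_simps)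
  also have "\<dots> = c * (LINT x|lborel. g x * cconv Ka f x) - c * (LINT x|lborel. g x * cconv Kb f x) + (LINT x|lborel. g x * cconv E f x)"
    using ig[OF Kb(1)] ig[OF Kb(2)] ig[OF Eb] by simp
  finally have "c * (LINT x|lborel. g x * cconv Ka f x) = (LINT x|lborel. g x * walk_op (hex h) hexw F x)
      + c * (LINT x|lborel. g x * cconv Kb f x) - (LINT x|lborel. g x * cconv E f x)" by simp
  then have "norm c * norm (LINT x|lborel. g x * cconv Ka f x) \<le> norm (LINT x|lborel. g x * walk_op (hex h) hexw F x)
      + norm c * norm (LINT x|lborel. g x * cconv Kb f x) + norm (LINT x|lborel. g x * cconv E f x)"
    by (smt (verit) norm_mult norm_triangle_ineq norm_triangle_ineq4)
  also have "\<dots> \<le> 4 * (p-1) * (pi * h\<^sup>2 * R powr (1/p)) * B powr (1/q) + norm c * ((1 / (pi * b\<^sup>2)) * (g1 * f1))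
       + (320 * h^4 / a^4) * (g1 * f1)"
  proof (intro add_mono main mult_left_mono)
    have "norm (Kb z) \<le> 1 / (pi * b\<^sup>2)" for z
    proof -
      have "1 / (pi * ((norm z)\<^sup>2 + b\<^sup>2)) \<le> 1 / (pi * b\<^sup>2)"
        using b by (intro divide_left_mono mult_left_mono mult_pos_pos den_pos) auto
      then show ?thesis unfolding Kb_def using norm_beurling_kernel[OF b, of z] by linarith
    qed
    then show "norm (LINT x|lborel. g x * cconv Kb f x) \<le> (1 / (pi * b\<^sup>2)) * (g1 * f1)"
      unfolding f1_def g1_def by (rule norm_pairing_bound[OF _ Kb(2) f g])
    show "norm (LINT x|lborel. g x * cconv E f x) \<le> (320 * h^4 / a^4) * (g1 * f1)"
      unfolding f1_def g1_def by (rule norm_pairing_bound[OF Ele Eb f g])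
  qed simp
  finally have fin: "norm c * norm (LINT x|lborel. g x * cconv Ka f x) \<le>
     4 * (p-1) * (pi * h\<^sup>2 * R powr (1/p)) * B powr (1/q) + norm c * ((1 / (pi * b\<^sup>2)) * (g1 * f1)) + (320 * h^4 / a^4) * (g1 * f1)" .
  \<comment> \<open>Division by 2 pi h^2 cancels the pi h^2 of the generator and turns 4 (p - 1)
    into 2 (p - 1).\<close>
  define n where "n = 2 * pi * h\<^sup>2"
  have n: "norm c = n" "n > 0" unfolding c_def norm_of_real n_def using h by simp_all
  have e1: "4 * (p-1) * (pi * h\<^sup>2 * r) * s = n * (2 * (p-1) * r * s)" for r s by (simp add: n_def)
  have e2: "(320 * h^4 / a^4) * s = n * (160 * h\<^sup>2 / (pi * a^4) * s)" for s
    by (simp add: n_def eval_nat_numeral)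
  have "n * norm (LINT x|lborel. g x * cconv Ka f x) \<le>
     n * (2 * (p-1) * R powr (1/p) * B powr (1/q) + (1 / (pi * b\<^sup>2)) * (g1 * f1) + 160 * h\<^sup>2 / (pi * a^4) * (g1 * f1))"
    using fin unfolding n e1 e2 distrib_left .
  then have "norm (LINT x|lborel. g x * cconv Ka f x) \<le>
     2 * (p-1) * R powr (1/p) * B powr (1/q) + (1 / (pi * b\<^sup>2)) * (g1 * f1) + 160 * h\<^sup>2 / (pi * a^4) * (g1 * f1)"
    using n(2) by (simp only: mult_le_cancel_left_pos)
  then show ?thesis unfolding Ka_def R_def d_def .
qed

text \<open>All auxiliary parameters are tied to h by b = 1 / h and t = h. The term at scale b then
  carries h^(1 - p) (h^2 / pi)^(p - 1) = (h / pi)^(p - 1) and vanishes in the limit.\<close>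

lemma pairing_ge_2:
  assumes p: "p \<ge> 2" and pq: "1/p + 1/q = 1" and f: "f \<in> test_fun" and g: "g \<in> test_fun" and a: "a > 0"
  shows "norm (LINT x|lborel. g x * cconv (beurling_kernel a) f x)
    \<le> 2 * (p - 1) * (LINT y|lborel. norm (f y) powr p) powr (1/p) * (LINT y|lborel. norm (g y) powr q) powr (1/q)"
proof -
  define A B f1 g1 where "A = (LINT y|lborel. norm (f y) powr p)" and "B = (LINT y|lborel. norm (g y) powr q)"
    and "f1 = (LINT y|lborel. norm (f y))" and "g1 = (LINT y|lborel. norm (g y))"
  have A0: "A \<ge> 0" unfolding A_def by (auto intro!: integral_nonneg_AE)
  define X where "X = norm (LINT x|lborel. g x * cconv (beurling_kernel a) f x)"
  define rhs where "rhs h = 2 * (p - 1) * ((1 - h) powr (1 - p) * (1 + 20 * h\<^sup>2 / a\<^sup>2) powr p * A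
          + (f1 + 1) powr p * (h / pi) powr (p - 1)) powr (1/p) * B powr (1/q)
        + (h\<^sup>2 / pi) * (g1 * f1) + 160 * h\<^sup>2 / (pi * a^4) * (g1 * f1)" for h
  have ev: "\<forall>\<^sub>F h in at_right 0. X \<le> rhs h"
  proof -
    \<comment> \<open>The three upper limits for h give, in this order, 24 h^2 <= a^2, t < 1 and a
      <= b.\<close>
    have "\<forall>\<^sub>F h in at_right 0. h < min (a / 5) (min 1 (1 / a))"
      using eventually_at_right_real[of 0 "min (a / 5) (min 1 (1 / a))"] a by (auto elim!: eventually_mono)
    then show ?thesis using eventually_at_right_less[of 0]
    proof eventually_elim
      case (elim h)
      then have h: "h > 0" "h < 1" "h < a / 5" "h < 1 / a" by auto
      have "(5 * h)\<^sup>2 \<le> a\<^sup>2" using h by (intro power_mono) auto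
      moreover have "(5 * h)\<^sup>2 = 25 * h\<^sup>2" by (simp add: power_mult_distrib)
      ultimately have h24: "24 * h\<^sup>2 \<le> a\<^sup>2" using zero_le_power2[of h] by linarith
      have ab: "a \<le> 1 / h" using h a by (simp add: field_simps)
      have b: "1 / (pi * (1 / h)\<^sup>2) = h\<^sup>2 / pi" by (simp add: power_divide)
      have e: "h powr (1 - p) * (s * (h\<^sup>2 / pi) powr (p - 1)) = s * (h / pi) powr (p - 1)" for s
      proof -
        have "(h\<^sup>2 / pi) powr (p - 1) = h powr (p - 1) * (h / pi) powr (p - 1)"
          using h by (simp add: powr_mult[symmetric] power2_eq_square)
        moreover have "h powr (1 - p) * h powr (p - 1) = 1" using h by (simp add: powr_add[symmetric])
        ultimately show ?thesis by (simp add: algebra_simps)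
      qed
      show ?case
        using pairing_discrete[OF p pq f g a ab h(1) h24 h(1,2)]
        unfolding rhs_def X_def A_def B_def f1_def g1_def b e .
    qed
  qed
  define base where "base h = (1 - h) powr (1 - p) * (1 + 20 * h\<^sup>2 / a\<^sup>2) powr p * A
          + (f1 + 1) powr p * (h / pi) powr (p - 1)" for h
  have l1: "((\<lambda>h::real. (1 - h) powr (1 - p)) \<longlongrightarrow> (1 - 0) powr (1 - p)) (at_right 0)"
    by (intro tendsto_powr tendsto_intros) auto
  have l2: "((\<lambda>h::real. (1 + 20 * h\<^sup>2 / a\<^sup>2) powr p) \<longlongrightarrow> (1 + 20 * 0\<^sup>2 / a\<^sup>2) powr p) (at_right 0)"
    by (intro tendsto_powr tendsto_intros) (use a in auto)
  have "((\<lambda>h::real. h / pi) \<longlongrightarrow> 0 / pi) (at_right 0)" by (intro tendsto_intros) auto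
  then have l3: "((\<lambda>h::real. (h / pi) powr (p - 1)) \<longlongrightarrow> 0) (at_right 0)"
    using eventually_at_right_less[of 0] p
    by (intro tendsto_zero_powrI[where b = "p - 1"]) (auto elim!: eventually_mono)
  have "(base \<longlongrightarrow> (1 - 0) powr (1 - p) * (1 + 20 * 0\<^sup>2 / a\<^sup>2) powr p * A + (f1 + 1) powr p * 0) (at_right 0)"
    unfolding base_def by (intro tendsto_intros l1 l2 l3)
  then have lb: "(base \<longlongrightarrow> A) (at_right 0)" by simp
  have l4: "((\<lambda>h. base h powr (1/p)) \<longlongrightarrow> A powr (1/p)) (at_right 0)"
  proof (rule tendsto_powr'[OF lb tendsto_const])
    show "A \<noteq> 0 \<or> 0 < 1 / p \<and> (\<forall>\<^sub>F h in at_right 0. 0 \<le> base h)"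
      using p A0 by (auto simp: base_def)
  qed
  have "(rhs \<longlongrightarrow> 2 * (p - 1) * A powr (1/p) * B powr (1/q) + (0\<^sup>2 / pi) * (g1 * f1) + 160 * 0\<^sup>2 / (pi * a^4) * (g1 * f1)) (at_right 0)"
    unfolding rhs_def base_def[symmetric] by (intro tendsto_intros l4) (use a in auto)
  then have lim: "(rhs \<longlongrightarrow> 2 * (p - 1) * A powr (1/p) * B powr (1/q)) (at_right 0)" by simp
  have "X \<le> 2 * (p - 1) * A powr (1/p) * B powr (1/q)"
    by (rule tendsto_lowerbound[OF lim ev]) simp
  then show ?thesis unfolding X_def A_def B_def .
qed

text \<open>The kernel is even and the pairing contains no conjugation, so the operator is its own
  transpose; this gives access to exponents below 2.\<close>

lemma pairing_swap:
  assumes f: "f \<in> test_fun" and g: "g \<in> test_fun" and a: "a > 0"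
  shows "(LINT x|lborel. g x * cconv (beurling_kernel a) f x) = (LINT x|lborel. f x * cconv (beurling_kernel a) g x)"
proof -
  define K where "K = beurling_kernel a"
  have Kb: "K \<in> bounded_borel" unfolding K_def by (rule bounded_borel_beurling_kernel[OF a])
  obtain c where c: "c > 0" "\<And>z. norm (K z) \<le> c" using bounded_borelE[OF Kb] by metis
  have Ks: "K (x - y) = K (y - x)" for x y
    by (simp add: K_def beurling_kernel_def norm_minus_commute power2_commute)
  have [measurable]: "f \<in> borel_measurable borel" "g \<in> borel_measurable borel" "K \<in> borel_measurable borel"
    using f g Kb by (auto intro: bounded_borel_measurable test_fun_bounded_borel)
  have "integrable (lborel \<Otimes>\<^sub>M lborel) (\<lambda>(x, y). g x * (K (x - y) * f y))"
  proof (rule integrableI_bounded)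
    show "(\<lambda>(x, y). g x * (K (x - y) * f y)) \<in> borel_measurable (lborel \<Otimes>\<^sub>M lborel)" by measurable
    have "(\<integral>\<^sup>+p. ennreal (norm (case p of (x, y) \<Rightarrow> g x * (K (x - y) * f y))) \<partial>(lborel \<Otimes>\<^sub>M lborel))
       = (\<integral>\<^sup>+x. \<integral>\<^sup>+y. ennreal (norm (g x * (K (x - y) * f y))) \<partial>lborel \<partial>lborel)"
      by (subst lborel.nn_integral_fst[symmetric]) auto
    also have "\<dots> \<le> (\<integral>\<^sup>+x. \<integral>\<^sup>+y. ennreal (norm (g x)) * (ennreal c * ennreal (norm (f y))) \<partial>lborel \<partial>lborel)"
    proof (intro nn_integral_mono)
      fix x y
      have "norm (g x) * (norm (K (x - y)) * norm (f y)) \<le> norm (g x) * (c * norm (f y))"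
        by (intro mult_left_mono mult_right_mono c) auto
      then show "ennreal (norm (g x * (K (x - y) * f y))) \<le> ennreal (norm (g x)) * (ennreal c * ennreal (norm (f y)))"
        using c(1) by (simp add: norm_mult ennreal_mult[symmetric] ennreal_leI)
    qed
    also have "\<dots> = (\<integral>\<^sup>+x. ennreal (norm (g x)) \<partial>lborel) * (ennreal c * (\<integral>\<^sup>+y. ennreal (norm (f y)) \<partial>lborel))"
      by (simp add: nn_integral_cmult nn_integral_multc)
    also have "\<dots> < \<infinity>" unfolding test_fun_nn_integral[OF f] test_fun_nn_integral[OF g]
      by (simp add: ennreal_mult_less_top)
    finally show "(\<integral>\<^sup>+p. ennreal (norm (case p of (x, y) \<Rightarrow> g x * (K (x - y) * f y))) \<partial>(lborel \<Otimes>\<^sub>M lborel)) < \<infinity>" .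
  qed
  from lborel_pair.Fubini_integral[OF this]
  have F: "(LINT y|lborel. LINT x|lborel. g x * (K (x - y) * f y)) = (LINT x|lborel. LINT y|lborel. g x * (K (x - y) * f y))" .
  have e1: "(LINT y|lborel. g x * (K (x - y) * f y)) = g x * cconv K f x" for x
    unfolding cconv_def by simp
  have e2: "(LINT x|lborel. g x * (K (x - y) * f y)) = f y * cconv K g y" for y
  proof -
    have "(LINT x|lborel. g x * (K (x - y) * f y)) = (LINT x|lborel. f y * (K (y - x) * g x))"
      by (rule Bochner_Integration.integral_cong) (auto simp: Ks[of y] mult_ac)
    then show ?thesis unfolding cconv_def by simp
  qed
  have "(LINT x|lborel. g x * cconv K f x) = (LINT x|lborel. LINT y|lborel. g x * (K (x - y) * f y))"
    unfolding e1 ..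
  also have "\<dots> = (LINT y|lborel. LINT x|lborel. g x * (K (x - y) * f y))" by (rule F[symmetric])
  also have "\<dots> = (LINT y|lborel. f y * cconv K g y)" unfolding e2 ..
  finally show ?thesis unfolding K_def .
qed

lemma pairing_bound:
  assumes p: "p > 1" and pq: "1/p + 1/q = 1" and f: "f \<in> test_fun" and g: "g \<in> test_fun" and a: "a > 0"
  shows "norm (LINT x|lborel. g x * cconv (beurling_kernel a) f x)
    \<le> 2 * (max p q - 1) * (LINT y|lborel. norm (f y) powr p) powr (1/p) * (LINT y|lborel. norm (g y) powr q) powr (1/q)"
proof -
  have q: "q > 1" by (rule conjugate_exponent[OF p pq])
  show ?thesis
  proof (cases "p \<ge> 2")
    case True
    have "1/p \<le> 1/2" using True by (simp add: field_simps)
    then have "1/q \<ge> 1/2" using pq by linarith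
    then have "q \<le> 2" using q by (simp add: field_simps)
    then have "max p q = p" using True by simp
    then show ?thesis using pairing_ge_2[OF True pq f g a] by simp
  next
    case False
    have "1/p > 1/2" using False p by (simp add: field_simps)
    then have "1/q < 1/2" using pq by linarith
    then have q2: "q \<ge> 2" using q by (simp add: field_simps)
    then have m: "max p q = q" using False by simp
    have qp: "1/q + 1/p = 1" using pq by simp
    show ?thesis
      unfolding pairing_swap[OF f g a] m using pairing_ge_2[OF q2 qp g f a] by (simp add: mult_ac)
  qed
qed

text \<open>Dividing by X^(1/q), which is legitimate because X is a finite number, leaves X^(1/p) <=
  Y.\<close>

lemma powr_absorb:
  fixes X Y p q :: real
  assumes "X \<ge> 0" "Y \<ge> 0" "1/p + 1/q = 1" "p > 1" "X \<le> Y * X powr (1/q)"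
  shows "X \<le> Y powr p"
proof (cases "X = 0")
  case False
  then have X: "X > 0" using assms by simp
  have e: "1/p = 1 - 1/q" using assms by simp
  have "X powr (1/p) = X / X powr (1/q)" unfolding e using X by (simp add: powr_diff)
  also have "\<dots> \<le> Y" using assms(5) X by (simp add: divide_le_eq)
  finally have "(X powr (1/p)) powr p \<le> Y powr p" using assms by (intro powr_mono2) auto
  then show ?thesis using X assms by (simp add: powr_powr)
qed simp

text \<open>The transform T is paired with the extremal dual function, its conjugate times |T|^(p -
  2), cut off to a disc. The cut-off makes this a test function and its integral against T finite,
  so that \<open>powr_absorb\<close> applies; then the discs exhaust the plane.\<close>

lemma beurling_norm_test_fun:
  assumes p: "p > 1" and pq: "1/p + 1/q = 1" and f: "f \<in> test_fun" and a: "a > 0"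
  shows "(\<integral>\<^sup>+x. ennreal (norm (cconv (beurling_kernel a) f x) powr p) \<partial>lborel)
    \<le> ennreal ((2 * (max p q - 1)) powr p * (LINT y|lborel. norm (f y) powr p))"
proof -
  define A where "A = (LINT y|lborel. norm (f y) powr p)"
  have A0: "A \<ge> 0" unfolding A_def by (auto intro!: integral_nonneg_AE)
  have q: "q > 1" by (rule conjugate_exponent[OF p pq])
  define D where "D = 2 * (max p q - 1)"
  have D: "D \<ge> 0" using p by (simp add: D_def)
  define T where "T = cconv (beurling_kernel a) f"
  have Tb: "T \<in> bounded_borel" unfolding T_def by (intro bounded_borel_cconv bounded_borel_beurling_kernel a f)
  then have [measurable]: "T \<in> borel_measurable borel" by (rule bounded_borel_measurable)
  obtain c where c: "c > 0" "\<And>z. norm (T z) \<le> c" using bounded_borelE[OF Tb] by metis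
  have bound: "(\<integral>\<^sup>+x. ennreal (norm (T x) powr p) * indicator (cball 0 (real n)) x \<partial>lborel) \<le> ennreal (D powr p * A)" for n :: nat
  proof -
    \<comment> \<open>For p < 2 the power is singular at zeros of T, but the product is 0 there; its
      norm is |T|^(p - 1).\<close>
    define g where "g x = (if norm x \<le> real n then cnj (T x) * of_real (norm (T x) powr (p - 2)) else 0)" for x
    have ng: "norm (g x) = (if norm x \<le> real n then norm (T x) powr (p - 1) else 0)" for x
    proof (cases "T x = 0")
      case False
      then show ?thesis using powr_add[of "norm (T x)" 1 "p - 2"] by (simp add: g_def norm_mult)
    qed (use p in \<open>simp add: g_def\<close>)
    have gt: "g \<in> test_fun"
      unfolding test_fun_def
    proof (intro CollectI conjI exI[of _ "real n"] allI impI)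
      have "cnj \<in> borel_measurable borel" by (intro borel_measurable_continuous_onI continuous_intros)
      then have [measurable]: "(\<lambda>x. cnj (T x)) \<in> borel_measurable borel" by measurable
      have [measurable]: "g \<in> borel_measurable borel" unfolding g_def[abs_def] by measurable
      show "g \<in> bounded_borel"
        by (rule bounded_borelI[of _ "c powr (p - 1)"]) (use p c in \<open>auto simp: ng intro!: powr_mono2\<close>)
    qed (simp add: g_def)
    have gT: "g x * T x = of_real (norm (T x) powr p * indicator (cball 0 (real n)) x)" for x
    proof (cases "T x = 0")
      case False
      have "cnj (T x) * T x = of_real ((norm (T x))\<^sup>2)" using complex_norm_square[of "T x"] by (simp add: mult.commute)
      moreover have "norm (T x) powr p = norm (T x) powr (p - 2) * (norm (T x))\<^sup>2"
        using False powr_add[of "norm (T x)" "p - 2" 2] by simp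
      ultimately show ?thesis by (auto simp: g_def indicator_def mult_ac)
    qed (use p in simp)
    define X where "X = (LINT x|lborel. norm (T x) powr p * indicator (cball 0 (real n)) x)"
    have X0: "X \<ge> 0" unfolding X_def by (auto intro!: integral_nonneg_AE)
    have Xi: "integrable lborel (\<lambda>x. norm (T x) powr p * indicator (cball 0 (real n)) x)"
      using integrable_norm[OF test_fun_integrable[OF test_fun_mult[OF gt Tb]]] unfolding gT norm_of_real by (simp add: abs_mult)
    have gq: "norm (g x) powr q = norm (T x) powr p * indicator (cball 0 (real n)) x" for x
    proof -
      have "(p - 1) * q = p" using pq p q by (simp add: field_simps)
      then show ?thesis using q by (auto simp: ng indicator_def powr_powr)
    qed
    have "(LINT x|lborel. g x * T x) = of_real X"
      unfolding X_def gT by (rule integral_complex_of_real)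
    then have "X = norm (LINT x|lborel. g x * T x)" using X0 by simp
    also have "\<dots> \<le> D * A powr (1/p) * (LINT y|lborel. norm (g y) powr q) powr (1/q)"
      unfolding T_def A_def D_def by (rule pairing_bound[OF p pq f gt a])
    also have "(LINT y|lborel. norm (g y) powr q) = X" unfolding gq X_def ..
    finally have "X \<le> (D * A powr (1/p)) powr p" using X0 D p pq by (intro powr_absorb) auto
    also have "\<dots> = D powr p * A" using D A0 p by (simp add: powr_mult powr_powr)
    finally have "X \<le> D powr p * A" .
    moreover have "(\<integral>\<^sup>+x. ennreal (norm (T x) powr p * indicator (cball 0 (real n)) x) \<partial>lborel) = ennreal X"
      unfolding X_def using Xi by (intro nn_integral_eq_integral) auto
    moreover have "ennreal (norm (T x) powr p * indicator (cball 0 (real n)) x) = ennreal (norm (T x) powr p) * indicator (cball 0 (real n)) x" for x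
      by (simp add: indicator_def)
    ultimately show ?thesis by (simp add: ennreal_leI)
  qed
  have "(\<integral>\<^sup>+x. ennreal (norm (T x) powr p) \<partial>lborel)
     = (\<integral>\<^sup>+x. (SUP n::nat. ennreal (norm (T x) powr p) * indicator (cball 0 (real n)) x) \<partial>lborel)"
  proof (rule nn_integral_cong)
    fix x :: complex
    obtain n :: nat where n: "norm x \<le> real n" using real_arch_simple by blast
    show "ennreal (norm (T x) powr p) = (SUP n::nat. ennreal (norm (T x) powr p) * indicator (cball 0 (real n)) x)"
    proof (rule antisym)
      have "ennreal (norm (T x) powr p) = ennreal (norm (T x) powr p) * indicator (cball 0 (real n)) x" using n by simp
      also have "\<dots> \<le> (SUP n::nat. ennreal (norm (T x) powr p) * indicator (cball 0 (real n)) x)" by (rule SUP_upper) simp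
      finally show "ennreal (norm (T x) powr p) \<le> (SUP n::nat. ennreal (norm (T x) powr p) * indicator (cball 0 (real n)) x)" .
    qed (auto intro!: SUP_least simp: indicator_def)
  qed
  also have "\<dots> = (SUP n::nat. (\<integral>\<^sup>+x. ennreal (norm (T x) powr p) * indicator (cball 0 (real n)) x \<partial>lborel))"
  proof (rule nn_integral_monotone_convergence_SUP)
    show "incseq (\<lambda>(n::nat) x. ennreal (norm (T x) powr p) * indicator (cball 0 (real n)) x)"
      by (auto simp: incseq_def le_fun_def indicator_def)
    show "(\<lambda>x. ennreal (norm (T x) powr p) * indicator (cball 0 (real n)) x) \<in> borel_measurable lborel" for n :: nat
      by (intro borel_measurable_times_ennreal borel_measurable_indicator) auto
  qed
  also have "\<dots> \<le> ennreal (D powr p * A)" by (rule SUP_least) (rule bound)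
  finally show ?thesis unfolding T_def D_def A_def .
qed

subsection \<open>Extension to the Lebesgue spaces\<close>

definition lp_borel :: "real \<Rightarrow> (complex \<Rightarrow> complex) set" where
  "lp_borel p = {f \<in> borel_measurable borel. integrable lborel (\<lambda>z. norm (f z) powr p)}"

text \<open>The common majorant of all kernels below. It is not integrable, but belongs to L^q for
  every q > 1, so its product with an L^p function is integrable.\<close>

definition decay :: "complex \<Rightarrow> real" where "decay z = 1 / ((norm z)\<^sup>2 + 1)"

lemma decay_pos: "decay z > 0" "decay z \<le> 1"
  using den_pos[of 1 z] by (auto simp: decay_def)

lemma borel_measurable_decay [measurable]: "decay \<in> borel_measurable borel"
  unfolding decay_def[abs_def] by measurable

lemma integrable_decay_powr:
  assumes "s > 1"
  shows "integrable lborel (\<lambda>z. decay z powr s)"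
proof (rule integrableI_bounded)
  have "decay z powr s = ((norm z)\<^sup>2 + 1\<^sup>2) powr (-s)" for z
    using den_pos[of 1 z] by (simp add: decay_def powr_divide powr_minus_divide)
  then show "(\<integral>\<^sup>+z. ennreal (norm (decay z powr s)) \<partial>lborel) < \<infinity>"
    using nn_integral_decay_finite[of 1 s] assms by simp
qed measurable

text \<open>Young's inequality for products dominates the integrand by two integrable terms, and
  reflection invariance makes the resulting bound independent of x.\<close>

lemma
  assumes p: "p > 1" and f: "f \<in> lp_borel p"
  shows integrable_decay_mult: "integrable lborel (\<lambda>y. decay (x - y) * norm (f y))"
    and integral_decay_mult_bounded: "\<exists>B. \<forall>x. (LINT y|lborel. decay (x - y) * norm (f y)) \<le> B"
proof -
  define q where "q = p / (p - 1)"
  have q: "q > 1" "1/p + 1/q = 1" using p by (auto simp: q_def field_simps)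
  have [measurable]: "f \<in> borel_measurable borel" and fi: "integrable lborel (\<lambda>z. norm (f z) powr p)"
    using f by (auto simp: lp_borel_def)
  have le: "decay (x - y) * norm (f y) \<le> decay (x - y) powr q / q + norm (f y) powr p / p" for x y
    using Youngs_inequality[of q p "decay (x - y)" "norm (f y)"] p q decay_pos[of "x - y"] by (simp add: add.commute)
  have di: "integrable lborel (\<lambda>y. decay (x - y) powr q)" for x
    by (rule lborel_integrable_reflect[OF integrable_decay_powr[OF q(1)]])
  have dom: "integrable lborel (\<lambda>y. decay (x - y) powr q / q + norm (f y) powr p / p)" for x
    using di fi by auto
  show i: "integrable lborel (\<lambda>y. decay (x - y) * norm (f y))" for x
  proof (rule Bochner_Integration.integrable_bound[OF dom[of x]])
    show "AE y in lborel. norm (decay (x - y) * norm (f y)) \<le> norm (decay (x - y) powr q / q + norm (f y) powr p / p)"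
    proof (rule AE_I2)
      fix y
      have "0 \<le> decay (x - y) * norm (f y)" using decay_pos[of "x - y"] by simp
      with le[of x y] show "norm (decay (x - y) * norm (f y)) \<le> norm (decay (x - y) powr q / q + norm (f y) powr p / p)"
        unfolding real_norm_def by linarith
    qed
  qed measurable
  show "\<exists>B. \<forall>x. (LINT y|lborel. decay (x - y) * norm (f y)) \<le> B"
  proof (intro exI allI)
    fix x
    have "(LINT y|lborel. decay (x - y) * norm (f y)) \<le> (LINT y|lborel. decay (x - y) powr q / q + norm (f y) powr p / p)"
      by (intro integral_mono i dom le)
    also have "\<dots> = (LINT y|lborel. decay (x - y) powr q) / q + (LINT y|lborel. norm (f y) powr p) / p"
      using di fi by simp
    also have "(LINT y|lborel. decay (x - y) powr q) = (LINT y|lborel. decay y powr q)"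
      by (rule lborel_integral_reflect[of "\<lambda>y. decay y powr q"]) measurable
    finally show "(LINT y|lborel. decay (x - y) * norm (f y)) \<le> (LINT y|lborel. decay y powr q) / q + (LINT y|lborel. norm (f y) powr p) / p" .
  qed
qed

lemma recip_den_le_decay:
  assumes "a > 0"
  shows "1 / ((norm z)\<^sup>2 + a\<^sup>2) \<le> (1 + 1 / a\<^sup>2) * decay z"
proof -
  have "(norm z)\<^sup>2 + 1 \<le> (1 + 1 / a\<^sup>2) * ((norm z)\<^sup>2 + a\<^sup>2)"
    using assms by (simp add: distrib_left distrib_right)
  then show ?thesis using den_pos[OF assms, of z] den_pos[of 1 z] unfolding decay_def by (simp add: field_simps)
qed

lemma norm_beurling_kernel_decay:
  assumes "a > 0"
  shows "norm (beurling_kernel a z) \<le> (1 + 1 / a\<^sup>2) * decay z"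
proof -
  have "1 / (pi * ((norm z)\<^sup>2 + a\<^sup>2)) \<le> 1 / (1 * ((norm z)\<^sup>2 + a\<^sup>2))"
    using den_pos[OF assms, of z] pi_gt3 by (intro divide_left_mono mult_right_mono mult_pos_pos) auto
  then show ?thesis using norm_beurling_kernel[OF assms, of z] recip_den_le_decay[OF assms, of z] by simp
qed

lemma integrable_kernel_mult:
  assumes p: "p > 1" and f: "f \<in> lp_borel p"
    and [measurable]: "\<kappa> \<in> borel_measurable borel" and \<kappa>: "\<And>z. norm (\<kappa> z) \<le> c * decay z"
  shows "integrable lborel (\<lambda>y. \<kappa> (x - y) * f y)"
proof (rule Bochner_Integration.integrable_bound)
  have [measurable]: "f \<in> borel_measurable borel" using f by (simp add: lp_borel_def)
  show "(\<lambda>y. \<kappa> (x - y) * f y) \<in> borel_measurable lborel" by measurable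
  show "integrable lborel (\<lambda>y. c * (decay (x - y) * norm (f y)))" using integrable_decay_mult[OF p f, of x] by simp
  show "AE y in lborel. norm (\<kappa> (x - y) * f y) \<le> norm (c * (decay (x - y) * norm (f y)))"
  proof (rule AE_I2)
    fix y
    have "norm (\<kappa> (x - y)) * norm (f y) \<le> c * decay (x - y) * norm (f y)" by (intro mult_right_mono \<kappa>) simp
    then have "norm (\<kappa> (x - y) * f y) \<le> c * (decay (x - y) * norm (f y))" by (simp add: norm_mult mult.assoc)
    then show "norm (\<kappa> (x - y) * f y) \<le> norm (c * (decay (x - y) * norm (f y)))"
      unfolding real_norm_def by (rule order_trans[OF _ abs_ge_self])
  qed
qed

definition truncate :: "nat \<Rightarrow> (complex \<Rightarrow> complex) \<Rightarrow> complex \<Rightarrow> complex" where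
  "truncate n f x = (if norm x \<le> real n \<and> norm (f x) \<le> real n then f x else 0)"

lemma truncate_test_fun:
  assumes [measurable]: "f \<in> borel_measurable borel"
  shows "truncate n f \<in> test_fun"
  unfolding test_fun_def
proof (intro CollectI conjI exI[of _ "real n"] allI impI)
  have "truncate n f \<in> borel_measurable borel" unfolding truncate_def[abs_def] by measurable
  then show "truncate n f \<in> bounded_borel" by (rule bounded_borelI[of _ "real n"]) (simp add: truncate_def)
qed (auto simp: truncate_def)

lemma norm_truncate_le: "norm (truncate n f x) \<le> norm (f x)"
  by (simp add: truncate_def)

lemma truncate_tendsto: "(\<lambda>n. truncate n f x) \<longlonglongrightarrow> f x"
proof (rule tendsto_eventually)
  obtain N :: nat where N: "max (norm x) (norm (f x)) \<le> real N" using real_arch_simple by blast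
  show "\<forall>\<^sub>F n in sequentially. truncate n f x = f x"
    using eventually_ge_at_top[of N] by eventually_elim (use N in \<open>auto simp: truncate_def\<close>)
qed

text \<open>Truncations in range and domain are test functions. Their transforms converge pointwise
  by dominated convergence, and Fatou's lemma keeps the constant.\<close>

lemma beurling_norm:
  assumes p: "p > 1" and pq: "1/p + 1/q = 1" and f: "f \<in> lp_borel p" and a: "a > 0"
  shows "(\<integral>\<^sup>+x. ennreal (norm (cconv (beurling_kernel a) f x) powr p) \<partial>lborel)
    \<le> ennreal ((2 * (max p q - 1)) powr p * (LINT y|lborel. norm (f y) powr p))"
proof -
  define K where "K = beurling_kernel a"
  have fm [measurable]: "f \<in> borel_measurable borel" and fi: "integrable lborel (\<lambda>z. norm (f z) powr p)"
    using f by (auto simp: lp_borel_def)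
  have [measurable]: "K \<in> borel_measurable borel" by (simp add: K_def)
  have Km: "norm (K z) \<le> (1 + 1 / a\<^sup>2) * decay z" for z unfolding K_def by (rule norm_beurling_kernel_decay[OF a])
  have [measurable]: "truncate n f \<in> borel_measurable borel" for n
    by (intro bounded_borel_measurable test_fun_bounded_borel truncate_test_fun fm)
  have lim: "(\<lambda>n. cconv K (truncate n f) x) \<longlonglongrightarrow> cconv K f x" for x
    unfolding cconv_def
  proof (rule integral_dominated_convergence[where w = "\<lambda>y. norm (K (x - y) * f y)"])
    show "integrable lborel (\<lambda>y. norm (K (x - y) * f y))"
      by (intro integrable_norm integrable_kernel_mult[OF p f _ Km]) measurable
    show "AE y in lborel. (\<lambda>n. K (x - y) * truncate n f y) \<longlonglongrightarrow> K (x - y) * f y"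
      by (intro AE_I2 tendsto_intros truncate_tendsto)
    show "AE y in lborel. norm (K (x - y) * truncate n f y) \<le> norm (K (x - y) * f y)" for n
      by (intro AE_I2) (simp add: norm_mult mult_left_mono norm_truncate_le)
  qed measurable
  have lim': "(\<lambda>n. ennreal (norm (cconv K (truncate n f) x) powr p)) \<longlonglongrightarrow> ennreal (norm (cconv K f x) powr p)" for x
    using p by (intro tendsto_ennrealI tendsto_powr' tendsto_norm lim tendsto_const) auto
  have "(\<integral>\<^sup>+x. ennreal (norm (cconv K f x) powr p) \<partial>lborel)
     = (\<integral>\<^sup>+x. liminf (\<lambda>n. ennreal (norm (cconv K (truncate n f) x) powr p)) \<partial>lborel)"
    by (intro nn_integral_cong lim_imp_Liminf[symmetric] lim') simp
  also have "\<dots> \<le> liminf (\<lambda>n. \<integral>\<^sup>+x. ennreal (norm (cconv K (truncate n f) x) powr p) \<partial>lborel)"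
    by (rule nn_integral_liminf) measurable
  also have "\<dots> \<le> limsup (\<lambda>n. \<integral>\<^sup>+x. ennreal (norm (cconv K (truncate n f) x) powr p) \<partial>lborel)"
    by (rule Liminf_le_Limsup) simp
  also have "\<dots> \<le> ennreal ((2 * (max p q - 1)) powr p * (LINT y|lborel. norm (f y) powr p))"
  proof (rule Limsup_bounded, rule always_eventually, rule allI)
    fix n
    have t: "truncate n f \<in> test_fun" by (rule truncate_test_fun[OF fm])
    have "(\<integral>\<^sup>+x. ennreal (norm (cconv K (truncate n f) x) powr p) \<partial>lborel)
       \<le> ennreal ((2 * (max p q - 1)) powr p * (LINT y|lborel. norm (truncate n f y) powr p))"
      unfolding K_def by (rule beurling_norm_test_fun[OF p pq t a])
    also have "\<dots> \<le> ennreal ((2 * (max p q - 1)) powr p * (LINT y|lborel. norm (f y) powr p))"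
      using p test_fun_integrable_powr[OF t, of p] fi
      by (intro ennreal_leI mult_left_mono integral_mono powr_mono2) (auto intro: norm_truncate_le)
    finally show "(\<integral>\<^sup>+x. ennreal (norm (cconv K (truncate n f) x) powr p) \<partial>lborel)
       \<le> ennreal ((2 * (max p q - 1)) powr p * (LINT y|lborel. norm (f y) powr p))" .
  qed
  finally show ?thesis unfolding K_def .
qed

subsection \<open>Decaying kernels\<close>

text \<open>A class stable under the walk in which two kernels can be convolved absolutely, since
  the product of their majorants decays like the inverse fourth power.\<close>

definition decaying :: "(complex \<Rightarrow> complex) \<Rightarrow> bool" where
  "decaying \<kappa> \<longleftrightarrow> \<kappa> \<in> borel_measurable borel \<and> (\<exists>C. \<forall>z. norm (\<kappa> z) \<le> C * decay z)"

lemma decayingI: "\<kappa> \<in> borel_measurable borel \<Longrightarrow> (\<And>z. norm (\<kappa> z) \<le> C * decay z) \<Longrightarrow> decaying \<kappa>"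
  by (auto simp: decaying_def)

lemma decayingE:
  assumes "decaying \<kappa>"
  obtains C where "C \<ge> 0" "\<And>z. norm (\<kappa> z) \<le> C * decay z" "\<kappa> \<in> borel_measurable borel"
proof -
  obtain C where C: "\<And>z. norm (\<kappa> z) \<le> C * decay z" "\<kappa> \<in> borel_measurable borel"
    using assms by (auto simp: decaying_def)
  have "0 \<le> C * decay 0" using C(1)[of 0] norm_ge_zero order_trans by blast
  then have "C \<ge> 0" using decay_pos(1)[of 0] by (simp add: zero_le_mult_iff)
  with C that show ?thesis by blast
qed

lemma decay_shift: "decay (z + v) \<le> 2 * (1 + (norm v)\<^sup>2) * decay z"
proof -
  have "norm z \<le> norm (z + v) + norm v" using norm_triangle_ineq4[of "z + v" v] by simp
  then have "(norm z)\<^sup>2 \<le> (norm (z + v) + norm v)\<^sup>2" by (intro power_mono) auto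
  also have "\<dots> \<le> 2 * (norm (z + v))\<^sup>2 + 2 * (norm v)\<^sup>2"
    using zero_le_power2[of "norm (z + v) - norm v"] by (simp add: power2_eq_square algebra_simps)
  finally have "(norm z)\<^sup>2 + 1 \<le> 2 * (norm (z + v))\<^sup>2 + 2 * (norm v)\<^sup>2 + 1" by simp
  also have "\<dots> \<le> 2 * (1 + (norm v)\<^sup>2) * ((norm (z + v))\<^sup>2 + 1)"
    using zero_le_mult_iff[of "(norm v)\<^sup>2" "(norm (z + v))\<^sup>2"] by (simp add: algebra_simps)
  finally show ?thesis using den_pos[of 1 z] den_pos[of 1 "z + v"] by (simp add: decay_def field_simps)
qed

lemma decaying_shift: assumes "decaying \<kappa>" shows "decaying (\<lambda>z. \<kappa> (z + v))"
proof -
  obtain C where C: "C \<ge> 0" "\<And>z. norm (\<kappa> z) \<le> C * decay z" and [measurable]: "\<kappa> \<in> borel_measurable borel"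
    using decayingE[OF assms] by metis
  have "norm (\<kappa> (z + v)) \<le> (C * (2 * (1 + (norm v)\<^sup>2))) * decay z" for z
    using order_trans[OF C(2)[of "z + v"] mult_left_mono[OF decay_shift C(1)]] by (simp add: mult.assoc)
  then show ?thesis by (intro decayingI) measurable
qed

lemma decaying_shift': "decaying \<kappa> \<Longrightarrow> decaying (\<lambda>z. \<kappa> (z - v))"
  using decaying_shift[of \<kappa> "-v"] by simp

lemma decaying_cmult: assumes "decaying \<kappa>" shows "decaying (\<lambda>z. c * \<kappa> z)"
proof -
  obtain C where C: "\<And>z. norm (\<kappa> z) \<le> C * decay z" and [measurable]: "\<kappa> \<in> borel_measurable borel"
    using decayingE[OF assms] by metis
  have "norm (c * \<kappa> z) \<le> (norm c * C) * decay z" for z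
    using mult_left_mono[OF C[of z] norm_ge_zero[of c]] by (simp add: norm_mult mult.assoc)
  then show ?thesis by (intro decayingI) measurable
qed

lemma decaying_add: assumes "decaying \<kappa>" "decaying \<rho>" shows "decaying (\<lambda>z. \<kappa> z + \<rho> z)"
proof -
  obtain C where C: "\<And>z. norm (\<kappa> z) \<le> C * decay z" and [measurable]: "\<kappa> \<in> borel_measurable borel"
    using decayingE[OF assms(1)] by metis
  obtain D where D: "\<And>z. norm (\<rho> z) \<le> D * decay z" and [measurable]: "\<rho> \<in> borel_measurable borel"
    using decayingE[OF assms(2)] by metis
  have "norm (\<kappa> z + \<rho> z) \<le> (C + D) * decay z" for z
    using norm_triangle_mono[OF C[of z] D[of z]] by (simp add: distrib_right)
  then show ?thesis by (intro decayingI) measurable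
qed

lemma decaying_diff: assumes "decaying \<kappa>" "decaying \<rho>" shows "decaying (\<lambda>z. \<kappa> z - \<rho> z)"
  using decaying_add[OF assms(1) decaying_cmult[OF assms(2), of "-1"]] by simp

lemma decaying_sym_avg: "decaying \<kappa> \<Longrightarrow> decaying (sym_avg v \<kappa>)"
  unfolding sym_avg_def[abs_def] scaleR_conv_of_real
  by (intro decaying_cmult decaying_add) (rule decaying_shift decaying_shift'; assumption)+

lemma decaying_avg3: "(\<And>j. decaying (\<kappa> j)) \<Longrightarrow> decaying (\<lambda>z. avg3 (\<lambda>j. \<kappa> j z))"
  unfolding avg3_def scaleR_conv_of_real by (intro decaying_cmult decaying_add)

lemma decaying_walk: "decaying \<kappa> \<Longrightarrow> decaying (walk v \<kappa>)"
  unfolding walk_def[abs_def] by (intro decaying_avg3 decaying_sym_avg)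

lemma decaying_walk_op: "decaying \<kappa> \<Longrightarrow> decaying (walk_op v \<omega> \<kappa>)"
  unfolding walk_op_def[abs_def] by (intro decaying_avg3 decaying_cmult decaying_diff decaying_sym_avg)

lemma integrable_decay_decay: "integrable lborel (\<lambda>y. decay (x - y) * decay y)"
proof (rule Bochner_Integration.integrable_bound)
  have d2: "integrable lborel (\<lambda>z. decay z powr 2)" by (rule integrable_decay_powr) simp
  show "integrable lborel (\<lambda>y. decay (x - y) powr 2 + decay y powr 2)"
    using lborel_integrable_reflect[OF d2, of x] d2 by simp
  show "AE y in lborel. norm (decay (x - y) * decay y) \<le> norm (decay (x - y) powr 2 + decay y powr 2)"
  proof (rule AE_I2)
    fix y
    have "0 < decay (x - y)" "0 < decay y" by (rule decay_pos)+
    moreover have "2 * (decay (x - y) * decay y) \<le> (decay (x - y))\<^sup>2 + (decay y)\<^sup>2"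
      using zero_le_power2[of "decay (x - y) - decay y"] by (simp add: power2_eq_square algebra_simps)
    moreover have "decay (x - y) * decay y > 0" by (intro mult_pos_pos decay_pos)
    ultimately have "decay (x - y) * decay y \<le> (decay (x - y))\<^sup>2 + (decay y)\<^sup>2" by linarith
    moreover have "norm (decay (x - y) * decay y) = decay (x - y) * decay y"
      using decay_pos(1)[of "x - y"] decay_pos(1)[of y] by simp
    moreover have "norm (decay (x - y) powr 2 + decay y powr 2) = (decay (x - y))\<^sup>2 + (decay y)\<^sup>2"
      using decay_pos(1)[of "x - y"] decay_pos(1)[of y] by simp
    ultimately show "norm (decay (x - y) * decay y) \<le> norm (decay (x - y) powr 2 + decay y powr 2)"
      by simp
  qed
qed measurable

lemma integrable_decaying:
  assumes "decaying \<kappa>" "decaying \<rho>"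
  shows "integrable lborel (\<lambda>y. \<kappa> (x - y) * \<rho> y)"
proof -
  obtain C where C: "C \<ge> 0" "\<And>z. norm (\<kappa> z) \<le> C * decay z" and [measurable]: "\<kappa> \<in> borel_measurable borel"
    using decayingE[OF assms(1)] by metis
  obtain D where D: "D \<ge> 0" "\<And>z. norm (\<rho> z) \<le> D * decay z" and [measurable]: "\<rho> \<in> borel_measurable borel"
    using decayingE[OF assms(2)] by metis
  show ?thesis
  proof (rule Bochner_Integration.integrable_bound)
    show "integrable lborel (\<lambda>y. (C * D) * (decay (x - y) * decay y))"
      by (intro integrable_mult_right integrable_decay_decay)
    show "AE y in lborel. norm (\<kappa> (x - y) * \<rho> y) \<le> norm ((C * D) * (decay (x - y) * decay y))"
    proof (rule AE_I2)
      fix y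
      have "norm (\<kappa> (x - y)) * norm (\<rho> y) \<le> (C * decay (x - y)) * (D * decay y)"
        by (intro mult_mono C D mult_nonneg_nonneg less_imp_le[OF decay_pos(1)]) auto
      then have "norm (\<kappa> (x - y) * \<rho> y) \<le> (C * D) * (decay (x - y) * decay y)" by (simp add: norm_mult mult_ac)
      then show "norm (\<kappa> (x - y) * \<rho> y) \<le> norm ((C * D) * (decay (x - y) * decay y))"
        unfolding real_norm_def by (rule order_trans[OF _ abs_ge_self])
    qed
  qed measurable
qed

section \<open>Exchanging the scales of the Poisson and the Beurling kernel\<close>

lemma cconv_decaying_linear:
  assumes k: "decaying \<kappa>" and r: "decaying \<rho>"
  shows "decaying \<kappa>' \<Longrightarrow> cconv (\<lambda>z. \<kappa> z + \<kappa>' z) \<rho> x = cconv \<kappa> \<rho> x + cconv \<kappa>' \<rho> x"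
    and "decaying \<kappa>' \<Longrightarrow> cconv (\<lambda>z. \<kappa> z - \<kappa>' z) \<rho> x = cconv \<kappa> \<rho> x - cconv \<kappa>' \<rho> x"
    and "cconv (\<lambda>z. c * \<kappa> z) \<rho> x = c * cconv \<kappa> \<rho> x"
    and "decaying \<rho>' \<Longrightarrow> cconv \<kappa> (\<lambda>z. \<rho> z + \<rho>' z) x = cconv \<kappa> \<rho> x + cconv \<kappa> \<rho>' x"
    and "decaying \<rho>' \<Longrightarrow> cconv \<kappa> (\<lambda>z. \<rho> z - \<rho>' z) x = cconv \<kappa> \<rho> x - cconv \<kappa> \<rho>' x"
    and "cconv \<kappa> (\<lambda>z. c * \<rho> z) x = c * cconv \<kappa> \<rho> x"
  unfolding cconv_def using integrable_decaying[OF k, of _ x] integrable_decaying[OF _ r, of _ x] k r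
  by (simp_all add: distrib_right left_diff_distrib distrib_left right_diff_distrib mult.assoc mult.left_commute[of _ c])

lemma cconv_shift_swap:
  assumes [measurable]: "\<kappa> \<in> borel_measurable borel" "\<rho> \<in> borel_measurable borel"
  shows "cconv (\<lambda>z. \<kappa> (z + v)) \<rho> x = cconv \<kappa> (\<lambda>z. \<rho> (z + v)) x"
  using lborel_integral_shift[of "\<lambda>y. \<kappa> (x - y + v) * \<rho> y" v] by (simp add: cconv_def)

lemma cconv_sym_avg_swap:
  assumes k: "decaying \<kappa>" and r: "decaying \<rho>"
  shows "cconv (sym_avg v \<kappa>) \<rho> x = cconv \<kappa> (sym_avg v \<rho>) x"
proof -
  have m: "\<kappa> \<in> borel_measurable borel" "\<rho> \<in> borel_measurable borel" using k r by (auto simp: decaying_def)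
  have s: "cconv (\<lambda>z. \<kappa> (z - v)) \<rho> x = cconv \<kappa> (\<lambda>z. \<rho> (z - v)) x"
    using cconv_shift_swap[OF m, of "-v" x] by simp
  note d = decaying_shift[OF k, of v] decaying_shift'[OF k, of v] decaying_shift[OF r, of v] decaying_shift'[OF r, of v]
  show ?thesis
    unfolding sym_avg_def[abs_def] scaleR_conv_of_real
      cconv_decaying_linear(3)[OF decaying_add[OF d(1,2)] r] cconv_decaying_linear(6)[OF k decaying_add[OF d(3,4)]]
      cconv_decaying_linear(1)[OF d(1) r d(2)] cconv_decaying_linear(4)[OF k d(3,4)] s cconv_shift_swap[OF m] ..
qed

lemma cconv_avg3_left:
  assumes k: "\<And>j. decaying (\<kappa> j)" and r: "decaying \<rho>"
  shows "cconv (\<lambda>z. avg3 (\<lambda>j. \<kappa> j z)) \<rho> x = avg3 (\<lambda>j. cconv (\<kappa> j) \<rho> x)"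
  unfolding avg3_def scaleR_conv_of_real
    cconv_decaying_linear(3)[OF decaying_add[OF decaying_add[OF k k] k] r]
    cconv_decaying_linear(1)[OF decaying_add[OF k k] r k] cconv_decaying_linear(1)[OF k r k] ..

lemma cconv_avg3_right:
  assumes k: "decaying \<kappa>" and r: "\<And>j. decaying (\<rho> j)"
  shows "cconv \<kappa> (\<lambda>z. avg3 (\<lambda>j. \<rho> j z)) x = avg3 (\<lambda>j. cconv \<kappa> (\<rho> j) x)"
  unfolding avg3_def scaleR_conv_of_real
    cconv_decaying_linear(6)[OF k decaying_add[OF decaying_add[OF r r] r]]
    cconv_decaying_linear(4)[OF k decaying_add[OF r r] r] cconv_decaying_linear(4)[OF k r r] ..

lemma cconv_walk_swap:
  assumes k: "decaying \<kappa>" and r: "decaying \<rho>"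
  shows "cconv (walk v \<kappa>) \<rho> x = cconv \<kappa> (walk v \<rho>) x"
  unfolding walk_def[abs_def] cconv_avg3_left[OF decaying_sym_avg[OF k] r] cconv_avg3_right[OF k decaying_sym_avg[OF r]]
    cconv_sym_avg_swap[OF k r] ..

lemma cconv_walk_op_swap:
  assumes k: "decaying \<kappa>" and r: "decaying \<rho>"
  shows "cconv (walk_op v \<omega> \<kappa>) \<rho> x = cconv \<kappa> (walk_op v \<omega> \<rho>) x"
proof -
  have dk: "decaying (\<lambda>z. sym_avg u \<kappa> z - \<kappa> z)" and dr: "decaying (\<lambda>z. sym_avg u \<rho> z - \<rho> z)" for u
    by (intro decaying_diff decaying_sym_avg k r)+
  show ?thesis
    unfolding walk_op_def[abs_def] cconv_avg3_left[OF decaying_cmult[OF dk] r] cconv_avg3_right[OF k decaying_cmult[OF dr]]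
      cconv_decaying_linear(3)[OF dk r] cconv_decaying_linear(6)[OF k dr]
      cconv_decaying_linear(2)[OF decaying_sym_avg[OF k] r k] cconv_decaying_linear(5)[OF k decaying_sym_avg[OF r] r]
      cconv_sym_avg_swap[OF k r] ..
qed

definition poissonc :: "real \<Rightarrow> complex \<Rightarrow> complex" where "poissonc a z = of_real (poisson a z)"

lemma borel_measurable_poissonc [measurable]: "poissonc a \<in> borel_measurable borel"
  unfolding poissonc_def[abs_def] by measurable

lemma poisson_le_recip:
  assumes "a > 0"
  shows "poisson a z \<le> 1 / (pi * ((norm z)\<^sup>2 + a\<^sup>2))"
proof -
  define d where "d = (norm z)\<^sup>2 + a\<^sup>2"
  have d: "d > 0" "a\<^sup>2 \<le> d" using den_pos[OF assms] by (auto simp: d_def)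
  have "poisson a z = a\<^sup>2 / (pi * d\<^sup>2)" by (simp add: poisson_def d_def)
  also have "\<dots> \<le> d / (pi * d\<^sup>2)" using d by (intro divide_right_mono) auto
  also have "\<dots> = 1 / (pi * d)" using d by (simp add: power2_eq_square)
  finally show ?thesis by (simp add: d_def)
qed

lemma recip_pi_den_le_decay:
  assumes "a > 0"
  shows "1 / (pi * ((norm z)\<^sup>2 + a\<^sup>2)) \<le> (1 + 1 / a\<^sup>2) * decay z"
proof -
  have "1 / (pi * ((norm z)\<^sup>2 + a\<^sup>2)) \<le> 1 / (1 * ((norm z)\<^sup>2 + a\<^sup>2))"
    using den_pos[OF assms, of z] pi_gt3 by (intro divide_left_mono mult_right_mono mult_pos_pos) auto
  then show ?thesis using recip_den_le_decay[OF assms, of z] by simp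
qed

lemma norm_poissonc_decay: "a > 0 \<Longrightarrow> norm (poissonc a z) \<le> (1 + 1 / a\<^sup>2) * decay z"
  using poisson_le_recip[of a z] recip_pi_den_le_decay[of a z] by (simp add: poissonc_def)

lemma decaying_beurling_kernel: "a > 0 \<Longrightarrow> decaying (beurling_kernel a)"
  by (rule decayingI[OF _ norm_beurling_kernel_decay]) auto

lemma decaying_log_diff:
  assumes ab: "0 < a" "a \<le> b"
  shows "decaying (log_diff a b)"
proof (rule decayingI)
  fix z
  have "a\<^sup>2 \<le> b\<^sup>2" using ab by (intro power_mono) auto
  then have "(b\<^sup>2 - a\<^sup>2) * (1 / ((norm z)\<^sup>2 + a\<^sup>2)) \<le> (b\<^sup>2 - a\<^sup>2) * ((1 + 1 / a\<^sup>2) * decay z)"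
    using ab by (intro mult_left_mono recip_den_le_decay) auto
  then show "norm (log_diff a b z) \<le> ((b\<^sup>2 - a\<^sup>2) * (1 + 1 / a\<^sup>2)) * decay z"
    using norm_log_diff[OF ab, of z] by (simp add: mult.assoc)
qed (auto intro: bounded_borel_measurable bounded_borel_log_diff ab)

lemma cconv_dominated_convergence:
  assumes k: "\<And>n. \<kappa> n \<in> borel_measurable borel" "\<kappa>' \<in> borel_measurable borel"
    and r: "\<And>n. \<rho> n \<in> borel_measurable borel" "\<rho>' \<in> borel_measurable borel"
    and C: "\<And>n z. norm (\<kappa> n z) \<le> C * decay z" and D: "\<And>n z. norm (\<rho> n z) \<le> D * decay z"
    and lk: "\<And>z. (\<lambda>n. \<kappa> n z) \<longlonglongrightarrow> \<kappa>' z" and lr: "\<And>z. (\<lambda>n. \<rho> n z) \<longlonglongrightarrow> \<rho>' z"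
  shows "(\<lambda>n. cconv (\<kappa> n) (\<rho> n) x) \<longlonglongrightarrow> cconv \<kappa>' \<rho>' x"
  unfolding cconv_def
proof (rule integral_dominated_convergence[where w = "\<lambda>y. (C * D) * (decay (x - y) * decay y)"])
  note [measurable] = k r
  show "(\<lambda>y. \<kappa>' (x - y) * \<rho>' y) \<in> borel_measurable lborel" "(\<lambda>y. \<kappa> n (x - y) * \<rho> n y) \<in> borel_measurable lborel" for n
    by measurable
  show "integrable lborel (\<lambda>y. (C * D) * (decay (x - y) * decay y))"
    by (intro integrable_mult_right integrable_decay_decay)
  show "AE y in lborel. (\<lambda>n. \<kappa> n (x - y) * \<rho> n y) \<longlonglongrightarrow> \<kappa>' (x - y) * \<rho>' y"
    by (intro AE_I2 tendsto_mult lk lr)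
  show "AE y in lborel. norm (\<kappa> n (x - y) * \<rho> n y) \<le> (C * D) * (decay (x - y) * decay y)" for n
  proof (rule AE_I2)
    fix y
    have "0 \<le> C * decay (x - y)" using C[of n "x - y"] norm_ge_zero order_trans by blast
    then have "norm (\<kappa> n (x - y)) * norm (\<rho> n y) \<le> (C * decay (x - y)) * (D * decay y)"
      by (intro mult_mono C D) auto
    then show "norm (\<kappa> n (x - y) * \<rho> n y) \<le> (C * D) * (decay (x - y) * decay y)" by (simp add: norm_mult mult_ac)
  qed
qed

lemma recip_den_square_le_decay:
  assumes a: "a > 0"
  shows "1 / ((norm z)\<^sup>2 + a\<^sup>2)\<^sup>2 \<le> (1 / a\<^sup>2) * (1 + 1 / a\<^sup>2) * decay z"
proof -
  have "1 / ((norm z)\<^sup>2 + a\<^sup>2) \<le> 1 / a\<^sup>2"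
    using a by (intro divide_left_mono mult_pos_pos den_pos) auto
  then have "(1 / ((norm z)\<^sup>2 + a\<^sup>2)) * (1 / ((norm z)\<^sup>2 + a\<^sup>2)) \<le> (1 / a\<^sup>2) * ((1 + 1 / a\<^sup>2) * decay z)"
    using a den_pos[OF a, of z] by (intro mult_mono recip_den_le_decay) auto
  then show ?thesis by (simp add: power2_eq_square)
qed

text \<open>Up to constants, the scaled differences below are the images of \<open>log_diff a b\<close> under the two
  commuting difference operators, so the convolution identity for \<open>poissonc\<close> and \<open>beurling_kernel\<close>
  expresses that these operators can be moved from one factor of a convolution to the other.\<close>

lemma scaled_walk_log_diff:
  assumes ab: "0 < a" "a \<le> b" and s: "0 < s" "s \<le> a"
  defines "h \<equiv> \<lambda>n::nat. s / (5 * real (Suc n))"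
  shows "\<exists>C. \<forall>n z. norm ((walk (hex (h n)) (log_diff a b) z - log_diff a b z) / of_real (pi * (h n)\<^sup>2)) \<le> C * decay z"
    and "(\<lambda>n. (walk (hex (h n)) (log_diff a b) z - log_diff a b z) / of_real (pi * (h n)\<^sup>2))
      \<longlonglongrightarrow> poissonc a z - poissonc b z"
    and "\<exists>C. \<forall>n z. norm (walk_op (hex (h n)) hexw (log_diff a b) z / of_real (2 * pi * (h n)\<^sup>2)) \<le> C * decay z"
    and "(\<lambda>n. walk_op (hex (h n)) hexw (log_diff a b) z / of_real (2 * pi * (h n)\<^sup>2))
      \<longlonglongrightarrow> beurling_kernel a z - beurling_kernel b z"
proof -
  have b: "b > 0" using ab by simp
  have h: "h n > 0" "24 * (h n)\<^sup>2 \<le> a\<^sup>2" for n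
  proof -
    show "h n > 0" using s by (simp add: h_def)
    \<comment> \<open>The divisor 5 in h yields 25 h^2 <= a^2 and so leaves room for the condition
      24 h^2 <= a^2.\<close>
    have "s \<le> s * real (Suc n)" using s by simp
    then have "5 * h n \<le> s" unfolding h_def using s by (simp add: divide_le_eq)
    then have "5 * h n \<le> a" using s by simp
    then have "(5 * h n)\<^sup>2 \<le> a\<^sup>2" using \<open>h n > 0\<close> by (intro power_mono) auto
    moreover have "(5 * h n)\<^sup>2 = 25 * (h n)\<^sup>2" by (simp add: power_mult_distrib)
    ultimately show "24 * (h n)\<^sup>2 \<le> a\<^sup>2" using zero_le_power2[of "h n"] by linarith
  qed
  have "(\<lambda>n. s / 5 * (1 / real (Suc n))) \<longlonglongrightarrow> s / 5 * 0"
    by (intro tendsto_mult tendsto_const LIMSEQ_Suc[OF lim_1_over_n])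
  then have h0: "h \<longlonglongrightarrow> 0" unfolding h_def by simp
  have divide: "norm (w / of_real s - m) \<le> E / s" if "s > 0" "norm (w - of_real s * m) \<le> E" for w m :: complex and s E :: real
  proof -
    have "w / of_real s - m = (w - of_real s * m) / of_real s" using that by (simp add: field_simps)
    then show ?thesis using that by (simp add: norm_divide divide_right_mono)
  qed
  define R where "R z = 1 / ((norm z)\<^sup>2 + a\<^sup>2)\<^sup>2" for z :: complex
  define w where "w n z = walk (hex (h n)) (log_diff a b) z - log_diff a b z" for n z
  define W where "W n z = walk_op (hex (h n)) hexw (log_diff a b) z" for n z
  have wle: "norm (w n z / of_real (pi * (h n)\<^sup>2) - (poissonc a z - poissonc b z)) \<le> 20 * (h n)\<^sup>2 / pi * R z" for n z
  proof -
    have "norm (w n z / of_real (pi * (h n)\<^sup>2) - (poissonc a z - poissonc b z)) \<le> (20 * (h n)^4 * R z) / (pi * (h n)\<^sup>2)"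
      using walk_log_diff(2)[OF ab h(1) h(2), of n z] h(1)[of n]
      by (intro divide) (simp_all add: w_def R_def poissonc_def)
    also have "\<dots> = 20 * (h n)\<^sup>2 / pi * R z" using h(1)[of n] by (simp add: eval_nat_numeral)
    finally show ?thesis .
  qed
  have Wle: "norm (W n z / of_real (2 * pi * (h n)\<^sup>2) - (beurling_kernel a z - beurling_kernel b z)) \<le> 160 * (h n)\<^sup>2 / pi * R z" for n z
  proof -
    have "norm (W n z / of_real (2 * pi * (h n)\<^sup>2) - (beurling_kernel a z - beurling_kernel b z)) \<le> (320 * (h n)^4 * R z) / (2 * pi * (h n)\<^sup>2)"
      using walk_log_diff(3)[OF ab h(1) h(2), of n z] h(1)[of n]
      by (intro divide) (simp_all add: W_def R_def)
    also have "\<dots> = 160 * (h n)\<^sup>2 / pi * R z" using h(1)[of n] by (simp add: eval_nat_numeral)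
    finally show ?thesis .
  qed
  have lim0: "(\<lambda>n. c * (h n)\<^sup>2 / pi * R z) \<longlonglongrightarrow> 0" for c z
  proof -
    have "(\<lambda>n. c * (h n)\<^sup>2 / pi * R z) \<longlonglongrightarrow> c * 0\<^sup>2 / pi * R z" by (intro tendsto_intros h0) auto
    then show ?thesis by simp
  qed
  show "(\<lambda>n. (walk (hex (h n)) (log_diff a b) z - log_diff a b z) / of_real (pi * (h n)\<^sup>2))
      \<longlonglongrightarrow> poissonc a z - poissonc b z"
    unfolding w_def[symmetric]
    by (rule LIM_zero_cancel, rule Lim_null_comparison[OF always_eventually[OF allI[OF wle]] lim0])
  show "(\<lambda>n. walk_op (hex (h n)) hexw (log_diff a b) z / of_real (2 * pi * (h n)\<^sup>2))
      \<longlonglongrightarrow> beurling_kernel a z - beurling_kernel b z"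
    unfolding W_def[symmetric]
    by (rule LIM_zero_cancel, rule Lim_null_comparison[OF always_eventually[OF allI[OF Wle]] lim0])
  define Ca Cb where "Ca = 1 + 1 / a\<^sup>2" and "Cb = 1 + 1 / b\<^sup>2"
  have hb: "c * (h n)\<^sup>2 / pi * R z \<le> (c * Ca) * decay z" if "c \<ge> 0" for c n z
  proof -
    have "R z \<le> (1 / a\<^sup>2) * Ca * decay z" unfolding R_def Ca_def by (rule recip_den_square_le_decay[OF ab(1)])
    moreover have R0: "R z \<ge> 0" by (simp add: R_def)
    moreover have "c * (h n)\<^sup>2 / pi \<le> c * a\<^sup>2"
    proof -
      have "c * (h n)\<^sup>2 \<le> c * a\<^sup>2" using that h(2)[of n] zero_le_power2[of "h n"] by (intro mult_left_mono) linarith+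
      moreover have "c * (h n)\<^sup>2 / pi \<le> c * (h n)\<^sup>2 / 1" using that pi_gt3 by (intro divide_left_mono) auto
      ultimately show ?thesis by simp
    qed
    ultimately have "c * (h n)\<^sup>2 / pi * R z \<le> c * a\<^sup>2 * ((1 / a\<^sup>2) * Ca * decay z)"
      using that by (intro mult_mono) auto
    also have "\<dots> = (c * Ca) * decay z" using ab by simp
    finally show ?thesis .
  qed
  show "\<exists>C. \<forall>n z. norm ((walk (hex (h n)) (log_diff a b) z - log_diff a b z) / of_real (pi * (h n)\<^sup>2)) \<le> C * decay z"
  proof (intro exI allI)
    fix n z
    have "norm (w n z / of_real (pi * (h n)\<^sup>2)) \<le> norm (poissonc a z - poissonc b z) + 20 * (h n)\<^sup>2 / pi * R z"
      using norm_triangle_sub[of "w n z / of_real (pi * (h n)\<^sup>2)" "poissonc a z - poissonc b z"] wle[of n z] by linarith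
    also have "\<dots> \<le> (Ca * decay z + Cb * decay z) + (20 * Ca) * decay z"
      using norm_triangle_ineq4[of "poissonc a z" "poissonc b z"] norm_poissonc_decay[OF ab(1), of z] norm_poissonc_decay[OF b, of z]
      by (intro add_mono hb) (auto simp: Ca_def Cb_def)
    also have "\<dots> = (Ca + Cb + 20 * Ca) * decay z" by (simp add: algebra_simps)
    finally show "norm ((walk (hex (h n)) (log_diff a b) z - log_diff a b z) / of_real (pi * (h n)\<^sup>2)) \<le> (Ca + Cb + 20 * Ca) * decay z"
      by (simp add: w_def)
  qed
  show "\<exists>C. \<forall>n z. norm (walk_op (hex (h n)) hexw (log_diff a b) z / of_real (2 * pi * (h n)\<^sup>2)) \<le> C * decay z"
  proof (intro exI allI)
    fix n z
    have "norm (W n z / of_real (2 * pi * (h n)\<^sup>2)) \<le> norm (beurling_kernel a z - beurling_kernel b z) + 160 * (h n)\<^sup>2 / pi * R z"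
      using norm_triangle_sub[of "W n z / of_real (2 * pi * (h n)\<^sup>2)" "beurling_kernel a z - beurling_kernel b z"] Wle[of n z] by linarith
    also have "\<dots> \<le> (Ca * decay z + Cb * decay z) + (160 * Ca) * decay z"
      using norm_triangle_ineq4[of "beurling_kernel a z" "beurling_kernel b z"] norm_beurling_kernel_decay[OF ab(1), of z] norm_beurling_kernel_decay[OF b, of z]
      by (intro add_mono hb) (auto simp: Ca_def Cb_def)
    also have "\<dots> = (Ca + Cb + 160 * Ca) * decay z" by (simp add: algebra_simps)
    finally show "norm (walk_op (hex (h n)) hexw (log_diff a b) z / of_real (2 * pi * (h n)\<^sup>2)) \<le> (Ca + Cb + 160 * Ca) * decay z"
      by (simp add: W_def)
  qed
qed

text \<open>The weighted difference moves to the first factor, commutes there with P - 1 for P =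
  \<open>walk v\<close>, and P - 1 then moves to the second factor.\<close>

lemma walk_minus_walk_op_swap:
  assumes k: "decaying \<kappa>" and r: "decaying \<rho>"
  shows "cconv (\<lambda>z. walk v \<kappa> z - \<kappa> z) (walk_op v \<omega> \<rho>) x = cconv (walk_op v \<omega> \<kappa>) (\<lambda>z. walk v \<rho> z - \<rho> z) x"
proof -
  have "cconv (\<lambda>z. walk v \<kappa> z - \<kappa> z) (walk_op v \<omega> \<rho>) x = cconv (walk_op v \<omega> (\<lambda>z. walk v \<kappa> z - \<kappa> z)) \<rho> x"
    by (intro cconv_walk_op_swap[symmetric] decaying_diff decaying_walk k r)
  also have "walk_op v \<omega> (\<lambda>z. walk v \<kappa> z - \<kappa> z) = (\<lambda>z. walk v (walk_op v \<omega> \<kappa>) z - walk_op v \<omega> \<kappa> z)"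
    by (simp add: walk_op_linear walk_walk_op)
  also have "cconv (\<lambda>z. walk v (walk_op v \<omega> \<kappa>) z - walk_op v \<omega> \<kappa> z) \<rho> x
      = cconv (walk v (walk_op v \<omega> \<kappa>)) \<rho> x - cconv (walk_op v \<omega> \<kappa>) \<rho> x"
    by (intro cconv_decaying_linear(2) decaying_walk decaying_walk_op k r)
  also have "cconv (walk v (walk_op v \<omega> \<kappa>)) \<rho> x = cconv (walk_op v \<omega> \<kappa>) (walk v \<rho>) x"
    by (intro cconv_walk_swap decaying_walk_op k r)
  also have "cconv (walk_op v \<omega> \<kappa>) (walk v \<rho>) x - cconv (walk_op v \<omega> \<kappa>) \<rho> x
      = cconv (walk_op v \<omega> \<kappa>) (\<lambda>z. walk v \<rho> z - \<rho> z) x"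
    by (intro cconv_decaying_linear(5)[symmetric] decaying_walk decaying_walk_op k r)
  finally show ?thesis .
qed

text \<open>The exchange of the two difference operators is applied to the potentials of both pairs
  of scales, divided by the powers of h that normalize them, and passed to the limit.\<close>

lemma poisson_beurling_swap_diff:
  assumes ab: "0 < a" "a \<le> b" and cd: "0 < c" "c \<le> d"
  shows "cconv (\<lambda>z. poissonc a z - poissonc b z) (\<lambda>z. beurling_kernel c z - beurling_kernel d z) x
    = cconv (\<lambda>z. beurling_kernel a z - beurling_kernel b z) (\<lambda>z. poissonc c z - poissonc d z) x"
proof -
  \<comment> \<open>One sequence of step sizes must suit both pairs of scales.\<close>
  define s where "s = min a c"
  have s: "0 < s" "s \<le> a" "s \<le> c" using ab cd by (auto simp: s_def)
  define h where "h n = s / (5 * real (Suc n))" for n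
  have h0: "h n \<noteq> 0" for n using s by (simp add: h_def)
  define \<phi> where "\<phi> M n z = (walk (hex (h n)) M z - M z) / of_real (pi * (h n)\<^sup>2)" for M :: "complex \<Rightarrow> complex" and n z
  define \<psi> where "\<psi> M n z = walk_op (hex (h n)) hexw M z / of_real (2 * pi * (h n)\<^sup>2)" for M n z
  define M1 M2 where "M1 = log_diff a b" and "M2 = log_diff c d"
  have M: "decaying M1" "decaying M2" unfolding M1_def M2_def by (intro decaying_log_diff ab cd)+
  have eq: "cconv (\<phi> M1 n) (\<psi> M2 n) x = cconv (\<psi> M1 n) (\<phi> M2 n) x" for n
  proof -
    define r t where "r = 1 / complex_of_real (pi * (h n)\<^sup>2)" and "t = 1 / complex_of_real (2 * pi * (h n)\<^sup>2)"
    have p: "\<phi> M n = (\<lambda>z. r * (walk (hex (h n)) M z - M z))" "\<psi> M n = (\<lambda>z. t * walk_op (hex (h n)) hexw M z)" for M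
      by (simp_all add: fun_eq_iff \<phi>_def \<psi>_def r_def t_def)
    have d: "decaying (\<lambda>z. walk (hex (h n)) M z - M z)" "decaying (walk_op (hex (h n)) hexw M)" if "decaying M" for M
      using that by (intro decaying_diff decaying_walk decaying_walk_op; assumption)+
    have "cconv (\<phi> M1 n) (\<psi> M2 n) x = r * (t * cconv (\<lambda>z. walk (hex (h n)) M1 z - M1 z) (walk_op (hex (h n)) hexw M2) x)"
      unfolding p cconv_decaying_linear(3)[OF d(1)[OF M(1)] decaying_cmult[OF d(2)[OF M(2)]]]
        cconv_decaying_linear(6)[OF d(1)[OF M(1)] d(2)[OF M(2)]] ..
    also have "\<dots> = t * (r * cconv (walk_op (hex (h n)) hexw M1) (\<lambda>z. walk (hex (h n)) M2 z - M2 z) x)"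
      unfolding walk_minus_walk_op_swap[OF M] by simp
    also have "\<dots> = cconv (\<psi> M1 n) (\<phi> M2 n) x"
      unfolding p cconv_decaying_linear(3)[OF d(2)[OF M(1)] decaying_cmult[OF d(1)[OF M(2)]]]
        cconv_decaying_linear(6)[OF d(2)[OF M(1)] d(1)[OF M(2)]] ..
    finally show ?thesis .
  qed
  have m: "\<phi> M n \<in> borel_measurable borel" "\<psi> M n \<in> borel_measurable borel" if "decaying M" for M n
  proof -
    have [measurable]: "M \<in> borel_measurable borel" "walk (hex (h n)) M \<in> borel_measurable borel"
      "walk_op (hex (h n)) hexw M \<in> borel_measurable borel"
      using that decaying_walk[OF that] decaying_walk_op[OF that] by (auto simp: decaying_def)
    show "\<phi> M n \<in> borel_measurable borel" "\<psi> M n \<in> borel_measurable borel"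
      unfolding \<phi>_def[abs_def] \<psi>_def[abs_def] by measurable
  qed
  note S1 = scaled_walk_log_diff[OF ab s(1,2), folded h_def[abs_def], folded M1_def]
  note S2 = scaled_walk_log_diff[OF cd s(1,3), folded h_def[abs_def], folded M2_def]
  obtain C1 where C1: "\<And>n z. norm (\<phi> M1 n z) \<le> C1 * decay z"
    using S1(1) unfolding h_def[symmetric] \<phi>_def by blast
  obtain C2 where C2: "\<And>n z. norm (\<psi> M1 n z) \<le> C2 * decay z"
    using S1(3) unfolding h_def[symmetric] \<psi>_def by blast
  obtain C3 where C3: "\<And>n z. norm (\<phi> M2 n z) \<le> C3 * decay z"
    using S2(1) unfolding h_def[symmetric] \<phi>_def by blast
  obtain C4 where C4: "\<And>n z. norm (\<psi> M2 n z) \<le> C4 * decay z"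
    using S2(3) unfolding h_def[symmetric] \<psi>_def by blast
  have l: "(\<lambda>n. \<phi> M1 n z) \<longlonglongrightarrow> poissonc a z - poissonc b z"
    "(\<lambda>n. \<psi> M1 n z) \<longlonglongrightarrow> beurling_kernel a z - beurling_kernel b z"
    "(\<lambda>n. \<phi> M2 n z) \<longlonglongrightarrow> poissonc c z - poissonc d z"
    "(\<lambda>n. \<psi> M2 n z) \<longlonglongrightarrow> beurling_kernel c z - beurling_kernel d z" for z
    using S1(2)[of z] S1(4)[of z] S2(2)[of z] S2(4)[of z] unfolding h_def[symmetric] \<phi>_def \<psi>_def by auto
  have bm: "(\<lambda>z. poissonc a z - poissonc b z) \<in> borel_measurable borel"
    "(\<lambda>z. beurling_kernel a z - beurling_kernel b z) \<in> borel_measurable borel" for a b by measurable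
  have "(\<lambda>n. cconv (\<phi> M1 n) (\<psi> M2 n) x) \<longlonglongrightarrow> cconv (\<lambda>z. poissonc a z - poissonc b z) (\<lambda>z. beurling_kernel c z - beurling_kernel d z) x"
    by (rule cconv_dominated_convergence[OF m(1)[OF M(1)] bm(1) m(2)[OF M(2)] bm(2) C1 C4 l(1) l(4)])
  moreover have "(\<lambda>n. cconv (\<psi> M1 n) (\<phi> M2 n) x) \<longlonglongrightarrow> cconv (\<lambda>z. beurling_kernel a z - beurling_kernel b z) (\<lambda>z. poissonc c z - poissonc d z) x"
    by (rule cconv_dominated_convergence[OF m(2)[OF M(1)] bm(2) m(1)[OF M(2)] bm(1) C2 C3 l(2) l(3)])
  ultimately show ?thesis unfolding eq by (rule LIMSEQ_unique)
qed

lemma cconv_commute: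
  assumes [measurable]: "\<kappa> \<in> borel_measurable borel" "\<rho> \<in> borel_measurable borel"
  shows "cconv \<kappa> \<rho> x = cconv \<rho> \<kappa> x"
  using lborel_integral_reflect[of "\<lambda>y. \<kappa> (x - y) * \<rho> y" x] by (simp add: cconv_def mult.commute)

text \<open>Formally both sides are the singular kernel smoothed at both scales. A common upper
  scale tends to infinity and removes the subtracted kernels from the identity for
  differences.\<close>

lemma poisson_beurling_swap:
  assumes a: "a > 0" and c: "c > 0"
  shows "cconv (poissonc a) (beurling_kernel c) x = cconv (poissonc c) (beurling_kernel a) x"
proof -
  \<comment> \<open>The upper scale must exceed a and c for the potentials; being at least 1, it
    bounds the decay constants 1 + 1 / (b n)^2 by 2.\<close>
  define b where "b n = a + c + 1 + real n" for n
  have b: "a \<le> b n" "c \<le> b n" "b n \<ge> 1" "b n > 0" for n using a c by (simp_all add: b_def)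
  have bb: "1 + 1 / (b n)\<^sup>2 \<le> 2" for n using b(3)[of n] by (simp add: divide_le_eq)
  have small: "1 / (pi * ((norm z)\<^sup>2 + (b n)\<^sup>2)) \<le> 1 / real (Suc n)" for n and z :: complex
  proof -
    have "real (Suc n) * 1 \<le> b n * b n" using a c by (intro mult_mono) (auto simp: b_def)
    then have "real (Suc n) \<le> (norm z)\<^sup>2 + (b n)\<^sup>2" by (simp add: power2_eq_square add_increasing)
    then have "1 * real (Suc n) \<le> pi * ((norm z)\<^sup>2 + (b n)\<^sup>2)" using pi_gt3 by (intro mult_mono) auto
    then show ?thesis by (intro divide_left_mono) (auto intro!: mult_pos_pos den_pos b)
  qed
  have lp: "(\<lambda>n. poissonc (b n) z) \<longlonglongrightarrow> 0" and lk: "(\<lambda>n. beurling_kernel (b n) z) \<longlonglongrightarrow> 0" for z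
  proof -
    have "norm (poissonc (b n) z) \<le> 1 / real (Suc n)" for n
      using poisson_le_recip[OF b(4)[of n], of z] small[of z n] by (simp add: poissonc_def)
    then show "(\<lambda>n. poissonc (b n) z) \<longlonglongrightarrow> 0"
      by (intro Lim_null_comparison[OF always_eventually LIMSEQ_Suc[OF lim_1_over_n]]) auto
    have "norm (beurling_kernel (b n) z) \<le> 1 / real (Suc n)" for n
      using norm_beurling_kernel[OF b(4)[of n], of z] small[of z n] by linarith
    then show "(\<lambda>n. beurling_kernel (b n) z) \<longlonglongrightarrow> 0"
      by (intro Lim_null_comparison[OF always_eventually LIMSEQ_Suc[OF lim_1_over_n]]) auto
  qed
  have lp': "(\<lambda>n. poissonc s z - poissonc (b n) z) \<longlonglongrightarrow> poissonc s z"
    and lk': "(\<lambda>n. beurling_kernel s z - beurling_kernel (b n) z) \<longlonglongrightarrow> beurling_kernel s z" for s z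
    using tendsto_diff[OF tendsto_const lp] tendsto_diff[OF tendsto_const lk] by auto
  have Cp: "norm (poissonc s z - poissonc (b n) z) \<le> (1 + 1 / s\<^sup>2 + 2) * decay z" if "s > 0" for s n z
    using norm_triangle_ineq4[of "poissonc s z" "poissonc (b n) z"] norm_poissonc_decay[OF that, of z]
      norm_poissonc_decay[OF b(4)[of n], of z] mult_right_mono[OF bb[of n] less_imp_le[OF decay_pos(1)[of z]]]
    by (simp only: distrib_right)
  have Ck: "norm (beurling_kernel s z - beurling_kernel (b n) z) \<le> (1 + 1 / s\<^sup>2 + 2) * decay z" if "s > 0" for s n z
    using norm_triangle_ineq4[of "beurling_kernel s z" "beurling_kernel (b n) z"] norm_beurling_kernel_decay[OF that, of z]
      norm_beurling_kernel_decay[OF b(4)[of n], of z] mult_right_mono[OF bb[of n] less_imp_le[OF decay_pos(1)[of z]]]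
    by (simp only: distrib_right)
  have mp: "(\<lambda>z. poissonc s z - poissonc (b n) z) \<in> borel_measurable borel"
    and mk: "(\<lambda>z. beurling_kernel s z - beurling_kernel (b n) z) \<in> borel_measurable borel" for s n by measurable
  have "(\<lambda>n. cconv (\<lambda>z. poissonc a z - poissonc (b n) z) (\<lambda>z. beurling_kernel c z - beurling_kernel (b n) z) x)
     \<longlonglongrightarrow> cconv (poissonc a) (beurling_kernel c) x"
    by (rule cconv_dominated_convergence[OF mp _ mk _ Cp[OF a] Ck[OF c] lp' lk']) auto
  moreover have "(\<lambda>n. cconv (\<lambda>z. beurling_kernel a z - beurling_kernel (b n) z) (\<lambda>z. poissonc c z - poissonc (b n) z) x)
     \<longlonglongrightarrow> cconv (beurling_kernel a) (poissonc c) x"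
    by (rule cconv_dominated_convergence[OF mk _ mp _ Ck[OF a] Cp[OF c] lk' lp']) auto
  ultimately have "cconv (poissonc a) (beurling_kernel c) x = cconv (beurling_kernel a) (poissonc c) x"
    unfolding poisson_beurling_swap_diff[OF a b(1) c b(2)] by (rule LIMSEQ_unique)
  also have "\<dots> = cconv (poissonc c) (beurling_kernel a) x" by (rule cconv_commute) auto
  finally show ?thesis .
qed

text \<open>Fubini's theorem applies although \<kappa> need not be integrable: the absolute integral
  against f is bounded uniformly in the point, and \<open>poisson\<close> has mass one.\<close>

lemma cconv_assoc:
  assumes a: "a > 0" and k: "decaying \<kappa>" and p: "p > 1" and f: "f \<in> lp_borel p"
  shows "cconv (poissonc a) (cconv \<kappa> f) z = cconv (cconv (poissonc a) \<kappa>) f z"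
proof -
  obtain C where C: "C \<ge> 0" "\<And>z. norm (\<kappa> z) \<le> C * decay z" and [measurable]: "\<kappa> \<in> borel_measurable borel"
    using decayingE[OF k] by metis
  have fm [measurable]: "f \<in> borel_measurable borel" using f by (simp add: lp_borel_def)
  obtain B where B: "\<And>x. (LINT y|lborel. decay (x - y) * norm (f y)) \<le> B" using integral_decay_mult_bounded[OF p f] by blast
  have B0: "B \<ge> 0"
  proof -
    have "0 \<le> (LINT y|lborel. decay (0 - y) * norm (f y))"
      by (intro integral_nonneg_AE AE_I2 mult_nonneg_nonneg less_imp_le[OF decay_pos(1)]) auto
    then show ?thesis using B[of 0] by linarith
  qed
  have inn: "(\<integral>\<^sup>+w. ennreal (norm (\<kappa> (y - w) * f w)) \<partial>lborel) \<le> ennreal (C * B)" for y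
  proof -
    have "(\<integral>\<^sup>+w. ennreal (norm (\<kappa> (y - w) * f w)) \<partial>lborel) \<le> (\<integral>\<^sup>+w. ennreal (C * (decay (y - w) * norm (f w))) \<partial>lborel)"
    proof (rule nn_integral_mono)
      fix w
      have "norm (\<kappa> (y - w)) * norm (f w) \<le> C * decay (y - w) * norm (f w)" by (intro mult_right_mono C) simp
      then show "ennreal (norm (\<kappa> (y - w) * f w)) \<le> ennreal (C * (decay (y - w) * norm (f w)))"
        by (intro ennreal_leI) (simp add: norm_mult mult.assoc)
    qed
    also have "\<dots> = ennreal (LINT w|lborel. C * (decay (y - w) * norm (f w)))"
      by (rule nn_integral_eq_integral) (use integrable_decay_mult[OF p f, of y] C decay_pos in \<open>auto intro!: AE_I2 mult_nonneg_nonneg less_imp_le[OF decay_pos(1)]\<close>)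
    also have "\<dots> \<le> ennreal (C * B)" using B[of y] C(1) by (intro ennreal_leI) (simp add: mult_left_mono)
    finally show ?thesis .
  qed
  have int: "integrable (lborel \<Otimes>\<^sub>M lborel) (\<lambda>(y, w). poissonc a (z - y) * (\<kappa> (y - w) * f w))"
  proof (rule integrableI_bounded)
    show "(\<lambda>(y, w). poissonc a (z - y) * (\<kappa> (y - w) * f w)) \<in> borel_measurable (lborel \<Otimes>\<^sub>M lborel)" by measurable
    have "(\<integral>\<^sup>+q. ennreal (norm (case q of (y, w) \<Rightarrow> poissonc a (z - y) * (\<kappa> (y - w) * f w))) \<partial>(lborel \<Otimes>\<^sub>M lborel))
       = (\<integral>\<^sup>+y. \<integral>\<^sup>+w. ennreal (norm (poissonc a (z - y) * (\<kappa> (y - w) * f w))) \<partial>lborel \<partial>lborel)"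
      by (subst lborel.nn_integral_fst[symmetric]) auto
    also have "\<dots> = (\<integral>\<^sup>+y. ennreal (poisson a (z - y)) * (\<integral>\<^sup>+w. ennreal (norm (\<kappa> (y - w) * f w)) \<partial>lborel) \<partial>lborel)"
      by (intro nn_integral_cong) (simp add: poissonc_def norm_mult ennreal_mult nn_integral_cmult)
    also have "\<dots> \<le> (\<integral>\<^sup>+y. ennreal (poisson a (z - y)) * ennreal (C * B) \<partial>lborel)"
      by (intro nn_integral_mono mult_left_mono inn) simp
    also have "\<dots> = (\<integral>\<^sup>+y. ennreal (poisson a (z - y)) \<partial>lborel) * ennreal (C * B)"
      by (rule nn_integral_multc) measurable
    also have "(\<integral>\<^sup>+y. ennreal (poisson a (z - y)) \<partial>lborel) = 1"
      using nn_integral_reflect[of "\<lambda>y. ennreal (poisson a y)" z] poisson_mass[OF a] by simp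
    finally show "(\<integral>\<^sup>+q. ennreal (norm (case q of (y, w) \<Rightarrow> poissonc a (z - y) * (\<kappa> (y - w) * f w))) \<partial>(lborel \<Otimes>\<^sub>M lborel)) < \<infinity>"
      by (simp add: le_less_trans[OF _ ennreal_less_top])
  qed
  from lborel_pair.Fubini_integral[OF int]
  have F: "(LINT w|lborel. LINT y|lborel. poissonc a (z - y) * (\<kappa> (y - w) * f w))
      = (LINT y|lborel. LINT w|lborel. poissonc a (z - y) * (\<kappa> (y - w) * f w))" .
  have e1: "(LINT w|lborel. poissonc a (z - y) * (\<kappa> (y - w) * f w)) = poissonc a (z - y) * cconv \<kappa> f y" for y
    unfolding cconv_def by simp
  have e2: "(LINT y|lborel. poissonc a (z - y) * (\<kappa> (y - w) * f w)) = cconv (poissonc a) \<kappa> (z - w) * f w" for w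
  proof -
    have "(LINT y|lborel. poissonc a (z - y) * (\<kappa> (y - w) * f w)) = (LINT y|lborel. (poissonc a (z - y) * \<kappa> (y - w)) * f w)"
      by (simp add: mult.assoc)
    also have "\<dots> = (LINT y|lborel. poissonc a (z - y) * \<kappa> (y - w)) * f w" by simp
    also have "(LINT y|lborel. poissonc a (z - y) * \<kappa> (y - w)) = (LINT y|lborel. poissonc a (z - (y + w)) * \<kappa> (y + w - w))"
      by (rule lborel_integral_shift[symmetric]) measurable
    also have "\<dots> = cconv (poissonc a) \<kappa> (z - w)" unfolding cconv_def by (simp add: algebra_simps)
    finally show ?thesis .
  qed
  have "cconv (poissonc a) (cconv \<kappa> f) z = (LINT y|lborel. LINT w|lborel. poissonc a (z - y) * (\<kappa> (y - w) * f w))"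
    unfolding e1 by (simp add: cconv_def[of "poissonc a"])
  also have "\<dots> = (LINT w|lborel. LINT y|lborel. poissonc a (z - y) * (\<kappa> (y - w) * f w))" by (rule F[symmetric])
  also have "\<dots> = cconv (cconv (poissonc a) \<kappa>) f z" unfolding e2 by (simp add: cconv_def[of "cconv (poissonc a) \<kappa>"])
  finally show ?thesis .
qed

text \<open>To be read with c tending to 0: one side averages an almost unsmoothed transform, the
  other tends to the transform at scale a. This is the mechanism behind Cotlar's inequality.\<close>

lemma poisson_beurling_transform_swap:
  assumes a: "a > 0" and c: "c > 0" and p: "p > 1" and f: "f \<in> lp_borel p"
  shows "cconv (poissonc a) (cconv (beurling_kernel c) f) z = cconv (poissonc c) (cconv (beurling_kernel a) f) z"
proof -
  have "cconv (poissonc a) (beurling_kernel c) = cconv (poissonc c) (beurling_kernel a)"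
    by (rule ext) (rule poisson_beurling_swap[OF a c])
  then show ?thesis
    unfolding cconv_assoc[OF a decaying_beurling_kernel[OF c] p f] cconv_assoc[OF c decaying_beurling_kernel[OF a] p f]
    by simp
qed

subsection \<open>Maximal estimates\<close>

lemma integrable_poisson: "a > 0 \<Longrightarrow> integrable lborel (poisson a)"
  by (rule integrableI_bounded) (auto simp: poisson_mass)

lemma integral_poisson: "a > 0 \<Longrightarrow> (LINT y|lborel. poisson a y) = 1"
  using nn_integral_eq_integral[OF integrable_poisson, of a] by (simp add: poisson_mass)

text \<open>For |w| >= d the sum |w|^2 + d^2 is at most 2 |w|^2, whence the 4. Tails of a narrow
  kernel are thus estimated by a wide one without a further integration.\<close>

lemma poisson_tail:
  assumes "c > 0" "d > 0" "norm w \<ge> d"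
  shows "poisson c w \<le> (4 * c\<^sup>2 / d\<^sup>2) * poisson d w"
proof -
  have w: "norm w > 0" using assms by linarith
  have dw: "d\<^sup>2 \<le> (norm w)\<^sup>2" using assms by (intro power_mono) auto
  have "poisson c w \<le> c\<^sup>2 / (pi * ((norm w)\<^sup>2)\<^sup>2)"
    unfolding poisson_def using assms w den_pos[of c w]
    by (intro divide_left_mono mult_left_mono power_mono mult_pos_pos zero_less_power) auto
  also have "\<dots> = (4 * c\<^sup>2 / d\<^sup>2) * (d\<^sup>2 / (pi * (2 * (norm w)\<^sup>2)\<^sup>2))"
    using assms w by (simp add: power_mult_distrib)
  also have "\<dots> \<le> (4 * c\<^sup>2 / d\<^sup>2) * (d\<^sup>2 / (pi * ((norm w)\<^sup>2 + d\<^sup>2)\<^sup>2))"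
    using assms w dw den_pos[of d w] by (intro mult_left_mono divide_left_mono power_mono mult_pos_pos zero_less_power) auto
  finally show ?thesis by (simp add: poisson_def)
qed

text \<open>An approximate identity at a point of continuity: within distance d the oscillation of u
  is at most e, and outside \<open>poisson_tail\<close> gives a term of order c^2 / d^2.\<close>

lemma cconv_poissonc_tendsto:
  assumes [measurable]: "u \<in> borel_measurable borel" and B: "\<And>y. norm (u y) \<le> B" and cont: "isCont u z"
  shows "(\<lambda>n. cconv (poissonc (1 / real (Suc n))) u z) \<longlonglongrightarrow> u z"
proof -
  have B0: "B \<ge> 0" using B[of 0] norm_ge_zero order_trans by blast
  have est: "norm (cconv (poissonc c) u z - u z) \<le> e + 8 * B * c\<^sup>2 / d\<^sup>2"
    if c: "c > 0" and d: "d > 0" and e: "e \<ge> 0" "\<And>y. norm (z - y) < d \<Longrightarrow> norm (u y - u z) \<le> e" for c d e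
  proof -
    have ri: "integrable lborel (\<lambda>y. poisson s (z - y))" if "s > 0" for s
      by (rule lborel_integrable_reflect[OF integrable_poisson[OF that]])
    have r1: "(LINT y|lborel. poisson s (z - y)) = 1" if "s > 0" for s
      using lborel_integral_reflect[of "poisson s" z] integral_poisson[OF that] by simp
    have iu: "integrable lborel (\<lambda>y. poissonc c (z - y) * u y)"
    proof (rule Bochner_Integration.integrable_bound)
      show "integrable lborel (\<lambda>y. B * poisson c (z - y))" using ri[OF c] by simp
      show "AE y in lborel. norm (poissonc c (z - y) * u y) \<le> norm (B * poisson c (z - y))"
      proof (rule AE_I2)
        fix y
        have "poisson c (z - y) * norm (u y) \<le> poisson c (z - y) * B" by (intro mult_left_mono B) simp
        then show "norm (poissonc c (z - y) * u y) \<le> norm (B * poisson c (z - y))"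
          using B0 by (simp add: poissonc_def norm_mult mult.commute abs_mult)
      qed
    qed measurable
    have ic: "integrable lborel (\<lambda>y. poissonc c (z - y) * u z)"
      unfolding poissonc_def using ri[OF c] by (intro integrable_mult_left integrable_of_real)
    have "(LINT y|lborel. poissonc c (z - y) * u z) = u z"
      using r1[OF c] unfolding poissonc_def by (simp add: integral_complex_of_real)
    then have "cconv (poissonc c) u z - u z = (LINT y|lborel. poissonc c (z - y) * u y - poissonc c (z - y) * u z)"
      using iu ic by (simp add: cconv_def)
    also have "norm \<dots> \<le> (LINT y|lborel. norm (poissonc c (z - y) * u y - poissonc c (z - y) * u z))"
      by (rule integral_norm_bound)
    also have "\<dots> \<le> (LINT y|lborel. e * poisson c (z - y) + (2 * B) * ((4 * c\<^sup>2 / d\<^sup>2) * poisson d (z - y)))"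
    proof (rule integral_mono)
      show "integrable lborel (\<lambda>y. norm (poissonc c (z - y) * u y - poissonc c (z - y) * u z))" using iu ic by auto
      show "integrable lborel (\<lambda>y. e * poisson c (z - y) + (2 * B) * ((4 * c\<^sup>2 / d\<^sup>2) * poisson d (z - y)))"
        using ri[OF c] ri[OF d] by auto
      fix y
      have n: "norm (poissonc c (z - y) * u y - poissonc c (z - y) * u z) = poisson c (z - y) * norm (u y - u z)"
        by (simp add: poissonc_def norm_mult flip: right_diff_distrib)
      show "norm (poissonc c (z - y) * u y - poissonc c (z - y) * u z) \<le> e * poisson c (z - y) + (2 * B) * ((4 * c\<^sup>2 / d\<^sup>2) * poisson d (z - y))"
      proof (cases "norm (z - y) < d")
        case True
        have "poisson c (z - y) * norm (u y - u z) \<le> poisson c (z - y) * e" by (intro mult_left_mono e True) simp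
        moreover have "0 \<le> (2 * B) * ((4 * c\<^sup>2 / d\<^sup>2) * poisson d (z - y))" using B0 by simp
        ultimately show ?thesis unfolding n by (simp add: mult.commute)
      next
        case False
        have "norm (u y - u z) \<le> 2 * B" using norm_triangle_ineq4[of "u y" "u z"] B[of y] B[of z] by linarith
        moreover have "poisson c (z - y) \<le> (4 * c\<^sup>2 / d\<^sup>2) * poisson d (z - y)"
          using False by (intro poisson_tail c d) auto
        ultimately have "poisson c (z - y) * norm (u y - u z) \<le> ((4 * c\<^sup>2 / d\<^sup>2) * poisson d (z - y)) * (2 * B)"
          by (intro mult_mono) auto
        moreover have "0 \<le> e * poisson c (z - y)" using e(1) by simp
        ultimately show ?thesis unfolding n by (simp add: mult.commute)
      qed
    qed
    also have "\<dots> = e + 8 * B * c\<^sup>2 / d\<^sup>2"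
      using ri[OF c] ri[OF d] r1[OF c] r1[OF d] by simp
    finally show ?thesis .
  qed
  show ?thesis
  proof (rule LIMSEQ_I)
    fix r :: real assume r: "r > 0"
    obtain d where d: "d > 0" "\<And>y. dist y z < d \<Longrightarrow> dist (u y) (u z) < r / 3"
      using cont r unfolding continuous_at_eps_delta by (metis divide_pos_pos zero_less_numeral)
    have "(\<lambda>n. 8 * B * (1 / real (Suc n))\<^sup>2 / d\<^sup>2) \<longlonglongrightarrow> 8 * B * 0\<^sup>2 / d\<^sup>2"
      by (intro tendsto_intros LIMSEQ_Suc[OF lim_1_over_n]) (use d in auto)
    then have "\<forall>\<^sub>F n in sequentially. 8 * B * (1 / real (Suc n))\<^sup>2 / d\<^sup>2 < r / 3"
      using r by (intro order_tendstoD(2)) auto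
    then obtain N where N: "\<And>n. n \<ge> N \<Longrightarrow> 8 * B * (1 / real (Suc n))\<^sup>2 / d\<^sup>2 < r / 3"
      by (auto simp: eventually_sequentially)
    show "\<exists>N. \<forall>n\<ge>N. norm (cconv (poissonc (1 / real (Suc n))) u z - u z) < r"
    proof (intro exI allI impI)
      fix n assume n: "n \<ge> N"
      have "norm (cconv (poissonc (1 / real (Suc n))) u z - u z) \<le> r / 3 + 8 * B * (1 / real (Suc n))\<^sup>2 / d\<^sup>2"
        using d r by (intro est) (auto simp: dist_norm norm_minus_commute less_imp_le)
      also have "\<dots> < r" using N[OF n] r by linarith
      finally show "norm (cconv (poissonc (1 / real (Suc n))) u z - u z) < r" .
    qed
  qed
qed

text \<open>Bounded and continuous transforms are recovered at every point, not just almost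
  everywhere, from their Poisson averages.\<close>

lemma decaying_transform:
  assumes k: "decaying \<kappa>" and p: "p > 1" and f: "f \<in> lp_borel p"
  shows "\<exists>B. \<forall>x. norm (cconv \<kappa> f x) \<le> B"
    and "(\<And>x. isCont \<kappa> x) \<Longrightarrow> isCont (cconv \<kappa> f) z"
proof -
  obtain C where C: "C \<ge> 0" "\<And>z. norm (\<kappa> z) \<le> C * decay z" and km [measurable]: "\<kappa> \<in> borel_measurable borel"
    using decayingE[OF k] by metis
  have fm [measurable]: "f \<in> borel_measurable borel" using f by (simp add: lp_borel_def)
  obtain B where B: "\<And>x. (LINT y|lborel. decay (x - y) * norm (f y)) \<le> B" using integral_decay_mult_bounded[OF p f] by blast
  have le: "norm (\<kappa> (x - y) * f y) \<le> C * (decay (x - y) * norm (f y))" for x y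
    using mult_right_mono[OF C(2)[of "x - y"] norm_ge_zero[of "f y"]] by (simp add: norm_mult mult.assoc)
  show "\<exists>B. \<forall>x. norm (cconv \<kappa> f x) \<le> B"
  proof (intro exI allI)
    fix x
    have "norm (cconv \<kappa> f x) \<le> (LINT y|lborel. norm (\<kappa> (x - y) * f y))" unfolding cconv_def by (rule integral_norm_bound)
    also have "\<dots> \<le> (LINT y|lborel. C * (decay (x - y) * norm (f y)))"
      by (intro integral_mono le integrable_norm integrable_kernel_mult[OF p f km C(2)] integrable_mult_right integrable_decay_mult[OF p f])
    also have "\<dots> \<le> C * B" using B[of x] C(1) by (simp add: mult_left_mono)
    finally show "norm (cconv \<kappa> f x) \<le> C * B" .
  qed
  assume cont: "\<And>x. isCont \<kappa> x"
  show "isCont (cconv \<kappa> f) z"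
    unfolding continuous_at_sequentially
  proof (intro allI impI, unfold comp_def)
    fix s :: "nat \<Rightarrow> complex" assume "(s \<longlonglongrightarrow> z)"
    then have s: "s \<longlonglongrightarrow> z" .
    then have "Bseq (\<lambda>n. s n - z)" by (intro convergent_imp_Bseq) (auto simp: convergent_def intro!: tendsto_intros)
    then obtain R where R: "\<And>n. norm (s n - z) \<le> R" by (auto simp: Bseq_def)
    \<comment> \<open>The sequence stays within R of z, so \<open>decay_shift\<close> provides one
      integrable majorant for all shifted kernels.\<close>
    define Q where "Q = C * (2 * (1 + R\<^sup>2))"
    show "(\<lambda>n. cconv \<kappa> f (s n)) \<longlonglongrightarrow> cconv \<kappa> f z"
      unfolding cconv_def
    proof (rule integral_dominated_convergence[where w = "\<lambda>y. Q * (decay (z - y) * norm (f y))"])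
      show "integrable lborel (\<lambda>y. Q * (decay (z - y) * norm (f y)))"
        by (intro integrable_mult_right integrable_decay_mult[OF p f])
      show "AE y in lborel. (\<lambda>n. \<kappa> (s n - y) * f y) \<longlonglongrightarrow> \<kappa> (z - y) * f y"
        by (intro AE_I2 tendsto_mult tendsto_const isCont_tendsto_compose[OF cont] tendsto_diff s)
      show "AE y in lborel. norm (\<kappa> (s n - y) * f y) \<le> Q * (decay (z - y) * norm (f y))" for n
      proof (rule AE_I2)
        fix y
        have "decay (s n - y) \<le> 2 * (1 + (norm (s n - z))\<^sup>2) * decay (z - y)"
          using decay_shift[of "z - y" "s n - z"] by simp
        also have "\<dots> \<le> 2 * (1 + R\<^sup>2) * decay (z - y)"
          using R[of n] less_imp_le[OF decay_pos(1)] by (intro mult_right_mono mult_left_mono add_left_mono power_mono) auto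
        finally have "C * decay (s n - y) \<le> Q * decay (z - y)"
          using mult_left_mono[OF _ C(1)] by (fastforce simp: Q_def mult.assoc)
        then have "C * decay (s n - y) * norm (f y) \<le> Q * decay (z - y) * norm (f y)" by (rule mult_right_mono) simp
        then show "norm (\<kappa> (s n - y) * f y) \<le> Q * (decay (z - y) * norm (f y))"
          using le[of "s n" y] by (simp add: mult.assoc)
      qed
    qed measurable
  qed
qed

lemma isCont_beurling_kernel: "a > 0 \<Longrightarrow> isCont (beurling_kernel a) z"
  unfolding beurling_kernel_def[abs_def] using den_pos[of a z]
  by (intro continuous_intros) (auto simp del: of_real_mult of_real_power of_real_add)

text \<open>One exceptional set serves all scales a, because the bound for discs in
  \<open>hardy_littlewood\<close> passes to every Poisson average.\<close>

lemma maximal_average: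
  fixes u :: "complex \<Rightarrow> ennreal"
  assumes [measurable]: "u \<in> borel_measurable borel" and fin: "(\<integral>\<^sup>+y. u y \<partial>lborel) \<le> ennreal A"
    and l: "l > 0" and A: "A \<ge> 0"
  obtains U where "U \<in> sets borel" "emeasure lborel U \<le> ennreal (25 * A / l)"
    "\<And>z a. z \<notin> U \<Longrightarrow> a > 0 \<Longrightarrow> (\<integral>\<^sup>+y. ennreal (poisson a (z - y)) * u y \<partial>lborel) \<le> ennreal l"
proof -
  obtain U where U: "U \<in> sets borel" "emeasure lborel U \<le> ennreal (25 * A / l)"
    "\<And>z t. t > 0 \<Longrightarrow> (\<integral>\<^sup>+y. u y * indicator (cball z t) y \<partial>lborel) > ennreal l * ennreal (pi * t\<^sup>2) \<Longrightarrow> z \<in> U"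
    using hardy_littlewood[OF assms(1) fin l A] by blast
  show ?thesis
  proof (rule that[OF U(1,2)])
    fix z a assume z: "z \<notin> U" and a: "(a::real) > 0"
    show "(\<integral>\<^sup>+y. ennreal (poisson a (z - y)) * u y \<partial>lborel) \<le> ennreal l"
      using U(3)[of _ z] z by (intro poisson_average_le a) (auto simp: not_less[symmetric])
  qed
qed

lemma powr_le_cancel:
  fixes x y p :: real
  assumes "x powr p \<le> y powr p" "x \<ge> 0" "y \<ge> 0" "p > 0"
  shows "x \<le> y"
  using assms powr_less_mono2[of p y x] by (meson linorder_not_less)

text \<open>Jensen's inequality for the probability kernel reduces averages of u to averages of its
  p-th power, to which the weak type inequality applies.\<close>

lemma poisson_average_powr:
  fixes u :: "complex \<Rightarrow> real"
  assumes a: "a > 0" and p: "p > 1" and [measurable]: "u \<in> borel_measurable borel" and u: "\<And>y. u y \<ge> 0"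
    and l: "l > 0" and N: "N \<ge> 0" "ennreal N \<le> (\<integral>\<^sup>+y. ennreal (poisson a (z - y) * u y) \<partial>lborel)"
    and le: "(\<integral>\<^sup>+y. ennreal (poisson a (z - y)) * ennreal (u y powr p) \<partial>lborel) \<le> ennreal (l powr p)"
  shows "N \<le> l"
proof -
  have mass: "(\<integral>\<^sup>+y. ennreal (poisson a (z - y)) \<partial>lborel) \<le> ennreal 1"
    using nn_integral_reflect[of "\<lambda>y. ennreal (poisson a y)" z] poisson_mass[OF a] by simp
  have "ennreal (N powr p) \<le> ennreal (1 powr (p - 1)) * (\<integral>\<^sup>+y. ennreal (poisson a (z - y) * u y powr p) \<partial>lborel)"
    by (rule nn_integral_jensen[OF _ _ _ u p _ mass N]) auto
  also have "\<dots> \<le> ennreal (l powr p)" using le by (simp add: ennreal_mult)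
  finally have "N powr p \<le> l powr p" by simp
  then show ?thesis using N l p by (intro powr_le_cancel[of N p l]) auto
qed

lemma lp_borel_nn_integral:
  "f \<in> lp_borel p \<Longrightarrow> (\<integral>\<^sup>+y. ennreal (norm (f y) powr p) \<partial>lborel) = ennreal (LINT y|lborel. norm (f y) powr p)"
  by (intro nn_integral_eq_integral) (auto simp: lp_borel_def)

lemma maximal_poisson:
  assumes p: "p > 1" and f: "f \<in> lp_borel p" and l: "l > 0"
  obtains U where "U \<in> sets borel" "emeasure lborel U \<le> ennreal (25 * (LINT y|lborel. norm (f y) powr p) / l powr p)"
    "\<And>z a. z \<notin> U \<Longrightarrow> a > 0 \<Longrightarrow> (LINT y|lborel. poisson a (z - y) * norm (f y)) \<le> l"
proof -
  have [measurable]: "f \<in> borel_measurable borel" using f by (simp add: lp_borel_def)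
  have A0: "(LINT y|lborel. norm (f y) powr p) \<ge> 0" by (auto intro!: integral_nonneg_AE)
  obtain U where U: "U \<in> sets borel" "emeasure lborel U \<le> ennreal (25 * (LINT y|lborel. norm (f y) powr p) / l powr p)"
    "\<And>z a. z \<notin> U \<Longrightarrow> a > 0 \<Longrightarrow> (\<integral>\<^sup>+y. ennreal (poisson a (z - y)) * ennreal (norm (f y) powr p) \<partial>lborel) \<le> ennreal (l powr p)"
    using maximal_average[of "\<lambda>y. ennreal (norm (f y) powr p)" "LINT y|lborel. norm (f y) powr p" "l powr p"]
      lp_borel_nn_integral[OF f] l A0 by auto
  show ?thesis
  proof (rule that[OF U(1,2)])
    fix z a assume z: "z \<notin> U" and a: "(a::real) > 0"
    have "integrable lborel (\<lambda>y. poissonc a (z - y) * f y)"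
      by (rule integrable_kernel_mult[OF p f _ norm_poissonc_decay[OF a]]) auto
    from integrable_norm[OF this] have i: "integrable lborel (\<lambda>y. poisson a (z - y) * norm (f y))"
      by (simp add: norm_mult poissonc_def)
    show "(LINT y|lborel. poisson a (z - y) * norm (f y)) \<le> l"
    proof (rule poisson_average_powr[OF a p _ _ l _ _ U(3)[OF z a]])
      show "ennreal (LINT y|lborel. poisson a (z - y) * norm (f y)) \<le> (\<integral>\<^sup>+y. ennreal (poisson a (z - y) * norm (f y)) \<partial>lborel)"
        using i by (subst nn_integral_eq_integral) auto
    qed (auto intro!: integral_nonneg_AE)
  qed
qed

text \<open>The transform at scale c n has a weak type exceptional set U n. At z outside U n the
  exchange of scales bounds, for every a at once, the Poisson average at scale c n of the transform
  at scale a. As c n tends to 0 these averages tend to the value at z.\<close>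

lemma maximal_beurling:
  assumes p: "p > 1" and pq: "1/p + 1/q = 1" and f: "f \<in> lp_borel p" and l: "l > 0"
  obtains U where "U \<in> sets borel"
    "emeasure lborel U \<le> ennreal (25 * ((2 * (max p q - 1)) powr p * (LINT y|lborel. norm (f y) powr p)) / l powr p)"
    "\<And>z a. z \<notin> U \<Longrightarrow> a > 0 \<Longrightarrow> norm (cconv (beurling_kernel a) f z) \<le> l"
proof -
  have [measurable]: "f \<in> borel_measurable borel" using f by (simp add: lp_borel_def)
  define A where "A = (2 * (max p q - 1)) powr p * (LINT y|lborel. norm (f y) powr p)"
  have A0: "A \<ge> 0" unfolding A_def by (auto intro!: integral_nonneg_AE mult_nonneg_nonneg)
  define c where "c n = 1 / real (Suc n)" for n
  have c: "c n > 0" for n by (simp add: c_def)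
  define T where "T n = cconv (beurling_kernel (c n)) f" for n
  have Tm [measurable]: "T n \<in> borel_measurable borel" for n unfolding T_def by measurable
  have lp: "l powr p > 0" using l by simp
  have Um: "(\<lambda>y. ennreal (norm (T n y) powr p)) \<in> borel_measurable borel" for n by measurable
  have Tle: "(\<integral>\<^sup>+y. ennreal (norm (T n y) powr p) \<partial>lborel) \<le> ennreal A" for n
    unfolding T_def A_def by (rule beurling_norm[OF p pq f c])
  have "\<forall>n. \<exists>U. U \<in> sets borel \<and> emeasure lborel U \<le> ennreal (25 * A / l powr p) \<and>
    (\<forall>z a. z \<notin> U \<longrightarrow> a > 0 \<longrightarrow> (\<integral>\<^sup>+y. ennreal (poisson a (z - y)) * ennreal (norm (T n y) powr p) \<partial>lborel) \<le> ennreal (l powr p))"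
  proof
    fix n
    show "\<exists>U. U \<in> sets borel \<and> emeasure lborel U \<le> ennreal (25 * A / l powr p) \<and>
      (\<forall>z a. z \<notin> U \<longrightarrow> a > 0 \<longrightarrow> (\<integral>\<^sup>+y. ennreal (poisson a (z - y)) * ennreal (norm (T n y) powr p) \<partial>lborel) \<le> ennreal (l powr p))"
      by (rule maximal_average[OF Um[of n] Tle[of n] lp A0]) blast
  qed
  from choice[OF this] obtain U where U: "\<And>n. U n \<in> sets borel" "\<And>n. emeasure lborel (U n) \<le> ennreal (25 * A / l powr p)"
    "\<And>n z a. z \<notin> U n \<Longrightarrow> a > 0 \<Longrightarrow> (\<integral>\<^sup>+y. ennreal (poisson a (z - y)) * ennreal (norm (T n y) powr p) \<partial>lborel) \<le> ennreal (l powr p)"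
    by blast
  \<comment> \<open>The union of the W N consists of the points lying in all but finitely many U n.
    By monotone continuity it obeys the common measure bound, and a point outside it avoids
    infinitely many U n, which suffices for the limit.\<close>
  define W where "W N = (\<Inter>n\<in>{N..}. U n)" for N
  have Ws: "W N \<in> sets borel" for N unfolding W_def using U(1) by (intro sets.countable_INT'') auto
  have Wi: "incseq W" unfolding W_def by (intro monoI) (auto simp: le_fun_def)
  show ?thesis
  proof (rule that[of "\<Union>N. W N"])
    show "(\<Union>N. W N) \<in> sets borel" using Ws by auto
    have "emeasure lborel (\<Union>N. W N) = (SUP N. emeasure lborel (W N))"
      using Ws Wi by (intro SUP_emeasure_incseq[symmetric]) auto
    also have "\<dots> \<le> ennreal (25 * A / l powr p)"
    proof (rule SUP_least)
      fix N
      have "emeasure lborel (W N) \<le> emeasure lborel (U N)" using U(1) by (intro emeasure_mono) (auto simp: W_def)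
      also have "\<dots> \<le> ennreal (25 * A / l powr p)" by (rule U(2))
      finally show "emeasure lborel (W N) \<le> ennreal (25 * A / l powr p)" .
    qed
    finally show "emeasure lborel (\<Union>N. W N) \<le> ennreal (25 * ((2 * (max p q - 1)) powr p * (LINT y|lborel. norm (f y) powr p)) / l powr p)"
      unfolding A_def .
    fix z a assume z: "z \<notin> (\<Union>N. W N)" and a: "(a::real) > 0"
    have inf: "\<exists>n\<ge>N. z \<notin> U n" for N using z by (auto simp: W_def)
    define Ta where "Ta = cconv (beurling_kernel a) f"
    have Tam [measurable]: "Ta \<in> borel_measurable borel" unfolding Ta_def by measurable
    obtain B where B: "\<And>x. norm (Ta x) \<le> B"
      using decaying_transform(1)[OF decaying_beurling_kernel[OF a] p f] unfolding Ta_def by blast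
    have "isCont Ta z" unfolding Ta_def
      by (rule decaying_transform(2)[OF decaying_beurling_kernel[OF a] p f isCont_beurling_kernel[OF a]])
    then have lim: "(\<lambda>n. norm (cconv (poissonc (c n)) Ta z)) \<longlonglongrightarrow> norm (Ta z)"
      unfolding c_def by (intro tendsto_norm cconv_poissonc_tendsto[OF Tam B])
    have le: "norm (cconv (poissonc (c n)) Ta z) \<le> l" if "z \<notin> U n" for n
    proof -
      have "norm (cconv (poissonc a) (T n) z) \<le> l"
      proof (rule poisson_average_powr[OF a p _ _ l _ _ U(3)[OF that a]])
        show "ennreal (norm (cconv (poissonc a) (T n) z)) \<le> (\<integral>\<^sup>+y. ennreal (poisson a (z - y) * norm (T n y)) \<partial>lborel)"
          using norm_cconv_le[of "poissonc a" "T n" z] by (simp add: poissonc_def)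
      qed auto
      then show ?thesis
        unfolding T_def Ta_def poisson_beurling_transform_swap[OF a c p f] .
    qed
    have "norm (Ta z) \<le> l"
    proof (rule ccontr)
      assume "\<not> norm (Ta z) \<le> l"
      then have "\<forall>\<^sub>F n in sequentially. norm (cconv (poissonc (c n)) Ta z) > l"
        using lim by (intro order_tendstoD(1)) auto
      then obtain N where N: "\<And>n. n \<ge> N \<Longrightarrow> norm (cconv (poissonc (c n)) Ta z) > l"
        by (auto simp: eventually_sequentially)
      obtain n where "n \<ge> N" "z \<notin> U n" using inf by blast
      with N[of n] le[of n] show False by simp
    qed
    then show "norm (cconv (beurling_kernel a) f z) \<le> l" unfolding Ta_def .
  qed
qed

subsection \<open>Truncated kernels\<close>

definition trunc_kernel :: "real \<Rightarrow> complex \<Rightarrow> complex" where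
  "trunc_kernel e w = (if norm w > e then - 1 / (of_real pi * w\<^sup>2) else 0)"

lemma borel_measurable_trunc_kernel [measurable]: "trunc_kernel e \<in> borel_measurable borel"
  unfolding trunc_kernel_def[abs_def] by measurable

lemma trunc_kernel_decay:
  assumes e: "e > 0"
  shows "norm (trunc_kernel e w) \<le> (1 + 1 / e\<^sup>2) * decay w"
proof (cases "norm w > e")
  case True
  have w: "norm w > 0" using True e by linarith
  have ew: "e\<^sup>2 \<le> (norm w)\<^sup>2" using True e by (intro power_mono) auto
  have "norm (trunc_kernel e w) = 1 / (pi * (norm w)\<^sup>2)"
    using True by (simp add: trunc_kernel_def norm_divide norm_mult norm_power)
  also have "\<dots> \<le> 1 / (1 * (norm w)\<^sup>2)" using w pi_gt3 by (intro divide_left_mono mult_right_mono mult_pos_pos) auto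
  also have "\<dots> \<le> (1 + 1 / e\<^sup>2) * decay w"
  proof -
    have "1 / (norm w)\<^sup>2 \<le> 1 / e\<^sup>2" using ew e w by (intro divide_left_mono) auto
    then have "(1 + 1 / (norm w)\<^sup>2) * decay w \<le> (1 + 1 / e\<^sup>2) * decay w"
      using decay_pos(1)[of w] by (intro mult_right_mono) auto
    moreover have "(1 + 1 / (norm w)\<^sup>2) * decay w = 1 / (norm w)\<^sup>2"
      using w den_pos[of 1 w] by (simp add: decay_def field_simps)
    ultimately show ?thesis by simp
  qed
  finally show ?thesis .
qed (use decay_pos(1)[of w] in \<open>simp add: trunc_kernel_def\<close>)

text \<open>Inside the disc only the smoothed kernel is left. Outside, the two kernels have the same
  direction and their moduli have ratio |w|^4 / (|w|^2 + e^2)^2, which differs from 1 by at most 3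
  e^2 |w|^2 / (|w|^2 + e^2)^2.\<close>

lemma trunc_kernel_diff:
  assumes e: "e > 0"
  shows "norm (trunc_kernel e w - beurling_kernel e w) \<le> 3 * poisson e w"
proof -
  define d where "d = (norm w)\<^sup>2 + e\<^sup>2"
  have d: "d > 0" using den_pos[OF e] by (simp add: d_def)
  have nb: "norm (beurling_kernel e w) = (norm w)\<^sup>2 / (pi * d\<^sup>2)"
    unfolding beurling_kernel_def norm_divide norm_of_real by (simp add: norm_power d_def)
  show ?thesis
  proof (cases "norm w > e")
    case True
    have w: "norm w > 0" "w \<noteq> 0" using True e by auto
    have ew: "e\<^sup>2 \<le> (norm w)\<^sup>2" using True e by (intro power_mono) auto
    have cw: "(cnj w)\<^sup>2 = of_real (((norm w)\<^sup>2)\<^sup>2) / w\<^sup>2"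
    proof -
      have "(cnj w)\<^sup>2 * w\<^sup>2 = (of_real ((norm w)\<^sup>2))\<^sup>2"
        using complex_norm_square[of w] by (simp add: power_mult_distrib[symmetric] mult.commute)
      then show ?thesis using w by (simp add: field_simps)
    qed
    have "trunc_kernel e w - beurling_kernel e w = - (1 / (of_real pi * w\<^sup>2)) * of_real (1 - ((norm w)\<^sup>2)\<^sup>2 / d\<^sup>2)"
      using True w d unfolding trunc_kernel_def beurling_kernel_def cw d_def[symmetric]
      by (simp add: field_simps)
    then have "norm (trunc_kernel e w - beurling_kernel e w) = (1 / (pi * (norm w)\<^sup>2)) * \<bar>1 - ((norm w)\<^sup>2)\<^sup>2 / d\<^sup>2\<bar>"
      by (simp only: norm_mult norm_minus_cancel norm_divide norm_of_real norm_power) simp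
    also have "1 - ((norm w)\<^sup>2)\<^sup>2 / d\<^sup>2 = e\<^sup>2 * (2 * (norm w)\<^sup>2 + e\<^sup>2) / d\<^sup>2"
      using d by (simp add: field_simps) (simp add: d_def eval_nat_numeral algebra_simps)
    also have "\<bar>e\<^sup>2 * (2 * (norm w)\<^sup>2 + e\<^sup>2) / d\<^sup>2\<bar> = e\<^sup>2 * (2 * (norm w)\<^sup>2 + e\<^sup>2) / d\<^sup>2" by simp
    also have "\<dots> \<le> e\<^sup>2 * (3 * (norm w)\<^sup>2) / d\<^sup>2" using ew by (intro divide_right_mono mult_left_mono) auto
    also have "(1 / (pi * (norm w)\<^sup>2)) * (e\<^sup>2 * (3 * (norm w)\<^sup>2) / d\<^sup>2) = 3 * poisson e w"
      using w by (simp add: poisson_def d_def)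
    finally show ?thesis using w by (simp add: divide_right_mono)
  next
    case False
    then have we: "(norm w)\<^sup>2 \<le> e\<^sup>2" by (intro power_mono) auto
    have "norm (trunc_kernel e w - beurling_kernel e w) = (norm w)\<^sup>2 / (pi * d\<^sup>2)"
      using False nb by (simp add: trunc_kernel_def)
    also have "\<dots> \<le> e\<^sup>2 / (pi * d\<^sup>2)" using we by (intro divide_right_mono) auto
    also have "\<dots> = poisson e w" by (simp add: poisson_def d_def)
    finally show ?thesis using poisson_nonneg[of e w] by linarith
  qed
qed

lemma lborel_distr_mult_i: "distr lborel borel (\<lambda>w. \<i> * w) = lborel"
proof (rule lborel_eqI[symmetric])
  fix l u :: complex
  assume lu: "\<And>b. b \<in> Basis \<Longrightarrow> l \<bullet> b \<le> u \<bullet> b"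
  have le: "Re l \<le> Re u" "Im l \<le> Im u" using lu[of 1] lu[of \<i>] by (auto simp: Basis_complex_def)
  have eq: "(\<lambda>w. \<i> * w) -` box l u = box (Complex (Im l) (- Re u)) (Complex (Im u) (- Re l))"
    by (auto simp: in_box_complex_iff)
  have "emeasure (distr lborel borel (\<lambda>w. \<i> * w)) (box l u) = emeasure lborel (box (Complex (Im l) (- Re u)) (Complex (Im u) (- Re l)))"
    by (subst emeasure_distr) (auto simp: eq)
  also have "\<dots> = ennreal ((Re u - Re l) * (Im u - Im l))"
    using le by (simp add: emeasure_lborel_box_eq Basis_complex_def inner_complex_def mult.commute)
  finally show "emeasure (distr lborel borel (\<lambda>w. \<i> * w)) (box l u) = ennreal (\<Prod>b\<in>Basis. (u - l) \<bullet> b)"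
    by (simp add: Basis_complex_def inner_complex_def)
qed simp

text \<open>A quarter turn preserves the measure and changes the sign; this is the source of all
  cancellation, without polar coordinates.\<close>

lemma integral_rotation_odd:
  fixes k :: "complex \<Rightarrow> complex"
  assumes [measurable]: "k \<in> borel_measurable borel" and odd: "\<And>w. k (\<i> * w) = - k w"
  shows "(LINT w|lborel. k w) = 0"
proof -
  have "(LINT w|lborel. k w) = (LINT w|distr lborel borel (\<lambda>w. \<i> * w). k w)" by (simp add: lborel_distr_mult_i)
  also have "\<dots> = (LINT w|lborel. k (\<i> * w))" by (rule integral_distr) auto
  also have "\<dots> = - (LINT w|lborel. k w)" by (simp add: odd)
  finally show ?thesis by (simp add: equal_neg_zero)
qed

lemma trunc_kernel_rotation: "trunc_kernel e (\<i> * w) = - trunc_kernel e w"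
  by (simp add: trunc_kernel_def norm_mult power_mult_distrib)

lemma beurling_kernel_rotation: "beurling_kernel e (\<i> * w) = - beurling_kernel e w"
  by (simp add: beurling_kernel_def norm_mult power_mult_distrib)

text \<open>On the support of the kernel the function is a constant, and the kernel has mean zero by
  the quarter turn.\<close>

lemma cconv_locally_constant:
  assumes [measurable]: "\<kappa> \<in> borel_measurable borel" "\<phi> \<in> borel_measurable borel"
    and odd: "\<And>w. \<kappa> (\<i> * w) = - \<kappa> w"
    and k0: "\<And>w. norm w \<ge> r \<Longrightarrow> \<kappa> w = 0" and loc: "\<And>y. y \<in> ball z r \<Longrightarrow> \<phi> y = \<phi> z"
  shows "cconv \<kappa> \<phi> z = 0"
proof -
  have c: "\<kappa> (z - y) * \<phi> y = \<kappa> (z - y) * \<phi> z" for y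
    using k0[of "z - y"] loc[of y] by (cases "norm (z - y) < r") (auto simp: dist_norm)
  have "cconv \<kappa> \<phi> z = (LINT y|lborel. \<kappa> (z - y)) * \<phi> z" unfolding cconv_def c by simp
  also have "(LINT y|lborel. \<kappa> (z - y)) = (LINT y|lborel. \<kappa> y)" by (rule lborel_integral_reflect) measurable
  also have "\<dots> = 0" by (rule integral_rotation_odd[where k = \<kappa>]) (simp_all add: odd)
  finally show ?thesis by simp
qed

subsection \<open>Locally constant functions\<close>

text \<open>For such functions cancellation alone gives the principal value almost everywhere. In
  the constructions below the exceptional points lie on finitely many circles.\<close>

definition loc_const :: "(complex \<Rightarrow> complex) \<Rightarrow> bool" where
  "loc_const \<phi> \<longleftrightarrow> \<phi> \<in> test_fun \<and> (AE z in lborel. \<exists>r>0. \<forall>y\<in>ball z r. \<phi> y = \<phi> z)"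

lemma loc_const_add:
  assumes "loc_const \<phi>" "loc_const \<psi>"
  shows "loc_const (\<lambda>x. \<phi> x + \<psi> x)"
proof -
  have "AE z in lborel. \<exists>r>0. \<forall>y\<in>ball z r. \<phi> y = \<phi> z" "AE z in lborel. \<exists>r>0. \<forall>y\<in>ball z r. \<psi> y = \<psi> z"
    using assms unfolding loc_const_def by blast+
  then have "AE z in lborel. \<exists>r>0. \<forall>y\<in>ball z r. \<phi> y + \<psi> y = \<phi> z + \<psi> z"
  proof eventually_elim
    case (elim z)
    from elim(1) obtain r where r: "r > 0" "\<forall>y\<in>ball z r. \<phi> y = \<phi> z" by (elim exE conjE)
    from elim(2) obtain s where s: "s > 0" "\<forall>y\<in>ball z s. \<psi> y = \<psi> z" by (elim exE conjE)
    have "ball z (min r s) \<subseteq> ball z r \<inter> ball z s" by auto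
    then have "\<forall>y\<in>ball z (min r s). \<phi> y + \<psi> y = \<phi> z + \<psi> z" using r(2) s(2) 
      by (metis Int_iff subset_eq)
    moreover have "min r s > 0" using r(1) s(1) by simp
    ultimately show ?case by (intro exI[of _ "min r s"] conjI)
  qed
  moreover have "(\<lambda>x. \<phi> x + \<psi> x) \<in> test_fun" using assms unfolding loc_const_def by (blast intro: test_fun_add)
  ultimately show ?thesis unfolding loc_const_def by (rule conjI[rotated])
qed

lemma loc_const_cmult:
  assumes "loc_const \<phi>"
  shows "loc_const (\<lambda>x. c * \<phi> x)"
proof -
  have "AE z in lborel. \<exists>r>0. \<forall>y\<in>ball z r. c * \<phi> y = c * \<phi> z"
    by (rule eventually_mono[OF conjunct2[OF assms[unfolded loc_const_def]]]) (metis)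
  moreover have "(\<lambda>x. c * \<phi> x) \<in> test_fun" using assms unfolding loc_const_def by (blast intro: test_fun_cmult)
  ultimately show ?thesis unfolding loc_const_def by (rule conjI[rotated])
qed

text \<open>The p-th power of the distance in L^p, kept in the extended reals; hence the factor 2^(p
  - 1) in its triangle inequality.\<close>

definition lp_err :: "real \<Rightarrow> (complex \<Rightarrow> complex) \<Rightarrow> (complex \<Rightarrow> complex) \<Rightarrow> ennreal" where
  "lp_err p f g = (\<integral>\<^sup>+x. ennreal (norm (f x - g x) powr p) \<partial>lborel)"

definition approx_lc :: "real \<Rightarrow> (complex \<Rightarrow> complex) \<Rightarrow> bool" where
  "approx_lc p f \<longleftrightarrow> f \<in> borel_measurable borel \<and> (\<forall>d>0. \<exists>\<phi>. loc_const \<phi> \<and> lp_err p f \<phi> \<le> ennreal d)"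

lemma lp_err_add:
  assumes [measurable]: "f \<in> borel_measurable borel" "f' \<in> borel_measurable borel" "g \<in> borel_measurable borel" "g' \<in> borel_measurable borel"
    and p: "p \<ge> 1"
  shows "lp_err p (\<lambda>x. f x + f' x) (\<lambda>x. g x + g' x) \<le> ennreal (2 powr (p - 1)) * (lp_err p f g + lp_err p f' g')"
proof -
  have "lp_err p (\<lambda>x. f x + f' x) (\<lambda>x. g x + g' x)
    \<le> (\<integral>\<^sup>+x. ennreal (2 powr (p - 1)) * (ennreal (norm (f x - g x) powr p) + ennreal (norm (f' x - g' x) powr p)) \<partial>lborel)"
    unfolding lp_err_def
  proof (rule nn_integral_mono)
    fix x
    have "norm (f x + f' x - (g x + g' x)) \<le> norm (f x - g x) + norm (f' x - g' x)"
      using norm_triangle_ineq[of "f x - g x" "f' x - g' x"] by (simp only: add_diff_add)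
    then have "norm (f x + f' x - (g x + g' x)) powr p \<le> (norm (f x - g x) + norm (f' x - g' x)) powr p"
      using p by (intro powr_mono2) auto
    also have "\<dots> \<le> 2 powr (p - 1) * (norm (f x - g x) powr p + norm (f' x - g' x) powr p)"
      using p by (intro powr_sum_le) auto
    finally have "ennreal (norm (f x + f' x - (g x + g' x)) powr p)
      \<le> ennreal (2 powr (p - 1) * (norm (f x - g x) powr p + norm (f' x - g' x) powr p))" by (rule ennreal_leI)
    also have "\<dots> = ennreal (2 powr (p - 1)) * ennreal (norm (f x - g x) powr p + norm (f' x - g' x) powr p)"
      by (rule ennreal_mult) simp_all
    also have "ennreal (norm (f x - g x) powr p + norm (f' x - g' x) powr p)
      = ennreal (norm (f x - g x) powr p) + ennreal (norm (f' x - g' x) powr p)" by (rule ennreal_plus) simp_all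
    finally show "ennreal (norm (f x + f' x - (g x + g' x)) powr p)
      \<le> ennreal (2 powr (p - 1)) * (ennreal (norm (f x - g x) powr p) + ennreal (norm (f' x - g' x) powr p))" .
  qed
  also have "\<dots> = ennreal (2 powr (p - 1)) * (lp_err p f g + lp_err p f' g')"
    unfolding lp_err_def by (simp add: nn_integral_cmult nn_integral_add)
  finally show ?thesis .
qed

lemma loc_const_measurable: "loc_const \<phi> \<Longrightarrow> \<phi> \<in> borel_measurable borel"
  unfolding loc_const_def by (blast intro: bounded_borel_measurable test_fun_bounded_borel)

lemma approx_lc_add:
  assumes p: "p \<ge> 1" and f: "approx_lc p f" and g: "approx_lc p g"
  shows "approx_lc p (\<lambda>x. f x + g x)"
  unfolding approx_lc_def
proof (intro conjI allI impI)
  have [measurable]: "f \<in> borel_measurable borel" "g \<in> borel_measurable borel" using f g by (auto simp: approx_lc_def)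
  show "(\<lambda>x. f x + g x) \<in> borel_measurable borel" by measurable
  fix d :: real assume d: "d > 0"
  define e where "e = d / (2 * 2 powr (p - 1))"
  have e: "e > 0" using d by (simp add: e_def)
  obtain \<phi> where \<phi>: "loc_const \<phi>" "lp_err p f \<phi> \<le> ennreal e" using f e by (auto simp: approx_lc_def)
  obtain \<psi> where \<psi>: "loc_const \<psi>" "lp_err p g \<psi> \<le> ennreal e" using g e by (auto simp: approx_lc_def)
  have "lp_err p (\<lambda>x. f x + g x) (\<lambda>x. \<phi> x + \<psi> x) \<le> ennreal (2 powr (p - 1)) * (lp_err p f \<phi> + lp_err p g \<psi>)"
    using loc_const_measurable[OF \<phi>(1)] loc_const_measurable[OF \<psi>(1)] p by (intro lp_err_add) auto
  also have "\<dots> \<le> ennreal (2 powr (p - 1)) * (ennreal e + ennreal e)" by (intro mult_left_mono add_mono \<phi> \<psi>) simp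
  also have "\<dots> = ennreal d" using e by (simp add: ennreal_mult[symmetric] ennreal_plus[symmetric] e_def del: ennreal_plus)
  finally show "\<exists>\<phi>. loc_const \<phi> \<and> lp_err p (\<lambda>x. f x + g x) \<phi> \<le> ennreal d"
    using loc_const_add[OF \<phi>(1) \<psi>(1)] by blast
qed

lemma approx_lc_cmult:
  assumes f: "approx_lc p f"
  shows "approx_lc p (\<lambda>x. c * f x)"
  unfolding approx_lc_def
proof (intro conjI allI impI)
  have [measurable]: "f \<in> borel_measurable borel" using f by (auto simp: approx_lc_def)
  show "(\<lambda>x. c * f x) \<in> borel_measurable borel" by measurable
  fix d :: real assume d: "d > 0"
  define m where "m = norm c powr p + 1"
  have m: "m > 0" by (simp add: m_def add_nonneg_pos)
  have "d / m > 0" using d m by simp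
  then obtain \<phi> where \<phi>: "loc_const \<phi>" "lp_err p f \<phi> \<le> ennreal (d / m)" using f unfolding approx_lc_def by blast
  have [measurable]: "\<phi> \<in> borel_measurable borel" by (rule loc_const_measurable[OF \<phi>(1)])
  have "lp_err p (\<lambda>x. c * f x) (\<lambda>x. c * \<phi> x) = (\<integral>\<^sup>+x. ennreal (norm c powr p) * ennreal (norm (f x - \<phi> x) powr p) \<partial>lborel)"
    unfolding lp_err_def
    by (intro nn_integral_cong) (simp add: norm_mult powr_mult ennreal_mult flip: right_diff_distrib)
  also have "\<dots> = ennreal (norm c powr p) * lp_err p f \<phi>" unfolding lp_err_def by (rule nn_integral_cmult) measurable
  also have "\<dots> \<le> ennreal m * ennreal (d / m)" by (intro mult_mono \<phi>) (auto simp: m_def intro!: ennreal_leI)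
  also have "\<dots> = ennreal d" using m d by (simp add: ennreal_mult[symmetric])
  finally show "\<exists>\<phi>. loc_const \<phi> \<and> lp_err p (\<lambda>x. c * f x) \<phi> \<le> ennreal d"
    using loc_const_cmult[OF \<phi>(1)] by blast
qed

text \<open>The indicator is locally constant off the frontiers of finitely many balls, and
  frontiers of convex sets are null.\<close>

lemma loc_const_ball_union:
  fixes S :: "complex set set"
  assumes fin: "finite S" and balls: "\<And>B. B \<in> S \<Longrightarrow> \<exists>c r. B = ball c r"
  shows "loc_const (indicator (\<Union>S))"
  unfolding loc_const_def
proof
  have op: "open (\<Union>S)" using balls by (intro open_Union) auto
  have bd: "bounded (\<Union>S)" using fin balls by (intro bounded_Union) auto
  then obtain R where R: "\<And>x. x \<in> \<Union>S \<Longrightarrow> norm x \<le> R" by (auto simp: bounded_iff)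
  have [measurable]: "\<Union>S \<in> sets borel" using op by (rule borel_open)
  show "indicator (\<Union>S) \<in> test_fun"
    unfolding test_fun_def
  proof (rule CollectI, rule conjI)
    show "indicator (\<Union>S) \<in> bounded_borel" by (rule bounded_borelI[of _ 1]) (auto simp: indicator_def)
    have "indicator (\<Union>S) x = (0::complex)" if "R < norm x" for x
      using R[of x] that by (cases "x \<in> \<Union>S") simp_all
    then show "\<exists>R. \<forall>x. R < norm x \<longrightarrow> indicator (\<Union>S) x = (0::complex)" by blast
  qed
  have "negligible (\<Union>B\<in>S. frontier B)"
    using fin balls by (intro negligible_Union finite_imageI) (auto intro!: negligible_convex_frontier)
  then have "(\<Union>B\<in>S. frontier B) \<in> null_sets lebesgue" by (simp add: negligible_iff_null_sets)
  moreover have "(\<Union>B\<in>S. frontier B) \<in> sets borel"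
    using fin by (intro borel_closed closed_UN) (auto simp: frontier_closed)
  ultimately have "(\<Union>B\<in>S. frontier B) \<in> null_sets lborel" by (simp add: null_sets_def)
  then have "AE z in lborel. z \<notin> (\<Union>B\<in>S. frontier B)" by (rule AE_not_in)
  then show "AE z in lborel. \<exists>r>0. \<forall>y\<in>ball z r. indicator (\<Union>S) y = (indicator (\<Union>S) z :: complex)"
  proof eventually_elim
    case (elim z)
    show ?case
    proof (cases "z \<in> \<Union>S")
      case True
      then obtain r where "r > 0" "ball z r \<subseteq> \<Union>S" using op open_contains_ball by blast
      then have "\<forall>y\<in>ball z r. indicator (\<Union>S) y = (indicator (\<Union>S) z :: complex)"
      proof (intro ballI)
        fix y assume "y \<in> ball z r"
        then have "y \<in> \<Union>S" using \<open>ball z r \<subseteq> \<Union>S\<close> by blast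
        then show "indicator (\<Union>S) y = (indicator (\<Union>S) z :: complex)" using True by (simp only: indicator_simps)
      qed
      then show ?thesis using \<open>r > 0\<close> by (intro exI[of _ r] conjI)
    next
      case False
      have "z \<notin> closure B" if BS: "B \<in> S" for B
      proof -
        obtain c r where "B = ball c r" using balls[OF BS] by blast
        then have "interior B = B" by (simp add: interior_open)
        moreover have "z \<notin> B" "z \<notin> frontier B" using BS elim False by blast+
        ultimately show ?thesis unfolding frontier_def by blast
      qed
      then have "z \<in> - (\<Union>B\<in>S. closure B)" by auto
      moreover have "open (- (\<Union>B\<in>S. closure B))" using fin by (intro open_Compl closed_UN) auto
      ultimately obtain r where r: "r > 0" "ball z r \<subseteq> - (\<Union>B\<in>S. closure B)" using open_contains_ball by blast
      have nS: "y \<notin> \<Union>S" if y: "y \<in> ball z r" for y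
      proof
        assume "y \<in> \<Union>S"
        then obtain B where "B \<in> S" "y \<in> B" by (rule UnionE)
        have "y \<in> closure B" using closure_subset[of B] \<open>y \<in> B\<close> by (rule subsetD)
        with \<open>B \<in> S\<close> have "y \<in> (\<Union>B\<in>S. closure B)" by (rule UN_I)
        then show False using ComplD[OF subsetD[OF r(2) y]] by contradiction
      qed
      have "\<forall>y\<in>ball z r. indicator (\<Union>S) y = (indicator (\<Union>S) z :: complex)"
      proof (intro ballI)
        fix y assume "y \<in> ball z r"
        then have "y \<notin> \<Union>S" by (rule nS)
        with False show "indicator (\<Union>S) y = (indicator (\<Union>S) z :: complex)" by (simp only: indicator_simps simp_thms)
      qed
      then show ?thesis using r(1) by (intro exI[of _ r] conjI)
    qed
  qed
qed

text \<open>A closed C inside E, a compact part \<open>K n\<close> of C and an open W around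
  \<open>K n\<close> cost d / 3 each; compactness puts a finite union V of balls between
  \<open>K n\<close> and W. The indicators of E and V differ only on E - C, C - \<open>K n\<close>
  and W - \<open>K n\<close>, and there the p-th power of the difference is at most 1.\<close>

lemma approx_lc_indicator:
  assumes E: "E \<in> sets borel" "emeasure lborel E < \<infinity>" and p: "p > 0"
  shows "approx_lc p (indicator E)"
  unfolding approx_lc_def
proof (intro conjI allI impI)
  show "indicator E \<in> borel_measurable borel" using E by (intro borel_measurable_indicator)
  fix d :: real assume d: "d > 0"
  have ElS: "E \<in> sets lebesgue" using E by simp
  obtain C where C: "closed C" "C \<subseteq> E" "E - C \<in> lmeasurable" "emeasure lebesgue (E - C) < ennreal (d / 3)"
    using sets_lebesgue_inner_closed[OF ElS, of "d / 3"] d by auto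
  define K where "K n = C \<inter> cball 0 (real n)" for n
  have Cs: "C \<in> sets borel" using C(1) by (rule borel_closed)
  have Ks: "K n \<in> sets borel" for n unfolding K_def using Cs by auto
  have "(\<lambda>n. emeasure lborel (C - K n)) \<longlonglongrightarrow> emeasure lborel (\<Inter>n. C - K n)"
  proof (rule Lim_emeasure_decseq)
    show "range (\<lambda>n. C - K n) \<subseteq> sets lborel" using Cs Ks by auto
    show "decseq (\<lambda>n. C - K n)" by (auto simp: decseq_def K_def)
    show "emeasure lborel (C - K n) \<noteq> \<infinity>" for n
    proof -
      have "emeasure lborel (C - K n) \<le> emeasure lborel E" using C(2) E(1) by (intro emeasure_mono) auto
      then show ?thesis using E(2) by auto
    qed
  qed
  moreover have "(\<Inter>n. C - K n) = {}"
  proof -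
    have "\<exists>n. x \<in> K n" if "x \<in> C" for x using that real_arch_simple[of "norm x"] by (auto simp: K_def)
    then show ?thesis by auto
  qed
  ultimately have "(\<lambda>n. emeasure lborel (C - K n)) \<longlonglongrightarrow> 0" by (simp only: emeasure_empty)
  then have "\<forall>\<^sub>F n in sequentially. emeasure lborel (C - K n) < ennreal (d / 3)"
    using d by (intro order_tendstoD(2)) auto
  then obtain n where n: "emeasure lborel (C - K n) < ennreal (d / 3)" by (auto simp: eventually_sequentially)
  have comp: "compact (K n)" unfolding K_def using C(1) by (intro closed_Int_compact) auto
  have KlS: "K n \<in> sets lebesgue" using Ks by simp
  obtain W where W: "open W" "K n \<subseteq> W" "W - K n \<in> lmeasurable" "emeasure lebesgue (W - K n) < ennreal (d / 3)"
    using sets_lebesgue_outer_open[OF KlS, of "d / 3"] d by auto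
  define \<B> where "\<B> = {B. \<exists>c r. B = ball c r \<and> B \<subseteq> W}"
  have "K n \<subseteq> \<Union>\<B>"
  proof
    fix x assume "x \<in> K n"
    then obtain r where "r > 0" "ball x r \<subseteq> W" using W open_contains_ball by blast
    then show "x \<in> \<Union>\<B>" unfolding \<B>_def by (intro UnionI[of "ball x r"]) auto
  qed
  then obtain S where S: "S \<subseteq> \<B>" "finite S" "K n \<subseteq> \<Union>S"
    by (rule compactE[OF comp]) (auto simp: \<B>_def)
  define V where "V = \<Union>S"
  have lc: "loc_const (indicator V)" unfolding V_def using S(1) by (intro loc_const_ball_union S(2)) (auto simp: \<B>_def)
  have VW: "V \<subseteq> W" using S by (auto simp: V_def \<B>_def)
  have Vo: "V \<in> sets borel" unfolding V_def using S by (intro borel_open open_Union) (auto simp: \<B>_def)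
  have "lp_err p (indicator E) (indicator V) \<le> (\<integral>\<^sup>+x. indicator (E - C) x + (indicator (C - K n) x + indicator (W - K n) x) \<partial>lborel)"
    unfolding lp_err_def
  proof (rule nn_integral_mono)
    fix x
    have "x \<in> K n \<Longrightarrow> x \<in> C" by (simp add: K_def)
    then show "ennreal (norm (indicator E x - indicator V x :: complex) powr p)
       \<le> indicator (E - C) x + (indicator (C - K n) x + indicator (W - K n) x)"
      using S(3) VW C(2) p unfolding V_def[symmetric] by (auto simp: indicator_def)
  qed
  also have "\<dots> = emeasure lborel (E - C) + (emeasure lborel (C - K n) + emeasure lborel (W - K n))"
    using E(1) Cs Ks[of n] borel_open[OF W(1)] by (simp add: nn_integral_add)
  also have "\<dots> \<le> ennreal (d / 3) + (ennreal (d / 3) + ennreal (d / 3))"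
    using C(4) W(4) n E(1) Cs Ks borel_open[OF W(1)] by (intro add_mono) (auto simp: less_imp_le)
  also have "\<dots> = ennreal d" using d by (simp add: ennreal_plus[symmetric] del: ennreal_plus)
  finally show "\<exists>\<phi>. loc_const \<phi> \<and> lp_err p (indicator E) \<phi> \<le> ennreal d" using lc by blast
qed

lemma approx_lc_sum:
  assumes p: "p \<ge> 1" and fin: "finite I" and f: "\<And>i. i \<in> I \<Longrightarrow> approx_lc p (f i)"
  shows "approx_lc p (\<lambda>x. \<Sum>i\<in>I. f i x)"
  using fin f
proof (induction I rule: finite_induct)
  case empty
  have "loc_const (\<lambda>x. 0)" unfolding loc_const_def by (simp add: test_fun_def bounded_borel_def gt_ex)
  moreover have "lp_err p (\<lambda>x. 0) (\<lambda>x. 0) = 0" using p by (simp add: lp_err_def)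
  ultimately have "\<exists>\<phi>. loc_const \<phi> \<and> lp_err p (\<lambda>x. 0) \<phi> \<le> ennreal d" for d by (metis zero_le)
  then show ?case by (simp add: approx_lc_def)
next
  case (insert i I)
  then show ?case using approx_lc_add[OF p, of "f i" "\<lambda>x. \<Sum>i\<in>I. f i x"] by simp
qed

text \<open>An L^p function takes each nonzero value on a set of finite measure, so every level set
  can be approximated.\<close>

lemma approx_lc_simple:
  assumes p: "p \<ge> 1" and s: "simple_function lborel s" and si: "integrable lborel (\<lambda>x. norm (s x :: complex) powr p)"
  shows "approx_lc p s"
proof -
  have fin: "finite (range s)" using s by (simp add: simple_function_def)
  have sm [measurable]: "s \<in> borel_measurable borel" using borel_measurable_simple_function[OF s] by simp
  have E: "s -` {v} \<in> sets borel" for v using measurable_sets[OF sm, of "{v}"] by simp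
  have "approx_lc p (\<lambda>x. \<Sum>v\<in>range s - {0}. v * indicator (s -` {v}) x)"
  proof (intro approx_lc_sum p approx_lc_cmult)
    show "finite (range s - {0})" using fin by simp
    fix v assume v: "v \<in> range s - {0}"
    have "emeasure lborel (s -` {v}) < \<infinity>"
    proof -
      have "ennreal (norm v powr p) * emeasure lborel (s -` {v}) = (\<integral>\<^sup>+x. ennreal (norm v powr p) * indicator (s -` {v}) x \<partial>lborel)"
        using E by (simp add: nn_integral_cmult_indicator)
      also have "\<dots> \<le> (\<integral>\<^sup>+x. ennreal (norm (s x) powr p) \<partial>lborel)"
        by (intro nn_integral_mono) (auto simp: indicator_def)
      also have "\<dots> < \<infinity>" using si by (subst nn_integral_eq_integral) auto
      finally show ?thesis using v by (auto simp: ennreal_mult_less_top)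
    qed
    then show "approx_lc p (indicator (s -` {v}))" using E p by (intro approx_lc_indicator) auto
  qed
  also have "(\<lambda>x. \<Sum>v\<in>range s - {0}. v * indicator (s -` {v}) x) = s"
  proof
    fix x
    show "(\<Sum>v\<in>range s - {0}. v * indicator (s -` {v}) x) = s x"
    proof (cases "s x = 0")
      case True
      have "(\<Sum>v\<in>range s - {0}. v * indicator (s -` {v}) x) = 0" using True by (intro sum.neutral) (auto simp: indicator_def)
      then show ?thesis using True by simp
    next
      case False
      have "(\<Sum>v\<in>range s - {0}. v * indicator (s -` {v}) x) = (\<Sum>v\<in>range s - {0}. if v = s x then s x else 0)"
        by (intro sum.cong) (auto simp: indicator_def)
      then show ?thesis using False fin by simp
    qed
  qed
  finally show ?thesis .
qed

lemma lp_borel_approx: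
  assumes p: "p > 1" and f: "f \<in> lp_borel p" and d: "d > 0"
  obtains \<phi> where "loc_const \<phi>" "lp_err p f \<phi> \<le> ennreal d"
proof -
  have fm [measurable]: "f \<in> borel_measurable borel" and fi: "integrable lborel (\<lambda>z. norm (f z) powr p)"
    using f by (auto simp: lp_borel_def)
  obtain s where s: "\<And>i. simple_function lborel (s i)" "\<And>x. (\<lambda>i. s i x) \<longlonglongrightarrow> f x" "\<And>i x. norm (s i x) \<le> 2 * norm (f x)"
    using borel_measurable_implies_sequence_metric[of f lborel 0] by auto
  have sm [measurable]: "s i \<in> borel_measurable borel" for i using borel_measurable_simple_function[OF s(1)[of i]] by simp
  have sb: "norm (f x - s i x) powr p \<le> (3 powr p) * norm (f x) powr p" for i x
  proof -
    have "norm (f x - s i x) \<le> 3 * norm (f x)" using norm_triangle_ineq4[of "f x" "s i x"] s(3)[of i x] by linarith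
    then have "norm (f x - s i x) powr p \<le> (3 * norm (f x)) powr p" using p by (intro powr_mono2) auto
    then show ?thesis by (simp add: powr_mult)
  qed
  have "(\<lambda>i. LINT x|lborel. norm (f x - s i x) powr p) \<longlonglongrightarrow> (LINT x|(lborel :: complex measure). 0)"
  proof (rule integral_dominated_convergence[where w = "\<lambda>x. (3 powr p) * norm (f x) powr p"])
    show "integrable lborel (\<lambda>x. (3 powr p) * norm (f x) powr p)" using fi by simp
    show "AE x in lborel. (\<lambda>i. norm (f x - s i x) powr p) \<longlonglongrightarrow> 0"
    proof (rule AE_I2)
      fix x
      have "(\<lambda>i. norm (f x - s i x)) \<longlonglongrightarrow> norm (f x - f x)" by (intro tendsto_intros s)
      then show "(\<lambda>i. norm (f x - s i x) powr p) \<longlonglongrightarrow> 0"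
        using p by (intro tendsto_zero_powrI[where b = p]) auto
    qed
    show "AE x in lborel. norm (norm (f x - s i x) powr p) \<le> (3 powr p) * norm (f x) powr p" for i
      using sb by simp
  qed measurable
  then have "\<forall>\<^sub>F i in sequentially. (LINT x|lborel. norm (f x - s i x) powr p) < d / (2 * 2 powr (p - 1))"
    using d by (intro order_tendstoD(2)) auto
  then obtain i where i: "(LINT x|lborel. norm (f x - s i x) powr p) < d / (2 * 2 powr (p - 1))" by (auto simp: eventually_sequentially)
  \<comment> \<open>Two errors occur, and the triangle inequality costs the factor 2^(p -
    1).\<close>
  define e where "e = d / (2 * 2 powr (p - 1))"
  have e: "e > 0" using d by (simp add: e_def)
  have "integrable lborel (\<lambda>x. norm (f x - s i x) powr p)"
    by (rule Bochner_Integration.integrable_bound[where f = "\<lambda>x. (3 powr p) * norm (f x) powr p"]) (use fi sb in auto)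
  then have err1: "lp_err p f (s i) \<le> ennreal e"
    unfolding lp_err_def using i by (subst nn_integral_eq_integral) (auto simp: e_def intro!: ennreal_leI)
  have "integrable lborel (\<lambda>x. norm (s i x) powr p)"
  proof (rule Bochner_Integration.integrable_bound[where f = "\<lambda>x. (2 powr p) * norm (f x) powr p"])
    have "norm (s i x) powr p \<le> (2 powr p) * norm (f x) powr p" for x
      using powr_mono2[of p "norm (s i x)" "2 * norm (f x)"] s(3)[of i x] p by (simp add: powr_mult)
    then show "AE x in lborel. norm (norm (s i x) powr p) \<le> norm ((2 powr p) * norm (f x) powr p)" by simp
  qed (use fi in auto)
  then have "approx_lc p (s i)" using p by (intro approx_lc_simple s) auto
  then obtain \<phi> where \<phi>: "loc_const \<phi>" "lp_err p (s i) \<phi> \<le> ennreal e" using e by (auto simp: approx_lc_def)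
  have [measurable]: "\<phi> \<in> borel_measurable borel" by (rule loc_const_measurable[OF \<phi>(1)])
  \<comment> \<open>Adding \<open>s i\<close> to both arguments brings the triangle inequality into
    the additive form of \<open>lp_err_add\<close>.\<close>
  have "lp_err p f \<phi> = lp_err p (\<lambda>x. f x + s i x) (\<lambda>x. s i x + \<phi> x)" by (simp add: lp_err_def)
  also have "\<dots> \<le> ennreal (2 powr (p - 1)) * (lp_err p f (s i) + lp_err p (s i) \<phi>)"
    using p by (intro lp_err_add) auto
  also have "\<dots> \<le> ennreal (2 powr (p - 1)) * (ennreal e + ennreal e)" by (intro mult_left_mono add_mono err1 \<phi>) simp
  also have "\<dots> = ennreal d" using e by (simp add: ennreal_mult[symmetric] ennreal_plus[symmetric] e_def del: ennreal_plus)
  finally show ?thesis using \<phi>(1) that by blast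
qed

subsection \<open>Principal values\<close>

lemma borel_measurable_test_fun: "f \<in> test_fun \<Longrightarrow> f \<in> borel_measurable borel"
  by (auto intro: bounded_borel_measurable test_fun_bounded_borel)

lemma lp_borel_test_fun: "f \<in> test_fun \<Longrightarrow> p > 0 \<Longrightarrow> f \<in> lp_borel p"
  by (simp add: lp_borel_def borel_measurable_test_fun test_fun_integrable_powr)

lemmas trunc_kernel_integrable =
  integrable_kernel_mult[OF _ _ borel_measurable_trunc_kernel trunc_kernel_decay]

lemmas beurling_kernel_integrable =
  integrable_kernel_mult[OF _ _ borel_measurable_beurling_kernel norm_beurling_kernel_decay]

lemma poisson_integrable:
  assumes p: "p > 1" and f: "f \<in> lp_borel p" and e: "e > 0"
  shows "integrable lborel (\<lambda>y. poisson e (z - y) * norm (f y))"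
proof -
  have "integrable lborel (\<lambda>y. poissonc e (z - y) * f y)"
    by (rule integrable_kernel_mult[OF p f _ norm_poissonc_decay[OF e]]) measurable
  from integrable_norm[OF this] show ?thesis by (simp add: norm_mult poissonc_def)
qed

lemma cconv_trunc_minus_beurling:
  assumes p: "p > 1" and f: "f \<in> lp_borel p" and e: "e > 0"
  shows "cconv (trunc_kernel e) f z - cconv (beurling_kernel e) f z
    = (LINT y|lborel. (trunc_kernel e (z - y) - beurling_kernel e (z - y)) * f y)"
  unfolding cconv_def left_diff_distrib
  using trunc_kernel_integrable[OF p f e] beurling_kernel_integrable[OF p f e] by simp

text \<open>Together with the maximal bounds for Poisson averages and smoothed transforms this
  controls all truncations.\<close>

lemma trunc_minus_beurling_le:
  assumes p: "p > 1" and f: "f \<in> lp_borel p" and e: "e > 0"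
  shows "norm (cconv (trunc_kernel e) f z - cconv (beurling_kernel e) f z) \<le> 3 * (LINT y|lborel. poisson e (z - y) * norm (f y))"
proof -
  have "norm (cconv (trunc_kernel e) f z - cconv (beurling_kernel e) f z) \<le> (LINT y|lborel. 3 * (poisson e (z - y) * norm (f y)))"
    unfolding cconv_trunc_minus_beurling[OF assms]
  proof (rule Bochner_Integration.integral_norm_bound_integral)
    show "integrable lborel (\<lambda>y. (trunc_kernel e (z - y) - beurling_kernel e (z - y)) * f y)"
      unfolding left_diff_distrib
      using trunc_kernel_integrable[OF p f e] beurling_kernel_integrable[OF p f e] by simp
    show "integrable lborel (\<lambda>y. 3 * (poisson e (z - y) * norm (f y)))" using poisson_integrable[OF assms] by simp
    show "norm ((trunc_kernel e (z - y) - beurling_kernel e (z - y)) * f y) \<le> 3 * (poisson e (z - y) * norm (f y))" for y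
      using mult_right_mono[OF trunc_kernel_diff[OF e, of "z - y"], of "norm (f y)"] by (simp add: norm_mult mult.assoc)
  qed
  then show ?thesis by simp
qed

text \<open>Two truncations differ by an annulus inside the ball of constancy, where the kernel has
  mean zero. So the truncated transform does not change any more as e tends to 0.\<close>

lemma trunc_locally_constant:
  assumes p: "p > 1" and f: "\<phi> \<in> lp_borel p" and loc: "\<And>y. y \<in> ball z r \<Longrightarrow> \<phi> y = \<phi> z"
    and e: "e > 0" "e \<le> r / 2"
  shows "cconv (trunc_kernel e) \<phi> z = cconv (trunc_kernel (r / 2)) \<phi> z"
proof -
  have r: "r / 2 > 0" "r > r / 2" using e by auto
  have [measurable]: "\<phi> \<in> borel_measurable borel" using f by (simp add: lp_borel_def)
  have "cconv (\<lambda>w. trunc_kernel e w - trunc_kernel (r / 2) w) \<phi> z = 0"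
  proof (rule cconv_locally_constant[where r = r])
    show "trunc_kernel e w - trunc_kernel (r / 2) w = 0" if "norm w \<ge> r" for w
    proof -
      have "norm w > e" "norm w > r / 2" using that e r(2) by linarith+
      then show ?thesis by (simp add: trunc_kernel_def)
    qed
    show "\<phi> y = \<phi> z" if "y \<in> ball z r" for y using that by (rule loc)
  qed (simp_all add: trunc_kernel_rotation)
  moreover have "cconv (\<lambda>w. trunc_kernel e w - trunc_kernel (r / 2) w) \<phi> z = cconv (trunc_kernel e) \<phi> z - cconv (trunc_kernel (r / 2)) \<phi> z"
    unfolding cconv_def left_diff_distrib
    using trunc_kernel_integrable[OF p f e(1)] trunc_kernel_integrable[OF p f r(1)] by simp
  ultimately show ?thesis by simp
qed

text \<open>Inside the ball the kernel difference integrates to 0 by the quarter turn; outside,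
  \<open>poisson_tail\<close> gains the factor 4 e^2 / r^2 on top of the 3 from
  \<open>trunc_kernel_diff\<close>.\<close>

lemma trunc_minus_beurling_locally_constant:
  assumes p: "p > 1" and f: "\<phi> \<in> lp_borel p" and loc: "\<And>y. y \<in> ball z r \<Longrightarrow> \<phi> y = \<phi> z"
    and e: "e > 0" and r: "r > 0"
  shows "norm (cconv (trunc_kernel e) \<phi> z - cconv (beurling_kernel e) \<phi> z)
    \<le> (12 * (LINT y|lborel. poisson r (z - y) * norm (\<phi> y)) / r\<^sup>2) * e\<^sup>2"
proof -
  have [measurable]: "\<phi> \<in> borel_measurable borel" using f by (simp add: lp_borel_def)
  define D where "D w = trunc_kernel e w - beurling_kernel e w" for w
  define N where "N w = (if norm w < r then D w else 0)" for w
  have [measurable]: "D \<in> borel_measurable borel" unfolding D_def[abs_def] by measurable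
  have [measurable]: "N \<in> borel_measurable borel" unfolding N_def[abs_def] by measurable
  have Di: "integrable lborel (\<lambda>y. D (z - y) * \<phi> y)"
    unfolding D_def left_diff_distrib
    using trunc_kernel_integrable[OF p f e] beurling_kernel_integrable[OF p f e] by simp
  have Ni: "integrable lborel (\<lambda>y. N (z - y) * \<phi> y)"
    by (rule Bochner_Integration.integrable_bound[OF Di]) (auto simp: N_def)
  have "cconv N \<phi> z = 0"
  proof (rule cconv_locally_constant[where r = r])
    show "\<phi> y = \<phi> z" if "y \<in> ball z r" for y using that by (rule loc)
  qed (simp_all add: N_def D_def trunc_kernel_rotation beurling_kernel_rotation norm_mult)
  then have N0: "(LINT y|lborel. N (z - y) * \<phi> y) = 0" by (simp only: cconv_def)
  have "cconv (trunc_kernel e) \<phi> z - cconv (beurling_kernel e) \<phi> z = (LINT y|lborel. D (z - y) * \<phi> y) - (LINT y|lborel. N (z - y) * \<phi> y)"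
    unfolding cconv_trunc_minus_beurling[OF p f e] N0 by (simp add: D_def)
  also have "\<dots> = (LINT y|lborel. D (z - y) * \<phi> y - N (z - y) * \<phi> y)" using Di Ni by simp
  also have "norm \<dots> \<le> (LINT y|lborel. (12 * e\<^sup>2 / r\<^sup>2) * (poisson r (z - y) * norm (\<phi> y)))"
  proof (rule Bochner_Integration.integral_norm_bound_integral)
    show "integrable lborel (\<lambda>y. D (z - y) * \<phi> y - N (z - y) * \<phi> y)" using Di Ni by simp
    show "integrable lborel (\<lambda>y. (12 * e\<^sup>2 / r\<^sup>2) * (poisson r (z - y) * norm (\<phi> y)))"
      using poisson_integrable[OF p f r] by simp
    fix y
    have "norm (D (z - y) - N (z - y)) \<le> (12 * e\<^sup>2 / r\<^sup>2) * poisson r (z - y)"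
    proof (cases "norm (z - y) < r")
      case True
      then show ?thesis by (simp add: N_def)
    next
      case False
      have "norm (D (z - y)) \<le> 3 * poisson e (z - y)" unfolding D_def by (rule trunc_kernel_diff[OF e])
      also have "\<dots> \<le> 3 * ((4 * e\<^sup>2 / r\<^sup>2) * poisson r (z - y))" using False by (intro mult_left_mono poisson_tail e r) auto
      finally show ?thesis using False by (simp add: N_def)
    qed
    from mult_right_mono[OF this, of "norm (\<phi> y)"]
    show "norm (D (z - y) * \<phi> y - N (z - y) * \<phi> y) \<le> (12 * e\<^sup>2 / r\<^sup>2) * (poisson r (z - y) * norm (\<phi> y))"
      by (simp only: left_diff_distrib[symmetric] norm_mult mult.assoc norm_ge_zero)
  qed
  also have "\<dots> = (12 * e\<^sup>2 / r\<^sup>2) * (LINT y|lborel. poisson r (z - y) * norm (\<phi> y))" by (rule integral_mult_right_zero)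
  finally show ?thesis by (simp add: mult_ac)
qed

text \<open>Oscillation at most s near scale 0, of the truncations among themselves and against the
  smoothed kernels. No limit is mentioned, since its existence is the goal.\<close>

definition pv_osc :: "(complex \<Rightarrow> complex) \<Rightarrow> complex \<Rightarrow> real \<Rightarrow> bool" where
  "pv_osc f z s \<longleftrightarrow> (\<exists>r>0. \<forall>e. 0 < e \<and> e < r \<longrightarrow>
     norm (cconv (trunc_kernel e) f z - cconv (beurling_kernel e) f z) \<le> s \<and>
     (\<forall>e'. 0 < e' \<and> e' < r \<longrightarrow> norm (cconv (trunc_kernel e) f z - cconv (trunc_kernel e') f z) \<le> s))"

text \<open>By its maximal bounds g contributes 3 s between truncation and smoothing and 4 s per
  truncation, hence 8 s for two. The locally constant part has equal truncations and loses at most s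
  against the smoothing.\<close>

lemma pv_osc_small:
  assumes p: "p > 1" and g: "g \<in> lp_borel p" and \<phi>: "\<phi> \<in> lp_borel p" and f: "f = (\<lambda>y. g y + \<phi> y)"
    and loc: "r > 0" "\<And>y. y \<in> ball z r \<Longrightarrow> \<phi> y = \<phi> z" and s: "s > 0"
    and mb: "\<And>a. a > 0 \<Longrightarrow> norm (cconv (beurling_kernel a) g z) \<le> s"
    and mp: "\<And>a. a > 0 \<Longrightarrow> (LINT y|lborel. poisson a (z - y) * norm (g y)) \<le> s"
  shows "pv_osc f z (8 * s)"
proof -
  have T: "cconv (trunc_kernel e) f z = cconv (trunc_kernel e) g z + cconv (trunc_kernel e) \<phi> z" if "e > 0" for e
    unfolding f cconv_def distrib_left
    using trunc_kernel_integrable[OF p g that] trunc_kernel_integrable[OF p \<phi> that] by simp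
  have K: "cconv (beurling_kernel e) f z = cconv (beurling_kernel e) g z + cconv (beurling_kernel e) \<phi> z" if "e > 0" for e
    unfolding f cconv_def distrib_left
    using beurling_kernel_integrable[OF p g that] beurling_kernel_integrable[OF p \<phi> that] by simp
  have TK: "norm (cconv (trunc_kernel e) g z - cconv (beurling_kernel e) g z) \<le> 3 * s" if "e > 0" for e
    using trunc_minus_beurling_le[OF p g that, of z] mp[OF that] by linarith
  have Tg: "norm (cconv (trunc_kernel e) g z) \<le> 4 * s" if "e > 0" for e
    using TK[OF that] mb[OF that] norm_triangle_sub[of "cconv (trunc_kernel e) g z" "cconv (beurling_kernel e) g z"] by linarith
  define C where "C = 12 * (LINT y|lborel. poisson r (z - y) * norm (\<phi> y)) / r\<^sup>2"
  have "((\<lambda>e. C * e\<^sup>2) \<longlongrightarrow> C * 0\<^sup>2) (at_right 0)" by (intro tendsto_intros)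
  then have "\<forall>\<^sub>F e in at_right 0. C * e\<^sup>2 < s" using s by (intro order_tendstoD(2)) auto
  then obtain b where b: "b > 0" "\<And>e. 0 < e \<Longrightarrow> e < b \<Longrightarrow> C * e\<^sup>2 < s" by (auto simp: eventually_at_right_field)
  show ?thesis
    unfolding pv_osc_def
  proof (intro exI[of _ "min b (r / 2)"] conjI allI impI)
    show "min b (r / 2) > 0" using b(1) loc(1) by simp
    fix e assume "0 < e \<and> e < min b (r / 2)"
    then have e: "e > 0" "e < b" "e \<le> r / 2" by auto
    have "norm (cconv (trunc_kernel e) \<phi> z - cconv (beurling_kernel e) \<phi> z) \<le> C * e\<^sup>2"
      unfolding C_def by (rule trunc_minus_beurling_locally_constant[OF p \<phi> loc(2) e(1) loc(1)])
    then have le: "norm (cconv (trunc_kernel e) \<phi> z - cconv (beurling_kernel e) \<phi> z) \<le> s" using b(2)[OF e(1,2)] by linarith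
    have eq: "cconv (trunc_kernel e) f z - cconv (beurling_kernel e) f z
      = (cconv (trunc_kernel e) g z - cconv (beurling_kernel e) g z) + (cconv (trunc_kernel e) \<phi> z - cconv (beurling_kernel e) \<phi> z)"
      unfolding T[OF e(1)] K[OF e(1)] by simp
    show "norm (cconv (trunc_kernel e) f z - cconv (beurling_kernel e) f z) \<le> 8 * s"
      unfolding eq using le TK[OF e(1)] norm_triangle_ineq[of "cconv (trunc_kernel e) g z - cconv (beurling_kernel e) g z"
        "cconv (trunc_kernel e) \<phi> z - cconv (beurling_kernel e) \<phi> z"] s by linarith
    fix e' assume "0 < e' \<and> e' < min b (r / 2)"
    then have e': "e' > 0" "e' \<le> r / 2" by auto
    have "cconv (trunc_kernel e) \<phi> z = cconv (trunc_kernel e') \<phi> z"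
      using trunc_locally_constant[OF p \<phi> loc(2) e(1,3)] trunc_locally_constant[OF p \<phi> loc(2) e'] by (rule trans[OF _ sym])
    then have "cconv (trunc_kernel e) f z - cconv (trunc_kernel e') f z = cconv (trunc_kernel e) g z - cconv (trunc_kernel e') g z"
      unfolding T[OF e(1)] T[OF e'(1)] by simp
    then show "norm (cconv (trunc_kernel e) f z - cconv (trunc_kernel e') f z) \<le> 8 * s"
      using Tg[OF e(1)] Tg[OF e'(1)] norm_triangle_ineq4[of "cconv (trunc_kernel e) g z" "cconv (trunc_kernel e') g z"] by simp
  qed
qed

text \<open>For fixed s the approximation can be made so good that the exceptional sets of both
  maximal estimates for the error g have total measure at most d.\<close>

lemma pv_osc_exceptional:
  assumes p: "p > 1" and pq: "1/p + 1/q = 1" and f: "f \<in> lp_borel p" and s: "s > 0" and d: "d > 0"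
  obtains U where "U \<in> sets borel" "emeasure lborel U \<le> ennreal d" "\<And>z. z \<notin> U \<Longrightarrow> pv_osc f z (8 * s)"
proof -
  define M where "M = (2 * (max p q - 1)) powr p"
  \<comment> \<open>Solves 25 (M + 1) t / s^p = d, the sum of the two weak type bounds at A =
    t.\<close>
  define t where "t = d * s powr p / (25 * (M + 1))"
  have M: "M \<ge> 0" by (simp add: M_def)
  have t: "t > 0" using d s M by (simp add: t_def add_nonneg_pos)
  obtain \<phi> where lc: "loc_const \<phi>" and err: "lp_err p f \<phi> \<le> ennreal t" by (rule lp_borel_approx[OF p f t])
  have tf: "\<phi> \<in> test_fun" and ae: "AE z in lborel. \<exists>r>0. \<forall>y\<in>ball z r. \<phi> y = \<phi> z" using lc unfolding loc_const_def by blast+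
  have \<phi>: "\<phi> \<in> lp_borel p" using tf p by (intro lp_borel_test_fun) auto
  have [measurable]: "f \<in> borel_measurable borel" "\<phi> \<in> borel_measurable borel" using f \<phi> by (auto simp: lp_borel_def)
  define g where "g y = f y - \<phi> y" for y
  have [measurable]: "g \<in> borel_measurable borel" unfolding g_def[abs_def] by measurable
  have gi: "integrable lborel (\<lambda>y. norm (g y) powr p)"
  proof (rule integrableI_bounded)
    show "(\<integral>\<^sup>+y. ennreal (norm (norm (g y) powr p)) \<partial>lborel) < \<infinity>"
      using err unfolding lp_err_def g_def by (auto simp: less_top[symmetric] top_unique)
  qed measurable
  have g: "g \<in> lp_borel p" using gi by (simp add: lp_borel_def)
  define A where "A = (LINT y|lborel. norm (g y) powr p)"
  have A0: "A \<ge> 0" unfolding A_def by (rule integral_nonneg_AE) simp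
  have At: "A \<le> t"
  proof -
    have "lp_err p f \<phi> = ennreal A" unfolding A_def lp_borel_nn_integral[OF g, symmetric] by (simp add: lp_err_def g_def)
    then show ?thesis using err t by simp
  qed
  obtain U1 where U1: "U1 \<in> sets borel" "emeasure lborel U1 \<le> ennreal (25 * A / s powr p)"
    "\<And>z a. z \<notin> U1 \<Longrightarrow> a > 0 \<Longrightarrow> (LINT y|lborel. poisson a (z - y) * norm (g y)) \<le> s"
    using maximal_poisson[OF p g s] unfolding A_def by metis
  obtain U2 where U2: "U2 \<in> sets borel" "emeasure lborel U2 \<le> ennreal (25 * (M * A) / s powr p)"
    "\<And>z a. z \<notin> U2 \<Longrightarrow> a > 0 \<Longrightarrow> norm (cconv (beurling_kernel a) g z) \<le> s"
    using maximal_beurling[OF p pq g s] unfolding A_def M_def by metis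
  from ae obtain U3 where U3: "{z \<in> space lborel. \<not> (\<exists>r>0. \<forall>y\<in>ball z r. \<phi> y = \<phi> z)} \<subseteq> U3" "emeasure lborel U3 = 0" "U3 \<in> sets lborel"
    by (rule AE_E)
  show ?thesis
  proof (rule that[of "U1 \<union> U2 \<union> U3"])
    show "U1 \<union> U2 \<union> U3 \<in> sets borel" using U1 U2 U3 by auto
    have "emeasure lborel (U1 \<union> U2 \<union> U3) \<le> emeasure lborel (U1 \<union> U2) + emeasure lborel U3"
      using U1 U2 U3 by (intro emeasure_subadditive) auto
    also have "\<dots> \<le> (emeasure lborel U1 + emeasure lborel U2) + 0"
      using U1 U2 U3 by (intro add_mono emeasure_subadditive) auto
    also have "\<dots> \<le> (ennreal (25 * A / s powr p) + ennreal (25 * (M * A) / s powr p)) + 0"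
      by (intro add_mono U1 U2) simp
    also have "\<dots> = ennreal (25 * A / s powr p + 25 * (M * A) / s powr p)"
      using A0 M by (subst ennreal_plus) simp_all
    also have "25 * A / s powr p + 25 * (M * A) / s powr p = (25 * (M + 1) / s powr p) * A"
      by (simp add: add_divide_distrib algebra_simps)
    also have "ennreal \<dots> \<le> ennreal ((25 * (M + 1) / s powr p) * t)"
      using At M by (intro ennreal_leI mult_left_mono) auto
    also have "(25 * (M + 1) / s powr p) * t = d"
    proof -
      have "25 * (M + 1) \<noteq> 0" "s powr p \<noteq> 0" using M s by auto
      then show ?thesis unfolding t_def by (simp only: times_divide_times_eq) (simp add: mult_ac)
    qed
    finally show "emeasure lborel (U1 \<union> U2 \<union> U3) \<le> ennreal d" .
    fix z assume z: "z \<notin> U1 \<union> U2 \<union> U3"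
    then have "z \<notin> {z \<in> space lborel. \<not> (\<exists>r>0. \<forall>y\<in>ball z r. \<phi> y = \<phi> z)}" using U3(1) by blast
    then have "\<exists>r>0. \<forall>y\<in>ball z r. \<phi> y = \<phi> z"
      by (simp only: mem_Collect_eq space_lborel space_borel UNIV_I simp_thms)
    then obtain r where r: "r > 0" "\<forall>y\<in>ball z r. \<phi> y = \<phi> z" by (elim exE conjE)
    have fg: "f = (\<lambda>y. g y + \<phi> y)" by (simp add: g_def)
    show "pv_osc f z (8 * s)"
      by (rule pv_osc_small[OF p g \<phi> fg r(1) bspec[OF r(2)] s U2(3) U1(3)]) (use z in auto)
  qed
qed

text \<open>The property fails only inside sets of arbitrarily small measure, hence inside their
  intersection, a null set.\<close>

lemma AE_pv_osc:
  assumes p: "p > 1" and pq: "1/p + 1/q = 1" and f: "f \<in> lp_borel p" and s: "s > 0"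
  shows "AE z in lborel. pv_osc f z s"
proof -
  have s8: "s / 8 > 0" using s by simp
  have "\<exists>U. U \<in> sets borel \<and> emeasure lborel U \<le> ennreal (1 / real (Suc n)) \<and> (\<forall>z. z \<notin> U \<longrightarrow> pv_osc f z s)" for n
    by (rule pv_osc_exceptional[OF p pq f s8, of "1 / real (Suc n)"]) auto
  then obtain U where U: "\<And>n. U n \<in> sets borel" "\<And>n. emeasure lborel (U n) \<le> ennreal (1 / real (Suc n))"
    "\<And>n z. z \<notin> U n \<Longrightarrow> pv_osc f z s" by metis
  have Is: "(\<Inter>n. U n) \<in> sets lborel" using U(1) by auto
  have "emeasure lborel (\<Inter>n. U n) \<le> ennreal (1 / real (Suc n))" for n
    by (rule order_trans[OF emeasure_mono U(2)]) (use U(1) in auto)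
  moreover have "(\<lambda>n. ennreal (1 / real (Suc n))) \<longlonglongrightarrow> ennreal 0"
    by (intro tendsto_ennrealI LIMSEQ_Suc[OF lim_1_over_n])
  ultimately have "emeasure lborel (\<Inter>n. U n) \<le> ennreal 0"
    by (intro LIMSEQ_le_const) auto
  then have z: "emeasure lborel (\<Inter>n. U n) = 0" by simp
  show ?thesis by (rule AE_I[OF _ z Is]) (use U(3) in auto)
qed

text \<open>This is Cauchy's criterion: the limit is obtained along 1 / (n + 1), extended to all e,
  and inherited by the smoothed kernels, whose distance from the truncations tends to 0.\<close>

lemma pv_osc_limit:
  assumes osc: "\<And>m. pv_osc f z (1 / real (Suc m))"
  obtains l where "((\<lambda>e. cconv (trunc_kernel e) f z) \<longlongrightarrow> l) (at_right 0)"
    "(\<lambda>n. cconv (beurling_kernel (1 / real (Suc n))) f z) \<longlonglongrightarrow> l"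
proof -
  define T where "T e = cconv (trunc_kernel e) f z" for e
  define K where "K e = cconv (beurling_kernel e) f z" for e
  have "\<exists>r>0. \<forall>e. 0 < e \<and> e < r \<longrightarrow> norm (T e - K e) \<le> 1 / real (Suc m) \<and>
     (\<forall>e'. 0 < e' \<and> e' < r \<longrightarrow> norm (T e - T e') \<le> 1 / real (Suc m))" for m
    using osc[of m] unfolding pv_osc_def T_def K_def .
  then obtain r where r: "\<And>m. r m > 0"
    and TK: "\<And>m e. 0 < e \<Longrightarrow> e < r m \<Longrightarrow> norm (T e - K e) \<le> 1 / real (Suc m)"
    and TT: "\<And>m e e'. 0 < e \<Longrightarrow> e < r m \<Longrightarrow> 0 < e' \<Longrightarrow> e' < r m \<Longrightarrow> norm (T e - T e') \<le> 1 / real (Suc m)"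
    by metis
  define u where "u n = 1 / real (Suc n)" for n
  have u0: "u n > 0" for n by (simp add: u_def)
  have ulim: "u \<longlonglongrightarrow> 0" unfolding u_def by (rule LIMSEQ_Suc[OF lim_1_over_n])
  have uev: "\<forall>\<^sub>F n in sequentially. u n < d" if "d > 0" for d using order_tendstoD(2)[OF ulim that] .
  have small: "\<exists>m. 1 / real (Suc m) < d" if "d > 0" for d :: real
    using uev[OF that] by (auto simp: eventually_sequentially u_def)
  have "Cauchy (\<lambda>n. T (u n))"
  proof (rule CauchyI)
    fix d :: real assume "d > 0"
    then obtain m where m: "1 / real (Suc m) < d" using small by blast
    obtain N where N: "\<And>n. n \<ge> N \<Longrightarrow> u n < r m" using uev[OF r[of m]] by (auto simp: eventually_sequentially)
    have "norm (T (u i) - T (u j)) < d" if "i \<ge> N" "j \<ge> N" for i j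
      using TT[OF u0 N[OF that(1)] u0 N[OF that(2)]] m by linarith
    then show "\<exists>M. \<forall>i\<ge>M. \<forall>j\<ge>M. norm (T (u i) - T (u j)) < d" by blast
  qed
  then obtain l where l: "(\<lambda>n. T (u n)) \<longlonglongrightarrow> l" by (auto simp: Cauchy_convergent_iff convergent_def)
  have near: "norm (T e - l) \<le> 1 / real (Suc m)" if e: "0 < e" "e < r m" for e m
  proof (rule LIMSEQ_le_const2)
    show "(\<lambda>n. norm (T e - T (u n))) \<longlonglongrightarrow> norm (T e - l)" by (intro tendsto_intros l)
    obtain N where N: "\<And>n. n \<ge> N \<Longrightarrow> u n < r m" using uev[OF r[of m]] by (auto simp: eventually_sequentially)
    show "\<exists>N. \<forall>n\<ge>N. norm (T e - T (u n)) \<le> 1 / real (Suc m)" using TT[OF e u0 N] by blast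
  qed
  have "(T \<longlongrightarrow> l) (at_right 0)"
  proof (rule tendstoI)
    fix d :: real assume "d > 0"
    then obtain m where m: "1 / real (Suc m) < d" using small by blast
    have "dist (T e) l < d" if "0 < e" "e < r m" for e using near[OF that] m unfolding dist_norm by linarith
    then show "\<forall>\<^sub>F e in at_right 0. dist (T e) l < d" using r[of m] unfolding eventually_at_right_field by blast
  qed
  moreover have "(\<lambda>n. T (u n) - K (u n)) \<longlonglongrightarrow> 0"
  proof (rule LIMSEQ_I)
    fix d :: real assume "d > 0"
    then obtain m where m: "1 / real (Suc m) < d" using small by blast
    obtain N where N: "\<And>n. n \<ge> N \<Longrightarrow> u n < r m" using uev[OF r[of m]] by (auto simp: eventually_sequentially)
    have "norm (T (u n) - K (u n) - 0) < d" if "n \<ge> N" for n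
      using TK[OF u0 N[OF that]] m by simp
    then show "\<exists>N. \<forall>n\<ge>N. norm (T (u n) - K (u n) - 0) < d" by blast
  qed
  then have "(\<lambda>n. K (u n)) \<longlonglongrightarrow> l" using tendsto_diff[OF l, of "\<lambda>n. T (u n) - K (u n)" 0] by simp
  ultimately show ?thesis unfolding T_def K_def u_def by (intro that)
qed

lemma AE_principal_value:
  assumes p: "p > 1" and pq: "1/p + 1/q = 1" and f: "f \<in> lp_borel p"
  shows "AE z in lborel. \<exists>l. ((\<lambda>e. cconv (trunc_kernel e) f z) \<longlongrightarrow> l) (at_right 0) \<and>
    (\<lambda>n. cconv (beurling_kernel (1 / real (Suc n))) f z) \<longlonglongrightarrow> l"
proof -
  have "AE z in lborel. \<forall>m. pv_osc f z (1 / real (Suc m))"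
    unfolding AE_all_countable by (intro allI AE_pv_osc[OF p pq f]) simp
  then show ?thesis
  proof eventually_elim
    case (elim z)
    then show ?case using pv_osc_limit[of f z] by metis
  qed
qed

subsection \<open>Lebesgue measurable functions\<close>

lemma lebesgue_borel_version:
  fixes f :: "complex \<Rightarrow> complex"
  assumes "f \<in> borel_measurable lebesgue"
  obtains g where "g \<in> borel_measurable borel" "AE x in lborel. f x = g x"
proof -
  have "(\<lambda>x. Re (f x)) \<in> borel_measurable lebesgue" "(\<lambda>x. Im (f x)) \<in> borel_measurable lebesgue"
    using assms by simp_all
  then obtain u v where u: "u \<in> borel_measurable lborel" "AE x in lborel. Re (f x) = u x"
    and v: "v \<in> borel_measurable lborel" "AE x in lborel. Im (f x) = v x"
    by (metis completion_ex_borel_measurable_real)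
  have "(\<lambda>x. Complex (u x) (v x)) = (\<lambda>x. of_real (u x) + \<i> * of_real (v x))" by (simp add: complex_eq_iff fun_eq_iff)
  moreover have "(\<lambda>x. complex_of_real (u x) + \<i> * of_real (v x)) \<in> borel_measurable borel" using u(1) v(1) by simp
  ultimately have "(\<lambda>x. Complex (u x) (v x)) \<in> borel_measurable borel" by simp
  moreover have "AE x in lborel. f x = Complex (u x) (v x)" using u(2) v(2) by eventually_elim (simp add: complex_eq_iff)
  ultimately show ?thesis by (rule that)
qed

lemma Lp_space_borel_version:
  assumes f: "f \<in> Lp_space p"
  obtains g where "g \<in> lp_borel p" "AE x in lborel. f x = g x"
    "(LINT z|lborel. norm (g z) powr p) = (LINT z|lebesgue. norm (f z) powr p)"
proof -
  have fm: "f \<in> borel_measurable lebesgue" and fi: "integrable lebesgue (\<lambda>z. norm (f z) powr p)" using f by (auto simp: Lp_space_def)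
  obtain g where gm [measurable]: "g \<in> borel_measurable borel" and fg: "AE x in lborel. f x = g x"
    by (rule lebesgue_borel_version[OF fm])
  have gp [measurable]: "(\<lambda>z. norm (g z) powr p) \<in> borel_measurable lborel" by measurable
  have ae: "AE z in lebesgue. norm (f z) powr p = norm (g z) powr p"
    using AE_completion[OF fg] by eventually_elim simp
  have fpm: "(\<lambda>z. norm (f z) powr p) \<in> borel_measurable lebesgue" using fi by (rule borel_measurable_integrable)
  have gpm: "(\<lambda>z. norm (g z) powr p) \<in> borel_measurable lebesgue" by (rule measurable_completion[OF gp])
  have "integrable lebesgue (\<lambda>z. norm (g z) powr p)" using fi integrable_cong_AE[OF fpm gpm ae] by simp
  then have "integrable lborel (\<lambda>z. norm (g z) powr p)" by (simp add: integrable_completion[OF gp])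
  then have "g \<in> lp_borel p" by (simp add: lp_borel_def)
  moreover have "(LINT z|lborel. norm (g z) powr p) = (LINT z|lebesgue. norm (f z) powr p)"
    using integral_cong_AE[OF fpm gpm ae] integral_completion[OF gp] by simp
  ultimately show ?thesis using fg by (intro that)
qed

text \<open>Changing f on a null set changes no truncated integral, so the Borel representative
  gives the same truncations at every z, not just almost everywhere.\<close>

lemma beurling_truncated_eq_cconv:
  assumes f: "f \<in> borel_measurable lebesgue" and [measurable]: "g \<in> borel_measurable borel" and fg: "AE x in lborel. f x = g x"
  shows "beurling_truncated f z e = cconv (trunc_kernel e) g z"
proof -
  define k where "k \<zeta> = (indicator {\<zeta>. e < dist z \<zeta>} \<zeta> :: real) *\<^sub>R (1 / (z - \<zeta>)\<^sup>2)" for \<zeta>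
  have km [measurable]: "k \<in> borel_measurable lborel" unfolding k_def[abs_def] by measurable
  have gm: "(\<lambda>\<zeta>. k \<zeta> * g \<zeta>) \<in> borel_measurable lborel" by measurable
  have fm: "(\<lambda>\<zeta>. k \<zeta> * f \<zeta>) \<in> borel_measurable lebesgue" using f measurable_completion[OF km] by (rule borel_measurable_times[rotated])
  have "(LINT \<zeta>:{\<zeta>. e < dist z \<zeta>}|lebesgue. f \<zeta> / (z - \<zeta>)\<^sup>2) = (LINT \<zeta>|lebesgue. k \<zeta> * f \<zeta>)"
    unfolding set_lebesgue_integral_def k_def by (simp add: scaleR_conv_of_real)
  also have "\<dots> = (LINT \<zeta>|lebesgue. k \<zeta> * g \<zeta>)"
    using AE_completion[OF fg] by (intro integral_cong_AE fm measurable_completion[OF gm]) (auto elim: eventually_mono)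
  also have "\<dots> = (LINT \<zeta>|lborel. k \<zeta> * g \<zeta>)" by (rule integral_completion[OF gm])
  finally have "beurling_truncated f z e = (LINT \<zeta>|lborel. - (1 / complex_of_real pi) * (k \<zeta> * g \<zeta>))"
    unfolding beurling_truncated_def by simp
  also have "(\<lambda>\<zeta>. - (1 / complex_of_real pi) * (k \<zeta> * g \<zeta>)) = (\<lambda>\<zeta>. trunc_kernel e (z - \<zeta>) * g \<zeta>)"
    by (auto simp: fun_eq_iff k_def trunc_kernel_def dist_norm)
  finally show ?thesis by (simp add: cconv_def)
qed

lemma beurling_principal_value:
  assumes p: "p > 1" and pq: "1/p + 1/q = 1" and f: "f \<in> Lp_space p" and g: "g \<in> lp_borel p" and fg: "AE x in lborel. f x = g x"
  shows "AE z in lborel. beurling_pv_exists f z \<and> (\<lambda>n. cconv (beurling_kernel (1 / real (Suc n))) g z) \<longlonglongrightarrow> ahlfors_beurling f z"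
proof -
  have fm: "f \<in> borel_measurable lebesgue" using f by (simp add: Lp_space_def)
  have gm: "g \<in> borel_measurable borel" using g by (simp add: lp_borel_def)
  have tr: "beurling_truncated f z = (\<lambda>e. cconv (trunc_kernel e) g z)" for z
    by (rule ext) (rule beurling_truncated_eq_cconv[OF fm gm fg])
  show ?thesis using AE_principal_value[OF p pq g]
  proof eventually_elim
    case (elim z)
    then obtain l where l: "((\<lambda>e. cconv (trunc_kernel e) g z) \<longlongrightarrow> l) (at_right 0)"
      "(\<lambda>n. cconv (beurling_kernel (1 / real (Suc n))) g z) \<longlonglongrightarrow> l" by blast
    have "ahlfors_beurling f z = l"
      unfolding ahlfors_beurling_def tr by (rule tendsto_Lim[OF _ l(1)]) (simp add: trivial_limit_at_right_real)
    then show ?case using l unfolding beurling_pv_exists_def tr by blast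
  qed
qed

text \<open>The transform has unspecified values on a null set, so the Borel function
  \<open>h\<close> takes its place. Completeness of Lebesgue measure carries measurability back, and
  Fatou's lemma transfers the uniform bound of the smoothed transforms.\<close>

lemma ahlfors_beurling_norm:
  assumes p: "p > 1" and pq: "1/p + 1/q = 1" and f: "f \<in> Lp_space p"
  shows "ahlfors_beurling f \<in> Lp_space p"
    and "(LINT z|lebesgue. norm (ahlfors_beurling f z) powr p) \<le> (2 * (max p q - 1)) powr p * (LINT z|lebesgue. norm (f z) powr p)"
proof -
  obtain g where g: "g \<in> lp_borel p" and fg: "AE x in lborel. f x = g x"
    and int: "(LINT z|lborel. norm (g z) powr p) = (LINT z|lebesgue. norm (f z) powr p)"
    by (rule Lp_space_borel_version[OF f])
  have gm [measurable]: "g \<in> borel_measurable borel" using g by (simp add: lp_borel_def)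
  define K where "K n z = cconv (beurling_kernel (1 / real (Suc n))) g z" for n z
  have [measurable]: "K n \<in> borel_measurable borel" for n unfolding K_def[abs_def] by measurable
  define B where "B = (2 * (max p q - 1)) powr p * (LINT z|lborel. norm (g z) powr p)"
  have B: "B \<ge> 0" unfolding B_def by (intro mult_nonneg_nonneg integral_nonneg_AE) auto
  have lim: "AE z in lborel. (\<lambda>n. K n z) \<longlonglongrightarrow> ahlfors_beurling f z"
    using beurling_principal_value[OF p pq f g fg] unfolding K_def by eventually_elim simp
  define h where "h z = lim (\<lambda>n. K n z)" for z
  have hm [measurable]: "h \<in> borel_measurable lborel" unfolding h_def[abs_def] by measurable
  have hT: "AE z in lborel. h z = ahlfors_beurling f z"
    using lim by eventually_elim (simp add: h_def limI)
  have Tm: "ahlfors_beurling f \<in> borel_measurable lebesgue"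
    by (rule borel_measurable_AE[OF measurable_completion[OF hm] AE_completion[OF hT]])
  have "(\<integral>\<^sup>+z. ennreal (norm (h z) powr p) \<partial>lborel) \<le> (\<integral>\<^sup>+z. liminf (\<lambda>n. ennreal (norm (K n z) powr p)) \<partial>lborel)"
  proof (rule nn_integral_mono_AE)
    show "AE z in lborel. ennreal (norm (h z) powr p) \<le> liminf (\<lambda>n. ennreal (norm (K n z) powr p))"
      using lim hT
    proof eventually_elim
      case (elim z)
      have "(\<lambda>n. norm (K n z) powr p) \<longlonglongrightarrow> norm (h z) powr p"
        using elim p by (intro tendsto_powr2 tendsto_norm tendsto_const) auto
      then have "(\<lambda>n. ennreal (norm (K n z) powr p)) \<longlonglongrightarrow> ennreal (norm (h z) powr p)" by (rule tendsto_ennrealI)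
      then have "liminf (\<lambda>n. ennreal (norm (K n z) powr p)) = ennreal (norm (h z) powr p)"
        by (rule lim_imp_Liminf[rotated]) simp
      then show ?case by simp
    qed
  qed
  also have "\<dots> \<le> liminf (\<lambda>n. \<integral>\<^sup>+z. ennreal (norm (K n z) powr p) \<partial>lborel)"
    by (rule nn_integral_liminf) measurable
  also have "\<dots> \<le> liminf (\<lambda>n. ennreal B)"
    unfolding K_def B_def by (intro Liminf_mono always_eventually allI beurling_norm[OF p pq g]) simp
  also have "\<dots> = ennreal B" by (simp add: Liminf_const)
  finally have hB: "(\<integral>\<^sup>+z. ennreal (norm (h z) powr p) \<partial>lborel) \<le> ennreal B" .
  have hp: "(\<lambda>z. norm (h z) powr p) \<in> borel_measurable lborel" by measurable
  have hi: "integrable lborel (\<lambda>z. norm (h z) powr p)"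
    by (rule integrableI_bounded[OF hp]) (use hB in \<open>auto simp: less_top[symmetric] top_unique\<close>)
  have Tp: "(\<lambda>z. norm (ahlfors_beurling f z) powr p) \<in> borel_measurable lebesgue" using Tm by simp
  have ae: "AE z in lebesgue. norm (h z) powr p = norm (ahlfors_beurling f z) powr p"
    using AE_completion[OF hT] by eventually_elim simp
  have "integrable lebesgue (\<lambda>z. norm (h z) powr p)" using hi by (simp add: integrable_completion[OF hp])
  then have "integrable lebesgue (\<lambda>z. norm (ahlfors_beurling f z) powr p)"
    using integrable_cong_AE[OF measurable_completion[OF hp] Tp ae] by simp
  then show "ahlfors_beurling f \<in> Lp_space p" using Tm by (simp add: Lp_space_def)
  have "(LINT z|lebesgue. norm (ahlfors_beurling f z) powr p) = (LINT z|lborel. norm (h z) powr p)"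
    using integral_cong_AE[OF measurable_completion[OF hp] Tp ae] integral_completion[OF hp] by simp
  also have "\<dots> \<le> B" using hB nn_integral_eq_integral[OF hi] B by simp
  finally show "(LINT z|lebesgue. norm (ahlfors_beurling f z) powr p) \<le> (2 * (max p q - 1)) powr p * (LINT z|lebesgue. norm (f z) powr p)"
    by (simp add: B_def int)
qed

lemma ahlfors_beurling_operator_norm:
  assumes p: "p > 1" and pq: "1/p + 1/q = 1"
  shows "Lp_operator_norm p ahlfors_beurling \<le> ennreal (2 * (max p q - 1))"
  unfolding Lp_operator_norm_def
proof (rule SUP_least)
  define D where "D = 2 * (max p q - 1)"
  have D: "D > 0" using p by (simp add: D_def)
  fix f assume "f \<in> {f. Lp_norm p f \<le> 1}"
  then have f1: "Lp_norm p f \<le> 1" by simp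
  \<comment> \<open>Membership comes from the norm bound, as \<open>Lp_norm\<close> is infinite
    outside the space.\<close>
  then have f: "f \<in> Lp_space p" by (auto simp: Lp_norm_def top_unique split: if_splits)
  define A where "A = (LINT z|lebesgue. norm (f z) powr p)"
  have A0: "A \<ge> 0" unfolding A_def by (intro integral_nonneg_AE) auto
  have "A powr (1 / p) \<le> 1" using f1 f by (simp add: Lp_norm_def A_def)
  then have "(A powr (1 / p)) powr p \<le> 1 powr p" using p by (intro powr_mono2) auto
  then have A1: "A \<le> 1" using p A0 by (simp add: powr_powr)
  define E where "E = (LINT z|lebesgue. norm (ahlfors_beurling f z) powr p)"
  have E0: "E \<ge> 0" unfolding E_def by (intro integral_nonneg_AE) auto
  have "E \<le> D powr p * A" unfolding E_def D_def A_def by (rule ahlfors_beurling_norm(2)[OF p pq f])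
  also have "\<dots> \<le> D powr p * 1" using A1 by (intro mult_left_mono) auto
  finally have "E powr (1 / p) \<le> (D powr p) powr (1 / p)" using p E0 by (intro powr_mono2) auto
  also have "\<dots> = D" using p D by (simp add: powr_powr)
  finally have "ennreal (E powr (1 / p)) \<le> ennreal D" by (rule ennreal_leI)
  then show "Lp_norm p (ahlfors_beurling f) \<le> ennreal (2 * (max p q - 1))"
    using ahlfors_beurling_norm(1)[OF p pq f] by (simp add: Lp_norm_def E_def D_def)
qed

subsection \<open>The constant \<open>I(\<surd>2, \<pi>/2)\<close>\<close>

lemma AE_not_finite: "finite S \<Longrightarrow> AE x::real in lborel. x \<notin> S"
  by (intro AE_not_in finite_imp_null_set_lborel)

text \<open>The value is the length of the overlap of two intervals; open or closed ends matter at
  finitely many points only.\<close>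

lemma overlap_integral:
  fixes a b c d x :: real
  shows "has_bochner_integral lborel (\<lambda>t. indicator {a..<b} t * indicator {c..<d} (x - t) :: real)
    (max 0 (min b (x - c) - max a (x - d)))"
proof -
  define l where "l = max a (x - d)"
  define u where "u = min b (x - c)"
  have "emeasure lborel {l..u} < \<infinity>" by (simp add: emeasure_lborel_Icc_eq)
  then have "has_bochner_integral lborel (indicator {l..u} :: real \<Rightarrow> real) (measure lborel {l..u})"
    by (intro has_bochner_integral_real_indicator) auto
  moreover have "measure lborel {l..u} = max 0 (u - l)" by (cases "l \<le> u") auto
  moreover have "AE t in lborel. indicator {l..u} t = (indicator {a..<b} t * indicator {c..<d} (x - t) :: real)"
  proof -
    have "AE t in lborel. t \<notin> {a, b, x - c, x - d}" by (rule AE_not_finite) simp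
    then show ?thesis by eventually_elim (auto simp: indicator_def l_def u_def)
  qed
  ultimately show ?thesis
    unfolding l_def[symmetric] u_def[symmetric] by (subst has_bochner_integral_cong_AE[symmetric]) auto
qed

lemma haar_beta_eq: "haar_beta x = max 0 (1 - \<bar>x\<bar>)"
proof -
  have "haar_beta x = max 0 (min (1/2) (x - -1/2) - max (-1/2) (x - 1/2))"
    unfolding haar_beta_def convolution_def chi0_def by (rule has_bochner_integral_integral_eq[OF overlap_integral])
  then show ?thesis by (auto simp: max_def min_def abs_if)
qed

lemma haar_alpha_eq:
  "haar_alpha x = (if \<bar>x\<bar> \<le> 1/2 then 3 * \<bar>x\<bar> - 1 else max 0 (1 - \<bar>x\<bar>))"
proof -
  have e: "haar0 t * haar0 (x - t) =
     indicator {0..<1/2} t * indicator {0..<1/2} (x - t) - indicator {0..<1/2} t * indicator {-1/2..<0} (x - t)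
     - indicator {-1/2..<0} t * indicator {0..<1/2} (x - t) + indicator {-1/2..<0} t * indicator {-1/2..<0} (x - t)" for t
    by (simp add: haar0_def algebra_simps)
  have "has_bochner_integral lborel (\<lambda>t. haar0 t * haar0 (x - t))
     (max 0 (min (1/2) (x - 0) - max 0 (x - 1/2)) - max 0 (min (1/2) (x - -1/2) - max 0 (x - 0))
      - max 0 (min 0 (x - 0) - max (-1/2) (x - 1/2)) + max 0 (min 0 (x - -1/2) - max (-1/2) (x - 0)))"
    unfolding e by (intro has_bochner_integral_add has_bochner_integral_diff overlap_integral)
  then have "haar_alpha x = max 0 (min (1/2) (x - 0) - max 0 (x - 1/2)) - max 0 (min (1/2) (x - -1/2) - max 0 (x - 0))
      - max 0 (min 0 (x - 0) - max (-1/2) (x - 1/2)) + max 0 (min 0 (x - -1/2) - max (-1/2) (x - 0))"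
    unfolding haar_alpha_def convolution_def by (rule has_bochner_integral_integral_eq)
  then show ?thesis by (auto simp: max_def min_def abs_if)
qed

lemma haar_F_minus: "haar_F (- x) y = haar_F x y" "haar_F x (- y) = haar_F x y"
  by (simp_all add: haar_F_def haar_alpha_eq haar_beta_eq)

text \<open>For y > 1/2 the values of \<open>haar_alpha\<close> and \<open>haar_beta\<close> at y
  agree, two of the three products cancel and the break at x = 1/2 disappears. The pieces are
  written as A + B x for the integration in x.\<close>

lemma haar_F_eq:
  assumes "0 \<le> x" "0 \<le> y"
  shows "x \<le> 1/2 \<Longrightarrow> y \<le> 1/2 \<Longrightarrow> haar_F x y = (y - 1) + (5 - 9 * y) * x"
    and "1/2 < x \<Longrightarrow> x \<le> 1 \<Longrightarrow> y \<le> 1/2 \<Longrightarrow> haar_F x y = (3 - 7 * y) + (7 * y - 3) * x"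
    and "x \<le> 1 \<Longrightarrow> 1/2 < y \<Longrightarrow> y \<le> 1 \<Longrightarrow> haar_F x y = (y - 1) + (1 - y) * x"
    and "1 < x \<or> 1 < y \<Longrightarrow> haar_F x y = 0"
  using assms by (auto simp: haar_F_def haar_alpha_eq haar_beta_eq algebra_simps)

text \<open>The integrals in x and in y share the evenness and the breakpoints 0, 1/2, 1. The
  formulas g and h are compared with f on open intervals only, as the endpoints form a null
  set.\<close>

lemma even_piecewise_integral:
  fixes f g h :: "real \<Rightarrow> real"
  assumes fm [measurable]: "f \<in> borel_measurable borel" and even: "\<And>x. f (- x) = f x"
    and g: "\<And>x. 0 < x \<Longrightarrow> x < 1/2 \<Longrightarrow> f x = g x" "continuous_on {0..1/2} g"
    and h: "\<And>x. 1/2 < x \<Longrightarrow> x < 1 \<Longrightarrow> f x = h x" "continuous_on {1/2..1} h"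
    and 0: "\<And>x. 1 < x \<Longrightarrow> f x = 0"
  shows "(LINT x|lborel. f x) = 2 * (integral {0..1/2} g + integral {1/2..1} h)"
proof -
  have gi: "set_integrable lborel {0..1/2} g" by (rule borel_integrable_atLeastAtMost'[OF g(2)])
  have hi: "set_integrable lborel {1/2..1} h" by (rule borel_integrable_atLeastAtMost'[OF h(2)])
  define k where "k x = indicator {0..1/2} x *\<^sub>R g x + indicator {1/2..1} x *\<^sub>R h x" for x
  have ki: "integrable lborel k"
    unfolding k_def[abs_def] using gi hi unfolding set_integrable_def by (rule Bochner_Integration.integrable_add)
  have kv: "(LINT x|lborel. k x) = integral {0..1/2} g + integral {1/2..1} h"
    using gi hi set_borel_integral_eq_integral(2)[OF gi] set_borel_integral_eq_integral(2)[OF hi]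
    unfolding k_def set_integrable_def set_lebesgue_integral_def by simp
  have kr: "integrable lborel (\<lambda>x. k (- x))" using lborel_integrable_real_affine[OF ki, of "-1" 0] by simp
  have kre: "(LINT x|lborel. k (- x)) = (LINT x|lborel. k x)"
    using lborel_integral_real_affine[of "-1" k 0] by simp
  have "(LINT x|lborel. f x) = (LINT x|lborel. k x + k (- x))"
  proof (rule integral_cong_AE)
    show "(\<lambda>x. k x + k (- x)) \<in> borel_measurable lborel"
      using ki kr by (intro borel_measurable_integrable) (rule Bochner_Integration.integrable_add)
    have "AE x in lborel. x \<notin> {0, 1/2, -1/2, 1, -1 :: real}" by (rule AE_not_finite) simp
    then show "AE x in lborel. f x = k x + k (- x)"
    proof eventually_elim
      case (elim x)
      have pos: "f x = k x \<and> k (- x) = 0" if "x > 0" "x \<noteq> 1/2" "x \<noteq> 1" for x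
        using that g(1)[of x] h(1)[of x] 0[of x] by (auto simp: k_def indicator_def)
      show ?case
      proof (cases "x > 0")
        case True
        then show ?thesis using pos[of x] elim by auto
      next
        case False
        then show ?thesis using pos[of "- x"] elim even[of x] by auto
      qed
    qed
  qed simp
  also have "\<dots> = 2 * (LINT x|lborel. k x)" using ki kr kre by simp
  finally show ?thesis unfolding kv .
qed

section \<open>Integration in closed form\<close>

lemma has_integral_Cauchy_kernel:
  fixes y A B a b :: real
  assumes y: "y > 0" and ab: "a \<le> b"
  shows "((\<lambda>x. (A + B * x) * (y\<^sup>2 / (x\<^sup>2 + 2 * y\<^sup>2))) has_integral
     y * (A * (arctan (b / (sqrt 2 * y)) - arctan (a / (sqrt 2 * y))) / sqrt 2)
     + y\<^sup>2 / 2 * B * (ln (b\<^sup>2 + 2 * y\<^sup>2) - ln (a\<^sup>2 + 2 * y\<^sup>2))) {a..b}"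
proof -
  define \<Phi> where "\<Phi> x = y * (A * arctan (x / (sqrt 2 * y)) / sqrt 2) + y\<^sup>2 / 2 * B * ln (x\<^sup>2 + 2 * y\<^sup>2)" for x
  have d: "(\<Phi> has_real_derivative (A + B * x) * (y\<^sup>2 / (x\<^sup>2 + 2 * y\<^sup>2))) (at x within {a..b})" for x
  proof -
    have p: "x\<^sup>2 + 2 * y\<^sup>2 > 0" using y by (simp add: add_nonneg_pos)
    have "((\<lambda>x. arctan (x / (sqrt 2 * y))) has_real_derivative inverse (1 + (x / (sqrt 2 * y))\<^sup>2) * (1 / (sqrt 2 * y))) (at x within {a..b})"
      by (rule DERIV_chain2[OF DERIV_arctan]) (use y in \<open>auto intro!: derivative_eq_intros\<close>)
    moreover have "inverse (1 + (x / (sqrt 2 * y))\<^sup>2) * (1 / (sqrt 2 * y)) = sqrt 2 * y / (x\<^sup>2 + 2 * y\<^sup>2)"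
    proof -
      have "1 + (x / (sqrt 2 * y))\<^sup>2 = (x\<^sup>2 + 2 * y\<^sup>2) / (2 * y\<^sup>2)" using y by (simp add: power_divide power_mult_distrib field_simps)
      moreover have "1 / (sqrt 2 * y) = sqrt 2 * y / (2 * y\<^sup>2)" using y by (simp add: field_simps power2_eq_square)
      ultimately show ?thesis using y p by simp
    qed
    ultimately have D1: "((\<lambda>x. arctan (x / (sqrt 2 * y))) has_real_derivative sqrt 2 * y / (x\<^sup>2 + 2 * y\<^sup>2)) (at x within {a..b})" by simp
    have D2: "((\<lambda>x. ln (x\<^sup>2 + 2 * y\<^sup>2)) has_real_derivative 2 * x / (x\<^sup>2 + 2 * y\<^sup>2)) (at x within {a..b})"
      using p by (auto intro!: derivative_eq_intros simp: field_simps)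
    have "(\<Phi> has_real_derivative y * (A * (sqrt 2 * y / (x\<^sup>2 + 2 * y\<^sup>2)) / sqrt 2) + y\<^sup>2 / 2 * B * (2 * x / (x\<^sup>2 + 2 * y\<^sup>2))) (at x within {a..b})"
      unfolding \<Phi>_def by (intro DERIV_add DERIV_cmult DERIV_cdivide D1 D2)
    moreover have "y * (A * (sqrt 2 * y / (x\<^sup>2 + 2 * y\<^sup>2)) / sqrt 2) + y\<^sup>2 / 2 * B * (2 * x / (x\<^sup>2 + 2 * y\<^sup>2))
        = (A + B * x) * (y\<^sup>2 / (x\<^sup>2 + 2 * y\<^sup>2))"
    proof -
      have "y * (A * (sqrt 2 * y / (x\<^sup>2 + 2 * y\<^sup>2)) / sqrt 2) = A * (y\<^sup>2 / (x\<^sup>2 + 2 * y\<^sup>2))" by (simp add: power2_eq_square)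
      then show ?thesis by (simp add: algebra_simps add_divide_distrib)
    qed
    ultimately show ?thesis by simp
  qed
  have "((\<lambda>x. (A + B * x) * (y\<^sup>2 / (x\<^sup>2 + 2 * y\<^sup>2))) has_integral (\<Phi> b - \<Phi> a)) {a..b}"
    using d by (intro fundamental_theorem_of_calculus ab) (simp add: has_real_derivative_iff_has_vector_derivative)
  moreover have "\<Phi> b - \<Phi> a = y * (A * (arctan (b / (sqrt 2 * y)) - arctan (a / (sqrt 2 * y))) / sqrt 2)
     + y\<^sup>2 / 2 * B * (ln (b\<^sup>2 + 2 * y\<^sup>2) - ln (a\<^sup>2 + 2 * y\<^sup>2))"
    by (simp add: \<Phi>_def algebra_simps diff_divide_distrib)
  ultimately show ?thesis by simp
qed

text \<open>For y > 0 this is arctan (1 / (sqrt 2 * y)) / sqrt 2, in a form that is smooth through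
  0, so that primitives can be evaluated at y = 0.\<close>

definition acot2 :: "real \<Rightarrow> real" where "acot2 y = (pi / 2 - arctan (sqrt 2 * y)) / sqrt 2"

lemma acot2_eq:
  assumes "y > 0"
  shows "arctan (1 / (sqrt 2 * y)) = sqrt 2 * acot2 y"
proof -
  have "arctan (inverse (sqrt 2 * y)) = pi / 2 - arctan (sqrt 2 * y)" using assms by (intro arctan_inverse) auto
  then have "arctan (1 / (sqrt 2 * y)) = pi / 2 - arctan (sqrt 2 * y)" by (simp only: inverse_eq_divide)
  moreover have "sqrt 2 * (x / sqrt 2) = x" for x by simp
  ultimately show ?thesis unfolding acot2_def by (simp only:)
qed

lemma acot2_deriv: "(acot2 has_real_derivative - 1 / (1 + 2 * y\<^sup>2)) (at y)"
proof -
  have "((\<lambda>y. arctan (sqrt 2 * y)) has_real_derivative inverse (1 + (sqrt 2 * y)\<^sup>2) * sqrt 2) (at y)"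
    by (rule DERIV_chain2[OF DERIV_arctan]) (auto intro!: derivative_eq_intros)
  then have "(acot2 has_real_derivative (0 - inverse (1 + (sqrt 2 * y)\<^sup>2) * sqrt 2) / sqrt 2) (at y)"
    unfolding acot2_def by (intro DERIV_cdivide DERIV_diff DERIV_const)
  then show ?thesis by (simp add: power_mult_distrib divide_inverse mult.assoc)
qed

definition inner_F :: "real \<Rightarrow> real" where
  "inner_F y = (LINT x|lborel. haar_F x y * (y\<^sup>2 / (x\<^sup>2 + 2 * y\<^sup>2)))"

lemma inner_F_borel: "inner_F \<in> borel_measurable borel"
  unfolding inner_F_def[abs_def] haar_F_def haar_alpha_eq haar_beta_eq by measurable

lemma inner_F_even: "inner_F (- y) = inner_F y"
  by (simp add: inner_F_def haar_F_minus)

lemma haar_F_section_borel: "(\<lambda>x. haar_F x y * (y\<^sup>2 / (x\<^sup>2 + 2 * y\<^sup>2))) \<in> borel_measurable borel"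
  unfolding haar_F_def haar_alpha_eq haar_beta_eq by measurable

lemma continuous_Cauchy_kernel:
  fixes y A B :: real
  assumes "y > 0"
  shows "continuous_on S (\<lambda>x. (A + B * x) * (y\<^sup>2 / (x\<^sup>2 + 2 * y\<^sup>2)))"
proof -
  have "x\<^sup>2 + 2 * y\<^sup>2 \<noteq> 0" for x using assms by (simp add: sum_power2_eq_zero_iff add_nonneg_eq_0_iff)
  then show ?thesis by (intro continuous_intros) auto
qed

text \<open>The terms are sorted by the endpoint in x. The endpoint 1 gives arguments y; the
  endpoint 1/2 gives 2 y because 1/4 + 2 y^2 = (1 + 2 (2 y)^2) / 4; the endpoint 0 and the factor
  1/4 give the terms with ln y and ln 2. Each summand has an explicit primitive in y.\<close>

lemma inner_F_small:
  assumes y: "0 < y" "y < 1/2"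
  shows "inner_F y = 2 * (3 * (y * acot2 y) - 7 * (y\<^sup>2 * acot2 y) - 3/2 * (y\<^sup>2 * ln (1 + 2 * y\<^sup>2)) + 7/2 * (y ^ 3 * ln (1 + 2 * y\<^sup>2))
     + 2 * (- (2 * y * acot2 (2 * y)) + (2 * y)\<^sup>2 * acot2 (2 * y) + 1/2 * ((2 * y)\<^sup>2 * ln (1 + 2 * (2 * y)\<^sup>2)) - 1/2 * ((2 * y) ^ 3 * ln (1 + 2 * (2 * y)\<^sup>2)))
     + (- (21/2) * (y\<^sup>2 * ln 2) + 41/2 * (y ^ 3 * ln 2) - 5 * (y * (y * ln y)) + 9 * (y\<^sup>2 * (y * ln y))))"
proof -
  have v: "inner_F y = 2 * (integral {0..1/2} (\<lambda>x. ((y - 1) + (5 - 9 * y) * x) * (y\<^sup>2 / (x\<^sup>2 + 2 * y\<^sup>2)))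
      + integral {1/2..1} (\<lambda>x. ((3 - 7 * y) + (7 * y - 3) * x) * (y\<^sup>2 / (x\<^sup>2 + 2 * y\<^sup>2))))"
    unfolding inner_F_def
    using y by (intro even_piecewise_integral haar_F_section_borel continuous_Cauchy_kernel)
      (simp_all add: haar_F_minus haar_F_eq)
  have i1: "integral {0..1/2} (\<lambda>x. ((y - 1) + (5 - 9 * y) * x) * (y\<^sup>2 / (x\<^sup>2 + 2 * y\<^sup>2))) =
     y * ((y - 1) * (arctan (1/2 / (sqrt 2 * y)) - arctan (0 / (sqrt 2 * y))) / sqrt 2)
     + y\<^sup>2 / 2 * (5 - 9 * y) * (ln ((1/2)\<^sup>2 + 2 * y\<^sup>2) - ln (0\<^sup>2 + 2 * y\<^sup>2))"
    using y by (intro integral_unique has_integral_Cauchy_kernel) auto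
  have i2: "integral {1/2..1} (\<lambda>x. ((3 - 7 * y) + (7 * y - 3) * x) * (y\<^sup>2 / (x\<^sup>2 + 2 * y\<^sup>2))) =
     y * ((3 - 7 * y) * (arctan (1 / (sqrt 2 * y)) - arctan (1/2 / (sqrt 2 * y))) / sqrt 2)
     + y\<^sup>2 / 2 * (7 * y - 3) * (ln (1\<^sup>2 + 2 * y\<^sup>2) - ln ((1/2)\<^sup>2 + 2 * y\<^sup>2))"
    using y by (intro integral_unique has_integral_Cauchy_kernel) auto
  have a1: "arctan (1 / (sqrt 2 * y)) = sqrt 2 * acot2 y" by (rule acot2_eq[OF y(1)])
  have a2: "arctan (1/2 / (sqrt 2 * y)) = sqrt 2 * acot2 (2 * y)"
    using acot2_eq[of "2 * y"] y by (simp add: mult.left_commute)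
  have l1: "ln ((1/2)\<^sup>2 + 2 * y\<^sup>2) = ln (1 + 2 * (2 * y)\<^sup>2) - 2 * ln 2"
  proof -
    have p: "1 + 2 * (2 * y)\<^sup>2 > 0" by (simp add: add_pos_nonneg)
    have "(1/2)\<^sup>2 + 2 * y\<^sup>2 = (1 + 2 * (2 * y)\<^sup>2) / (2 * 2)" by (simp add: power2_eq_square)
    also have "ln \<dots> = ln (1 + 2 * (2 * y)\<^sup>2) - ln (2 * 2)" using p by (intro ln_divide_pos) auto
    also have "ln (2 * 2 :: real) = 2 * ln 2" by (subst ln_mult) auto
    finally show ?thesis .
  qed
  have l2: "ln (0\<^sup>2 + 2 * y\<^sup>2) = ln 2 + 2 * ln y" using y by (simp add: ln_mult ln_realpow)
  have c: "A * (sqrt 2 * u - sqrt 2 * w) / sqrt 2 = A * (u - w)" "A * (sqrt 2 * u - arctan (0 / r)) / sqrt 2 = A * u" for A u w r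
    by (simp_all flip: right_diff_distrib)
  have l3: "ln (1\<^sup>2 + 2 * y\<^sup>2) = ln (1 + 2 * y\<^sup>2)" by simp
  have "2 * (y * ((y - 1) * W) + y\<^sup>2 / 2 * (5 - 9 * y) * (M - 2 * l - (l + 2 * m)) +
      (y * ((3 - 7 * y) * (U - W)) + y\<^sup>2 / 2 * (7 * y - 3) * (L - (M - 2 * l)))) =
    2 * (3 * (y * U) - 7 * (y\<^sup>2 * U) - 3/2 * (y\<^sup>2 * L) + 7/2 * (y ^ 3 * L)
     + 2 * (- (2 * y * W) + (2 * y)\<^sup>2 * W + 1/2 * ((2 * y)\<^sup>2 * M) - 1/2 * ((2 * y) ^ 3 * M))
     + (- (21/2) * (y\<^sup>2 * l) + 41/2 * (y ^ 3 * l) - 5 * (y * (y * m)) + 9 * (y\<^sup>2 * (y * m))))" for U W L M l m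
    by (simp add: field_simps power2_eq_square power3_eq_cube)
  then show ?thesis unfolding v i1 i2 a1 a2 l1 l2 l3 c .
qed

text \<open>One formula is valid for all x in [0, 1], so the two pieces are merged and the endpoint
  1/2 leaves no terms.\<close>

lemma inner_F_large:
  assumes y: "1/2 < y" "y < 1"
  shows "inner_F y = 2 * ((- (y * acot2 y) + y\<^sup>2 * acot2 y + 1/2 * (y\<^sup>2 * ln (1 + 2 * y\<^sup>2)) - 1/2 * (y ^ 3 * ln (1 + 2 * y\<^sup>2)))
     + (- (1/2) * (y\<^sup>2 * ln 2) + 1/2 * (y ^ 3 * ln 2) - y * (y * ln y) + y\<^sup>2 * (y * ln y)))"
proof -
  have y0: "y > 0" using y by simp
  have v: "inner_F y = 2 * (integral {0..1/2} (\<lambda>x. ((y - 1) + (1 - y) * x) * (y\<^sup>2 / (x\<^sup>2 + 2 * y\<^sup>2)))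
      + integral {1/2..1} (\<lambda>x. ((y - 1) + (1 - y) * x) * (y\<^sup>2 / (x\<^sup>2 + 2 * y\<^sup>2))))"
    unfolding inner_F_def
    using y by (intro even_piecewise_integral haar_F_section_borel continuous_Cauchy_kernel)
      (simp_all add: haar_F_minus haar_F_eq)
  have "integral {0..1/2} (\<lambda>x. ((y - 1) + (1 - y) * x) * (y\<^sup>2 / (x\<^sup>2 + 2 * y\<^sup>2)))
      + integral {1/2..1} (\<lambda>x. ((y - 1) + (1 - y) * x) * (y\<^sup>2 / (x\<^sup>2 + 2 * y\<^sup>2)))
     = integral {0..1} (\<lambda>x. ((y - 1) + (1 - y) * x) * (y\<^sup>2 / (x\<^sup>2 + 2 * y\<^sup>2)))"
    using y0 by (intro Henstock_Kurzweil_Integration.integral_combine integrable_continuous_interval continuous_Cauchy_kernel) auto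
  also have "\<dots> = y * ((y - 1) * (arctan (1 / (sqrt 2 * y)) - arctan (0 / (sqrt 2 * y))) / sqrt 2)
     + y\<^sup>2 / 2 * (1 - y) * (ln (1\<^sup>2 + 2 * y\<^sup>2) - ln (0\<^sup>2 + 2 * y\<^sup>2))"
    using y by (intro integral_unique has_integral_Cauchy_kernel) auto
  finally have v2: "inner_F y = 2 * (y * ((y - 1) * (arctan (1 / (sqrt 2 * y)) - arctan (0 / (sqrt 2 * y))) / sqrt 2)
     + y\<^sup>2 / 2 * (1 - y) * (ln (1\<^sup>2 + 2 * y\<^sup>2) - ln (0\<^sup>2 + 2 * y\<^sup>2)))" unfolding v by simp
  have a1: "arctan (1 / (sqrt 2 * y)) = sqrt 2 * acot2 y" by (rule acot2_eq[OF y0])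
  have l2: "ln (0\<^sup>2 + 2 * y\<^sup>2) = ln 2 + 2 * ln y" using y by (simp add: ln_mult ln_realpow)
  have c: "A * (sqrt 2 * u - arctan (0 / r)) / sqrt 2 = A * u" for A u r by simp
  have l3: "ln (1\<^sup>2 + 2 * y\<^sup>2) = ln (1 + 2 * y\<^sup>2)" by simp
  have "2 * (y * ((y - 1) * U) + y\<^sup>2 / 2 * (1 - y) * (L - (l + 2 * m))) =
    2 * ((- (y * U) + y\<^sup>2 * U + 1/2 * (y\<^sup>2 * L) - 1/2 * (y ^ 3 * L))
     + (- (1/2) * (y\<^sup>2 * l) + 1/2 * (y ^ 3 * l) - y * (y * m) + y\<^sup>2 * (y * m)))" for U L l m
    by (simp add: field_simps power2_eq_square power3_eq_cube)
  then show ?thesis unfolding v2 a1 l2 l3 c .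
qed

lemma inner_F_outside: "1 < y \<Longrightarrow> inner_F y = 0"
proof -
  assume y: "1 < y"
  have "haar_F x y = 0" for x
  proof -
    have "haar_F x y = haar_F \<bar>x\<bar> y" by (simp add: abs_if haar_F_minus)
    also have "\<dots> = 0" using y by (intro haar_F_eq(4)) auto
    finally show ?thesis .
  qed
  then show "inner_F y = 0" by (simp add: inner_F_def)
qed


text \<open>The logarithm is singular at 0 but y ln y is continuous there; for this reason the
  product is kept as a unit in all formulas.\<close>

lemma continuous_on_times_ln: "continuous_on {0..} (\<lambda>y::real. y * ln y)"
  unfolding continuous_on_eq_continuous_within
proof
  fix x :: real assume "x \<in> {0..}"
  then consider "x > 0" | "x = 0" by (auto simp: less_le)
  then show "continuous (at x within {0..}) (\<lambda>y. y * ln y)"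
  proof cases
    case 1
    then show ?thesis by (intro continuous_intros) auto
  next
    case 2
    have "((\<lambda>y::real. y * ln y) \<longlongrightarrow> 0) (at_right 0)" by real_asymp
    then show ?thesis using 2 by (simp add: continuous_within at_within_Ici_at_right)
  qed
qed

lemma continuous_on_acot2: "continuous_on S acot2"
  unfolding acot2_def[abs_def] by (intro continuous_intros) auto

lemma continuous_on_ln_quadratic: "continuous_on S (\<lambda>y::real. ln (1 + 2 * y\<^sup>2))"
  by (intro continuous_intros) (auto simp: add_pos_nonneg less_imp_neq[THEN not_sym])

text \<open>Found by partial integration; the derivatives of \<open>acot2\<close> and of the
  logarithm have the common denominator d.\<close>

lemma primitives:
  fixes y :: real
  defines "d \<equiv> 1 + 2 * y\<^sup>2"
  shows "((\<lambda>y. y\<^sup>2 / 2 * acot2 y + acot2 y / 4 + y / 4) has_real_derivative y * acot2 y) (at y)"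
    and "((\<lambda>y. y ^ 3 / 3 * acot2 y + y\<^sup>2 / 12 - ln (1 + 2 * y\<^sup>2) / 24) has_real_derivative y\<^sup>2 * acot2 y) (at y)"
    and "((\<lambda>y. y ^ 3 / 3 * ln (1 + 2 * y\<^sup>2) - 2/9 * y ^ 3 + y / 3 + acot2 y / 3) has_real_derivative y\<^sup>2 * ln (1 + 2 * y\<^sup>2)) (at y)"
    and "((\<lambda>y. y ^ 4 / 4 * ln (1 + 2 * y\<^sup>2) - ln (1 + 2 * y\<^sup>2) / 16 - y ^ 4 / 8 + y\<^sup>2 / 8) has_real_derivative y ^ 3 * ln (1 + 2 * y\<^sup>2)) (at y)"
proof -
  have d: "d > 0" by (simp add: d_def add_pos_nonneg)
  have L: "((\<lambda>y. ln (1 + 2 * y\<^sup>2)) has_real_derivative 4 * y / d) (at y)"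
    using d unfolding d_def by (auto intro!: derivative_eq_intros)
  have B: "(acot2 has_real_derivative - 1 / d) (at y)" unfolding d_def by (rule acot2_deriv)
  show "((\<lambda>y. y\<^sup>2 / 2 * acot2 y + acot2 y / 4 + y / 4) has_real_derivative y * acot2 y) (at y)"
    by (rule B L derivative_eq_intros numeral_neq_zero refl)+ (use d in \<open>simp add: field_simps, simp add: d_def algebra_simps eval_nat_numeral\<close>)
  show "((\<lambda>y. y ^ 3 / 3 * acot2 y + y\<^sup>2 / 12 - ln (1 + 2 * y\<^sup>2) / 24) has_real_derivative y\<^sup>2 * acot2 y) (at y)"
    by (rule B L derivative_eq_intros numeral_neq_zero refl)+ (use d in \<open>simp add: field_simps, simp add: d_def algebra_simps eval_nat_numeral\<close>)
  show "((\<lambda>y. y ^ 3 / 3 * ln (1 + 2 * y\<^sup>2) - 2/9 * y ^ 3 + y / 3 + acot2 y / 3) has_real_derivative y\<^sup>2 * ln (1 + 2 * y\<^sup>2)) (at y)"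
    by (rule B L derivative_eq_intros numeral_neq_zero refl)+ (use d in \<open>simp add: field_simps, simp add: d_def algebra_simps eval_nat_numeral\<close>)
  show "((\<lambda>y. y ^ 4 / 4 * ln (1 + 2 * y\<^sup>2) - ln (1 + 2 * y\<^sup>2) / 16 - y ^ 4 / 8 + y\<^sup>2 / 8) has_real_derivative y ^ 3 * ln (1 + 2 * y\<^sup>2)) (at y)"
    by (rule B L derivative_eq_intros numeral_neq_zero refl)+ (use d in \<open>simp add: field_simps, simp add: d_def algebra_simps eval_nat_numeral\<close>)
qed

lemma times_ln_primitives:
  fixes y :: real
  assumes "y > 0"
  shows "((\<lambda>y. y\<^sup>2 * (y * ln y) / 3 - y ^ 3 / 9) has_real_derivative y * (y * ln y)) (at y)"
    and "((\<lambda>y. y ^ 3 * (y * ln y) / 4 - y ^ 4 / 16) has_real_derivative y\<^sup>2 * (y * ln y)) (at y)"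
  using assms by (auto intro!: derivative_eq_intros simp: field_simps eval_nat_numeral)

text \<open>With t = arctan (1 / sqrt 2), the addition theorem gives 2 t = arctan (2 sqrt 2), so
  arctan (sqrt 2 / 4) = pi / 2 - 2 t. Adding arctan (sqrt 2 / 5) to it gives t again, hence arctan
  (sqrt 2 / 5) = 3 t - pi / 2.\<close>

lemma acot2_values:
  "acot2 0 = acot2 (1/2) + acot2 1" "2 * acot2 1 - acot2 (1/2) = arctan (sqrt 2 / 5) / sqrt 2"
proof -
  have s: "sqrt 2 * sqrt 2 = 2" by simp
  have s2: "sqrt 2 < 2" using real_sqrt_less_mono[of 2 4] by simp
  define \<theta> where "\<theta> = arctan (sqrt 2 / 2)"
  have inv: "inverse (sqrt 2) = sqrt 2 / 2" using s by (simp add: field_simps)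
  have h: "arctan (sqrt 2) = pi / 2 - \<theta>" using arctan_inverse[of "sqrt 2"] by (simp add: inv \<theta>_def)
  have b1: "acot2 (1/2) = (pi / 2 - \<theta>) / sqrt 2" by (simp add: acot2_def \<theta>_def)
  have b2: "acot2 1 = \<theta> / sqrt 2" by (simp add: acot2_def h)
  show "acot2 0 = acot2 (1/2) + acot2 1" by (simp add: acot2_def[of 0] b1 b2 diff_divide_distrib)
  have "\<theta> + \<theta> = arctan ((sqrt 2 / 2 + sqrt 2 / 2) / (1 - (sqrt 2 / 2) * (sqrt 2 / 2)))"
    unfolding \<theta>_def using s2 by (intro arctan_add) auto
  also have "(sqrt 2 / 2 + sqrt 2 / 2) / (1 - (sqrt 2 / 2) * (sqrt 2 / 2)) = 2 * sqrt 2" by simp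
  finally have t2: "\<theta> + \<theta> = arctan (2 * sqrt 2)" .
  have "arctan (sqrt 2 / 4) + arctan (sqrt 2 / 5) = arctan ((sqrt 2 / 4 + sqrt 2 / 5) / (1 - (sqrt 2 / 4) * (sqrt 2 / 5)))"
    using s2 by (intro arctan_add) auto
  also have "(sqrt 2 / 4 + sqrt 2 / 5) / (1 - (sqrt 2 / 4) * (sqrt 2 / 5)) = sqrt 2 / 2" by simp
  finally have t1: "arctan (sqrt 2 / 4) + arctan (sqrt 2 / 5) = \<theta>" by (simp add: \<theta>_def)
  have i: "inverse (2 * sqrt 2) = sqrt 2 / 4" using s by (simp add: field_simps)
  have "arctan (inverse (2 * sqrt 2)) = pi / 2 - arctan (2 * sqrt 2)" by (rule arctan_inverse) simp
  then have "arctan (sqrt 2 / 4) = pi / 2 - (\<theta> + \<theta>)" unfolding i t2 .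
  then have "arctan (sqrt 2 / 5) = 3 * \<theta> - pi / 2" using t1 by simp
  then show "2 * acot2 1 - acot2 (1/2) = arctan (sqrt 2 / 5) / sqrt 2"
    unfolding b1 b2 by (simp add: diff_divide_distrib)
qed

lemma I_sqrt2_pi_half_eq:
  "I_sqrt2_pi_half = 2/3 * ln 2 - 2 * ln (3/2) + 16/3 * (arctan (sqrt 2 / 5) / sqrt 2)"
proof -
  note cont = continuous_on_add continuous_on_diff continuous_on_minus continuous_on_mult
    continuous_on_power continuous_on_const continuous_on_id
  define p1 where "p1 y = y\<^sup>2 / 2 * acot2 y + acot2 y / 4 + y / 4" for y
  define p2 where "p2 y = y ^ 3 / 3 * acot2 y + y\<^sup>2 / 12 - ln (1 + 2 * y\<^sup>2) / 24" for y
  define p3 where "p3 y = y ^ 3 / 3 * ln (1 + 2 * y\<^sup>2) - 2/9 * y ^ 3 + y / 3 + acot2 y / 3" for y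
  define p4 where "p4 y = y ^ 4 / 4 * ln (1 + 2 * y\<^sup>2) - ln (1 + 2 * y\<^sup>2) / 16 - y ^ 4 / 8 + y\<^sup>2 / 8" for y :: real
  define e2 where "e2 y = y\<^sup>2 * (y * ln y) / 3 - y ^ 3 / 9" for y :: real
  define e3 where "e3 y = y ^ 3 * (y * ln y) / 4 - y ^ 4 / 16" for y :: real
  have pd: "(p1 has_real_derivative y * acot2 y) (at y)" "(p2 has_real_derivative y\<^sup>2 * acot2 y) (at y)"
    "(p3 has_real_derivative y\<^sup>2 * ln (1 + 2 * y\<^sup>2)) (at y)" "(p4 has_real_derivative y ^ 3 * ln (1 + 2 * y\<^sup>2)) (at y)" for y
    unfolding p1_def[abs_def] p2_def[abs_def] p3_def[abs_def] p4_def[abs_def] by (rule primitives)+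
  have ed: "(e2 has_real_derivative y * (y * ln y)) (at y)" "(e3 has_real_derivative y\<^sup>2 * (y * ln y)) (at y)" if "y > 0" for y
    unfolding e2_def[abs_def] e3_def[abs_def] by (rule times_ln_primitives[OF that])+
  have pc: "continuous_on S p1" "continuous_on S p2" "continuous_on S p3" "continuous_on S p4" for S
    by (rule continuous_at_imp_continuous_on, rule ballI, rule DERIV_isCont, rule pd)+
  have tl: "continuous_on S (\<lambda>y::real. y * ln y)" if "S \<subseteq> {0..}" for S
    using continuous_on_times_ln that by (rule continuous_on_subset)
  have ec: "continuous_on S e2" "continuous_on S e3" if "S \<subseteq> {0..}" for S
    unfolding e2_def[abs_def] e3_def[abs_def] divide_inverse by (rule tl[OF that] cont)+
  define R where "R y = - 1 * p1 y + p2 y + 1/2 * p3 y - 1/2 * p4 y" for y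
  define r where "r y = - (y * acot2 y) + y\<^sup>2 * acot2 y + 1/2 * (y\<^sup>2 * ln (1 + 2 * y\<^sup>2)) - 1/2 * (y ^ 3 * ln (1 + 2 * y\<^sup>2))" for y
  have Rd: "(R has_real_derivative r y) (at y)" for y
    unfolding R_def[abs_def] by (rule DERIV_cong, (rule DERIV_add DERIV_diff DERIV_cmult pd)+) (simp add: r_def)
  have rc: "continuous_on S (\<lambda>y. r (c * y))" for S c
  proof (rule continuous_on_compose2[of UNIV r])
    show "continuous_on UNIV r" unfolding r_def[abs_def]
      by (rule continuous_on_acot2 continuous_on_ln_quadratic cont)+
  qed (auto intro!: continuous_intros)
  define W where "W y = 3 * p1 y - 7 * p2 y - 3/2 * p3 y + 7/2 * p4 y" for y
  define w where "w y = 3 * (y * acot2 y) - 7 * (y\<^sup>2 * acot2 y) - 3/2 * (y\<^sup>2 * ln (1 + 2 * y\<^sup>2)) + 7/2 * (y ^ 3 * ln (1 + 2 * y\<^sup>2))" for y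
  have Wd: "(W has_real_derivative w y) (at y)" for y
    unfolding W_def[abs_def] w_def by (rule DERIV_add DERIV_diff DERIV_cmult pd)+
  have wc: "continuous_on S w" for S
    unfolding w_def[abs_def]
    by (rule continuous_on_acot2 continuous_on_ln_quadratic cont)+
  define g where "g y = 2 * (w y + 2 * r (2 * y) + (- (21/2) * (y\<^sup>2 * ln 2) + 41/2 * (y ^ 3 * ln 2) - 5 * (y * (y * ln y)) + 9 * (y\<^sup>2 * (y * ln y))))" for y
  \<comment> \<open>The derivative of R (2 y) is 2 r (2 y), which is exactly the group with doubled
    arguments in \<open>inner_F_small\<close>.\<close>
  define G where "G y = 2 * (W y + R (2 * y) + (- (7/2) * (y ^ 3 * ln 2) + 41/8 * (y ^ 4 * ln 2) - 5 * e2 y + 9 * e3 y))" for y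
  define h where "h y = 2 * (r y + (- (1/2) * (y\<^sup>2 * ln 2) + 1/2 * (y ^ 3 * ln 2) - y * (y * ln y) + y\<^sup>2 * (y * ln y)))" for y
  define H where "H y = 2 * (R y + (- (1/6) * (y ^ 3 * ln 2) + 1/8 * (y ^ 4 * ln 2) - e2 y + e3 y))" for y
  have pw: "((\<lambda>y. y ^ 3 * ln 2) has_real_derivative 3 * (y\<^sup>2 * ln 2)) (at y)"
    "((\<lambda>y. y ^ 4 * ln 2) has_real_derivative 4 * (y ^ 3 * ln 2)) (at y)" for y :: real
    by (auto intro!: derivative_eq_intros simp: eval_nat_numeral)
  have R2: "((\<lambda>y. R (2 * y)) has_real_derivative r (2 * y) * 2) (at y)" for y
    by (rule DERIV_chain2[OF Rd]) (auto intro!: derivative_eq_intros)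
  have Gd: "(G has_real_derivative g y) (at y)" if "y > 0" for y
    unfolding G_def[abs_def]
    by (rule DERIV_cong, (rule DERIV_add DERIV_diff DERIV_cmult Wd R2 pw ed[OF that])+) (simp add: g_def)
  have Hd: "(H has_real_derivative h y) (at y)" if "y > 0" for y
    unfolding H_def[abs_def]
    by (rule DERIV_cong, (rule DERIV_add DERIV_diff DERIV_cmult Rd pw ed[OF that])+) (simp add: h_def)
  have s1: "{0..1/2} \<subseteq> {0 :: real..}" and s2: "{1/2..1} \<subseteq> {0 :: real..}" by auto
  have gc: "continuous_on {0..1/2} g"
    unfolding g_def[abs_def] by (rule tl[OF s1] wc rc cont)+
  have hc: "continuous_on {1/2..1} h"
    unfolding h_def[abs_def] by (rule tl[OF s2] rc[of _ 1, simplified] cont)+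
  have Rc: "continuous_on S (\<lambda>y. R (c * y))" for S c
    by (rule continuous_on_compose2[of UNIV R]) (auto intro!: continuous_intros continuous_at_imp_continuous_on DERIV_isCont[OF Rd])
  have Gc: "continuous_on {0..1/2} G"
    unfolding G_def[abs_def] W_def by (rule pc Rc ec[OF s1] cont)+
  have Hc: "continuous_on {1/2..1} H"
    unfolding H_def[abs_def] by (rule Rc[of _ 1, simplified] ec[OF s2] cont)+
  \<comment> \<open>Because of y ln y the derivative is known for y > 0 only; the fundamental
    theorem with interior derivatives asks just for continuity at 0.\<close>
  have "integral {0..1/2} g = G (1/2) - G 0"
    by (intro integral_unique fundamental_theorem_of_calculus_interior Gc)
      (use Gd in \<open>auto simp: has_real_derivative_iff_has_vector_derivative\<close>)
  moreover have "integral {1/2..1} h = H 1 - H (1/2)"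
    by (intro integral_unique fundamental_theorem_of_calculus_interior Hc)
      (use Hd in \<open>auto simp: has_real_derivative_iff_has_vector_derivative\<close>)
  moreover have "(LINT y|lborel. inner_F y) = 2 * (integral {0..1/2} g + integral {1/2..1} h)"
  proof (rule even_piecewise_integral[OF inner_F_borel inner_F_even _ gc _ hc inner_F_outside])
    show "inner_F y = g y" if "0 < y" "y < 1/2" for y unfolding g_def w_def r_def by (rule inner_F_small[OF that])
    show "inner_F y = h y" if "1/2 < y" "y < 1" for y unfolding h_def r_def by (rule inner_F_large[OF that])
  qed
  \<comment> \<open>The factor - 8 is the - 4 of the definition times 2 from evenness in y; evenness
    in x is already contained in g and h.\<close>
  ultimately have I: "I_sqrt2_pi_half = - 8 * (G (1/2) - G 0 + (H 1 - H (1/2)))"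
    unfolding I_sqrt2_pi_half_def inner_F_def by simp
  \<comment> \<open>At y = 0, 1/2, 1 the quantity 1 + 2 y^2 is 1, 3/2, 3, so all boundary values are
    rational combinations of 1, a, b, l and m. In the total the rational parts cancel.\<close>
  define a where "a = acot2 (1/2)"
  define b where "b = acot2 1"
  define l where "l = (ln 2 :: real)"
  define m where "m = (ln (3/2) :: real)"
  have ln3: "ln 3 = l + m" unfolding l_def m_def using ln_mult_pos[of 2 "3/2 :: real"] by simp
  have lnh: "ln (1/2) = - l" unfolding l_def using ln_divide_pos[of 1 "2 :: real"] by simp
  have q: "1 + 2 * (1/2)\<^sup>2 = (3/2 :: real)" "1 + 2 * 1\<^sup>2 = (3 :: real)" "1 + 2 * 0\<^sup>2 = (1 :: real)" by (simp_all add: power2_eq_square)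
  have "p1 0 = (a + b) / 4" "p1 (1/2) = 3/8 * a + 1/8" "p1 1 = 3/4 * b + 1/4"
    by (simp_all add: p1_def acot2_values(1) a_def b_def power2_eq_square)
  moreover have "p2 0 = 0" "p2 (1/2) = a / 24 + 1/48 - m / 24" "p2 1 = b / 3 + 1/12 - (l + m) / 24"
    unfolding p2_def q ln3 by (simp_all add: a_def b_def m_def power2_eq_square power3_eq_cube)
  moreover have "p3 0 = (a + b) / 3" "p3 (1/2) = m / 24 + 5/36 + a / 3" "p3 1 = (l + m) / 3 + 1/9 + b / 3"
    unfolding p3_def q ln3 by (simp_all add: acot2_values(1) a_def b_def m_def power2_eq_square power3_eq_cube)
  moreover have "p4 0 = 0" "p4 (1/2) = 3/128 - 3/64 * m" "p4 1 = 3/16 * (l + m)"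
    unfolding p4_def q ln3 by (simp_all add: m_def eval_nat_numeral)
  moreover have "e2 0 = 0" "e2 (1/2) = - l / 24 - 1/72" "e2 1 = - 1/9" "e3 0 = 0" "e3 (1/2) = - l / 64 - 1/256" "e3 1 = - 1/16"
    unfolding e2_def e3_def lnh by (simp_all add: eval_nat_numeral)
  ultimately have "G (1/2) - G 0 + (H 1 - H (1/2)) = - (l / 12) + m / 4 - 2/3 * (2 * b - a)"
    unfolding G_def H_def W_def R_def l_def[symmetric] by (simp add: power3_eq_cube power4_eq_xxxx field_simps)
  then have "I_sqrt2_pi_half = 2/3 * ln 2 - 2 * ln (3/2) + 16/3 * (2 * acot2 1 - acot2 (1/2))"
    unfolding I a_def b_def l_def m_def by simp
  then show ?thesis unfolding acot2_values(2) .
qed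

section \<open>Numerical bounds\<close>

lemma arctan_polynomial_bounds:
  fixes x :: real
  assumes "x \<ge> 0"
  shows "arctan x \<le> x - x ^ 3 / 3 + x ^ 5 / 5 - x ^ 7 / 7 + x ^ 9 / 9"
    and "arctan x \<ge> x - x ^ 3 / 3 + x ^ 5 / 5 - x ^ 7 / 7 + x ^ 9 / 9 - x ^ 11 / 11"
proof -
  have p: "1 + y\<^sup>2 > 0" for y :: real by (simp add: add_pos_nonneg)
  \<comment> \<open>A finite geometric sum shows that the derivative of this error is y^10 / (1 +
    y^2); lying between 0 and y^10, it yields both bounds.\<close>
  define P where "P y = y - y ^ 3 / 3 + y ^ 5 / 5 - y ^ 7 / 7 + y ^ 9 / 9 - arctan y" for y :: real
  have d: "(P has_real_derivative y ^ 10 / (1 + y\<^sup>2)) (at y)" for y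
  proof -
    have "(P has_real_derivative (1 - y\<^sup>2 + y ^ 4 - y ^ 6 + y ^ 8 - inverse (1 + y\<^sup>2))) (at y)"
      unfolding P_def[abs_def] by (rule DERIV_arctan derivative_eq_intros numeral_neq_zero refl)+ simp
    moreover have "1 - y\<^sup>2 + y ^ 4 - y ^ 6 + y ^ 8 - inverse (1 + y\<^sup>2) = y ^ 10 / (1 + y\<^sup>2)"
    proof -
      have "(1 - y\<^sup>2 + y ^ 4 - y ^ 6 + y ^ 8) * (1 + y\<^sup>2) = 1 + y ^ 10" by (simp add: algebra_simps flip: power_add)
      then have "1 - y\<^sup>2 + y ^ 4 - y ^ 6 + y ^ 8 = (1 + y ^ 10) / (1 + y\<^sup>2)" using p[of y] by (simp add: eq_divide_eq)
      then show ?thesis by (simp add: divide_inverse distrib_right)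
    qed
    ultimately show ?thesis by simp
  qed
  have "P 0 \<le> P x"
  proof (rule DERIV_nonneg_imp_nondecreasing[OF assms])
    show "\<exists>z. DERIV P y :> z \<and> z \<ge> 0" for y using d[of y] p[of y] by (intro exI[of _ "y ^ 10 / (1 + y\<^sup>2)"]) auto
  qed
  then show "arctan x \<le> x - x ^ 3 / 3 + x ^ 5 / 5 - x ^ 7 / 7 + x ^ 9 / 9" by (simp add: P_def)
  have "x ^ 11 / 11 - P x \<ge> 0 ^ 11 / 11 - P 0"
  proof (rule DERIV_nonneg_imp_nondecreasing[OF assms, of "\<lambda>y. y ^ 11 / 11 - P y"])
    fix y :: real
    have "((\<lambda>y. y ^ 11 / 11 - P y) has_real_derivative (y ^ 10 - y ^ 10 / (1 + y\<^sup>2))) (at y)"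
      by (rule d derivative_eq_intros numeral_neq_zero refl)+ simp
    moreover have "y ^ 10 / (1 + y\<^sup>2) \<le> y ^ 10 / 1" by (intro divide_left_mono) (auto simp: add_pos_nonneg)
    ultimately show "\<exists>z. DERIV (\<lambda>y. y ^ 11 / 11 - P y) y :> z \<and> z \<ge> 0" by (intro exI[of _ "y ^ 10 - y ^ 10 / (1 + y\<^sup>2)"]) auto
  qed
  then show "arctan x \<ge> x - x ^ 3 / 3 + x ^ 5 / 5 - x ^ 7 / 7 + x ^ 9 / 9 - x ^ 11 / 11" by (simp add: P_def)
qed

text \<open>Odd powers of sqrt 2 divided by sqrt 2 are rational, so the alternating partial sums at
  sqrt 2 / 5 become rational bounds.\<close>

lemma arctan_sqrt2_bounds:
  defines "u \<equiv> arctan (sqrt 2 / 5) / sqrt 2"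
  defines "s \<equiv> 1/5 - 2/375 + 4/15625 - 8/546875 + 16/17578125"
  shows "u \<le> s" "u \<ge> s - 32/537109375"
proof -
  have e: "(sqrt 2 / 5) ^ 3 / sqrt 2 = 2/125" "(sqrt 2 / 5) ^ 5 / sqrt 2 = 4/3125" "(sqrt 2 / 5) ^ 7 / sqrt 2 = 8/78125"
    "(sqrt 2 / 5) ^ 9 / sqrt 2 = 16/1953125" "(sqrt 2 / 5) ^ 11 / sqrt 2 = 32/48828125" "(sqrt 2 / 5) / sqrt 2 = 1/5"
    by (simp_all add: power_divide eval_nat_numeral)
  have m: "x / n / sqrt 2 = x / sqrt 2 / n" for x n :: real by simp
  have "u \<le> (sqrt 2 / 5 - (sqrt 2 / 5) ^ 3 / 3 + (sqrt 2 / 5) ^ 5 / 5 - (sqrt 2 / 5) ^ 7 / 7 + (sqrt 2 / 5) ^ 9 / 9) / sqrt 2"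
    unfolding u_def by (intro divide_right_mono arctan_polynomial_bounds) auto
  then show "u \<le> s" unfolding add_divide_distrib diff_divide_distrib m[of "_ ^ _"] e s_def by simp
  have "u \<ge> (sqrt 2 / 5 - (sqrt 2 / 5) ^ 3 / 3 + (sqrt 2 / 5) ^ 5 / 5 - (sqrt 2 / 5) ^ 7 / 7 + (sqrt 2 / 5) ^ 9 / 9 - (sqrt 2 / 5) ^ 11 / 11) / sqrt 2"
    unfolding u_def by (intro divide_right_mono arctan_polynomial_bounds) auto
  then show "u \<ge> s - 32/537109375" unfolding add_divide_distrib diff_divide_distrib m[of "_ ^ _"] e s_def by simp
qed

lemma ln2_bounds: "ln (2::real) \<in> {0.693147170 .. 0.693147190}"
  using ln_approx_bounds[of 2 "Suc (Suc (Suc (Suc (Suc (Suc (Suc 0))))))"] by (simp add: power_divide)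

lemma ln_3_2_bounds: "ln (3/2::real) \<in> {0.405465100 .. 0.405465120}"
  using ln_approx_bounds[of "3/2" "Suc (Suc (Suc (Suc (Suc 0))))"] by (simp add: power_divide)

text \<open>The quotient is enclosed in the rounding interval from 2.007135 to 2.007145; the crude
  bound 0.5 makes the denominator positive, so that the quotient can be cleared.\<close>

lemma constant_bound: "\<bar>2 * ln 2 / I_sqrt2_pi_half - 2.00714\<bar> < 0.000005"
proof -
  have "I_sqrt2_pi_half > 0.5" "2 * ln 2 > 2.007135 * I_sqrt2_pi_half" "2 * ln 2 < 2.007145 * I_sqrt2_pi_half"
    using arctan_sqrt2_bounds ln2_bounds ln_3_2_bounds unfolding I_sqrt2_pi_half_eq by simp_all
  then have "2.007135 < 2 * ln 2 / I_sqrt2_pi_half" "2 * ln 2 / I_sqrt2_pi_half < 2.007145"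
    by (simp_all add: less_divide_eq divide_less_eq)
  moreover have "2.007135 < x \<Longrightarrow> x < 2.007145 \<Longrightarrow> \<bar>x - 2.00714\<bar> < 0.000005" for x :: real
    by (simp add: abs_if)
  ultimately show ?thesis by blast
qed

text \<open>The first conjunct makes the second meaningful: almost everywhere
  \<open>ahlfors_beurling\<close> is a genuine principal value and not the unspecified value of
  \<open>Lim\<close>. The ratio is at most 2, and the third conjunct shows that the constant exceeds
  2.\<close>

theorem corollary1:
  fixes p q :: real
  assumes "1 < p" and "1 / p + 1 / q = 1"
  shows "(\<forall>f \<in> Lp_space p. AE z in lebesgue. beurling_pv_exists f z) \<and>
         Lp_operator_norm p ahlfors_beurling / ennreal (max p q - 1)
           \<le> ennreal (2 * ln 2 / I_sqrt2_pi_half) \<and>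
         \<bar>2 * ln 2 / I_sqrt2_pi_half - 2.00714\<bar> < 0.000005"
proof (intro conjI ballI)
  have m: "max p q - 1 > 0" using assms(1) by simp
  show "AE z in lebesgue. beurling_pv_exists f z" if f: "f \<in> Lp_space p" for f
  proof -
    obtain g where g: "g \<in> lp_borel p" "AE x in lborel. f x = g x" by (rule Lp_space_borel_version[OF f])
    have "AE z in lborel. beurling_pv_exists f z"
      using beurling_principal_value[OF assms f g] by eventually_elim simp
    then show ?thesis by (rule AE_completion)
  qed
  show c: "\<bar>2 * ln 2 / I_sqrt2_pi_half - 2.00714\<bar> < 0.000005" by (rule constant_bound)
  have "Lp_operator_norm p ahlfors_beurling / ennreal (max p q - 1) \<le> ennreal (2 * (max p q - 1)) / ennreal (max p q - 1)"
    by (rule divide_right_mono_ennreal[OF ahlfors_beurling_operator_norm[OF assms]])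
  also have "\<dots> = ennreal (2 * (max p q - 1) / (max p q - 1))" using m by (intro divide_ennreal) auto
  also have "2 * (max p q - 1) / (max p q - 1) = 2" using m by (intro nonzero_mult_div_cancel_right) simp
  also have "\<dots> \<le> ennreal (2 * ln 2 / I_sqrt2_pi_half)"
    using c unfolding abs_less_iff by (intro ennreal_leI) simp
  finally show "Lp_operator_norm p ahlfors_beurling / ennreal (max p q - 1) \<le> ennreal (2 * ln 2 / I_sqrt2_pi_half)" .
qed

end
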